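(* Let $\Omega \subset \mathbb{R}^n$ be open and bounded with smooth boundary, let $\nu$ be its outward unit normal, and let $\Gamma_+ := \{ x \in \partial \Omega : x\cdot \nu >0 \}$. Let $\mathfrak{U} := \mathbb{R}^m \times \Omega$, and fix $R>0$ such that $\Omega \subseteq \{ r<R \}$. Let $\varepsilon, a, b >0$ be constants such that \[ a \geqslant (m+n)^2, \qquad a \gg R, \qquad \varepsilon \ll_{m,n} b \ll R^{-1}. \] Fix $\sigma >0$ and define $\omega := \mathcal{O}_\sigma (\Gamma_+) \cap \Omega$, where $\mathcal{O}_\sigma(\Gamma_+) := \{ y \in \mathbb{R}^n : |y-x|< \sigma \text{ for some } x \in \Gamma_+ \}$. Then there exists $C>0$ such that for any $z \in C^2(\mathfrak{U})\cap C^1(\bar{\mathfrak{U}})$ satisfying $z|_{\partial\mathfrak{U} \cap \mathfrak{D}} = 0$, we have \begin{align*} C\varepsilon \int_{\mathfrak{U} \cap \mathfrak{D}} \zeta_{a,b;\varepsilon}\, r^{-1}\big(|u\partial_u z |^2 + |v\partial_v z |^2 + f g^{ab}\nabla^{\omega_x}_a z\, \nabla^{\omega_x}_b z - f g^{CD} \nabla^{\omega_t}_C z\, \nabla^{\omega_t}_D z \big) + Cba^2\int_{\mathfrak{U} \cap \mathfrak{D}}\zeta_{a,b;\varepsilon} f^{-\frac{1}{2}} z^2 \\ \leqslant \frac{1}{a} \int_{\mathfrak{U}\cap \mathfrak{D}} \zeta_{a,b;\varepsilon} f |\square z|^2 + a^2 R^3 \int_{( \mathbb{R}^m \times \omega )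 \cap \mathfrak{D}} \zeta_{a,b;\varepsilon} f^{-2} |\nabla_t z|^2 + a^4 R^4 \int_{( \mathbb{R}^m \times \omega ) \cap \mathfrak{D}} \zeta_{a,b;\varepsilon} f^{-3} z^2, \end{align*} where \[ \zeta_{ a, b; \varepsilon } := \left\{ \frac{ f }{ ( 1 + \varepsilon u ) ( 1 - \varepsilon v ) } \cdot \exp \left[ \frac{ 2 b f^\frac{1}{2} }{ ( 1 - \varepsilon u )^\frac{1}{2} ( 1 + \varepsilon v )^\frac{1}{2} } \right] \right\}^{2a}. \]
   Context: Fix $m,n\in\mathbb{N}$. On $\mathbb{R}^{m+n}$ with Cartesian coordinates $t=(t_1,\dots,t_m)$, $x=(x_1,\dots,x_n)$, let $g=-dt_1^2-\dots-dt_m^2+dx_1^2+\dots+dx_n^2$, $\nabla$ its Levi-Civita connection and $\square=g^{\alpha\beta}\nabla_{\alpha\beta}$. Let $r=|x|$, $\tau=|t|$, $u=\frac12(\tau-r)$, $v=\frac12(\tau+r)$, $f=-uv=\frac14(|x|^2-|t|^2)$, and $\mathfrak{D}=\{f>0\}$ (exterior of the null cone centred at the origin). In polar coordinates $(u,v,\omega_x,\omega_t)$, $\omega_x\in\mathbb{S}^{n-1}$, $\omega_t\in\mathbb{S}^{m-1}$, $g=-4\,du\,dv+r^2\mathring\gamma_{\mathbb{S}^{n-1}}-\tau^2\mathring\gamma_{\mathbb{S}^{m-1}}$. Indices $a,b$ denote spatial angular components and $C,D$ temporal angular components; $\nabla^{\omega_x}_a$ denotes derivatives (w.r.t. $g$)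 in the spatial angular directions and $\nabla^{\omega_t}_C$ in the temporal angular directions; $\nabla_t z=(\partial_{t_1}z,\dots,\partial_{t_m}z)$. *)

theory Defs
  imports "HOL-Analysis.Analysis"
begin

definition dder :: "('a::real_normed_vector \<Rightarrow> real) \<Rightarrow> 'a \<Rightarrow> 'a \<Rightarrow> real" where
  "dder f h p = frechet_derivative f (at p) h"

fun Ck :: "nat \<Rightarrow> 'a::real_normed_vector set \<Rightarrow> ('a \<Rightarrow> real) \<Rightarrow> bool" where
  "Ck 0 S f = continuous_on S f"
| "Ck (Suc k) S f = ((\<forall>x\<in>S. f differentiable (at x)) \<and> (\<forall>h. Ck k S (dder f h)))"

definition smooth_on :: "'a::real_normed_vector set \<Rightarrow> ('a \<Rightarrow> real) \<Rightarrow> bool" where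
  "smooth_on S f = (\<forall>k. Ck k S f)"

definition C1_closure :: "'a::real_normed_vector set \<Rightarrow> ('a \<Rightarrow> real) \<Rightarrow> bool" where
  "C1_closure S f = (continuous_on (closure S) f \<and>
     (\<forall>h. \<exists>g. continuous_on (closure S) g \<and> (\<forall>p\<in>S. g p = dder f h p)))"

definition grad :: "(real^'n \<Rightarrow> real) \<Rightarrow> real^'n \<Rightarrow> real^'n" where
  "grad \<phi> y = (\<chi> j. dder \<phi> (axis j 1) y)"

definition local_defining :: "(real^'n) set \<Rightarrow> real^'n \<Rightarrow> (real^'n) set \<Rightarrow> (real^'n \<Rightarrow> real) \<Rightarrow> bool" where
  "local_defining \<Omega> x U \<phi> = (open U \<and> x \<in> U \<and> smooth_on U \<phi> \<and>
      (\<forall>y\<in>U. grad \<phi> y \<noteq> 0) \<and> \<Omega> \<inter> U = {y\<in>U. \<phi> y < 0})"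

definition smooth_boundary :: "(real^'n) set \<Rightarrow> bool" where
  "smooth_boundary \<Omega> = (\<forall>x\<in>frontier \<Omega>. \<exists>U \<phi>. local_defining \<Omega> x U \<phi>)"

text \<open>Outward unit normal (independent of the choice of defining function).\<close>
definition outward_normal :: "(real^'n) set \<Rightarrow> real^'n \<Rightarrow> real^'n" where
  "outward_normal \<Omega> x = (SOME \<nu>. \<exists>U \<phi>. local_defining \<Omega> x U \<phi> \<and> \<nu> = sgn (grad \<phi> x))"

definition Gamma_plus :: "(real^'n) set \<Rightarrow> (real^'n) set" where
  "Gamma_plus \<Omega> = {x \<in> frontier \<Omega>. x \<bullet> outward_normal \<Omega> x > 0}"

definition nbhd :: "real \<Rightarrow> (real^'n) set \<Rightarrow> (real^'n) set" where
  "nbhd \<sigma> A = {y. \<exists>x\<in>A. dist y x < \<sigma>}"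

definition rr :: "(real^'m) \<times> (real^'n) \<Rightarrow> real" where "rr p = norm (snd p)"
definition tau :: "(real^'m) \<times> (real^'n) \<Rightarrow> real" where "tau p = norm (fst p)"
definition uu :: "(real^'m) \<times> (real^'n) \<Rightarrow> real" where "uu p = (tau p - rr p) / 2"
definition vv :: "(real^'m) \<times> (real^'n) \<Rightarrow> real" where "vv p = (tau p + rr p) / 2"
definition ff :: "(real^'m) \<times> (real^'n) \<Rightarrow> real" where "ff p = - uu p * vv p"

definition DD :: "((real^'m) \<times> (real^'n)) set" where "DD = {p. ff p > 0}"

definition zeta :: "real \<Rightarrow> real \<Rightarrow> real \<Rightarrow> (real^'m) \<times> (real^'n) \<Rightarrow> real" where
  "zeta a b \<epsilon> p = (ff p / ((1 + \<epsilon> * uu p) * (1 - \<epsilon> * vv p))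
      * exp (2 * b * sqrt (ff p) / (sqrt (1 - \<epsilon> * uu p) * sqrt (1 + \<epsilon> * vv p)))) powr (2 * a)"

definition dt :: "((real^'m) \<times> (real^'n) \<Rightarrow> real) \<Rightarrow> 'm \<Rightarrow> (real^'m) \<times> (real^'n) \<Rightarrow> real" where
  "dt z i p = dder z (axis i 1, 0) p"
definition dx :: "((real^'m) \<times> (real^'n) \<Rightarrow> real) \<Rightarrow> 'n \<Rightarrow> (real^'m) \<times> (real^'n) \<Rightarrow> real" where
  "dx z j p = dder z (0, axis j 1) p"

definition gradt_sq :: "((real^'m) \<times> (real^'n) \<Rightarrow> real) \<Rightarrow> (real^'m) \<times> (real^'n) \<Rightarrow> real" where
  "gradt_sq z p = (\<Sum>i\<in>UNIV. (dt z i p)\<^sup>2)"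
definition gradx_sq :: "((real^'m) \<times> (real^'n) \<Rightarrow> real) \<Rightarrow> (real^'m) \<times> (real^'n) \<Rightarrow> real" where
  "gradx_sq z p = (\<Sum>j\<in>UNIV. (dx z j p)\<^sup>2)"

definition dtau :: "((real^'m) \<times> (real^'n) \<Rightarrow> real) \<Rightarrow> (real^'m) \<times> (real^'n) \<Rightarrow> real" where
  "dtau z p = dder z (sgn (fst p), 0) p"
definition dr :: "((real^'m) \<times> (real^'n) \<Rightarrow> real) \<Rightarrow> (real^'m) \<times> (real^'n) \<Rightarrow> real" where
  "dr z p = dder z (0, sgn (snd p)) p"

text \<open>Since tau = u + v and r = v - u: partial_u = partial_tau - partial_r, partial_v = partial_tau + partial_r.\<close>
definition du :: "((real^'m) \<times> (real^'n) \<Rightarrow> real) \<Rightarrow> (real^'m) \<times> (real^'n) \<Rightarrow> real" where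
  "du z p = dtau z p - dr z p"
definition dv :: "((real^'m) \<times> (real^'n) \<Rightarrow> real) \<Rightarrow> (real^'m) \<times> (real^'n) \<Rightarrow> real" where
  "dv z p = dtau z p + dr z p"

text \<open>g^{ab} nabla_a z nabla_b z (spatial angular part) = |nabla_x z|^2 - (partial_r z)^2.\<close>
definition ang_x :: "((real^'m) \<times> (real^'n) \<Rightarrow> real) \<Rightarrow> (real^'m) \<times> (real^'n) \<Rightarrow> real" where
  "ang_x z p = gradx_sq z p - (dr z p)\<^sup>2"

text \<open>g^{CD} nabla_C z nabla_D z (temporal angular part) = -(|nabla_t z|^2 - (partial_tau z)^2),
  as g restricted to the temporal spheres is -tau^2 times the round metric.\<close>
definition ang_t :: "((real^'m) \<times> (real^'n) \<Rightarrow> real) \<Rightarrow> (real^'m) \<times> (real^'n) \<Rightarrow> real" where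
  "ang_t z p = - (gradt_sq z p - (dtau z p)\<^sup>2)"

definition box :: "((real^'m) \<times> (real^'n) \<Rightarrow> real) \<Rightarrow> (real^'m) \<times> (real^'n) \<Rightarrow> real" where
  "box z p = - (\<Sum>i\<in>UNIV. dder (dt z i) (axis i 1, 0) p) + (\<Sum>j\<in>UNIV. dder (dx z j) (0, axis j 1) p)"

end

theory Submission
  imports Defs
begin

text \<open>
  The constant \<open>C\<close> may depend on everything except \<open>z\<close>, so the weight may be replaced by any weight
  comparable to \<open>f powr (2 * a)\<close>. We use \<open>(f / k) powr (2 * a)\<close> with \<open>k = 1 - e * r\<close> and \<open>e\<close> small: the
  gradient of \<open>f / k\<close> is proportional to \<open>Y = k \<nabla>f - f \<nabla>k\<close>, and the symmetrised covariant derivative of \<open>Y\<close> is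
  exactly \<open>k / 2\<close> times the metric plus \<open>e f / r\<close> times the metric of the spatial spheres. The multiplier method for
  \<open>\<psi> = (f / k) powr a * z\<close> with multiplier \<open>Y \<psi> + q \<psi>\<close>, together with a Hardy inequality along \<open>Y\<close>, therefore
  gives a pointwise inequality whose only boundary term is \<open>(x \<bullet> \<nu>) |\<partial>\<^sub>\<nu> \<psi>|\<^sup>2\<close> up to a positive factor. A spatial cutoff
  vanishing on \<open>\<Gamma>\<^sub>+\<close> removes the part of the boundary where this term has the wrong sign; the error it produces is
  supported in \<open>\<omega>\<close> and is controlled by a Caccioppoli inequality, in which the equation trades spatial for time derivatives.
  Boundary contributions are read off as limits of interior cutoffs, so that only integration by parts
  for compactly supported fields is needed.
\<close>

section \<open>Continuously differentiable maps\<close>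

definition C1_deriv :: "'a::real_normed_vector set \<Rightarrow> ('a \<Rightarrow> 'b::real_normed_vector) \<Rightarrow> ('a \<Rightarrow> 'a \<Rightarrow> 'b) \<Rightarrow> bool" where
  "C1_deriv S F F' \<longleftrightarrow> (\<forall>p\<in>S. (F has_derivative F' p) (at p)) \<and> (\<forall>v. continuous_on S (\<lambda>p. F' p v))"

lemma C1_derivI:
  "\<lbrakk>\<And>p. p \<in> S \<Longrightarrow> (F has_derivative F' p) (at p); \<And>v. continuous_on S (\<lambda>p. F' p v)\<rbrakk> \<Longrightarrow> C1_deriv S F F'"
  by (simp add: C1_deriv_def)

lemma C1_deriv_has_derivative: "C1_deriv S F F' \<Longrightarrow> p \<in> S \<Longrightarrow> (F has_derivative F' p) (at p)"
  by (simp add: C1_deriv_def)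

lemma C1_deriv_linear: "C1_deriv S F F' \<Longrightarrow> p \<in> S \<Longrightarrow> linear (F' p)"
  using C1_deriv_has_derivative has_derivative_linear by blast

lemma C1_deriv_continuous_deriv: "C1_deriv S F F' \<Longrightarrow> continuous_on S (\<lambda>p. F' p v)"
  by (simp add: C1_deriv_def)

lemma C1_deriv_continuous_on: "C1_deriv S F F' \<Longrightarrow> continuous_on S F"
  unfolding C1_deriv_def
  by (meson continuous_at_imp_continuous_on has_derivative_continuous)

lemma C1_deriv_subset: "C1_deriv S F F' \<Longrightarrow> T \<subseteq> S \<Longrightarrow> C1_deriv T F F'"
  unfolding C1_deriv_def by (meson continuous_on_subset subset_iff)

lemma C1_deriv_cong_deriv:
  assumes "C1_deriv S F F'" "\<And>p v. p \<in> S \<Longrightarrow> F' p v = G' p v"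
  shows "C1_deriv S F G'"
proof (rule C1_derivI)
  show "(F has_derivative G' p) (at p)" if "p \<in> S" for p
  proof -
    have "F' p = G' p" using assms(2) that by blast
    then show ?thesis using C1_deriv_has_derivative[OF assms(1) that] by simp
  qed
  show "continuous_on S (\<lambda>p. G' p v)" for v
    by (rule continuous_on_eq[OF C1_deriv_continuous_deriv[OF assms(1)]]) (use assms(2) in auto)
qed

lemma C1_deriv_cong:
  assumes "C1_deriv S F F'" "open S" "\<And>p. p \<in> S \<Longrightarrow> F p = G p" "\<And>p v. p \<in> S \<Longrightarrow> F' p v = G' p v"
  shows "C1_deriv S G G'"
proof -
  have "C1_deriv S F G'" using C1_deriv_cong_deriv assms(1,4) by blast
  then show ?thesis
    unfolding C1_deriv_def using has_derivative_transform_within_open[OF _ assms(2)] assms(3) by blast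
qed

lemma C1_deriv_const: "C1_deriv S (\<lambda>p. c) (\<lambda>p v. 0)"
  by (auto intro!: C1_derivI)

lemma C1_deriv_bounded_linear: "bounded_linear L \<Longrightarrow> C1_deriv S L (\<lambda>p. L)"
  by (auto intro!: C1_derivI bounded_linear_imp_has_derivative)

lemma C1_deriv_linear_compose:
  assumes "bounded_linear L" "C1_deriv S F F'"
  shows "C1_deriv S (\<lambda>p. L (F p)) (\<lambda>p v. L (F' p v))"
  using assms unfolding C1_deriv_def
  by (auto intro: bounded_linear.has_derivative bounded_linear.continuous_on)

lemma C1_deriv_compose_linear:
  assumes F: "C1_deriv T F F'" and L: "bounded_linear L" and "L ` S \<subseteq> T"
  shows "C1_deriv S (\<lambda>p. F (L p)) (\<lambda>p v. F' (L p) (L v))"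
proof (rule C1_derivI)
  show "((\<lambda>p. F (L p)) has_derivative (\<lambda>v. F' (L p) (L v))) (at p)" if "p \<in> S" for p
    using has_derivative_compose[OF bounded_linear_imp_has_derivative[OF L] C1_deriv_has_derivative[OF F]] that assms(3)
    by auto
  show "continuous_on S (\<lambda>p. F' (L p) (L v))" for v
    by (rule continuous_on_compose2[OF C1_deriv_continuous_deriv[OF F]])
      (use assms(3) in \<open>auto intro: bounded_linear.continuous_on[OF L]\<close>)
qed

lemma C1_deriv_add:
  "C1_deriv S F F' \<Longrightarrow> C1_deriv S G G' \<Longrightarrow> C1_deriv S (\<lambda>p. F p + G p) (\<lambda>p v. F' p v + G' p v)"
  unfolding C1_deriv_def by (auto intro!: has_derivative_add continuous_on_add)

lemma C1_deriv_diff: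
  "C1_deriv S F F' \<Longrightarrow> C1_deriv S G G' \<Longrightarrow> C1_deriv S (\<lambda>p. F p - G p) (\<lambda>p v. F' p v - G' p v)"
  unfolding C1_deriv_def by (auto intro!: has_derivative_diff continuous_on_diff)

lemma C1_deriv_scaleR:
  assumes "C1_deriv S s s'" "C1_deriv S F F'"
  shows "C1_deriv S (\<lambda>p. s p *\<^sub>R F p) (\<lambda>p v. s p *\<^sub>R F' p v + s' p v *\<^sub>R F p)"
  using assms C1_deriv_continuous_on[OF assms(1)] C1_deriv_continuous_on[OF assms(2)]
  unfolding C1_deriv_def by (auto intro!: has_derivative_scaleR continuous_intros)

lemma C1_deriv_mult:
  fixes s u :: "'a::real_normed_vector \<Rightarrow> real"
  shows "C1_deriv S s s' \<Longrightarrow> C1_deriv S u u' \<Longrightarrow> C1_deriv S (\<lambda>p. s p * u p) (\<lambda>p v. s p * u' p v + s' p v * u p)"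
  using C1_deriv_scaleR[of S s s' u u'] by simp

lemma C1_deriv_cmult:
  fixes s :: "'a::real_normed_vector \<Rightarrow> real"
  shows "C1_deriv S s s' \<Longrightarrow> C1_deriv S (\<lambda>p. c * s p) (\<lambda>p v. c * s' p v)"
  by (rule C1_deriv_linear_compose[OF bounded_linear_mult_right])

lemma C1_deriv_inner:
  assumes "C1_deriv S F F'" "C1_deriv S G G'"
  shows "C1_deriv S (\<lambda>p. F p \<bullet> G p) (\<lambda>p v. F p \<bullet> G' p v + F' p v \<bullet> G p)"
  using assms C1_deriv_continuous_on[OF assms(1)] C1_deriv_continuous_on[OF assms(2)]
  unfolding C1_deriv_def by (auto intro!: has_derivative_inner continuous_intros)

lemma C1_deriv_compose_real:
  fixes s :: "'a::real_normed_vector \<Rightarrow> real" and h :: "real \<Rightarrow> real"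
  assumes "C1_deriv S s s'" "\<And>p. p \<in> S \<Longrightarrow> (h has_real_derivative h' (s p)) (at (s p))"
    and "continuous_on (s ` S) h'"
  shows "C1_deriv S (\<lambda>p. h (s p)) (\<lambda>p v. h' (s p) * s' p v)"
proof (rule C1_derivI)
  fix p assume "p \<in> S"
  then show "((\<lambda>p. h (s p)) has_derivative (\<lambda>v. h' (s p) * s' p v)) (at p)"
    using has_derivative_compose[OF C1_deriv_has_derivative[OF assms(1)], of p h "\<lambda>t. h' (s p) * t"] assms(2)
    by (simp add: has_field_derivative_def)
next
  fix v
  have "continuous_on S (\<lambda>p. h' (s p))"
    using continuous_on_compose[OF C1_deriv_continuous_on[OF assms(1)] assms(3)] by (simp add: o_def)
  then show "continuous_on S (\<lambda>p. h' (s p) * s' p v)"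
    using assms(1) by (auto simp: C1_deriv_def intro!: continuous_intros)
qed

lemma C1_deriv_inverse:
  fixes s :: "'a::real_normed_vector \<Rightarrow> real"
  assumes "C1_deriv S s s'" "\<And>p. p \<in> S \<Longrightarrow> s p \<noteq> 0"
  shows "C1_deriv S (\<lambda>p. 1 / s p) (\<lambda>p v. - s' p v / (s p)\<^sup>2)"
proof -
  have "C1_deriv S (\<lambda>p. (\<lambda>x. 1 / x) (s p)) (\<lambda>p v. (\<lambda>x. - 1 / x\<^sup>2) (s p) * s' p v)"
    using assms by (intro C1_deriv_compose_real)
      (auto intro!: continuous_intros derivative_eq_intros simp: power2_eq_square)
  then show ?thesis by (rule C1_deriv_cong_deriv) simp
qed

lemma C1_deriv_powr:
  fixes s :: "'a::real_normed_vector \<Rightarrow> real"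
  assumes "C1_deriv S s s'" "\<And>p. p \<in> S \<Longrightarrow> s p > 0"
  shows "C1_deriv S (\<lambda>p. s p powr c) (\<lambda>p v. c * s p powr (c - 1) * s' p v)"
proof (rule C1_deriv_compose_real[OF assms(1), where h="\<lambda>x. x powr c" and h'="\<lambda>x. c * x powr (c - 1)"])
  show "((\<lambda>x. x powr c) has_real_derivative c * s p powr (c - 1)) (at (s p))" if "p \<in> S" for p
    using has_real_derivative_powr[OF assms(2)[OF that]] by (simp add: mult.commute)
  show "continuous_on (s ` S) (\<lambda>x. c * x powr (c - 1))"
    by (intro continuous_intros) (use assms(2) in force)
qed

lemma C1_deriv_prod:
  fixes h :: "'i \<Rightarrow> 'a::real_normed_vector \<Rightarrow> real"
  assumes "\<And>i. i \<in> A \<Longrightarrow> C1_deriv S (h i) (h' i)"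
  shows "C1_deriv S (\<lambda>p. \<Prod>i\<in>A. h i p) (\<lambda>p v. \<Sum>i\<in>A. h' i p v * (\<Prod>j\<in>A - {i}. h j p))"
  using assms C1_deriv_continuous_on[OF assms]
  unfolding C1_deriv_def
  by (auto intro!: has_derivative_prod continuous_on_sum continuous_on_mult continuous_on_prod)

lemma C1_deriv_line:
  assumes F: "C1_deriv S F F'" and "c + s *\<^sub>R b \<in> S"
  shows "((\<lambda>s. F (c + s *\<^sub>R b)) has_derivative (\<lambda>h. h *\<^sub>R F' (c + s *\<^sub>R b) b)) (at s)"
proof -
  have "((\<lambda>s. c + s *\<^sub>R b) has_derivative (\<lambda>h. h *\<^sub>R b)) (at s)"
    by (auto intro!: derivative_eq_intros)
  from has_derivative_compose[OF this C1_deriv_has_derivative[OF assms]]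
  have "((\<lambda>s. F (c + s *\<^sub>R b)) has_derivative (\<lambda>h. F' (c + s *\<^sub>R b) (h *\<^sub>R b))) (at s)" .
  moreover have "F' (c + s *\<^sub>R b) (h *\<^sub>R b) = h *\<^sub>R F' (c + s *\<^sub>R b) b" for h
    using C1_deriv_linear[OF assms] by (simp add: linear_cmul)
  ultimately show ?thesis by simp
qed

lemma C1_deriv_line_real:
  fixes F :: "'a::real_normed_vector \<Rightarrow> real"
  assumes "C1_deriv S F F'" and "c + s *\<^sub>R b \<in> S"
  shows "((\<lambda>s. F (c + s *\<^sub>R b)) has_real_derivative F' (c + s *\<^sub>R b) b) (at s)"
  by (rule has_derivative_imp_has_field_derivative[OF C1_deriv_line[OF assms]]) simp

lemma C1_deriv_eq_0_of_local_zero: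
  assumes "C1_deriv S F F'" "open T" "p \<in> T" "p \<in> S" "\<And>q. q \<in> T \<Longrightarrow> F q = 0"
  shows "F' p v = 0"
proof -
  have "(F has_derivative (\<lambda>v. 0)) (at p)"
    by (rule has_derivative_transform_within_open[OF _ assms(2,3), of "\<lambda>_. 0"]) (use assms in auto)
  then show ?thesis
    using C1_deriv_has_derivative[OF assms(1,4)] has_derivative_unique by metis
qed

lemma C1_deriv_Un:
  assumes "C1_deriv S F F'" "C1_deriv T F F'" "open S" "open T"
  shows "C1_deriv (S \<union> T) F F'"
  using assms unfolding C1_deriv_def by (auto intro: continuous_on_open_Un)

lemma C1_deriv_extend_zero:
  assumes F: "C1_deriv S F F'" and "open S" and "closed K" "K \<subseteq> S" and "\<And>p. p \<in> S - K \<Longrightarrow> F p = 0"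
  shows "C1_deriv UNIV (\<lambda>p. if p \<in> S then F p else 0) (\<lambda>p v. if p \<in> S then F' p v else 0)"
    (is "C1_deriv _ ?F ?F'")
proof -
  have F'_zero: "F' p v = 0" if "p \<in> S - K" for p v
    using C1_deriv_eq_0_of_local_zero[OF F, of "S - K" p v] assms that by auto
  have "C1_deriv S ?F ?F'" by (rule C1_deriv_cong[OF F \<open>open S\<close>]) auto
  moreover have "C1_deriv (-K) ?F ?F'"
    by (rule C1_deriv_cong[OF C1_deriv_const[of "-K" 0]]) (use assms F'_zero in auto)
  moreover have "S \<union> (-K) = UNIV" using \<open>K \<subseteq> S\<close> by auto
  ultimately show ?thesis using C1_deriv_Un[of S ?F ?F' "-K"] assms by (simp add: open_Compl)
qed

lemma linear_eq_inner_Basis_sum: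
  fixes l :: "'a::euclidean_space \<Rightarrow> real"
  assumes "linear l"
  shows "l v = (\<Sum>b\<in>Basis. l b *\<^sub>R b) \<bullet> v"
proof -
  have "l v = l (\<Sum>b\<in>Basis. (v \<bullet> b) *\<^sub>R b)" by (simp add: euclidean_representation)
  also have "\<dots> = (\<Sum>b\<in>Basis. (v \<bullet> b) * l b)" using assms by (simp add: linear_sum linear_cmul)
  finally show ?thesis by (simp add: inner_sum_left inner_commute[of v] mult.commute)
qed

lemma C1_deriv_apply_continuous:
  fixes s :: "'a::euclidean_space \<Rightarrow> real"
  assumes s: "C1_deriv S s s'" and "continuous_on S J"
  shows "continuous_on S (\<lambda>p. s' p (J p))"
proof -
  have "continuous_on S (\<lambda>p. (\<Sum>b\<in>Basis. s' p b *\<^sub>R b) \<bullet> J p)"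
    by (intro continuous_intros C1_deriv_continuous_deriv[OF s] assms)
  then show ?thesis
    by (rule continuous_on_eq) (simp only: linear_eq_inner_Basis_sum[OF C1_deriv_linear[OF s], symmetric])
qed

definition trace_of :: "('a::euclidean_space \<Rightarrow> 'a) \<Rightarrow> real" where
  "trace_of L = (\<Sum>b\<in>Basis. L b \<bullet> b)"

lemma trace_of_add: "trace_of (\<lambda>v. A v + B v) = trace_of A + trace_of B"
  by (simp add: trace_of_def inner_add_left sum.distrib)

lemma trace_of_diff: "trace_of (\<lambda>v. A v - B v) = trace_of A - trace_of B"
  by (simp add: trace_of_def inner_diff_left sum_subtractf)

lemma trace_of_scaleR: "trace_of (\<lambda>v. c *\<^sub>R A v) = c * trace_of A"
  by (simp add: trace_of_def sum_distrib_left)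

lemma trace_of_rank_one:
  fixes l :: "'a::euclidean_space \<Rightarrow> real"
  assumes "linear l"
  shows "trace_of (\<lambda>v. l v *\<^sub>R c) = l c"
  using linear_eq_inner_Basis_sum[OF assms, of c]
  by (simp add: trace_of_def inner_sum_left inner_commute[of c])

lemma trace_of_inner: "trace_of (\<lambda>v. (a \<bullet> v) *\<^sub>R c) = a \<bullet> c"
  by (rule trace_of_rank_one) (simp add: linear_iff inner_add_right)

lemma trace_of_id: "trace_of (\<lambda>v::'a::euclidean_space. v) = DIM('a)"
  by (simp add: trace_of_def inner_Basis)

lemma C1_deriv_continuous_trace: "C1_deriv S J J' \<Longrightarrow> continuous_on S (\<lambda>p. trace_of (J' p))"
  unfolding trace_of_def by (intro continuous_intros C1_deriv_continuous_deriv)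

definition C1_div :: "'a::euclidean_space set \<Rightarrow> ('a \<Rightarrow> 'a) \<Rightarrow> ('a \<Rightarrow> real) \<Rightarrow> bool" where
  "C1_div S J \<delta> \<longleftrightarrow> (\<exists>J'. C1_deriv S J J' \<and> (\<forall>p\<in>S. trace_of (J' p) = \<delta> p))"

lemma C1_divI: "C1_deriv S J J' \<Longrightarrow> (\<And>p. p \<in> S \<Longrightarrow> trace_of (J' p) = \<delta> p) \<Longrightarrow> C1_div S J \<delta>"
  by (auto simp: C1_div_def)

lemma C1_div_cong_div: "C1_div S J \<delta> \<Longrightarrow> (\<And>p. p \<in> S \<Longrightarrow> \<delta> p = \<gamma> p) \<Longrightarrow> C1_div S J \<gamma>"
  by (auto simp: C1_div_def)

lemma C1_div_cong:
  assumes "C1_div S J \<delta>" "open S" "\<And>p. p \<in> S \<Longrightarrow> J p = K p"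
  shows "C1_div S K \<delta>"
proof -
  obtain J' where J': "C1_deriv S J J'" "\<forall>p\<in>S. trace_of (J' p) = \<delta> p" using assms(1) by (auto simp: C1_div_def)
  show ?thesis by (rule C1_divI[OF C1_deriv_cong[OF J'(1) assms(2,3)]]) (use J'(2) in auto)
qed

lemma C1_div_subset: "C1_div S J \<delta> \<Longrightarrow> T \<subseteq> S \<Longrightarrow> C1_div T J \<delta>"
  unfolding C1_div_def using C1_deriv_subset by blast

lemma C1_div_continuous_on: "C1_div S J \<delta> \<Longrightarrow> continuous_on S J"
  unfolding C1_div_def using C1_deriv_continuous_on by blast

lemma C1_div_continuous_div:
  assumes "C1_div S J \<delta>" shows "continuous_on S \<delta>"
proof -
  obtain J' where "C1_deriv S J J'" "\<forall>p\<in>S. trace_of (J' p) = \<delta> p" using assms by (auto simp: C1_div_def)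
  then show ?thesis using continuous_on_eq[OF C1_deriv_continuous_trace] by blast
qed

lemma C1_div_add: "C1_div S J \<delta> \<Longrightarrow> C1_div S K \<gamma> \<Longrightarrow> C1_div S (\<lambda>p. J p + K p) (\<lambda>p. \<delta> p + \<gamma> p)"
  unfolding C1_div_def using C1_deriv_add by (fastforce simp: trace_of_add)

lemma C1_div_diff: "C1_div S J \<delta> \<Longrightarrow> C1_div S K \<gamma> \<Longrightarrow> C1_div S (\<lambda>p. J p - K p) (\<lambda>p. \<delta> p - \<gamma> p)"
  unfolding C1_div_def using C1_deriv_diff by (fastforce simp: trace_of_diff)

lemma C1_div_scaleR:
  assumes s: "C1_deriv S s s'" and "C1_div S J \<delta>"
  shows "C1_div S (\<lambda>p. s p *\<^sub>R J p) (\<lambda>p. s p * \<delta> p + s' p (J p))"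
proof -
  obtain J' where J': "C1_deriv S J J'" "\<And>p. p \<in> S \<Longrightarrow> trace_of (J' p) = \<delta> p" using assms(2) by (auto simp: C1_div_def)
  show ?thesis
    by (rule C1_divI[OF C1_deriv_scaleR[OF s J'(1)]])
      (simp add: trace_of_add trace_of_scaleR J'(2) trace_of_rank_one[OF C1_deriv_linear[OF s]])
qed

section \<open>Integration by parts for compactly supported fields\<close>

lemma integrable_compact_support_on:
  fixes g :: "'a::euclidean_space \<Rightarrow> real"
  assumes "continuous_on S g" "compact K" "K \<subseteq> S" "\<And>p. p \<in> S - K \<Longrightarrow> g p = 0"
  shows "integrable lborel (\<lambda>p. if p \<in> S then g p else 0)"
proof -
  have "integrable lborel (\<lambda>p. indicator K p *\<^sub>R g p)"
    by (rule borel_integrable_compact[OF assms(2) continuous_on_subset[OF assms(1,3)]])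
  moreover have "(\<lambda>p. indicator K p *\<^sub>R g p) = (\<lambda>p. if p \<in> S then g p else 0)"
    using assms(3,4) by (auto simp: fun_eq_iff indicator_def subset_iff)
  ultimately show ?thesis by simp
qed

lemma integral_lborel_translate:
  fixes g :: "'a::euclidean_space \<Rightarrow> real"
  assumes "integrable lborel g"
  shows "integrable lborel (\<lambda>p. g (c + p))" "(\<integral>p. g (c + p) \<partial>lborel) = (\<integral>p. g p \<partial>lborel)"
proof -
  have "distr lborel borel ((+) c) = lborel" by (rule lborel_distr_plus)
  moreover have "g \<in> borel_measurable borel" using assms by (simp add: borel_measurable_integrable)
  ultimately show "integrable lborel (\<lambda>p. g (c + p))" "(\<integral>p. g (c + p) \<partial>lborel) = (\<integral>p. g p \<partial>lborel)"
    using integral_distr[of "(+) c" lborel borel g] integrable_distr_eq[of "(+) c" lborel borel g] assms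
    by simp_all
qed

lemma difference_quotient_tendsto:
  fixes g :: "'a::real_normed_vector \<Rightarrow> real"
  assumes "C1_deriv S g g'" "p \<in> S"
  shows "(\<lambda>n. (g (p + (1 / real (Suc n)) *\<^sub>R b) - g p) * real (Suc n)) \<longlonglongrightarrow> g' p b"
proof -
  have "((\<lambda>h. (g (p + h *\<^sub>R b) - g p) / h) \<longlongrightarrow> g' p b) (at 0)"
    using C1_deriv_line_real[OF assms(1), of p 0 b] assms(2) by (simp add: DERIV_def)
  moreover have "filterlim (\<lambda>n. 1 / real (Suc n)) (at 0) sequentially"
    unfolding filterlim_at using LIMSEQ_inverse_real_of_nat by (simp add: inverse_eq_divide)
  ultimately have "((\<lambda>n. (g (p + (1 / real (Suc n)) *\<^sub>R b) - g p) / (1 / real (Suc n))) \<longlongrightarrow> g' p b) sequentially"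
    by (rule filterlim_compose)
  then show ?thesis by simp
qed

lemma difference_quotient_bound:
  fixes g :: "'a::real_normed_vector \<Rightarrow> real"
  assumes g: "C1_deriv UNIV g g'" and M: "\<And>p. \<bar>g' p b\<bar> \<le> M"
    and B: "\<And>p. B < norm p \<Longrightarrow> g p = 0"
  shows "\<bar>(g (p + (1 / real (Suc n)) *\<^sub>R b) - g p) * real (Suc n)\<bar> \<le> M * indicator (cball 0 (B + norm b)) p"
proof (cases "p \<in> cball 0 (B + norm b)")
  case True
  obtain \<xi> where "g (p + (1 / real (Suc n)) *\<^sub>R b) - g (p + 0 *\<^sub>R b)
      = (1 / real (Suc n) - 0) * g' (p + \<xi> *\<^sub>R b) b"
    using MVT2[of 0 "1 / real (Suc n)", OF _ C1_deriv_line_real[OF g]] by auto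
  then show ?thesis using True M by simp
next
  case False
  have "norm ((1 / real (Suc n)) *\<^sub>R b) \<le> norm b"
    by (simp add: mult_left_le_one_le divide_le_eq mult_le_cancel_left1)
  then have "norm p - norm b \<le> norm (p + (1 / real (Suc n)) *\<^sub>R b)"
    using norm_diff_ineq[of p "(1 / real (Suc n)) *\<^sub>R b"] by linarith
  moreover have "B + norm b < norm p" using False by simp
  ultimately have "B < norm (p + (1 / real (Suc n)) *\<^sub>R b)" "B < norm p" using norm_ge_zero[of b] by linarith+
  then show ?thesis using B False by simp
qed

lemma integral_directional_derivative_zero:
  fixes g :: "'a::euclidean_space \<Rightarrow> real"
  assumes g: "C1_deriv UNIV g g'" and K: "compact K" and g_zero: "\<And>p. p \<notin> K \<Longrightarrow> g p = 0"
  shows "integrable lborel (\<lambda>p. g' p b)" "(\<integral>p. g' p b \<partial>lborel) = 0"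
proof -
  have continuous: "continuous_on UNIV g" "continuous_on UNIV (\<lambda>p. g' p b)"
    using g C1_deriv_continuous_on C1_deriv_continuous_deriv by auto
  have g'_zero: "g' p b = 0" if "p \<notin> K" for p
    using C1_deriv_eq_0_of_local_zero[OF g, of "-K" p b] g_zero that compact_imp_closed[OF K]
    by (auto simp: open_Compl)
  obtain M where "\<And>p. p \<in> K \<Longrightarrow> \<bar>g' p b\<bar> \<le> M"
    using compact_imp_bounded[OF compact_continuous_image[OF continuous_on_subset[OF continuous(2)] K]]
    by (auto simp: bounded_iff)
  then have g'_le: "\<bar>g' p b\<bar> \<le> max M 0" for p using g'_zero by (cases "p \<in> K") (auto simp: le_max_iff_disj)
  obtain B where "\<And>p. p \<in> K \<Longrightarrow> norm p \<le> B" using compact_imp_bounded[OF K] by (auto simp: bounded_iff)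
  then have zero_outside: "g p = 0" if "B < norm p" for p using g_zero that by force
  define quotient where "quotient n p = (g (p + (1 / real (Suc n)) *\<^sub>R b) - g p) * real (Suc n)" for n p
  have measurable: "(\<lambda>p. g' p b) \<in> borel_measurable lborel" "\<And>n. quotient n \<in> borel_measurable lborel"
    unfolding quotient_def using continuous
    by (auto intro!: borel_measurable_continuous_onI continuous_intros continuous_on_compose2[OF continuous(1)])
  have dominating: "integrable lborel (\<lambda>p. max M 0 * indicator (cball 0 (B + norm b)) (p::'a))"
    using emeasure_bounded_finite[of "cball (0::'a) (B + norm b)"] by simp
  have limit: "AE p in lborel. (\<lambda>n. quotient n p) \<longlonglongrightarrow> g' p b"
    unfolding quotient_def using difference_quotient_tendsto[OF g] by simp
  have bound: "AE p in lborel. norm (quotient n p) \<le> max M 0 * indicator (cball 0 (B + norm b)) p" for n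
    unfolding quotient_def real_norm_def using difference_quotient_bound[OF g g'_le zero_outside] by blast
  show "integrable lborel (\<lambda>p. g' p b)"
    by (rule integrable_dominated_convergence[OF measurable dominating limit bound])
  have "(\<lambda>n. \<integral>p. quotient n p \<partial>lborel) \<longlonglongrightarrow> (\<integral>p. g' p b \<partial>lborel)"
    by (rule integral_dominated_convergence[OF measurable dominating limit bound])
  moreover have "integrable lborel g"
    using integrable_compact_support_on[OF continuous(1) K] g_zero by simp
  then have "(\<integral>p. quotient n p \<partial>lborel) = 0" for n
    using integral_lborel_translate[of g "(1 / real (Suc n)) *\<^sub>R b"] by (simp add: quotient_def add.commute)
  ultimately show "(\<integral>p. g' p b \<partial>lborel) = 0" by (simp add: LIMSEQ_const_iff)
qed

lemma integral_divergence_zero: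
  fixes F :: "'a::euclidean_space \<Rightarrow> 'a"
  assumes "C1_div S F \<delta>" "open S" "compact K" "K \<subseteq> S" "\<And>p. p \<in> S - K \<Longrightarrow> F p = 0"
  shows "integrable lborel (\<lambda>p. if p \<in> S then \<delta> p else 0)" "(\<integral>p. (if p \<in> S then \<delta> p else 0) \<partial>lborel) = 0"
proof -
  obtain F' where F': "C1_deriv S F F'" "\<And>p. p \<in> S \<Longrightarrow> trace_of (F' p) = \<delta> p" using assms(1) by (auto simp: C1_div_def)
  have component: "C1_deriv UNIV (\<lambda>p. (if p \<in> S then F p else 0) \<bullet> b) (\<lambda>p v. (if p \<in> S then F' p v else 0) \<bullet> b)" for b
    by (rule C1_deriv_linear_compose[OF bounded_linear_inner_left
        C1_deriv_extend_zero[OF F'(1) assms(2) compact_imp_closed[OF assms(3)] assms(4,5)]])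
  have trace: "(if p \<in> S then \<delta> p else 0) = (\<Sum>b\<in>Basis. (if p \<in> S then F' p b else 0) \<bullet> b)" for p
    by (simp add: trace_of_def F'(2)[symmetric])
  have "integrable lborel (\<lambda>p. (if p \<in> S then F' p b else 0) \<bullet> b)"
       "(\<integral>p. (if p \<in> S then F' p b else 0) \<bullet> b \<partial>lborel) = 0" for b
    using integral_directional_derivative_zero[OF component[of b] assms(3), of b] assms(5) by fastforce+
  then show "integrable lborel (\<lambda>p. if p \<in> S then \<delta> p else 0)" "(\<integral>p. (if p \<in> S then \<delta> p else 0) \<partial>lborel) = 0"
    unfolding trace by (auto simp: Bochner_Integration.integral_sum)
qed

lemma integral_gradient_zero:
  fixes s :: "'a::euclidean_space \<Rightarrow> real"
  assumes "C1_deriv S s s'" "open S" "compact K" "K \<subseteq> S" "\<And>p. p \<in> S - K \<Longrightarrow> s p = 0"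
  shows "(\<integral>p. (if p \<in> S then s' p h else 0) \<partial>lborel) = 0"
  using integral_directional_derivative_zero(2)[OF
      C1_deriv_extend_zero[OF assms(1,2) compact_imp_closed[OF assms(3)] assms(4,5)] assms(3), of h]
    assms(5) by fastforce

section \<open>Symmetry of second derivatives\<close>

definition second_difference :: "('a::real_vector \<Rightarrow> real) \<Rightarrow> 'a \<Rightarrow> 'a \<Rightarrow> 'a \<Rightarrow> real" where
  "second_difference z p u v = z (p + u + v) - z (p + u) - (z (p + v) - z p)"

lemma second_difference_commute: "second_difference z p u v = second_difference z p v u"
  by (simp add: second_difference_def add.commute add.left_commute)

lemma second_difference_mean_value:
  fixes z :: "'a::euclidean_space \<Rightarrow> real"
  assumes z: "C1_deriv S z (\<lambda>p v. G p \<bullet> v)" and G: "C1_deriv S G H" and s_pos: "0 < s"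
    and in_S: "\<And>\<sigma> \<rho>. \<lbrakk>0 \<le> \<sigma>; \<sigma> \<le> s; 0 \<le> \<rho>; \<rho> \<le> s\<rbrakk> \<Longrightarrow> p + \<sigma> *\<^sub>R u + \<rho> *\<^sub>R v \<in> S"
  obtains \<sigma> \<rho> where "0 < \<sigma>" "\<sigma> < s" "0 < \<rho>" "\<rho> < s"
    "second_difference z p (s *\<^sub>R u) (s *\<^sub>R v) = s\<^sup>2 * (H (p + \<sigma> *\<^sub>R u + \<rho> *\<^sub>R v) v \<bullet> u)"
proof -
  have "((\<lambda>\<sigma>. z (p + \<sigma> *\<^sub>R u + s *\<^sub>R v) - z (p + \<sigma> *\<^sub>R u)) has_real_derivative
      (G (p + \<sigma> *\<^sub>R u + s *\<^sub>R v) \<bullet> u - G (p + \<sigma> *\<^sub>R u) \<bullet> u)) (at \<sigma>)" if "0 \<le> \<sigma>" "\<sigma> \<le> s" for \<sigma>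
  proof -
    have "p + \<sigma> *\<^sub>R u \<in> S" "p + \<sigma> *\<^sub>R u + s *\<^sub>R v \<in> S" using in_S[of \<sigma> s] in_S[of \<sigma> 0] that s_pos by auto
    then show ?thesis
      using DERIV_diff[OF C1_deriv_line_real[OF z, of "p + s *\<^sub>R v" \<sigma> u] C1_deriv_line_real[OF z, of p \<sigma> u]]
      by (simp add: add.commute add.left_commute)
  qed
  from MVT2[OF s_pos this] obtain \<sigma> where \<sigma>: "0 < \<sigma>" "\<sigma> < s"
    "second_difference z p (s *\<^sub>R u) (s *\<^sub>R v) = s * (G (p + \<sigma> *\<^sub>R u + s *\<^sub>R v) \<bullet> u - G (p + \<sigma> *\<^sub>R u) \<bullet> u)"
    by (auto simp: second_difference_def)
  have "((\<lambda>\<rho>. G (p + \<sigma> *\<^sub>R u + \<rho> *\<^sub>R v) \<bullet> u) has_real_derivative H (p + \<sigma> *\<^sub>R u + \<rho> *\<^sub>R v) v \<bullet> u) (at \<rho>)"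
    if "0 \<le> \<rho>" "\<rho> \<le> s" for \<rho>
  proof -
    have "p + \<sigma> *\<^sub>R u + \<rho> *\<^sub>R v \<in> S" using in_S that \<sigma> by auto
    then show ?thesis
      by (rule has_derivative_imp_has_field_derivative[OF has_derivative_inner_left[OF C1_deriv_line[OF G]]]) simp
  qed
  from MVT2[OF s_pos this] obtain \<rho> where "0 < \<rho>" "\<rho> < s"
    "G (p + \<sigma> *\<^sub>R u + s *\<^sub>R v) \<bullet> u - G (p + \<sigma> *\<^sub>R u) \<bullet> u = s * (H (p + \<sigma> *\<^sub>R u + \<rho> *\<^sub>R v) v \<bullet> u)" by auto
  with \<sigma> show ?thesis using that by (simp add: power2_eq_square)
qed

lemma norm_scaleR_add_scaleR_le:
  fixes u v :: "'a::real_normed_vector"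
  assumes "0 \<le> \<sigma>" "\<sigma> \<le> s" "0 \<le> \<rho>" "\<rho> \<le> s"
  shows "norm (\<sigma> *\<^sub>R u + \<rho> *\<^sub>R v) \<le> s * (norm u + norm v)"
proof -
  have "norm (\<sigma> *\<^sub>R u + \<rho> *\<^sub>R v) \<le> \<sigma> * norm u + \<rho> * norm v"
    using norm_triangle_ineq[of "\<sigma> *\<^sub>R u" "\<rho> *\<^sub>R v"] assms by simp
  also have "\<dots> \<le> s * norm u + s * norm v" using assms by (intro add_mono mult_right_mono) auto
  finally show ?thesis by (simp add: distrib_left)
qed

lemma second_difference_tendsto:
  fixes z :: "'a::euclidean_space \<Rightarrow> real"
  assumes "open S" "p \<in> S" and z: "C1_deriv S z (\<lambda>p v. G p \<bullet> v)" and G: "C1_deriv S G H"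
  shows "((\<lambda>s. second_difference z p (s *\<^sub>R u) (s *\<^sub>R v) / s\<^sup>2) \<longlongrightarrow> H p v \<bullet> u) (at_right 0)"
proof (rule tendstoI)
  fix \<kappa> :: real assume "\<kappa> > 0"
  have "isCont (\<lambda>q. H q v \<bullet> u) p"
    using C1_deriv_continuous_deriv[OF G, of v] assms(1,2)
    by (auto simp: continuous_on_eq_continuous_at intro!: continuous_intros)
  then obtain d where d: "d > 0" "\<And>q. dist q p < d \<Longrightarrow> dist (H q v \<bullet> u) (H p v \<bullet> u) < \<kappa>"
    using \<open>\<kappa> > 0\<close> unfolding continuous_at_eps_delta by blast
  obtain e where e: "e > 0" "ball p e \<subseteq> S" using assms(1,2) openE by blast
  define N where "N = norm u + norm v + 1"
  have N: "N > 0" "norm u + norm v < N" unfolding N_def using norm_ge_zero[of u] norm_ge_zero[of v] by linarith+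
  have "dist (second_difference z p (s *\<^sub>R u) (s *\<^sub>R v) / s\<^sup>2) (H p v \<bullet> u) < \<kappa>"
    if s: "0 < s" "s < min d e / N" for s
  proof -
    have "s * (norm u + norm v) < min d e"
      using s N mult_strict_left_mono[OF N(2) s(1)] by (simp add: field_simps)
    then have close: "dist (p + \<sigma> *\<^sub>R u + \<rho> *\<^sub>R v) p < min d e" if "0 \<le> \<sigma>" "\<sigma> \<le> s" "0 \<le> \<rho>" "\<rho> \<le> s" for \<sigma> \<rho>
      using norm_scaleR_add_scaleR_le[OF that, of u v] by (simp add: dist_norm add.assoc)
    have "p + \<sigma> *\<^sub>R u + \<rho> *\<^sub>R v \<in> S" if "0 \<le> \<sigma>" "\<sigma> \<le> s" "0 \<le> \<rho>" "\<rho> \<le> s" for \<sigma> \<rho>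
      using close[OF that] e(2) by (auto simp: dist_commute)
    from second_difference_mean_value[OF z G s(1) this] obtain \<sigma> \<rho> where
      "0 < \<sigma>" "\<sigma> < s" "0 < \<rho>" "\<rho> < s"
      "second_difference z p (s *\<^sub>R u) (s *\<^sub>R v) = s\<^sup>2 * (H (p + \<sigma> *\<^sub>R u + \<rho> *\<^sub>R v) v \<bullet> u)" by blast
    then show ?thesis using d(2)[of "p + \<sigma> *\<^sub>R u + \<rho> *\<^sub>R v"] close[of \<sigma> \<rho>] s(1) by simp
  qed
  moreover have "min d e / N > 0" using d(1) e(1) N(1) by simp
  ultimately show "\<forall>\<^sub>F s in at_right 0. dist (second_difference z p (s *\<^sub>R u) (s *\<^sub>R v) / s\<^sup>2) (H p v \<bullet> u) < \<kappa>"
    by (auto simp: eventually_at_right_field)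
qed

lemma second_derivative_symmetric:
  fixes z :: "'a::euclidean_space \<Rightarrow> real"
  assumes "open S" "p \<in> S" "C1_deriv S z (\<lambda>p v. G p \<bullet> v)" "C1_deriv S G H"
  shows "H p u \<bullet> v = H p v \<bullet> u"
  using second_difference_tendsto[OF assms, of u v] second_difference_tendsto[OF assms, of v u]
  by (simp add: second_difference_commute[of z p] tendsto_unique[OF trivial_limit_at_right_real])

section \<open>Cutoff functions\<close>

definition pos_sq :: "real \<Rightarrow> real" where "pos_sq s = (max 0 s)\<^sup>2"

lemma pos_sq_has_derivative: "(pos_sq has_real_derivative 2 * max 0 s) (at s)"
proof -
  consider "s < 0" | "s > 0" | "s = 0" by linarith
  then show ?thesis
  proof cases
    case 1
    then have "((\<lambda>_. 0) has_real_derivative 2 * max 0 s) (at s)" by simp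
    then show ?thesis
      by (rule has_field_derivative_transform_within_open[where S="{..<0}"]) (use 1 in \<open>auto simp: pos_sq_def\<close>)
  next
    case 2
    then have "((\<lambda>s. s\<^sup>2) has_real_derivative 2 * max 0 s) (at s)" by (auto intro!: derivative_eq_intros)
    then show ?thesis
      by (rule has_field_derivative_transform_within_open[where S="{0<..}"]) (use 2 in \<open>auto simp: pos_sq_def\<close>)
  next
    case 3
    have "((\<lambda>h. pos_sq h / h) \<longlongrightarrow> 0) (at 0)"
    proof (rule Lim_null_comparison)
      show "\<forall>\<^sub>F h in at 0. norm (pos_sq h / h) \<le> \<bar>h\<bar>"
        by (auto simp: pos_sq_def eventually_at_filter max_def power2_eq_square)
      show "((\<lambda>h::real. \<bar>h\<bar>) \<longlongrightarrow> 0) (at 0)" by (intro tendsto_rabs_zero tendsto_ident_at)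
    qed
    then show ?thesis using 3 by (simp add: DERIV_def pos_sq_def)
  qed
qed

definition cutoff :: "real \<Rightarrow> real" where
  "cutoff s = pos_sq (s - 1) / (pos_sq (s - 1) + pos_sq (2 - s))"

definition cutoff' :: "real \<Rightarrow> real" where
  "cutoff' s = (2 * max 0 (s - 1) * pos_sq (2 - s) + pos_sq (s - 1) * (2 * max 0 (2 - s)))
     / (pos_sq (s - 1) + pos_sq (2 - s))\<^sup>2"

lemma cutoff_denominator_pos: "pos_sq (s - 1) + pos_sq (2 - s) > 0"
proof (cases "s > 1")
  case True
  then show ?thesis by (simp add: pos_sq_def add_pos_nonneg)
next
  case False
  then show ?thesis by (simp add: pos_sq_def add_nonneg_pos)
qed

lemma cutoff_has_derivative: "(cutoff has_real_derivative cutoff' s) (at s)"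
proof -
  have rising: "((\<lambda>s. pos_sq (s - 1)) has_real_derivative 2 * max 0 (s - 1)) (at s)"
    by (rule DERIV_cong[OF DERIV_chain2[OF pos_sq_has_derivative DERIV_diff[OF DERIV_ident DERIV_const]]]) simp
  have falling: "((\<lambda>s. pos_sq (2 - s)) has_real_derivative - (2 * max 0 (2 - s))) (at s)"
    by (rule DERIV_cong[OF DERIV_chain2[OF pos_sq_has_derivative DERIV_diff[OF DERIV_const DERIV_ident]]]) simp
  have "(cutoff has_real_derivative
    (2 * max 0 (s - 1) * (pos_sq (s - 1) + pos_sq (2 - s)) - pos_sq (s - 1) * (2 * max 0 (s - 1) + - (2 * max 0 (2 - s))))
     / ((pos_sq (s - 1) + pos_sq (2 - s)) * (pos_sq (s - 1) + pos_sq (2 - s)))) (at s)"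
    unfolding cutoff_def[abs_def]
    by (rule DERIV_divide[OF rising DERIV_add[OF rising falling]]) (use cutoff_denominator_pos[of s] in simp)
  then show ?thesis by (simp add: cutoff'_def power2_eq_square algebra_simps)
qed

lemma continuous_on_cutoff': "continuous_on A cutoff'"
proof -
  have "pos_sq (s - 1) + pos_sq (2 - s) \<noteq> 0" for s using cutoff_denominator_pos[of s] by simp
  moreover have "continuous_on A (\<lambda>s. pos_sq (s - 1))" "continuous_on A (\<lambda>s. pos_sq (2 - s))"
    unfolding pos_sq_def by (intro continuous_intros)+
  ultimately show ?thesis unfolding cutoff'_def[abs_def] by (intro continuous_intros) auto
qed

lemma cutoff_nonneg: "0 \<le> cutoff s" and cutoff_le_1: "cutoff s \<le> 1"
  using cutoff_denominator_pos[of s] by (auto simp: cutoff_def pos_sq_def divide_le_eq)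

lemma cutoff_eq_0: "s \<le> 1 \<Longrightarrow> cutoff s = 0" and cutoff_eq_1: "2 \<le> s \<Longrightarrow> cutoff s = 1"
  by (auto simp: cutoff_def pos_sq_def)

lemma cutoff'_nonneg: "0 \<le> cutoff' s"
  by (simp add: cutoff'_def pos_sq_def)

lemma cutoff'_eq_0: "s \<le> 1 \<or> 2 \<le> s \<Longrightarrow> cutoff' s = 0"
  by (auto simp: cutoff'_def pos_sq_def)

lemma cutoff'_bounded: obtains M where "M > 0" "\<And>s. cutoff' s \<le> M"
proof -
  obtain M where M: "\<forall>s\<in>{1..2}. \<bar>cutoff' s\<bar> \<le> M"
    using compact_imp_bounded[OF compact_continuous_image[OF continuous_on_cutoff'[of "{1..2}"]]]
    by (auto simp: bounded_iff)
  have "cutoff' s \<le> max M 1" for s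
  proof (cases "s \<in> {1..2}")
    case True
    then have "\<bar>cutoff' s\<bar> \<le> M" using M by blast
    then show ?thesis by linarith
  next
    case False
    then show ?thesis using cutoff'_eq_0[of s] by auto
  qed
  then show ?thesis using that[of "max M 1"] by simp
qed

lemma C1_deriv_cutoff:
  assumes "C1_deriv S s s'"
  shows "C1_deriv S (\<lambda>p. cutoff (s p)) (\<lambda>p v. cutoff' (s p) * s' p v)"
  by (rule C1_deriv_compose_real[OF assms cutoff_has_derivative continuous_on_cutoff'])

definition bump :: "'a::euclidean_space \<Rightarrow> real \<Rightarrow> 'a \<Rightarrow> real" where
  "bump c \<rho> p = cutoff (3 - ((p - c) \<bullet> (p - c)) / \<rho>\<^sup>2)"

definition bump' :: "'a::euclidean_space \<Rightarrow> real \<Rightarrow> 'a \<Rightarrow> 'a \<Rightarrow> real" where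
  "bump' c \<rho> p v = cutoff' (3 - ((p - c) \<bullet> (p - c)) / \<rho>\<^sup>2) * (- 2 * ((p - c) \<bullet> v) / \<rho>\<^sup>2)"

lemma C1_deriv_dist_sq: "C1_deriv S (\<lambda>p. (p - c) \<bullet> (p - c)) (\<lambda>p v. 2 * ((p - c) \<bullet> v))"
  by (rule C1_deriv_cong_deriv[OF C1_deriv_inner[OF
        C1_deriv_diff[OF C1_deriv_bounded_linear[OF bounded_linear_ident] C1_deriv_const]
        C1_deriv_diff[OF C1_deriv_bounded_linear[OF bounded_linear_ident] C1_deriv_const]]])
    (simp add: inner_commute)

lemma C1_deriv_bump: "C1_deriv S (bump c \<rho>) (bump' c \<rho>)"
proof -
  have "C1_deriv S (\<lambda>p. 3 - (1 / \<rho>\<^sup>2) * ((p - c) \<bullet> (p - c))) (\<lambda>p v. 0 - (1 / \<rho>\<^sup>2) * (2 * ((p - c) \<bullet> v)))"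
    by (intro C1_deriv_diff C1_deriv_const C1_deriv_cmult C1_deriv_dist_sq)
  from C1_deriv_cutoff[OF this] show ?thesis
    unfolding bump_def[abs_def] bump'_def[abs_def] by simp
qed

lemma bump_nonneg [simp]: "0 \<le> bump c \<rho> p" and bump_le_1 [simp]: "bump c \<rho> p \<le> 1"
  by (auto simp: bump_def cutoff_nonneg cutoff_le_1)

lemma
  assumes "\<rho> > 0" "dist p c \<le> \<rho>"
  shows bump_eq_1: "bump c \<rho> p = 1" and bump'_eq_0_inside: "bump' c \<rho> p v = 0"
proof -
  have "(p - c) \<bullet> (p - c) \<le> \<rho>\<^sup>2" using assms
    by (simp add: dist_norm power2_norm_eq_inner[symmetric] power_mono)
  then have argument_ge: "2 \<le> 3 - ((p - c) \<bullet> (p - c)) / \<rho>\<^sup>2" using assms(1) by (simp add: field_simps)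
  show "bump c \<rho> p = 1" unfolding bump_def by (rule cutoff_eq_1[OF argument_ge])
  show "bump' c \<rho> p v = 0" unfolding bump'_def using cutoff'_eq_0 argument_ge by simp
qed

lemma
  assumes "\<rho> > 0" "2 * \<rho> \<le> dist p c"
  shows bump_eq_0: "bump c \<rho> p = 0" and bump'_eq_0: "bump' c \<rho> p v = 0"
proof -
  have "(2 * \<rho>)\<^sup>2 \<le> (dist p c)\<^sup>2" using assms by (intro power_mono) auto
  then have "4 * \<rho>\<^sup>2 \<le> (p - c) \<bullet> (p - c)"
    by (simp add: dist_norm power2_norm_eq_inner power_mult_distrib)
  then have "2 * \<rho>\<^sup>2 \<le> (p - c) \<bullet> (p - c)" using zero_le_power2[of \<rho>] by linarith
  then have argument_le: "3 - ((p - c) \<bullet> (p - c)) / \<rho>\<^sup>2 \<le> 1" using assms(1) by (simp add: field_simps)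
  show "bump c \<rho> p = 0" unfolding bump_def by (rule cutoff_eq_0[OF argument_le])
  show "bump' c \<rho> p v = 0" unfolding bump'_def using cutoff'_eq_0 argument_le by simp
qed

definition steepness :: "nat \<Rightarrow> real" where "steepness j = real (Suc j)"

lemma steepness_pos: "steepness j > 0"
  by (simp add: steepness_def)

lemma eventually_steepness_gt: "\<forall>\<^sub>F j in sequentially. x < steepness j"
proof -
  have "\<forall>\<^sub>F j in sequentially. x < real j"
    using filterlim_real_sequentially by (simp add: filterlim_at_top_dense)
  then show ?thesis by eventually_elim (simp add: steepness_def)
qed

section \<open>Interior cutoffs at a smooth boundary\<close>

lemma borel_measurable_on_open:
  fixes g :: "'a::euclidean_space \<Rightarrow> real"
  assumes "open S" "continuous_on S g"
  shows "(\<lambda>p. if p \<in> S then g p else 0) \<in> borel_measurable borel"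
  using assms by (intro borel_measurable_continuous_on_if) auto

lemma borel_measurable_indicator_on_open:
  fixes g :: "'a::euclidean_space \<Rightarrow> real"
  assumes "open S" "continuous_on S g"
  shows "(\<lambda>p. ennreal (g p) * indicator S p) \<in> borel_measurable lborel"
proof -
  have "(\<lambda>p. ennreal (g p) * indicator S p) = (\<lambda>p. ennreal (if p \<in> S then g p else 0))"
    by (auto simp: indicator_def)
  then show ?thesis using borel_measurable_on_open[OF assms] by simp
qed

definition flux_loss_le :: "'a::euclidean_space set \<Rightarrow> ('a \<Rightarrow> 'a) \<Rightarrow> ('a \<Rightarrow> 'a \<Rightarrow> real) \<Rightarrow> real \<Rightarrow> bool" where
  "flux_loss_le S Q h' e \<longleftrightarrow> (\<exists>A. (\<forall>p\<in>S. - h' p (Q p) \<le> A p) \<and> (\<forall>p. 0 \<le> A p) \<and>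
     A \<in> borel_measurable borel \<and> (\<integral>\<^sup>+p\<in>S. ennreal (A p) \<partial>lborel) \<le> ennreal e)"

locale interior_cutoffs =
  fixes S :: "'a::euclidean_space set" and Q :: "'a \<Rightarrow> 'a" and U :: "'a set"
    and h :: "nat \<Rightarrow> 'a \<Rightarrow> real" and h' :: "nat \<Rightarrow> 'a \<Rightarrow> 'a \<Rightarrow> real"
  assumes C1_h: "C1_deriv S (h j) (h' j)"
    and range: "p \<in> S \<Longrightarrow> 0 \<le> h j p \<and> h j p \<le> 1"
    and eventually_1: "p \<in> S \<Longrightarrow> \<forall>\<^sub>F j in sequentially. h j p = 1"
    and vanishing: "p \<in> frontier S \<Longrightarrow> p \<in> U \<Longrightarrow> \<exists>T. open T \<and> p \<in> T \<and> (\<forall>q\<in>T \<inter> S. h j q = 0)"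
    and eventually_flux: "e > 0 \<Longrightarrow> \<forall>\<^sub>F j in sequentially. flux_loss_le S Q (h' j) e"

locale boundary_chart =
  fixes S V :: "'a::euclidean_space set" and c :: 'a and \<Phi> :: "'a \<Rightarrow> real" and G :: "'a \<Rightarrow> 'a"
  assumes open_S: "open S" and open_V: "open V" and center: "c \<in> V"
    and C1_\<Phi>: "C1_deriv V \<Phi> (\<lambda>p v. G p \<bullet> v)" and G_center: "G c \<noteq> 0"
    and S_Int_V: "S \<inter> V = {p\<in>V. \<Phi> p < 0}"
begin

lemma continuous_on_\<Phi>: "continuous_on V \<Phi>"
  by (rule C1_deriv_continuous_on[OF C1_\<Phi>])

lemma continuous_on_G: "continuous_on V G"
  unfolding continuous_on_componentwise[of V G] using C1_deriv_continuous_deriv[OF C1_\<Phi>] by blast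

lemma open_S_Int_V: "open (S \<inter> V)"
  using open_S open_V by auto

lemma \<Phi>_frontier_zero:
  assumes "p \<in> frontier S" "p \<in> V" shows "\<Phi> p = 0"
proof -
  have p: "p \<notin> S" "p \<in> closure S" using assms(1) open_S by (auto simp: frontier_def interior_open)
  have "\<not> 0 < \<Phi> p"
  proof
    assume "0 < \<Phi> p"
    then have "p \<in> V \<inter> \<Phi> -` {0<..}" using assms(2) by simp
    moreover have "open (V \<inter> \<Phi> -` {0<..})" by (rule continuous_open_preimage[OF continuous_on_\<Phi> open_V open_greaterThan])
    ultimately obtain q where "q \<in> S" "q \<in> V \<inter> \<Phi> -` {0<..}"
      using p(2) closure_iff_nhds_not_empty by (metis disjoint_iff order_refl)
    then have "q \<in> S \<inter> V" "0 < \<Phi> q" by auto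
    then show False unfolding S_Int_V by simp
  qed
  moreover have "\<not> \<Phi> p < 0" using p(1) assms(2) S_Int_V by blast
  ultimately show ?thesis by simp
qed

lemma \<Phi>_line_derivative: "((\<lambda>s. \<Phi> (c + s *\<^sub>R h)) has_real_derivative G c \<bullet> h) (at 0)"
  using C1_deriv_line_real[OF C1_\<Phi>, of c 0 h] center by simp

lemma eventually_line_in_V: "\<forall>\<^sub>F s in at_right 0. c + s *\<^sub>R h \<in> V"
proof (rule topological_tendstoD[OF _ open_V center])
  show "((\<lambda>s. c + s *\<^sub>R h) \<longlongrightarrow> c) (at_right 0)" by (auto intro!: tendsto_eq_intros)
qed

lemma
  assumes "c \<in> frontier S"
  shows eventually_line_inside: "G c \<bullet> h < 0 \<Longrightarrow> \<forall>\<^sub>F s in at_right 0. c + s *\<^sub>R h \<in> S"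
    and eventually_line_outside: "0 < G c \<bullet> h \<Longrightarrow> \<forall>\<^sub>F s in at_right 0. c + s *\<^sub>R h \<notin> S"
proof -
  have \<Phi>_center: "\<Phi> c = 0" by (rule \<Phi>_frontier_zero[OF assms center])
  have in_S: "q \<in> S \<longleftrightarrow> \<Phi> q < 0" if "q \<in> V" for q using S_Int_V that by blast
  show "\<forall>\<^sub>F s in at_right 0. c + s *\<^sub>R h \<in> S" if "G c \<bullet> h < 0"
  proof -
    have "\<forall>\<^sub>F s in at_right 0. \<Phi> (c + s *\<^sub>R h) < 0"
      using DERIV_neg_dec_right[OF \<Phi>_line_derivative that] by (auto simp: eventually_at_right_field \<Phi>_center)
    with eventually_line_in_V[of h] show ?thesis by eventually_elim (simp add: in_S)
  qed
  show "\<forall>\<^sub>F s in at_right 0. c + s *\<^sub>R h \<notin> S" if "0 < G c \<bullet> h"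
  proof -
    have "\<forall>\<^sub>F s in at_right 0. 0 < \<Phi> (c + s *\<^sub>R h)"
      using DERIV_pos_inc_right[OF \<Phi>_line_derivative that] by (auto simp: eventually_at_right_field \<Phi>_center)
    with eventually_line_in_V[of h] show ?thesis by eventually_elim (simp add: in_S)
  qed
qed

lemma gradient_bounded_below_near_center:
  obtains \<rho> where "\<rho> > 0" "cball c (2 * \<rho>) \<subseteq> V" "\<And>p. p \<in> cball c (2 * \<rho>) \<Longrightarrow> (G c \<bullet> G c) / 2 \<le> G p \<bullet> G c"
proof -
  have "open (V \<inter> (\<lambda>p. G p \<bullet> G c) -` {(G c \<bullet> G c) / 2<..})"
    by (intro continuous_open_preimage continuous_intros continuous_on_G open_V)
  moreover have "c \<in> V \<inter> (\<lambda>p. G p \<bullet> G c) -` {(G c \<bullet> G c) / 2<..}" using center G_center by simp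
  ultimately obtain \<rho> where "\<rho> > 0" "cball c \<rho> \<subseteq> V \<inter> (\<lambda>p. G p \<bullet> G c) -` {(G c \<bullet> G c) / 2<..}"
    using open_contains_cball by blast
  then show ?thesis by (intro that[of "\<rho> / 2"]) (auto simp: less_imp_le subset_iff)
qed

end

locale boundary_patch = boundary_chart +
  fixes \<rho> :: real
  assumes radius_pos: "\<rho> > 0" and cball_subset: "cball c (2 * \<rho>) \<subseteq> V"
    and gradient_lower: "p \<in> cball c (2 * \<rho>) \<Longrightarrow> (G c \<bullet> G c) / 2 \<le> G p \<bullet> G c"
begin

definition depth :: "nat \<Rightarrow> 'a \<Rightarrow> real" where
  "depth j p = cutoff (- steepness j * \<Phi> p)"

definition depth' :: "nat \<Rightarrow> 'a \<Rightarrow> 'a \<Rightarrow> real" where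
  "depth' j p v = - steepness j * cutoff' (- steepness j * \<Phi> p) * (G p \<bullet> v)"

definition patch :: "nat \<Rightarrow> 'a \<Rightarrow> real" where
  "patch j p = 1 - bump c \<rho> p * (1 - depth j p)"

definition patch' :: "nat \<Rightarrow> 'a \<Rightarrow> 'a \<Rightarrow> real" where
  "patch' j p v = (if p \<in> V then bump c \<rho> p * depth' j p v - bump' c \<rho> p v * (1 - depth j p) else 0)"

definition layer :: "nat \<Rightarrow> 'a \<Rightarrow> real" where
  "layer j p = bump c \<rho> p * (steepness j * cutoff' (- steepness j * \<Phi> p))"

definition depth_support :: "nat \<Rightarrow> 'a set" where
  "depth_support j = cball c (2 * \<rho>) \<inter> \<Phi> -` {.. - 1 / steepness j}"

lemma bump_outside: "p \<notin> cball c (2 * \<rho>) \<Longrightarrow> bump c \<rho> p = 0" "p \<notin> cball c (2 * \<rho>) \<Longrightarrow> bump' c \<rho> p v = 0"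
  using radius_pos by (auto simp: dist_commute bump_eq_0 bump'_eq_0)

lemma C1_deriv_depth: "C1_deriv V (depth j) (depth' j)"
proof -
  from C1_deriv_cutoff[OF C1_deriv_cmult[OF C1_\<Phi>, of "- steepness j"]] show ?thesis
    unfolding depth_def[abs_def] depth'_def[abs_def] by (simp add: algebra_simps)
qed

lemma depth_range: "0 \<le> depth j p" "depth j p \<le> 1"
  by (auto simp: depth_def cutoff_nonneg cutoff_le_1)

lemma layer_nonneg: "0 \<le> layer j p"
  unfolding layer_def using steepness_pos[of j] cutoff'_nonneg by (simp add: less_imp_le)

lemma C1_deriv_patch: "C1_deriv S (patch j) (patch' j)"
proof -
  have "C1_deriv V (patch j) (\<lambda>p v. 0 - (bump c \<rho> p * (0 - depth' j p v) + bump' c \<rho> p v * (1 - depth j p)))"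
    unfolding patch_def[abs_def]
    by (intro C1_deriv_diff C1_deriv_const C1_deriv_mult C1_deriv_bump C1_deriv_depth)
  then have inside: "C1_deriv V (patch j) (patch' j)"
    by (rule C1_deriv_cong_deriv) (simp add: patch'_def)
  have outside: "C1_deriv (- cball c (2 * \<rho>)) (patch j) (patch' j)"
    by (rule C1_deriv_cong[OF C1_deriv_const[of _ 1]])
      (use bump_outside in \<open>auto simp: patch_def patch'_def open_Compl\<close>)
  have "C1_deriv (V \<union> - cball c (2 * \<rho>)) (patch j) (patch' j)"
    by (rule C1_deriv_Un[OF inside outside open_V]) (simp add: open_Compl)
  then show ?thesis by (rule C1_deriv_subset) (use cball_subset in auto)
qed

lemma patch_range: "0 \<le> patch j p \<and> patch j p \<le> 1"
proof -
  have "bump c \<rho> p * (1 - depth j p) \<le> 1 * 1"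
    using depth_range by (intro mult_mono) auto
  moreover have "0 \<le> bump c \<rho> p * (1 - depth j p)" using depth_range by simp
  ultimately show ?thesis by (simp add: patch_def)
qed

lemma eventually_depth_eq_1:
  assumes "p \<in> S \<inter> V" shows "\<forall>\<^sub>F j in sequentially. depth j p = 1"
proof -
  have "\<Phi> p < 0" using assms S_Int_V by blast
  show ?thesis
    using eventually_steepness_gt[of "2 / (- \<Phi> p)"]
  proof eventually_elim
    case (elim j)
    then have "2 \<le> - steepness j * \<Phi> p" using \<open>\<Phi> p < 0\<close> by (simp add: field_simps)
    then show ?case unfolding depth_def by (rule cutoff_eq_1)
  qed
qed

lemma eventually_patch_eq_1:
  assumes "p \<in> S" shows "\<forall>\<^sub>F j in sequentially. patch j p = 1"
proof (cases "p \<in> V")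
  case True
  with assms have "\<forall>\<^sub>F j in sequentially. depth j p = 1" by (intro eventually_depth_eq_1) blast
  then show ?thesis by eventually_elim (simp add: patch_def)
next
  case False
  then have "bump c \<rho> p = 0" using cball_subset by (intro bump_outside) blast
  then show ?thesis by (simp add: patch_def)
qed

lemma patch_vanishes_near_frontier:
  assumes "p \<in> frontier S" "p \<in> ball c \<rho>"
  shows "\<exists>T. open T \<and> p \<in> T \<and> (\<forall>q\<in>T \<inter> S. patch j q = 0)"
proof -
  define T where "T = ball c \<rho> \<inter> (V \<inter> \<Phi> -` {- 1 / steepness j<..})"
  have in_V: "p \<in> V" using assms(2) cball_subset radius_pos by (auto simp: subset_iff)
  have "- 1 / steepness j < 0" using steepness_pos[of j] by simp
  also have "0 \<le> \<Phi> p" using \<Phi>_frontier_zero[OF assms(1) in_V] by simp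
  finally have "p \<in> T" using assms(2) in_V by (simp add: T_def)
  moreover have "open T" unfolding T_def
    by (intro open_Int open_ball continuous_open_preimage continuous_on_\<Phi> open_V open_greaterThan)
  moreover have "patch j q = 0" if "q \<in> T" for q
  proof -
    have "bump c \<rho> q = 1" using that radius_pos by (intro bump_eq_1) (auto simp: T_def dist_commute)
    moreover have "- 1 / steepness j < \<Phi> q" using that by (auto simp: T_def)
    then have "- steepness j * \<Phi> q \<le> 1" using steepness_pos[of j] by (simp add: field_simps)
    then have "depth j q = 0" unfolding depth_def by (rule cutoff_eq_0)
    ultimately show ?thesis by (simp add: patch_def)
  qed
  ultimately show ?thesis by blast
qed

lemma continuous_on_layer: "continuous_on V (layer j)"
  unfolding layer_def[abs_def]
  by (intro continuous_intros continuous_on_compose2[OF continuous_on_cutoff'[of UNIV]] continuous_on_\<Phi>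
      C1_deriv_continuous_on[OF C1_deriv_bump]) auto

lemma compact_depth_support: "compact (depth_support j)"
proof -
  have "closed (depth_support j)" unfolding depth_support_def
    by (intro continuous_closed_preimage continuous_on_subset[OF continuous_on_\<Phi> cball_subset] closed_cball closed_atMost)
  moreover have "depth_support j = cball c (2 * \<rho>) \<inter> depth_support j" by (auto simp: depth_support_def)
  ultimately show ?thesis using compact_Int_closed[OF compact_cball] by metis
qed

lemma depth_support_subset: "depth_support j \<subseteq> S \<inter> V"
proof
  fix p assume p: "p \<in> depth_support j"
  then have "\<Phi> p \<le> - 1 / steepness j" by (simp add: depth_support_def)
  also have "\<dots> < 0" using steepness_pos[of j] by simp
  finally show "p \<in> S \<inter> V" using p cball_subset S_Int_V by (auto simp: depth_support_def)
qed

lemma outside_depth_support: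
  assumes "p \<notin> depth_support j" "p \<in> cball c (2 * \<rho>)"
  shows "depth j p = 0" "cutoff' (- steepness j * \<Phi> p) = 0"
proof -
  have "- 1 / steepness j < \<Phi> p" using assms by (auto simp: depth_support_def)
  then have "- steepness j * \<Phi> p \<le> 1" using steepness_pos[of j] by (simp add: field_simps)
  then show "depth j p = 0" "cutoff' (- steepness j * \<Phi> p) = 0"
    using cutoff_eq_0 cutoff'_eq_0 by (auto simp: depth_def)
qed

lemma layer_outside_depth_support: "p \<notin> depth_support j \<Longrightarrow> layer j p = 0"
  using outside_depth_support(2)[of p j] bump_outside(1)[of p]
  by (cases "p \<in> cball c (2 * \<rho>)") (simp_all add: layer_def)

lemma integrable_layer:
  assumes "continuous_on V w"
  shows "integrable lborel (\<lambda>p. if p \<in> S \<inter> V then layer j p * w p else 0)"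
  by (rule integrable_compact_support_on[OF _ compact_depth_support[of j] depth_support_subset])
    (auto intro!: continuous_on_mult continuous_on_subset[OF continuous_on_layer] continuous_on_subset[OF assms]
      simp: layer_outside_depth_support)

lemma integrable_layer_mass: "integrable lborel (\<lambda>p. if p \<in> S \<inter> V then layer j p else 0)"
  using integrable_layer[OF continuous_on_const, of j 1] by (simp cong: if_cong)

lemma integrable_bump'_depth: "integrable lborel (\<lambda>p. if p \<in> S \<inter> V then bump' c \<rho> p v * depth j p else 0)"
proof (rule integrable_compact_support_on[OF _ compact_depth_support[of j] depth_support_subset])
  show "continuous_on (S \<inter> V) (\<lambda>p. bump' c \<rho> p v * depth j p)"
    by (intro continuous_intros C1_deriv_continuous_deriv[OF C1_deriv_bump]
        continuous_on_subset[OF C1_deriv_continuous_on[OF C1_deriv_depth]]) simp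
  show "bump' c \<rho> p v * depth j p = 0" if "p \<in> S \<inter> V - depth_support j" for p
    using outside_depth_support(1)[of p j] bump_outside(2)[of p] that by (cases "p \<in> cball c (2 * \<rho>)") auto
qed

lemma integral_layer_gradient:
  "(\<integral>p. (if p \<in> S \<inter> V then layer j p * (G p \<bullet> v) else 0) \<partial>lborel)
    = (\<integral>p. (if p \<in> S \<inter> V then bump' c \<rho> p v * depth j p else 0) \<partial>lborel)"
proof -
  have product: "C1_deriv (S \<inter> V) (\<lambda>p. bump c \<rho> p * depth j p) (\<lambda>p v. bump c \<rho> p * depth' j p v + bump' c \<rho> p v * depth j p)"
    by (rule C1_deriv_subset[OF C1_deriv_mult[OF C1_deriv_bump C1_deriv_depth]]) auto
  have "bump c \<rho> p * depth j p = 0" if "p \<in> S \<inter> V - depth_support j" for p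
    using outside_depth_support(1)[of p j] bump_outside(1)[of p] that by (cases "p \<in> cball c (2 * \<rho>)") auto
  note zero = integral_gradient_zero[OF product open_S_Int_V compact_depth_support depth_support_subset this, where h=v]
  have "(\<integral>p. (if p \<in> S \<inter> V then bump' c \<rho> p v * depth j p else 0)
     - (if p \<in> S \<inter> V then layer j p * (G p \<bullet> v) else 0) \<partial>lborel) = 0"
    by (rule trans[OF Bochner_Integration.integral_cong zero]) (auto simp: layer_def depth'_def algebra_simps)
  moreover have "integrable lborel (\<lambda>p. if p \<in> S \<inter> V then layer j p * (G p \<bullet> v) else 0)"
    by (intro integrable_layer continuous_intros continuous_on_G)
  ultimately show ?thesis using integrable_bump'_depth by simp
qed

text \<open>Tests the cutoff against the constant field \<open>G c\<close>.\<close>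

lemma layer_mass_bounded:
  obtains M where "M \<ge> 0" "\<And>j. (\<integral>p. (if p \<in> S \<inter> V then layer j p else 0) \<partial>lborel) \<le> M"
proof -
  define M where "M = (\<integral>p. \<bar>bump' c \<rho> p (G c)\<bar> \<partial>lborel) / (G c \<bullet> G c / 2)"
  have "integrable lborel (\<lambda>p. if p \<in> UNIV then \<bar>bump' c \<rho> p (G c)\<bar> else 0)"
    by (rule integrable_compact_support_on[OF _ compact_cball[of c "2 * \<rho>"]])
      (auto intro!: continuous_intros C1_deriv_continuous_deriv[OF C1_deriv_bump] simp: bump_outside)
  then have integrable_bump': "integrable lborel (\<lambda>p. \<bar>bump' c \<rho> p (G c)\<bar>)" by simp
  have "(\<integral>p. (if p \<in> S \<inter> V then layer j p else 0) \<partial>lborel) \<le> M" for j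
  proof -
    have "(\<integral>p. G c \<bullet> G c / 2 * (if p \<in> S \<inter> V then layer j p else 0) \<partial>lborel)
       \<le> (\<integral>p. (if p \<in> S \<inter> V then layer j p * (G p \<bullet> G c) else 0) \<partial>lborel)"
    proof (rule integral_mono)
      show "integrable lborel (\<lambda>p. G c \<bullet> G c / 2 * (if p \<in> S \<inter> V then layer j p else 0))"
        using integrable_layer_mass by (rule integrable_mult_right)
      show "integrable lborel (\<lambda>p. if p \<in> S \<inter> V then layer j p * (G p \<bullet> G c) else 0)"
        by (intro integrable_layer continuous_intros continuous_on_G)
      show "G c \<bullet> G c / 2 * (if p \<in> S \<inter> V then layer j p else 0) \<le> (if p \<in> S \<inter> V then layer j p * (G p \<bullet> G c) else 0)" for p
        using mult_left_mono[OF gradient_lower layer_nonneg, of p j] bump_outside(1)[of p]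
        by (cases "p \<in> cball c (2 * \<rho>)") (auto simp: layer_def mult.commute)
    qed
    also have "\<dots> = (\<integral>p. (if p \<in> S \<inter> V then bump' c \<rho> p (G c) * depth j p else 0) \<partial>lborel)"
      by (rule integral_layer_gradient)
    also have "\<dots> \<le> (\<integral>p. \<bar>bump' c \<rho> p (G c)\<bar> \<partial>lborel)"
    proof (rule integral_mono[OF integrable_bump'_depth integrable_bump'])
      show "(if p \<in> S \<inter> V then bump' c \<rho> p (G c) * depth j p else 0) \<le> \<bar>bump' c \<rho> p (G c)\<bar>" for p
        using depth_range[of j p] abs_ge_self[of "bump' c \<rho> p (G c) * depth j p"]
          mult_left_le[of "depth j p" "\<bar>bump' c \<rho> p (G c)\<bar>"] by (auto simp: abs_mult)
    qed
    finally show ?thesis using G_center by (simp add: M_def field_simps)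
  qed
  moreover have "M \<ge> 0" unfolding M_def by simp
  ultimately show ?thesis using that by blast
qed

end

locale inward_patch = boundary_patch S V c \<Phi> G \<rho>
  for S V :: "'a::euclidean_space set" and c \<Phi> G \<rho> +
  fixes Q :: "'a \<Rightarrow> 'a"
  assumes continuous_on_Q: "continuous_on (closure S) Q"
    and inward: "p \<in> V \<Longrightarrow> p \<in> frontier S \<Longrightarrow> Q p \<bullet> G p \<le> 0"
begin

definition drift :: "nat \<Rightarrow> 'a \<Rightarrow> real" where
  "drift j p = (if p \<in> S \<inter> V then \<bar>bump' c \<rho> p (Q p)\<bar> * (1 - depth j p) else 0)"

lemma drift_nonneg: "0 \<le> drift j p"
  using depth_range[of j p] by (simp add: drift_def)

lemma continuous_on_bump'_Q: "continuous_on (closure S) (\<lambda>p. bump' c \<rho> p (Q p))"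
  by (rule C1_deriv_apply_continuous[OF C1_deriv_bump continuous_on_Q])

lemma drift_measurable: "drift j \<in> borel_measurable lborel"
proof -
  have "continuous_on (S \<inter> V) (\<lambda>p. \<bar>bump' c \<rho> p (Q p)\<bar> * (1 - depth j p))"
    using closure_subset
    by (intro continuous_intros continuous_on_subset[OF continuous_on_bump'_Q]
        continuous_on_subset[OF C1_deriv_continuous_on[OF C1_deriv_depth]]) auto
  from borel_measurable_on_open[OF open_S_Int_V this] show ?thesis unfolding drift_def by simp
qed

lemma drift_dominated:
  obtains L where "\<And>j p. norm (drift j p) \<le> L * indicator (cball c (2 * \<rho>)) p"
proof -
  have "compact (cball c (2 * \<rho>) \<inter> closure S)" by (simp add: compact_Int_closed)
  from compact_imp_bounded[OF compact_continuous_image[OF continuous_on_subset[OF continuous_on_bump'_Q] this]]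
  obtain L where L: "\<forall>p\<in>cball c (2 * \<rho>) \<inter> closure S. \<bar>bump' c \<rho> p (Q p)\<bar> \<le> L" by (auto simp: bounded_iff)
  have "norm (drift j p) \<le> max L 0 * indicator (cball c (2 * \<rho>)) p" for j p
  proof (cases "p \<in> S \<inter> V \<inter> cball c (2 * \<rho>)")
    case True
    then have "\<bar>bump' c \<rho> p (Q p)\<bar> \<le> L" using L closure_subset[of S] by blast
    moreover have "\<bar>bump' c \<rho> p (Q p)\<bar> * (1 - depth j p) \<le> \<bar>bump' c \<rho> p (Q p)\<bar>"
      using depth_range[of j p] by (intro mult_left_le) auto
    ultimately show ?thesis using True depth_range[of j p] by (auto simp: drift_def abs_mult)
  next
    case False
    then show ?thesis using bump_outside by (auto simp: drift_def indicator_def)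
  qed
  then show ?thesis by (rule that)
qed

lemma
  shows integrable_drift: "integrable lborel (drift j)"
    and integral_drift_tendsto_0: "(\<lambda>j. \<integral>p. drift j p \<partial>lborel) \<longlonglongrightarrow> 0"
proof -
  obtain L where L: "\<And>j p. norm (drift j p) \<le> L * indicator (cball c (2 * \<rho>)) p"
    by (rule drift_dominated) (rule that)
  have dominating: "integrable lborel (\<lambda>p. L * indicator (cball c (2 * \<rho>)) p)"
    using emeasure_bounded_finite[of "cball c (2 * \<rho>)"] by simp
  show "integrable lborel (drift j)"
  proof (rule Bochner_Integration.integrable_bound[OF dominating drift_measurable])
    show "AE p in lborel. norm (drift j p) \<le> norm (L * indicator (cball c (2 * \<rho>)) p)"
      using L[of j] by (intro AE_I2) (metis abs_ge_self order_trans real_norm_def)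
  qed
  have "(\<lambda>j. drift j p) \<longlonglongrightarrow> 0" for p
  proof (cases "p \<in> S \<inter> V")
    case True
    from eventually_depth_eq_1[OF this] have "\<forall>\<^sub>F j in sequentially. drift j p = 0"
      by eventually_elim (simp add: drift_def)
    then show ?thesis by (rule tendsto_eventually)
  qed (auto simp: drift_def)
  then have "(\<lambda>j. \<integral>p. drift j p \<partial>lborel) \<longlonglongrightarrow> (\<integral>p. 0 \<partial>(lborel::'a measure))"
    by (intro integral_dominated_convergence[OF _ drift_measurable dominating]) (use L in auto)
  then show "(\<lambda>j. \<integral>p. drift j p \<partial>lborel) \<longlonglongrightarrow> 0" by simp
qed

lemma outward_set_inside:
  assumes "e > 0" "C = cball c (2 * \<rho>) \<inter> closure S \<inter> (\<lambda>p. Q p \<bullet> G p) -` {e..}"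
  shows "compact C" "\<And>p. p \<in> C \<Longrightarrow> \<Phi> p < 0"
proof -
  have "closed C" unfolding assms(2)
    by (intro continuous_closed_preimage continuous_intros continuous_on_subset[OF continuous_on_G]
        continuous_on_subset[OF continuous_on_Q]) (use cball_subset in auto)
  moreover have "C = cball c (2 * \<rho>) \<inter> C" by (auto simp: assms(2))
  ultimately show "compact C" using compact_Int_closed[OF compact_cball] by metis
  show "\<Phi> p < 0" if "p \<in> C" for p
  proof (rule ccontr)
    assume "\<not> \<Phi> p < 0"
    then have "p \<notin> S" "p \<in> V" using S_Int_V that cball_subset by (auto simp: assms(2))
    then have "Q p \<bullet> G p \<le> 0" using that open_S by (intro inward) (auto simp: assms(2) frontier_def interior_open)
    then show False using that assms by auto
  qed
qed

lemma eventually_almost_inward: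
  assumes e_pos: "e > 0"
  shows "\<forall>\<^sub>F j in sequentially. \<forall>p\<in>S \<inter> cball c (2 * \<rho>). \<Phi> p \<ge> - 2 / steepness j \<longrightarrow> Q p \<bullet> G p \<le> e"
proof -
  define C where "C = cball c (2 * \<rho>) \<inter> closure S \<inter> (\<lambda>p. Q p \<bullet> G p) -` {e..}"
  note C = outward_set_inside[OF e_pos C_def]
  have in_C: "p \<in> C" if "p \<in> S \<inter> cball c (2 * \<rho>)" "\<not> Q p \<bullet> G p \<le> e" for p
    using that closure_subset by (auto simp: C_def)
  show ?thesis
  proof (cases "C = {}")
    case True
    then have "\<forall>p\<in>S \<inter> cball c (2 * \<rho>). Q p \<bullet> G p \<le> e" using in_C by blast
    then show ?thesis by simp
  next
    case False
    have "continuous_on C \<Phi>"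
      by (rule continuous_on_subset[OF continuous_on_\<Phi>]) (use cball_subset in \<open>auto simp: C_def\<close>)
    then obtain q where q: "q \<in> C" "\<forall>p\<in>C. \<Phi> p \<le> \<Phi> q" using continuous_attains_sup[OF C(1) False] by blast
    show ?thesis
      using eventually_steepness_gt[of "2 / (- \<Phi> q)"]
    proof eventually_elim
      case (elim j)
      then have "\<Phi> q < - 2 / steepness j" using C(2)[OF q(1)] steepness_pos[of j] by (simp add: field_simps)
      then show ?case using in_C q(2) by fastforce
    qed
  qed
qed

lemma patch_flux_le:
  assumes p: "p \<in> S" and "e \<ge> 0"
    and almost_inward: "\<forall>p\<in>S \<inter> cball c (2 * \<rho>). \<Phi> p \<ge> - 2 / steepness j \<longrightarrow> Q p \<bullet> G p \<le> e"
  shows "- patch' j p (Q p) \<le> drift j p + e * (if p \<in> S \<inter> V then layer j p else 0)"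
proof (cases "p \<in> cball c (2 * \<rho>)")
  case True
  then have in_V: "p \<in> V" using cball_subset by auto
  have "layer j p * (Q p \<bullet> G p) \<le> layer j p * e"
  proof (cases "\<Phi> p \<ge> - 2 / steepness j")
    case True
    then show ?thesis using almost_inward p \<open>p \<in> cball c (2 * \<rho>)\<close> layer_nonneg by (intro mult_left_mono) auto
  next
    case False
    then have "2 \<le> - steepness j * \<Phi> p" using steepness_pos[of j] by (simp add: field_simps)
    then show ?thesis using cutoff'_eq_0 by (simp add: layer_def)
  qed
  moreover have "bump' c \<rho> p (Q p) * (1 - depth j p) \<le> \<bar>bump' c \<rho> p (Q p)\<bar> * (1 - depth j p)"
    using depth_range[of j p] by (intro mult_right_mono) auto
  moreover have "- patch' j p (Q p) = bump' c \<rho> p (Q p) * (1 - depth j p) + layer j p * (Q p \<bullet> G p)"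
    using in_V by (simp add: patch'_def depth'_def layer_def inner_commute)
  ultimately show ?thesis using in_V p by (simp add: drift_def mult.commute)
next
  case False
  then show ?thesis using drift_nonneg[of j p] layer_nonneg[of j p] \<open>e \<ge> 0\<close> bump_outside by (auto simp: patch'_def)
qed

lemma patch_flux_integral_le:
  assumes "e \<ge> 0" "b \<ge> 0" and drift: "(\<integral>p. drift j p \<partial>lborel) \<le> b"
    and layer: "(\<integral>p. (if p \<in> S \<inter> V then layer j p else 0) \<partial>lborel) \<le> M"
    and almost_inward: "\<forall>p\<in>S \<inter> cball c (2 * \<rho>). \<Phi> p \<ge> - 2 / steepness j \<longrightarrow> Q p \<bullet> G p \<le> e"
  shows "flux_loss_le S Q (patch' j) (b + e * M)"
proof -
  define A where "A p = drift j p + e * (if p \<in> S \<inter> V then layer j p else 0)" for p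
  have flux: "- patch' j p (Q p) \<le> A p" if "p \<in> S" for p
    unfolding A_def by (rule patch_flux_le[OF that \<open>e \<ge> 0\<close> almost_inward])
  have A_nonneg: "0 \<le> A p" for p unfolding A_def using drift_nonneg layer_nonneg \<open>e \<ge> 0\<close> by auto
  have integrable_A: "integrable lborel A"
    unfolding A_def[abs_def] using integrable_drift integrable_layer_mass[of j] by auto
  have "(\<integral>\<^sup>+p\<in>S. ennreal (A p) \<partial>lborel) \<le> (\<integral>\<^sup>+p. ennreal (A p) \<partial>lborel)"
    by (intro nn_integral_mono) (auto simp: indicator_def)
  also have "\<dots> = ennreal (\<integral>p. A p \<partial>lborel)"
    using nn_integral_eq_integral[OF integrable_A] A_nonneg by auto
  also have "(\<integral>p. A p \<partial>lborel) = (\<integral>p. drift j p \<partial>lborel) + e * (\<integral>p. (if p \<in> S \<inter> V then layer j p else 0) \<partial>lborel)"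
    unfolding A_def[abs_def] using integrable_drift[of j] integrable_layer_mass[of j] by simp
  also have "ennreal \<dots> \<le> ennreal (b + e * M)"
    using drift layer \<open>e \<ge> 0\<close> by (intro ennreal_leI add_mono mult_left_mono) auto
  finally show ?thesis
    unfolding flux_loss_le_def using flux A_nonneg integrable_A
    by (intro exI[of _ A]) (auto dest: borel_measurable_integrable)
qed

lemma interior_cutoffs_patch: "interior_cutoffs S Q (ball c \<rho>) patch patch'"
proof
  fix e :: real assume e_pos: "e > 0"
  obtain M where M: "M \<ge> 0" "\<And>j. (\<integral>p. (if p \<in> S \<inter> V then layer j p else 0) \<partial>lborel) \<le> M"
    using layer_mass_bounded by blast
  define e' where "e' = e / (2 * (M + 1))"
  have e'_pos: "e' > 0" using e_pos M(1) by (simp add: e'_def)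
  have "\<forall>\<^sub>F j in sequentially. (\<integral>p. drift j p \<partial>lborel) < e / 2"
    using integral_drift_tendsto_0 e_pos by (intro order_tendstoD) auto
  then show "\<forall>\<^sub>F j in sequentially. flux_loss_le S Q (patch' j) e"
    using eventually_almost_inward[OF e'_pos]
  proof eventually_elim
    case (elim j)
    have "e' * M \<le> e' * (M + 1)" using e'_pos by simp
    also have "\<dots> = e / 2" using M(1) by (simp add: e'_def field_simps)
    finally have "e / 2 + e' * M \<le> e" by linarith
    moreover have "flux_loss_le S Q (patch' j) (e / 2 + e' * M)"
      using elim e_pos e'_pos M(2) by (intro patch_flux_integral_le) auto
    ultimately show ?case unfolding flux_loss_le_def by (meson ennreal_leI order_trans)
  qed
qed (simp_all add: C1_deriv_patch patch_range eventually_patch_eq_1 patch_vanishes_near_frontier del: mem_ball)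

end

definition inward_at :: "'a::euclidean_space set \<Rightarrow> ('a \<Rightarrow> 'a) \<Rightarrow> 'a \<Rightarrow> bool" where
  "inward_at S Q c \<longleftrightarrow> (\<exists>V \<Phi> G. boundary_chart S V c \<Phi> G \<and> (\<forall>p\<in>V \<inter> frontier S. Q p \<bullet> G p \<le> 0))"

lemma interior_cutoffs_near:
  assumes "inward_at S Q c" "continuous_on (closure S) Q"
  shows "\<exists>\<rho> h h'. \<rho> > 0 \<and> interior_cutoffs S Q (ball c \<rho>) h h'"
proof -
  obtain V \<Phi> G where chart: "boundary_chart S V c \<Phi> G" and inward: "\<forall>p\<in>V \<inter> frontier S. Q p \<bullet> G p \<le> 0"
    using assms(1) unfolding inward_at_def by blast
  obtain \<rho> where "\<rho> > 0" "cball c (2 * \<rho>) \<subseteq> V" "\<And>p. p \<in> cball c (2 * \<rho>) \<Longrightarrow> (G c \<bullet> G c) / 2 \<le> G p \<bullet> G c"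
    by (rule boundary_chart.gradient_bounded_below_near_center[OF chart]) (rule that)
  with chart inward assms(2) have "inward_patch S V c \<Phi> G \<rho> Q"
    by (auto simp: inward_patch_def inward_patch_axioms_def boundary_patch_def boundary_patch_axioms_def)
  then show ?thesis using inward_patch.interior_cutoffs_patch \<open>\<rho> > 0\<close> by blast
qed

lemma flux_loss_le_prod:
  fixes h :: "'i \<Rightarrow> 'a::euclidean_space \<Rightarrow> real"
  assumes "finite I" and S: "S \<in> sets borel"
    and range: "\<And>i p. i \<in> I \<Longrightarrow> p \<in> S \<Longrightarrow> 0 \<le> h i p \<and> h i p \<le> 1"
    and flux: "\<And>i. i \<in> I \<Longrightarrow> flux_loss_le S Q (h' i) e" and e_nonneg: "e \<ge> 0"
  shows "flux_loss_le S Q (\<lambda>p v. \<Sum>i\<in>I. h' i p v * (\<Prod>l\<in>I - {i}. h l p)) (real (card I) * e)"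
proof -
  obtain A where A: "\<And>i p. i \<in> I \<Longrightarrow> p \<in> S \<Longrightarrow> - h' i p (Q p) \<le> A i p"
    "\<And>i p. i \<in> I \<Longrightarrow> 0 \<le> A i p" "\<And>i. i \<in> I \<Longrightarrow> A i \<in> borel_measurable borel"
    "\<And>i. i \<in> I \<Longrightarrow> (\<integral>\<^sup>+p\<in>S. ennreal (A i p) \<partial>lborel) \<le> ennreal e"
    using flux unfolding flux_loss_le_def by metis
  have "- (\<Sum>i\<in>I. h' i p (Q p) * (\<Prod>l\<in>I - {i}. h l p)) \<le> (\<Sum>i\<in>I. A i p)" if p: "p \<in> S" for p
    unfolding sum_negf[symmetric]
  proof (rule sum_mono)
    fix i assume i: "i \<in> I"
    have others: "0 \<le> (\<Prod>l\<in>I - {i}. h l p)" "(\<Prod>l\<in>I - {i}. h l p) \<le> 1"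
      using range p by (auto intro!: prod_nonneg prod_le_1)
    have "- h' i p (Q p) * (\<Prod>l\<in>I - {i}. h l p) \<le> A i p * (\<Prod>l\<in>I - {i}. h l p)"
      using A(1)[OF i p] others by (intro mult_right_mono)
    also have "\<dots> \<le> A i p" using others A(2)[OF i] by (simp add: mult_left_le)
    finally show "- (h' i p (Q p) * (\<Prod>l\<in>I - {i}. h l p)) \<le> A i p" by simp
  qed
  moreover have "(\<integral>\<^sup>+p\<in>S. ennreal (\<Sum>i\<in>I. A i p) \<partial>lborel) \<le> ennreal (real (card I) * e)"
  proof -
    have "(\<integral>\<^sup>+p\<in>S. ennreal (\<Sum>i\<in>I. A i p) \<partial>lborel) = (\<integral>\<^sup>+p. (\<Sum>i\<in>I. ennreal (A i p) * indicator S p) \<partial>lborel)"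
      using A(2) by (intro nn_integral_cong) (simp add: sum_distrib_right[symmetric] sum_nonneg)
    also have "\<dots> = (\<Sum>i\<in>I. \<integral>\<^sup>+p\<in>S. ennreal (A i p) \<partial>lborel)"
      using A(3) S by (intro nn_integral_sum) (auto intro!: borel_measurable_times_ennreal)
    also have "\<dots> \<le> (\<Sum>i\<in>I. ennreal e)" using A(4) by (intro sum_mono)
    finally show ?thesis using e_nonneg by (simp add: ennreal_mult' ennreal_of_nat_eq_real_of_nat)
  qed
  moreover have "0 \<le> (\<Sum>i\<in>I. A i p)" "(\<lambda>p. \<Sum>i\<in>I. A i p) \<in> borel_measurable borel" for p
    using A(2,3) by (auto intro: sum_nonneg)
  ultimately show ?thesis unfolding flux_loss_le_def by (intro exI[of _ "\<lambda>p. \<Sum>i\<in>I. A i p"]) blast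
qed

lemma interior_cutoffs_prod:
  assumes "finite I" "open S" and cutoffs: "\<And>i. i \<in> I \<Longrightarrow> interior_cutoffs S Q (U i) (h i) (h' i)"
  shows "interior_cutoffs S Q (\<Union>i\<in>I. U i) (\<lambda>j p. \<Prod>i\<in>I. h i j p) (\<lambda>j p v. \<Sum>i\<in>I. h' i j p v * (\<Prod>l\<in>I - {i}. h l j p))"
proof
  show "C1_deriv S (\<lambda>p. \<Prod>i\<in>I. h i j p) (\<lambda>p v. \<Sum>i\<in>I. h' i j p v * (\<Prod>l\<in>I - {i}. h l j p))" for j
    by (rule C1_deriv_prod[OF interior_cutoffs.C1_h[OF cutoffs]])
  have range: "0 \<le> h i j p \<and> h i j p \<le> 1" if "i \<in> I" "p \<in> S" for i j p
    using interior_cutoffs.range[OF cutoffs] that by blast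
  then show "0 \<le> (\<Prod>i\<in>I. h i j p) \<and> (\<Prod>i\<in>I. h i j p) \<le> 1" if "p \<in> S" for j p
    using that by (auto intro!: prod_nonneg prod_le_1)
  show "\<forall>\<^sub>F j in sequentially. (\<Prod>i\<in>I. h i j p) = 1" if "p \<in> S" for p
  proof -
    have "\<forall>\<^sub>F j in sequentially. \<forall>i\<in>I. h i j p = 1"
      using \<open>finite I\<close> interior_cutoffs.eventually_1[OF cutoffs that] by (simp add: eventually_ball_finite)
    then show ?thesis by eventually_elim simp
  qed
  show "\<exists>T. open T \<and> p \<in> T \<and> (\<forall>q\<in>T \<inter> S. (\<Prod>i\<in>I. h i j q) = 0)" if "p \<in> frontier S" "p \<in> (\<Union>i\<in>I. U i)" for p j
    using that interior_cutoffs.vanishing[OF cutoffs] \<open>finite I\<close> by (fastforce simp: prod_zero_iff)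
  fix e :: real assume e_pos: "e > 0"
  define e' where "e' = e / (real (card I) + 1)"
  have e': "e' > 0" "real (card I) * e' \<le> e" using e_pos by (auto simp: e'_def field_simps)
  have "\<forall>\<^sub>F j in sequentially. \<forall>i\<in>I. flux_loss_le S Q (h' i j) e'"
    using \<open>finite I\<close> interior_cutoffs.eventually_flux[OF cutoffs e'(1)] by (simp add: eventually_ball_finite)
  then show "\<forall>\<^sub>F j in sequentially. flux_loss_le S Q (\<lambda>p v. \<Sum>i\<in>I. h' i j p v * (\<Prod>l\<in>I - {i}. h l j p)) e"
  proof eventually_elim
    case (elim j)
    then have "flux_loss_le S Q (\<lambda>p v. \<Sum>i\<in>I. h' i j p v * (\<Prod>l\<in>I - {i}. h l j p)) (real (card I) * e')"
      using flux_loss_le_prod[OF \<open>finite I\<close>, of S "\<lambda>i. h i j"] range e'(1) \<open>open S\<close> by simp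
    then show ?case using ennreal_leI[OF e'(2)] unfolding flux_loss_le_def by (meson order_trans)
  qed
qed

lemma interior_cutoffs_exist:
  assumes "open S" and Q: "continuous_on (closure S) Q" and K: "compact K"
    and inward: "\<And>c. c \<in> frontier S \<inter> K \<Longrightarrow> inward_at S Q c"
  obtains U h h' where "interior_cutoffs S Q U h h'" "frontier S \<inter> K \<subseteq> U"
proof -
  obtain \<rho> h h' where cutoffs: "\<And>c. c \<in> frontier S \<inter> K \<Longrightarrow> \<rho> c > 0"
    "\<And>c. c \<in> frontier S \<inter> K \<Longrightarrow> interior_cutoffs S Q (ball c (\<rho> c)) (h c) (h' c)"
    using interior_cutoffs_near[OF inward Q] by metis
  have "compact (frontier S \<inter> K)" using K by (simp add: closed_Int_compact)
  moreover have "frontier S \<inter> K \<subseteq> (\<Union>c\<in>frontier S \<inter> K. ball c (\<rho> c))" using cutoffs(1) by fastforce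
  ultimately obtain I where I: "I \<subseteq> frontier S \<inter> K" "finite I" "frontier S \<inter> K \<subseteq> (\<Union>c\<in>I. ball c (\<rho> c))"
    using compactE_image[of "frontier S \<inter> K" "frontier S \<inter> K" "\<lambda>c. ball c (\<rho> c)"] open_ball by metis
  have "\<And>i. i \<in> I \<Longrightarrow> interior_cutoffs S Q (ball i (\<rho> i)) (h i) (h' i)" using cutoffs(2) I(1) by blast
  from that[OF interior_cutoffs_prod[OF I(2) \<open>open S\<close> this] I(3)] show ?thesis .
qed

lemma (in interior_cutoffs) compact_support_within:
  assumes "open S" "compact K" "frontier S \<inter> K \<subseteq> U"
  obtains L where "compact L" "L \<subseteq> S" "\<And>p. p \<in> S \<inter> K - L \<Longrightarrow> h j p = 0"
proof -
  define L where "L = closure {p\<in>S \<inter> K. h j p \<noteq> 0}"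
  have "L \<subseteq> K" unfolding L_def using \<open>compact K\<close> by (intro closure_minimal) (auto simp: compact_imp_closed)
  then have "L = K \<inter> L" by auto
  then have "compact L" using \<open>compact K\<close> compact_Int_closed[of K L] by (simp add: L_def)
  moreover have "L \<subseteq> S"
  proof (rule ccontr)
    assume "\<not> L \<subseteq> S"
    then obtain p where p: "p \<in> L" "p \<notin> S" by blast
    then have "p \<in> closure S" using closure_mono[of "{p\<in>S \<inter> K. h j p \<noteq> 0}" S] unfolding L_def by auto
    then have "p \<in> frontier S" "p \<in> U" using p \<open>L \<subseteq> K\<close> assms(1,3) by (auto simp: frontier_def interior_open)
    then obtain T where T: "open T" "p \<in> T" "\<forall>q\<in>T \<inter> S. h j q = 0" using vanishing by blast
    then have "T \<inter> {p\<in>S \<inter> K. h j p \<noteq> 0} = {}" by auto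
    then show False using p(1) T(1,2) unfolding L_def by (meson closure_iff_nhds_not_empty disjoint_iff order_refl)
  qed
  moreover have "h j p = 0" if "p \<in> S \<inter> K - L" for p
    using closure_subset[of "{p\<in>S \<inter> K. h j p \<noteq> 0}"] that by (auto simp: L_def)
  ultimately show ?thesis using that by blast
qed

section \<open>A divergence inequality\<close>

lemma nn_integral_le_of_eventually:
  fixes u :: "nat \<Rightarrow> 'a \<Rightarrow> ennreal"
  assumes "\<And>n. u n \<in> borel_measurable M"
    and "\<And>p. \<forall>\<^sub>F n in sequentially. u n p = v p"
    and eventually_le: "\<And>e::real. e > 0 \<Longrightarrow> \<forall>\<^sub>F n in sequentially. (\<integral>\<^sup>+p. u n p \<partial>M) \<le> B + ennreal e"
  shows "(\<integral>\<^sup>+p. v p \<partial>M) \<le> B"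
proof (rule ennreal_le_epsilon)
  fix e :: real assume e_pos: "0 < e"
  have "liminf (\<lambda>n. u n p) = v p" for p
    using assms(2) by (intro lim_imp_Liminf tendsto_eventually) auto
  then have "(\<integral>\<^sup>+p. v p \<partial>M) = (\<integral>\<^sup>+p. liminf (\<lambda>n. u n p) \<partial>M)" by simp
  also have "\<dots> \<le> liminf (\<lambda>n. \<integral>\<^sup>+p. u n p \<partial>M)" by (rule nn_integral_liminf[OF assms(1)])
  also have "\<dots> \<le> limsup (\<lambda>n. \<integral>\<^sup>+p. u n p \<partial>M)" by (rule Liminf_le_Limsup) simp
  also have "\<dots> \<le> B + ennreal e" by (rule Limsup_bounded[OF eventually_le[OF e_pos]])
  finally show "(\<integral>\<^sup>+p. v p \<partial>M) \<le> B + ennreal e" .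
qed

lemma ennreal_integral_le_nn_integral:
  fixes X :: "'a \<Rightarrow> real"
  assumes "integrable M X"
  shows "ennreal (\<integral>p. X p \<partial>M) \<le> (\<integral>\<^sup>+p. ennreal (X p) \<partial>M)"
proof -
  have positive_part: "integrable M (\<lambda>p. max 0 (X p))" using assms by auto
  have "ennreal (\<integral>p. X p \<partial>M) \<le> ennreal (\<integral>p. max 0 (X p) \<partial>M)"
    by (intro ennreal_leI integral_mono assms positive_part) auto
  also have "\<dots> = (\<integral>\<^sup>+p. ennreal (max 0 (X p)) \<partial>M)"
    using nn_integral_eq_integral[OF positive_part] by simp
  also have "\<dots> = (\<integral>\<^sup>+p. ennreal (X p) \<partial>M)"
    by (intro nn_integral_cong) (auto simp: max_def ennreal_neg)
  finally show ?thesis .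
qed

lemma nn_integral_div_le_of_compact_support:
  fixes J :: "'a::euclidean_space \<Rightarrow> 'a"
  assumes "open S" and J: "C1_div S J \<delta>" and s: "C1_deriv S s s'" and F: "continuous_on S F"
    and nonneg: "\<And>p. p \<in> S \<Longrightarrow> 0 \<le> s p * (F p + \<delta> p)"
    and support: "compact L" "L \<subseteq> S" "\<And>p. p \<in> S - L \<Longrightarrow> s p = 0"
  shows "(\<integral>\<^sup>+p\<in>S. ennreal (s p * (F p + \<delta> p)) \<partial>lborel) \<le> (\<integral>\<^sup>+p\<in>S. ennreal (s p * F p - s' p (J p)) \<partial>lborel)"
proof -
  define P where "P p = (if p \<in> S then s p * (F p + \<delta> p) else 0)" for p
  define X where "X p = P p - (if p \<in> S then s p * \<delta> p + s' p (J p) else 0)" for p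
  have "s p *\<^sub>R J p = 0" if "p \<in> S - L" for p using support(3)[OF that] by simp
  note divergence = integral_divergence_zero[OF C1_div_scaleR[OF s J] \<open>open S\<close> support(1,2) this]
  have integrable_P: "integrable lborel P" unfolding P_def
    by (rule integrable_compact_support_on[OF _ support(1,2)])
      (auto intro!: continuous_intros F C1_div_continuous_div[OF J] C1_deriv_continuous_on[OF s] simp: support(3))
  have P_nonneg: "0 \<le> P p" for p using nonneg by (simp add: P_def)
  have "(\<integral>\<^sup>+p\<in>S. ennreal (s p * (F p + \<delta> p)) \<partial>lborel) = (\<integral>\<^sup>+p. ennreal (P p) \<partial>lborel)"
    by (intro nn_integral_cong) (auto simp: P_def indicator_def)
  also have "\<dots> = ennreal (\<integral>p. P p \<partial>lborel)"
    using nn_integral_eq_integral[OF integrable_P] P_nonneg by simp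
  also have "\<dots> = ennreal (\<integral>p. X p \<partial>lborel)"
    unfolding X_def[abs_def] using integrable_P divergence by simp
  also have "\<dots> \<le> (\<integral>\<^sup>+p. ennreal (X p) \<partial>lborel)"
    by (rule ennreal_integral_le_nn_integral) (use integrable_P divergence(1) in \<open>simp add: X_def[abs_def]\<close>)
  also have "\<dots> = (\<integral>\<^sup>+p\<in>S. ennreal (s p * F p - s' p (J p)) \<partial>lborel)"
    by (intro nn_integral_cong) (auto simp: X_def P_def indicator_def algebra_simps)
  finally show ?thesis .
qed

lemma nn_integral_div_le_cutoff:
  fixes J :: "'a::euclidean_space \<Rightarrow> 'a"
  assumes "open S" and J: "C1_div S J \<delta>"
    and g: "C1_deriv UNIV g g'" "\<And>p. 0 \<le> g p" and h: "C1_deriv S h h'" "\<And>p. p \<in> S \<Longrightarrow> 0 \<le> h p \<and> h p \<le> 1"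
    and support: "compact L" "L \<subseteq> S" "\<And>p. p \<in> S - L \<Longrightarrow> g p * h p = 0"
    and flux: "flux_loss_le S (\<lambda>p. g p *\<^sub>R J p) h' e"
    and F: "continuous_on S F" "\<And>p. p \<in> S \<Longrightarrow> 0 \<le> F p" "\<And>p. p \<in> S \<Longrightarrow> 0 \<le> F p + \<delta> p"
  shows "(\<integral>\<^sup>+p\<in>S. ennreal (g p * h p * (F p + \<delta> p)) \<partial>lborel)
    \<le> (\<integral>\<^sup>+p\<in>S. ennreal (g p * F p) \<partial>lborel) + (\<integral>\<^sup>+p\<in>S. ennreal \<bar>g' p (J p)\<bar> \<partial>lborel) + ennreal e"
proof -
  obtain A where A: "\<And>p. p \<in> S \<Longrightarrow> - h' p (g p *\<^sub>R J p) \<le> A p" "\<And>p. 0 \<le> A p"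
    "A \<in> borel_measurable borel" "(\<integral>\<^sup>+p\<in>S. ennreal (A p) \<partial>lborel) \<le> ennreal e"
    using flux unfolding flux_loss_le_def by blast
  have pointwise: "g p * h p * F p - (g p * h' p (J p) + g' p (J p) * h p) \<le> g p * F p + \<bar>g' p (J p)\<bar> + A p" if p: "p \<in> S" for p
  proof -
    have "g p * h p * F p \<le> g p * F p"
      using h(2)[OF p] F(2)[OF p] g(2)[of p] by (intro mult_right_mono mult_left_le) auto
    moreover have "- (g p * h' p (J p)) \<le> A p"
      using A(1)[OF p] C1_deriv_linear[OF h(1) p] by (simp add: linear_cmul)
    moreover have "\<bar>g' p (J p) * h p\<bar> \<le> \<bar>g' p (J p)\<bar> * 1"
      unfolding abs_mult using h(2)[OF p] by (intro mult_left_mono) auto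
    ultimately show ?thesis by linarith
  qed
  have measurable_g: "(\<lambda>p. ennreal (g p * F p) * indicator S p) \<in> borel_measurable lborel"
    by (intro borel_measurable_indicator_on_open[OF \<open>open S\<close>] continuous_on_mult F(1)
        C1_deriv_continuous_on[OF C1_deriv_subset[OF g(1) subset_UNIV]])
  have measurable_g': "(\<lambda>p. ennreal \<bar>g' p (J p)\<bar> * indicator S p) \<in> borel_measurable lborel"
    by (intro borel_measurable_indicator_on_open[OF \<open>open S\<close>] continuous_on_rabs
        C1_deriv_apply_continuous[OF C1_deriv_subset[OF g(1) subset_UNIV] C1_div_continuous_on[OF J]])
  have measurable_A: "(\<lambda>p. ennreal (A p) * indicator S p) \<in> borel_measurable lborel"
    using \<open>open S\<close> A(3) by simp
  have "(\<integral>\<^sup>+p\<in>S. ennreal (g p * h p * (F p + \<delta> p)) \<partial>lborel)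
      \<le> (\<integral>\<^sup>+p\<in>S. ennreal (g p * h p * F p - (g p * h' p (J p) + g' p (J p) * h p)) \<partial>lborel)"
    by (rule nn_integral_div_le_of_compact_support[OF \<open>open S\<close> J C1_deriv_mult[OF C1_deriv_subset[OF g(1)] h(1)] F(1) _ support])
      (use g(2) h(2) F(3) in auto)
  also have "\<dots> \<le> (\<integral>\<^sup>+p. (ennreal (g p * F p) * indicator S p + ennreal \<bar>g' p (J p)\<bar> * indicator S p)
       + ennreal (A p) * indicator S p \<partial>lborel)"
    using pointwise F(2) g(2) A(2)
    by (intro nn_integral_mono) (auto simp: indicator_def ennreal_plus[symmetric] simp del: ennreal_plus intro!: ennreal_leI)
  also have "\<dots> = (\<integral>\<^sup>+p\<in>S. ennreal (g p * F p) \<partial>lborel) + (\<integral>\<^sup>+p\<in>S. ennreal \<bar>g' p (J p)\<bar> \<partial>lborel)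
      + (\<integral>\<^sup>+p\<in>S. ennreal (A p) \<partial>lborel)"
    by (simp add: nn_integral_add[OF borel_measurable_add[OF measurable_g measurable_g'] measurable_A]
        nn_integral_add[OF measurable_g measurable_g'])
  also have "\<dots> \<le> (\<integral>\<^sup>+p\<in>S. ennreal (g p * F p) \<partial>lborel) + (\<integral>\<^sup>+p\<in>S. ennreal \<bar>g' p (J p)\<bar> \<partial>lborel) + ennreal e"
    by (intro add_left_mono A(4))
  finally show ?thesis .
qed

text \<open>Only the sign of the normal component of the field on the boundary is needed, so no surface measure appears.\<close>

lemma divergence_inequality:
  fixes J :: "'a::euclidean_space \<Rightarrow> 'a"
  assumes S: "open S" and J: "C1_div S J \<delta>"
    and g: "C1_deriv UNIV g g'" "\<And>p. 0 \<le> g p" and K: "compact K" and g_outside: "\<And>p. p \<notin> K \<Longrightarrow> g p = 0"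
    and cutoff_field_closure: "continuous_on (closure S) (\<lambda>p. g p *\<^sub>R J p)"
    and inward: "\<And>c. c \<in> frontier S \<inter> K \<Longrightarrow> inward_at S (\<lambda>p. g p *\<^sub>R J p) c"
    and F: "continuous_on S F" "\<And>p. p \<in> S \<Longrightarrow> 0 \<le> F p" "\<And>p. p \<in> S \<Longrightarrow> 0 \<le> F p + \<delta> p"
  shows "(\<integral>\<^sup>+p\<in>S. ennreal (g p * (F p + \<delta> p)) \<partial>lborel)
     \<le> (\<integral>\<^sup>+p\<in>S. ennreal (g p * F p) \<partial>lborel) + (\<integral>\<^sup>+p\<in>S. ennreal \<bar>g' p (J p)\<bar> \<partial>lborel)"
proof -
  obtain U h h' where cutoffs: "interior_cutoffs S (\<lambda>p. g p *\<^sub>R J p) U h h'" and U: "frontier S \<inter> K \<subseteq> U"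
    by (rule interior_cutoffs_exist[OF S cutoff_field_closure K inward])
  show ?thesis
  proof (rule nn_integral_le_of_eventually[where u="\<lambda>j p. ennreal (g p * h j p * (F p + \<delta> p)) * indicator S p"])
    show "(\<lambda>p. ennreal (g p * h j p * (F p + \<delta> p)) * indicator S p) \<in> borel_measurable lborel" for j
      by (intro borel_measurable_indicator_on_open[OF S] continuous_intros F C1_div_continuous_div[OF J]
          C1_deriv_continuous_on[OF C1_deriv_subset[OF g(1)]] C1_deriv_continuous_on[OF interior_cutoffs.C1_h[OF cutoffs]]) simp
    show "\<forall>\<^sub>F j in sequentially. ennreal (g p * h j p * (F p + \<delta> p)) * indicator S p
       = ennreal (g p * (F p + \<delta> p)) * indicator S p" for p
    proof (cases "p \<in> S")
      case True
      show ?thesis by (rule eventually_mono[OF interior_cutoffs.eventually_1[OF cutoffs True]]) simp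
    qed simp
    fix e :: real assume "e > 0"
    from interior_cutoffs.eventually_flux[OF cutoffs this]
    show "\<forall>\<^sub>F j in sequentially. (\<integral>\<^sup>+p\<in>S. ennreal (g p * h j p * (F p + \<delta> p)) \<partial>lborel)
      \<le> (\<integral>\<^sup>+p\<in>S. ennreal (g p * F p) \<partial>lborel) + (\<integral>\<^sup>+p\<in>S. ennreal \<bar>g' p (J p)\<bar> \<partial>lborel) + ennreal e"
    proof eventually_elim
      case (elim j)
      obtain L where L: "compact L" "L \<subseteq> S" "\<And>p. p \<in> S \<inter> K - L \<Longrightarrow> h j p = 0"
        using interior_cutoffs.compact_support_within[OF cutoffs S K U] by blast
      have gh_outside: "g p * h j p = 0" if "p \<in> S - L" for p using L(3) g_outside that by (cases "p \<in> K") auto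
      show ?case
        by (rule nn_integral_div_le_cutoff[OF S J g interior_cutoffs.C1_h[OF cutoffs] interior_cutoffs.range[OF cutoffs]
              L(1,2) gh_outside elim F])
    qed
  qed
qed

section \<open>Gradients and defining functions\<close>

definition egrad :: "('a::euclidean_space \<Rightarrow> real) \<Rightarrow> 'a \<Rightarrow> 'a" where
  "egrad z p = (\<Sum>b\<in>Basis. dder z b p *\<^sub>R b)"

definition hess :: "('a::euclidean_space \<Rightarrow> real) \<Rightarrow> 'a \<Rightarrow> 'a \<Rightarrow> 'a" where
  "hess z p v = (\<Sum>b\<in>Basis. dder (dder z b) v p *\<^sub>R b)"

lemma
  assumes "z differentiable (at p)"
  shows egrad_has_derivative: "(z has_derivative (\<lambda>v. egrad z p \<bullet> v)) (at p)"
    and dder_eq_egrad_inner: "dder z v p = egrad z p \<bullet> v"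
proof -
  have works: "(z has_derivative frechet_derivative z (at p)) (at p)"
    using assms frechet_derivative_works by blast
  have "frechet_derivative z (at p) = (\<lambda>v. egrad z p \<bullet> v)"
    unfolding egrad_def dder_def by (rule ext) (rule linear_eq_inner_Basis_sum[OF has_derivative_linear[OF works]])
  then show "(z has_derivative (\<lambda>v. egrad z p \<bullet> v)) (at p)" "dder z v p = egrad z p \<bullet> v"
    using works by (simp_all add: dder_def)
qed

lemma Ck_1_C1_deriv:
  assumes "Ck 1 S z"
  shows "C1_deriv S z (\<lambda>p v. egrad z p \<bullet> v)"
proof (rule C1_derivI)
  have differentiable: "\<And>p. p \<in> S \<Longrightarrow> z differentiable (at p)" and continuous: "\<And>h. continuous_on S (dder z h)"
    using assms by (auto simp: One_nat_def)
  show "continuous_on S (\<lambda>p. egrad z p \<bullet> v)" for v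
    by (rule continuous_on_eq[OF continuous[of v]]) (simp add: dder_eq_egrad_inner differentiable)
  show "(z has_derivative (\<lambda>v. egrad z p \<bullet> v)) (at p)" if "p \<in> S" for p
    by (rule egrad_has_derivative[OF differentiable[OF that]])
qed

lemma
  assumes "Ck 2 S z"
  shows Ck_2_differentiable: "p \<in> S \<Longrightarrow> z differentiable (at p)"
    and Ck_2_C1_deriv: "C1_deriv S z (\<lambda>p v. egrad z p \<bullet> v)"
    and Ck_2_C1_deriv_egrad: "C1_deriv S (egrad z) (hess z)"
proof -
  have differentiable: "\<And>p. p \<in> S \<Longrightarrow> z differentiable (at p)" and Ck_1_dder: "\<And>h. Ck 1 S (dder z h)"
    using assms(1) by (auto simp: numeral_2_eq_2)
  then show "p \<in> S \<Longrightarrow> z differentiable (at p)" by blast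
  have dder_C1: "C1_deriv S (dder z b) (\<lambda>p v. egrad (dder z b) p \<bullet> v)" for b using Ck_1_C1_deriv[OF Ck_1_dder] .
  have "Ck 1 S z" using differentiable C1_deriv_continuous_on[OF dder_C1] by (simp add: One_nat_def)
  then show "C1_deriv S z (\<lambda>p v. egrad z p \<bullet> v)" by (rule Ck_1_C1_deriv)
  have dder_dder: "dder (dder z b) v p = egrad (dder z b) p \<bullet> v" if "p \<in> S" for b v p
    using dder_eq_egrad_inner Ck_1_dder[of b] that by (auto simp: One_nat_def)
  show "C1_deriv S (egrad z) (hess z)"
  proof (rule C1_deriv_cong_deriv[OF C1_derivI])
    show "(egrad z has_derivative (\<lambda>v. \<Sum>b\<in>Basis. (egrad (dder z b) p \<bullet> v) *\<^sub>R b)) (at p)" if "p \<in> S" for p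
      unfolding egrad_def[of z, abs_def]
      by (intro has_derivative_sum has_derivative_scaleR_left C1_deriv_has_derivative[OF dder_C1 that])
    show "continuous_on S (\<lambda>p. \<Sum>b\<in>Basis. (egrad (dder z b) p \<bullet> v) *\<^sub>R b)" for v
      by (intro continuous_intros C1_deriv_continuous_deriv[OF dder_C1])
  qed (simp add: hess_def dder_dder)
qed

lemma C1_closure_gradient:
  fixes z :: "'a::euclidean_space \<Rightarrow> real"
  assumes "C1_closure S z"
  obtains W where "continuous_on (closure S) W" "\<And>p. p \<in> S \<Longrightarrow> W p = egrad z p"
proof -
  obtain g where g: "\<And>h. continuous_on (closure S) (g h)" "\<And>h p. p \<in> S \<Longrightarrow> g h p = dder z h p"
    using assms unfolding C1_closure_def by metis
  show ?thesis
    by (rule that[of "\<lambda>p. \<Sum>b\<in>Basis. g b p *\<^sub>R b"]) (auto intro!: continuous_intros g simp: egrad_def g(2))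
qed

lemma grad_eq_egrad:
  assumes "\<phi> differentiable (at y)" shows "grad \<phi> y = egrad \<phi> y"
  unfolding vec_eq_iff grad_def by (simp add: dder_eq_egrad_inner[OF assms] inner_axis)

lemma local_defining_C1_deriv:
  assumes "local_defining \<Omega> x V \<phi>" shows "C1_deriv V \<phi> (\<lambda>y v. grad \<phi> y \<bullet> v)"
proof (rule C1_deriv_cong_deriv[OF Ck_1_C1_deriv])
  show "Ck 1 V \<phi>" using assms by (auto simp: local_defining_def smooth_on_def)
  then show "egrad \<phi> p \<bullet> v = grad \<phi> p \<bullet> v" if "p \<in> V" for p v
    using grad_eq_egrad[of \<phi> p] that by (auto simp: One_nat_def)
qed

lemma local_defining_mem_iff: "local_defining \<Omega> x V \<phi> \<Longrightarrow> y \<in> V \<Longrightarrow> y \<in> \<Omega> \<longleftrightarrow> \<phi> y < 0"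
  unfolding local_defining_def by blast

lemma local_defining_move: "local_defining \<Omega> x V \<phi> \<Longrightarrow> y \<in> V \<Longrightarrow> local_defining \<Omega> y V \<phi>"
  unfolding local_defining_def by blast

lemma local_defining_boundary_chart:
  assumes "local_defining \<Omega> x V \<phi>" "open \<Omega>" shows "boundary_chart \<Omega> V x \<phi> (grad \<phi>)"
  using assms local_defining_C1_deriv[OF assms(1)] by (simp add: boundary_chart_def local_defining_def)

section \<open>Cylinders in the exterior of the null cone\<close>

definition mink :: "'a::real_inner \<times> 'b::real_inner \<Rightarrow> 'a \<times> 'b" where
  "mink p = (- fst p, snd p)"

lemma mink_mink [simp]: "mink (mink p) = p"
  by (simp add: mink_def)

lemma snd_mink [simp]: "snd (mink p) = snd p"
  by (simp add: mink_def)

lemma inner_mink: "mink p \<bullet> q = p \<bullet> mink q"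
  by (simp add: mink_def inner_prod_def)

lemma inner_mink_self: "p \<bullet> mink p = snd p \<bullet> snd p - fst p \<bullet> fst p"
  by (simp add: mink_def inner_prod_def)

lemma norm_mink [simp]: "norm (mink p) = norm p"
  by (simp add: mink_def norm_prod_def)

lemma bounded_linear_mink: "bounded_linear mink"
  unfolding mink_def[abs_def]
  by (intro bounded_linear_Pair bounded_linear_minus bounded_linear_fst bounded_linear_snd)

lemma linear_mink: "linear mink"
  using bounded_linear_mink by (rule bounded_linear.linear)

lemmas mink_linear = linear_add[OF linear_mink] linear_cmul[OF linear_mink] linear_diff[OF linear_mink]

lemma ff_eq: "ff p = (p \<bullet> mink p) / 4"
  by (simp add: ff_def uu_def vv_def tau_def rr_def mink_def inner_prod_def
      power2_norm_eq_inner[symmetric] power2_eq_square field_simps)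

lemma ff_eq_tau_rr: "4 * ff p = (rr p)\<^sup>2 - (tau p)\<^sup>2"
  by (simp add: ff_eq inner_mink_self rr_def tau_def power2_norm_eq_inner)

lemma C1_deriv_ff: "C1_deriv S ff (\<lambda>p v. (mink p \<bullet> v) / 2)"
proof -
  have "C1_deriv S (\<lambda>p. (1 / 4) * (p \<bullet> mink p)) (\<lambda>p v. (1 / 4) * (p \<bullet> mink v + v \<bullet> mink p))"
    by (intro C1_deriv_cmult C1_deriv_inner C1_deriv_bounded_linear bounded_linear_ident bounded_linear_mink)
  then have "C1_deriv S ff (\<lambda>p v. (1 / 4) * (p \<bullet> mink v + v \<bullet> mink p))"
    by (simp add: ff_eq[abs_def])
  moreover have "p \<bullet> mink v = mink p \<bullet> v" "v \<bullet> mink p = mink p \<bullet> v" for p v :: "(real^'a) \<times> (real^'b)"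
    by (rule inner_mink[symmetric], rule inner_commute)
  ultimately show ?thesis by (elim C1_deriv_cong_deriv) simp
qed

lemma continuous_on_ff: "continuous_on A ff"
  by (rule C1_deriv_continuous_on[OF C1_deriv_ff])

lemma open_DD: "open (DD :: ((real^'m) \<times> (real^'n)) set)"
  unfolding DD_def by (intro open_Collect_less continuous_on_const continuous_on_ff)

lemma tau_less_rr: "p \<in> DD \<Longrightarrow> tau p < rr p"
  using ff_eq_tau_rr[of p] by (intro power2_less_imp_less[of "tau p"]) (auto simp: DD_def rr_def)

lemma rr_pos: "p \<in> DD \<Longrightarrow> rr p > 0"
  using tau_less_rr[of p] norm_ge_zero[of "fst p"] unfolding tau_def by linarith

lemma rr_sq_ge: "4 * ff p \<le> (rr p)\<^sup>2"
  by (simp add: ff_eq_tau_rr)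

lemma norm_le_2_rr: "p \<in> DD \<Longrightarrow> norm p \<le> 2 * rr p"
  using norm_Pair_le[of "fst p" "snd p"] tau_less_rr[of p] by (simp add: tau_def rr_def)

lemma ff_le_sq:
  assumes "rr p \<le> R" shows "ff p \<le> R\<^sup>2"
proof -
  have "(rr p)\<^sup>2 \<le> R\<^sup>2" using assms by (intro power_mono) (auto simp: rr_def)
  then show ?thesis using rr_sq_ge[of p] by (smt (verit) zero_le_power2)
qed

definition slab :: "(real^'n) set \<Rightarrow> ((real^'m) \<times> (real^'n)) set" where
  "slab \<Omega> = (UNIV \<times> \<Omega>) \<inter> DD"

lemma open_slab: "open \<Omega> \<Longrightarrow> open (slab \<Omega>)"
  unfolding slab_def using open_DD by (intro open_Int open_Times) auto

lemma slab_subset: "slab \<Omega> \<subseteq> UNIV \<times> \<Omega>" "slab \<Omega> \<subseteq> DD"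
  by (auto simp: slab_def)

lemma frontier_cylinder: "frontier (UNIV \<times> \<Omega>) = UNIV \<times> frontier \<Omega>"
  by (auto simp: frontier_def closure_Times interior_Times)

lemma frontier_slab:
  assumes "open \<Omega>" "p \<in> frontier (slab \<Omega>)" "p \<in> DD"
  shows "p \<in> frontier (UNIV \<times> \<Omega>)"
proof -
  have "p \<in> closure (UNIV \<times> \<Omega>)" "p \<notin> slab \<Omega>"
    using assms(2) closure_mono[OF slab_subset(1)[of \<Omega>]]
    by (auto simp: frontier_def interior_open[OF open_slab[OF assms(1)]])
  moreover have "interior (UNIV \<times> \<Omega>) = UNIV \<times> \<Omega>" using assms(1) by (simp add: interior_Times interior_open)
  ultimately show ?thesis using assms(3) by (auto simp: frontier_def slab_def)
qed

lemma slab_boundary_chart: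
  fixes p :: "(real^'m) \<times> (real^'n)"
  assumes "open \<Omega>" and defining: "local_defining \<Omega> (snd p) V \<phi>" and "p \<in> DD"
  shows "boundary_chart (slab \<Omega>) (slab V) p (\<lambda>q. \<phi> (snd q)) (\<lambda>q. (0, grad \<phi> (snd q)))"
proof
  have V: "open V" "snd p \<in> V" "grad \<phi> (snd p) \<noteq> 0" using defining by (auto simp: local_defining_def)
  show "open (slab \<Omega> :: ((real^'m) \<times> (real^'n)) set)" "open (slab V :: ((real^'m) \<times> (real^'n)) set)"
    using assms(1) V(1) by (simp_all add: open_slab)
  show "p \<in> slab V" using V(2) assms(3) by (simp add: slab_def mem_Times_iff)
  show "(0, grad \<phi> (snd p)) \<noteq> (0 :: (real^'m) \<times> (real^'n))" using V(3) by (simp add: zero_prod_def)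
  show "slab \<Omega> \<inter> slab V = {q \<in> slab V. \<phi> (snd q) < 0}"
    using local_defining_mem_iff[OF defining] by (auto simp: slab_def)
  have "C1_deriv (slab V) (\<lambda>q::(real^'m) \<times> (real^'n). \<phi> (snd q)) (\<lambda>q v. grad \<phi> (snd q) \<bullet> snd v)"
    by (rule C1_deriv_compose_linear[OF local_defining_C1_deriv[OF defining] bounded_linear_snd]) (auto simp: slab_def)
  then show "C1_deriv (slab V) (\<lambda>q::(real^'m) \<times> (real^'n). \<phi> (snd q)) (\<lambda>q v. (0, grad \<phi> (snd q)) \<bullet> v)"
    by (rule C1_deriv_cong_deriv) (simp add: inner_prod_def)
qed

definition cone_cutoff :: "real \<Rightarrow> nat \<Rightarrow> (real^'m) \<times> (real^'n) \<Rightarrow> real" where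
  "cone_cutoff R n p = cutoff (steepness n * ff p) * bump 0 R (snd p)"

definition cone_cutoff' :: "real \<Rightarrow> nat \<Rightarrow> (real^'m) \<times> (real^'n) \<Rightarrow> (real^'m) \<times> (real^'n) \<Rightarrow> real" where
  "cone_cutoff' R n p v = cutoff (steepness n * ff p) * bump' 0 R (snd p) (snd v)
     + cutoff' (steepness n * ff p) * (steepness n * ((mink p \<bullet> v) / 2)) * bump 0 R (snd p)"

definition cone_cutoff_support :: "real \<Rightarrow> nat \<Rightarrow> ((real^'m) \<times> (real^'n)) set" where
  "cone_cutoff_support R n = cball 0 (4 * R) \<inter> ff -` {1 / steepness n..}"

lemma C1_deriv_cone_cutoff: "C1_deriv S (cone_cutoff R n) (cone_cutoff' R n)"
  unfolding cone_cutoff_def[abs_def] cone_cutoff'_def[abs_def]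
  by (intro C1_deriv_mult C1_deriv_cutoff C1_deriv_cmult C1_deriv_ff
      C1_deriv_compose_linear[OF C1_deriv_bump bounded_linear_snd subset_UNIV])

lemma cone_cutoff_range: "0 \<le> cone_cutoff R n p" "cone_cutoff R n p \<le> 1"
  by (auto simp: cone_cutoff_def cutoff_nonneg cutoff_le_1 intro!: mult_le_one)

lemma in_DD_if_ff_ge: "1 / steepness n \<le> ff p \<Longrightarrow> p \<in> DD"
  using divide_pos_pos[OF zero_less_one steepness_pos[of n]] by (simp add: DD_def del: zero_less_divide_1_iff)

lemma compact_cone_cutoff_support: "compact (cone_cutoff_support R n)"
proof -
  have "closed (UNIV \<inter> ff -` {1 / steepness n..} :: ((real^'m) \<times> (real^'n)) set)"
    by (rule continuous_closed_preimage[OF continuous_on_ff]) auto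
  then show ?thesis unfolding cone_cutoff_support_def by (intro compact_Int_closed) auto
qed

lemma cone_cutoff_support_subset: "cone_cutoff_support R n \<subseteq> DD"
  using in_DD_if_ff_ge by (auto simp: cone_cutoff_support_def)

lemma cone_cutoff_near_cone: "ff p \<le> 1 / steepness n \<Longrightarrow> cone_cutoff R n p = 0"
  using steepness_pos[of n] by (simp add: cone_cutoff_def cutoff_eq_0 field_simps)

lemma cone_cutoff_outside_support:
  assumes "R > 0" "p \<notin> cone_cutoff_support R n" shows "cone_cutoff R n p = 0"
proof (cases "ff p \<le> 1 / steepness n")
  case False
  then have "p \<in> DD" by (intro in_DD_if_ff_ge[of n]) simp
  moreover have "4 * R < norm p" using assms(2) False by (simp add: cone_cutoff_support_def)
  ultimately have "2 * R < norm (snd p)" using norm_le_2_rr[of p] by (simp add: rr_def)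
  then show ?thesis using assms(1) by (simp add: cone_cutoff_def bump_eq_0)
qed (rule cone_cutoff_near_cone)

lemma eventually_cone_cutoff_eq_1:
  assumes "p \<in> DD" "R > 0" "rr p \<le> R"
  shows "\<forall>\<^sub>F n in sequentially. cone_cutoff R n p = 1"
  using eventually_steepness_gt[of "2 / ff p"]
proof eventually_elim
  case (elim n)
  then have "2 \<le> steepness n * ff p" using assms(1) by (simp add: DD_def field_simps)
  then show ?case using assms(2,3) by (simp add: cone_cutoff_def cutoff_eq_1 bump_eq_1 rr_def)
qed

lemma cone_cutoff'_bound:
  fixes p :: "(real^'m) \<times> (real^'n)"
  assumes p: "p \<in> DD" "rr p \<le> R" and R_pos: "R > 0" and M: "\<And>s. cutoff' s \<le> M" and v: "norm v \<le> C * (ff p)\<^sup>2"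
  shows "\<bar>cone_cutoff' R n p v\<bar> \<le> M * R * (4 * C) / steepness n"
proof -
  have ff_pos: "ff p > 0" using p(1) by (simp add: DD_def)
  have C_nonneg: "C \<ge> 0" using order_trans[OF norm_ge_zero v] ff_pos by (simp add: zero_le_mult_iff)
  have M_nonneg: "M \<ge> 0" using order_trans[OF cutoff'_nonneg M] .
  have cone_cutoff'_eq: "cone_cutoff' R n p v = cutoff' (steepness n * ff p) * (steepness n * ((mink p \<bullet> v) / 2))"
    using p R_pos by (simp add: cone_cutoff'_def bump_eq_1 bump'_eq_0_inside rr_def)
  show ?thesis
  proof (cases "steepness n * ff p \<le> 2")
    case True
    then have "ff p \<le> 2 / steepness n" using steepness_pos[of n] by (simp add: field_simps)
    then have "(ff p)\<^sup>2 \<le> (2 / steepness n)\<^sup>2" using ff_pos by (intro power_mono) auto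
    have "\<bar>mink p \<bullet> v\<bar> \<le> norm p * norm v" using Cauchy_Schwarz_ineq2[of "mink p" v] by simp
    also have "\<dots> \<le> (2 * R) * (C * (ff p)\<^sup>2)" using norm_le_2_rr[OF p(1)] p(2) R_pos v by (intro mult_mono) auto
    also have "\<dots> \<le> (2 * R) * (C * (2 / steepness n)\<^sup>2)"
      using R_pos C_nonneg \<open>(ff p)\<^sup>2 \<le> _\<close> by (intro mult_left_mono) auto
    finally have inner_le: "\<bar>mink p \<bullet> v\<bar> \<le> (2 * R) * (C * (2 / steepness n)\<^sup>2)" .
    have "\<bar>cone_cutoff' R n p v\<bar> = cutoff' (steepness n * ff p) * (steepness n * (\<bar>mink p \<bullet> v\<bar> / 2))"
      unfolding cone_cutoff'_eq using steepness_pos[of n] cutoff'_nonneg by (simp add: abs_mult)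
    also have "\<dots> \<le> M * (steepness n * (((2 * R) * (C * (2 / steepness n)\<^sup>2)) / 2))"
      using inner_le M M_nonneg steepness_pos[of n] cutoff'_nonneg by (intro mult_mono) auto
    also have "\<dots> = M * R * (4 * C) / steepness n"
      using steepness_pos[of n] by (simp add: power2_eq_square field_simps)
    finally show ?thesis .
  next
    case False
    then have "cone_cutoff' R n p v = 0" unfolding cone_cutoff'_eq by (simp add: cutoff'_eq_0)
    then show ?thesis using steepness_pos[of n] M_nonneg R_pos C_nonneg by simp
  qed
qed

lemma continuous_on_scaleR_vanishing:
  fixes J :: "'a::metric_space \<Rightarrow> 'b::real_normed_vector"
  assumes "continuous_on T g" "continuous_on (T \<inter> U) J" "open U" "open W" "T \<subseteq> U \<union> W" "\<And>p. p \<in> W \<Longrightarrow> g p = 0"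
  shows "continuous_on T (\<lambda>p. g p *\<^sub>R J p)"
proof -
  have cover: "(T \<inter> U) \<union> (T \<inter> W) = T" using assms(5) by auto
  have "continuous_on ((T \<inter> U) \<union> (T \<inter> W)) (\<lambda>p. g p *\<^sub>R J p)"
  proof (rule continuous_on_Un_local_open)
    show "openin (top_of_set ((T \<inter> U) \<union> (T \<inter> W))) (T \<inter> U)" "openin (top_of_set ((T \<inter> U) \<union> (T \<inter> W))) (T \<inter> W)"
      unfolding cover using assms(3,4) by (simp_all add: openin_open_Int)
    show "continuous_on (T \<inter> U) (\<lambda>p. g p *\<^sub>R J p)"
      by (intro continuous_on_scaleR continuous_on_subset[OF assms(1)] assms(2)) auto
    show "continuous_on (T \<inter> W) (\<lambda>p. g p *\<^sub>R J p)"
      by (rule continuous_on_eq[of _ "\<lambda>_. 0"]) (use assms(6) in auto)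
  qed
  then show ?thesis by (simp only: cover)
qed

locale cylinder =
  fixes \<Omega> :: "(real^'n) set" and R :: real
  assumes open_\<Omega>: "open \<Omega>" and smooth_boundary: "smooth_boundary \<Omega>"
    and radius_pos: "R > 0" and norm_less: "x \<in> \<Omega> \<Longrightarrow> norm x < R"
begin

lemma slab_bounds:
  assumes "p \<in> slab \<Omega>"
  shows "p \<in> DD" "ff p > 0" "rr p < R" "rr p > 0" "norm p \<le> 2 * R" "ff p \<le> R\<^sup>2"
proof -
  show in_DD: "p \<in> DD" and "rr p < R" using assms norm_less by (auto simp: slab_def rr_def)
  then show "ff p > 0" "rr p > 0" "norm p \<le> 2 * R" "ff p \<le> R\<^sup>2"
    using norm_le_2_rr[OF in_DD] ff_le_sq[of p R] rr_pos[OF in_DD] by (auto simp: DD_def)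
qed

lemma bounded_slab: "bounded (slab \<Omega>)"
  unfolding bounded_iff using slab_bounds(5) by blast

lemma inward_at_slab:
  fixes J :: "(real^'m) \<times> (real^'n) \<Rightarrow> (real^'m) \<times> (real^'n)"
  assumes inward: "\<And>p V \<phi>. p \<in> frontier (UNIV \<times> \<Omega>) \<Longrightarrow> p \<in> DD \<Longrightarrow> local_defining \<Omega> (snd p) V \<phi> \<Longrightarrow> snd (J p) \<bullet> grad \<phi> (snd p) \<le> 0"
    and "c \<in> frontier (slab \<Omega>)" "c \<in> DD" and g: "\<And>p. 0 \<le> g p"
  shows "inward_at (slab \<Omega>) (\<lambda>p. g p *\<^sub>R J p) c"
proof -
  have "snd c \<in> frontier \<Omega>" using frontier_slab[OF open_\<Omega> assms(2,3)] by (simp add: frontier_cylinder mem_Times_iff)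
  then obtain V \<phi> where defining: "local_defining \<Omega> (snd c) V \<phi>"
    using smooth_boundary unfolding smooth_boundary_def by blast
  have "(g p *\<^sub>R J p) \<bullet> (0, grad \<phi> (snd p)) \<le> 0" if p: "p \<in> slab V \<inter> frontier (slab \<Omega>)" for p
  proof -
    have "p \<in> DD" "snd p \<in> V" using p by (auto simp: slab_def)
    then have "snd (J p) \<bullet> grad \<phi> (snd p) \<le> 0"
      using inward frontier_slab[OF open_\<Omega>, of p] local_defining_move[OF defining, of "snd p"] p by blast
    then show ?thesis using g[of p] by (simp add: inner_prod_def mult_nonneg_nonpos)
  qed
  then show ?thesis
    unfolding inward_at_def using slab_boundary_chart[OF open_\<Omega> defining assms(3)] by blast
qed

lemma divergence_inequality_cone_cutoff:
  fixes J :: "(real^'m) \<times> (real^'n) \<Rightarrow> (real^'m) \<times> (real^'n)"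
  assumes J: "C1_div (slab \<Omega>) J \<delta>" and J_closure: "continuous_on (closure (UNIV \<times> \<Omega>) \<inter> DD) J"
    and J_decay: "\<And>p. p \<in> slab \<Omega> \<Longrightarrow> norm (J p) \<le> C * (ff p)\<^sup>2"
    and inward: "\<And>p V \<phi>. p \<in> frontier (UNIV \<times> \<Omega>) \<Longrightarrow> p \<in> DD \<Longrightarrow> local_defining \<Omega> (snd p) V \<phi> \<Longrightarrow> snd (J p) \<bullet> grad \<phi> (snd p) \<le> 0"
    and F: "continuous_on (slab \<Omega>) F" "\<And>p. p \<in> slab \<Omega> \<Longrightarrow> 0 \<le> F p" "\<And>p. p \<in> slab \<Omega> \<Longrightarrow> 0 \<le> F p + \<delta> p"
    and M: "\<And>s. cutoff' s \<le> M"
  shows "(\<integral>\<^sup>+p\<in>slab \<Omega>. ennreal (cone_cutoff R n p * (F p + \<delta> p)) \<partial>lborel)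
    \<le> (\<integral>\<^sup>+p\<in>slab \<Omega>. ennreal (F p) \<partial>lborel) + ennreal (M * R * (4 * C) / steepness n) * emeasure lborel (slab \<Omega> :: ((real^'m) \<times> (real^'n)) set)"
proof -
  have J_closure_slab: "continuous_on (closure (slab \<Omega>)) (\<lambda>p. cone_cutoff R n p *\<^sub>R J p)"
  proof (rule continuous_on_scaleR_vanishing[where U=DD and W="ff -` {..<1 / steepness n}"])
    show "continuous_on (closure (slab \<Omega>) \<inter> DD) J"
      by (rule continuous_on_subset[OF J_closure]) (use closure_mono[OF slab_subset(1)] in blast)
    show "open (ff -` {..<1 / steepness n} :: ((real^'m) \<times> (real^'n)) set)"
      using continuous_open_preimage[OF continuous_on_ff open_UNIV open_lessThan] by simp
    show "closure (slab \<Omega>) \<subseteq> DD \<union> ff -` {..<1 / steepness n}"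
      using in_DD_if_ff_ge[of n] by (auto simp: not_less)
  qed (auto simp: open_DD cone_cutoff_near_cone intro: C1_deriv_continuous_on[OF C1_deriv_cone_cutoff])
  have inward_cutoff: "inward_at (slab \<Omega>) (\<lambda>p. cone_cutoff R n p *\<^sub>R J p) c"
    if "c \<in> frontier (slab \<Omega>) \<inter> cone_cutoff_support R n" for c
    by (rule inward_at_slab[OF inward]) (use that cone_cutoff_support_subset cone_cutoff_range(1) in auto)
  have flux_le: "\<bar>cone_cutoff' R n p (J p)\<bar> \<le> M * R * (4 * C) / steepness n" if "p \<in> slab \<Omega>" for p
    using slab_bounds[OF that] by (intro cone_cutoff'_bound[OF _ _ radius_pos M J_decay[OF that]]) auto
  have "(\<integral>\<^sup>+p\<in>slab \<Omega>. ennreal (cone_cutoff R n p * (F p + \<delta> p)) \<partial>lborel)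
      \<le> (\<integral>\<^sup>+p\<in>slab \<Omega>. ennreal (cone_cutoff R n p * F p) \<partial>lborel) + (\<integral>\<^sup>+p\<in>slab \<Omega>. ennreal \<bar>cone_cutoff' R n p (J p)\<bar> \<partial>lborel)"
    by (rule divergence_inequality[OF open_slab[OF open_\<Omega>] J C1_deriv_cone_cutoff cone_cutoff_range(1)
          compact_cone_cutoff_support cone_cutoff_outside_support[OF radius_pos] J_closure_slab inward_cutoff F])
  also have "\<dots> \<le> (\<integral>\<^sup>+p\<in>slab \<Omega>. ennreal (F p) \<partial>lborel) + (\<integral>\<^sup>+p\<in>(slab \<Omega> :: ((real^'m) \<times> (real^'n)) set). ennreal (M * R * (4 * C) / steepness n) \<partial>lborel)"
  proof (intro add_mono nn_integral_mono)
    fix p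
    show "ennreal (cone_cutoff R n p * F p) * indicator (slab \<Omega>) p \<le> ennreal (F p) * indicator (slab \<Omega>) p"
      using F(2)[of p] cone_cutoff_range[of R n p] by (auto simp: indicator_def intro!: ennreal_leI mult_left_le_one_le)
    show "ennreal \<bar>cone_cutoff' R n p (J p)\<bar> * indicator (slab \<Omega>) p \<le> ennreal (M * R * (4 * C) / steepness n) * indicator (slab \<Omega>) p"
      using flux_le[of p] by (auto simp: indicator_def intro!: ennreal_leI)
  qed
  also have "(\<integral>\<^sup>+p\<in>(slab \<Omega> :: ((real^'m) \<times> (real^'n)) set). ennreal (M * R * (4 * C) / steepness n) \<partial>lborel)
      = ennreal (M * R * (4 * C) / steepness n) * emeasure lborel (slab \<Omega> :: ((real^'m) \<times> (real^'n)) set)"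
    by (subst nn_integral_cmult_indicator) (auto intro!: borel_open open_slab[OF open_\<Omega>])
  finally show ?thesis .
qed

lemma divergence_inequality_slab:
  fixes J :: "(real^'m) \<times> (real^'n) \<Rightarrow> (real^'m) \<times> (real^'n)"
  assumes J: "C1_div (slab \<Omega>) J \<delta>" and J_closure: "continuous_on (closure (UNIV \<times> \<Omega>) \<inter> DD) J"
    and J_decay: "\<And>p. p \<in> slab \<Omega> \<Longrightarrow> norm (J p) \<le> C * (ff p)\<^sup>2"
    and inward: "\<And>p V \<phi>. p \<in> frontier (UNIV \<times> \<Omega>) \<Longrightarrow> p \<in> DD \<Longrightarrow> local_defining \<Omega> (snd p) V \<phi> \<Longrightarrow> snd (J p) \<bullet> grad \<phi> (snd p) \<le> 0"
    and F: "continuous_on (slab \<Omega>) F" "\<And>p. p \<in> slab \<Omega> \<Longrightarrow> 0 \<le> F p" "\<And>p. p \<in> slab \<Omega> \<Longrightarrow> 0 \<le> F p + \<delta> p"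
  shows "(\<integral>\<^sup>+p\<in>slab \<Omega>. ennreal (F p + \<delta> p) \<partial>lborel) \<le> (\<integral>\<^sup>+p\<in>slab \<Omega>. ennreal (F p) \<partial>lborel)"
proof (rule nn_integral_le_of_eventually[where u="\<lambda>n p. ennreal (cone_cutoff R n p * (F p + \<delta> p)) * indicator (slab \<Omega>) p"])
  show "(\<lambda>p. ennreal (cone_cutoff R n p * (F p + \<delta> p)) * indicator (slab \<Omega>) p) \<in> borel_measurable lborel" for n
    by (intro borel_measurable_indicator_on_open[OF open_slab[OF open_\<Omega>]] continuous_intros F C1_div_continuous_div[OF J]
        C1_deriv_continuous_on[OF C1_deriv_cone_cutoff])
  show "\<forall>\<^sub>F n in sequentially. ennreal (cone_cutoff R n p * (F p + \<delta> p)) * indicator (slab \<Omega>) p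
     = ennreal (F p + \<delta> p) * indicator (slab \<Omega>) p" for p
  proof (cases "p \<in> slab \<Omega>")
    case True
    then have "\<forall>\<^sub>F n in sequentially. cone_cutoff R n p = 1"
      using slab_bounds[OF True] radius_pos by (intro eventually_cone_cutoff_eq_1) auto
    then show ?thesis by eventually_elim simp
  qed simp
  fix e :: real assume e_pos: "e > 0"
  obtain M where M: "\<And>s. cutoff' s \<le> M" using cutoff'_bounded by blast
  have "emeasure lborel (slab \<Omega> :: ((real^'m) \<times> (real^'n)) set) < \<infinity>" by (rule emeasure_bounded_finite[OF bounded_slab])
  then obtain vol where vol: "emeasure lborel (slab \<Omega> :: ((real^'m) \<times> (real^'n)) set) = ennreal vol" "vol \<ge> 0"
    by (cases "emeasure lborel (slab \<Omega> :: ((real^'m) \<times> (real^'n)) set)") auto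
  have "norm (J p) \<le> \<bar>C\<bar> * (ff p)\<^sup>2" if "p \<in> slab \<Omega>" for p
    using J_decay[OF that] by (smt (verit) mult_right_mono zero_le_power2)
  note step = divergence_inequality_cone_cutoff[OF J J_closure this inward F M, unfolded vol]
  show "\<forall>\<^sub>F n in sequentially. (\<integral>\<^sup>+p\<in>slab \<Omega>. ennreal (cone_cutoff R n p * (F p + \<delta> p)) \<partial>lborel)
    \<le> (\<integral>\<^sup>+p\<in>slab \<Omega>. ennreal (F p) \<partial>lborel) + ennreal e"
    using eventually_steepness_gt[of "M * R * (4 * \<bar>C\<bar>) * vol / e"]
  proof eventually_elim
    case (elim n)
    then have "M * R * (4 * \<bar>C\<bar>) / steepness n * vol \<le> e" using e_pos steepness_pos[of n] by (simp add: field_simps)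
    then have "ennreal (M * R * (4 * \<bar>C\<bar>) / steepness n) * ennreal vol \<le> ennreal e"
      using vol(2) by (simp add: ennreal_mult''[symmetric] ennreal_leI)
    then show ?case by (intro order_trans[OF step] add_left_mono)
  qed
qed

end

section \<open>Functions vanishing on the boundary\<close>

lemma segment_increment_bound:
  fixes z :: "'a::euclidean_space \<Rightarrow> real"
  assumes z: "C1_deriv S z (\<lambda>p v. Z p \<bullet> v)" and z_closure: "continuous_on (closure S) z"
    and segment: "\<And>\<theta>. 0 < \<theta> \<Longrightarrow> \<theta> < 1 \<Longrightarrow> b + \<theta> *\<^sub>R w \<in> S" and ends: "b \<in> closure S" "b + w \<in> closure S"
    and gradient_near: "\<And>\<theta>. 0 < \<theta> \<Longrightarrow> \<theta> < 1 \<Longrightarrow> norm (Z (b + \<theta> *\<^sub>R w) - g) \<le> \<kappa>"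
  shows "\<bar>z (b + w) - z b - g \<bullet> w\<bar> \<le> \<kappa> * norm w"
proof -
  have in_closure: "b + \<theta> *\<^sub>R w \<in> closure S" if "\<theta> \<in> {0..1}" for \<theta>
  proof -
    have "\<theta> = 0 \<or> \<theta> = 1 \<or> (0 < \<theta> \<and> \<theta> < 1)" using that by auto
    then consider "\<theta> = 0" | "\<theta> = 1" | "0 < \<theta>" "\<theta> < 1" by blast
    then show ?thesis using ends segment closure_subset by cases auto
  qed
  have continuous: "continuous_on {0..1} (\<lambda>\<theta>. z (b + \<theta> *\<^sub>R w))"
    by (rule continuous_on_compose2[OF z_closure]) (auto intro!: continuous_intros in_closure)
  have derivative: "((\<lambda>\<theta>. z (b + \<theta> *\<^sub>R w)) has_real_derivative Z (b + \<theta> *\<^sub>R w) \<bullet> w) (at \<theta>)" if "0 < \<theta>" "\<theta> < 1" for \<theta>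
    by (rule C1_deriv_line_real[OF z segment[OF that]])
  have "\<exists>l \<theta>. 0 < \<theta> \<and> \<theta> < 1 \<and> ((\<lambda>\<theta>. z (b + \<theta> *\<^sub>R w)) has_real_derivative l) (at \<theta>)
       \<and> z (b + 1 *\<^sub>R w) - z (b + 0 *\<^sub>R w) = (1 - 0) * l"
    by (rule MVT[OF _ continuous]) (use derivative real_differentiable_def in auto)
  then obtain l \<theta> where \<theta>: "0 < \<theta>" "\<theta> < 1" "((\<lambda>\<theta>. z (b + \<theta> *\<^sub>R w)) has_real_derivative l) (at \<theta>)"
     "z (b + w) - z b = l" by auto
  have "l = Z (b + \<theta> *\<^sub>R w) \<bullet> w" by (rule DERIV_unique[OF \<theta>(3) derivative[OF \<theta>(1,2)]])
  then have "z (b + w) - z b - g \<bullet> w = (Z (b + \<theta> *\<^sub>R w) - g) \<bullet> w" by (simp add: \<theta>(4) inner_diff_left)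
  also have "\<bar>\<dots>\<bar> \<le> norm (Z (b + \<theta> *\<^sub>R w) - g) * norm w" by (rule Cauchy_Schwarz_ineq2)
  also have "\<dots> \<le> \<kappa> * norm w" using gradient_near[OF \<theta>(1,2)] by (intro mult_right_mono) auto
  finally show ?thesis .
qed

lemma first_exit:
  fixes b w :: "'a::real_normed_vector"
  assumes "open S" "b \<in> S" "b + w \<notin> S"
  obtains t where "0 < t" "t \<le> 1" "b + t *\<^sub>R w \<in> frontier S" "\<And>\<theta>. 0 \<le> \<theta> \<Longrightarrow> \<theta> < t \<Longrightarrow> b + \<theta> *\<^sub>R w \<in> S"
proof -
  define T where "T = {0..1} \<inter> (\<lambda>\<theta>. b + \<theta> *\<^sub>R w) -` (- S)"
  have "closed T" unfolding T_def
    by (intro continuous_closed_preimage continuous_intros) (use assms(1) in auto)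
  then have "compact T" using compact_Int_closed[of "{0..1::real}" T] by (simp add: T_def Int_absorb1)
  moreover have "1 \<in> T" using assms(3) by (simp add: T_def)
  then have "T \<noteq> {}" by blast
  ultimately obtain t where t: "t \<in> T" "\<forall>\<theta>\<in>T. t \<le> \<theta>" using continuous_attains_inf[of T "\<lambda>x. x"] continuous_on_id by blast
  have before: "b + \<theta> *\<^sub>R w \<in> S" if "0 \<le> \<theta>" "\<theta> < t" for \<theta>
    using t that by (force simp: T_def)
  have "t \<noteq> 0" using t(1) assms(2) by (auto simp: T_def)
  then have t_pos: "0 < t" using t(1) by (simp add: T_def)
  have "((\<lambda>\<theta>. b + \<theta> *\<^sub>R w) \<longlongrightarrow> b + t *\<^sub>R w) (at_left t)" by (intro tendsto_intros)
  moreover have "\<forall>\<^sub>F \<theta> in at_left t. b + \<theta> *\<^sub>R w \<in> closure S"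
    using eventually_at_left_real[OF t_pos]
    by eventually_elim (use before closure_subset in force)
  ultimately have "b + t *\<^sub>R w \<in> closure S"
    by (intro Lim_in_closed_set[OF closed_closure, of _ _ "at_left t"]) auto
  then have "b + t *\<^sub>R w \<in> frontier S" using t(1) assms(1) by (simp add: T_def frontier_def interior_open)
  with t_pos t(1) before show ?thesis by (intro that) (auto simp: T_def)
qed

lemma linearization_bound:
  fixes \<Phi> :: "'a::euclidean_space \<Rightarrow> real"
  assumes "(\<Phi> has_derivative (\<lambda>v. n \<bullet> v)) (at c)" "\<Phi> c = 0" "\<kappa> > 0"
  obtains d where "d > 0" "\<And>v. norm v < d \<Longrightarrow> \<bar>\<Phi> (c + v) - n \<bullet> v\<bar> \<le> \<kappa> * norm v"
proof -
  obtain d where d: "d > 0" "\<And>y. norm (y - c) < d \<Longrightarrow> norm (\<Phi> y - \<Phi> c - n \<bullet> (y - c)) \<le> \<kappa> * norm (y - c)"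
    using assms(1,3) unfolding has_derivative_at_alt by blast
  show ?thesis
  proof (rule that[OF d(1)])
    show "\<bar>\<Phi> (c + v) - n \<bullet> v\<bar> \<le> \<kappa> * norm v" if "norm v < d" for v
      using d(2)[of "c + v"] that assms(2) by simp
  qed
qed

lemma sign_along_tangential_wedge:
  fixes \<Phi> :: "'a::euclidean_space \<Rightarrow> real"
  assumes \<Phi>: "(\<Phi> has_derivative (\<lambda>v. n \<bullet> v)) (at c)" "\<Phi> c = 0" and n: "n \<noteq> 0" and h: "n \<bullet> h = 0" and \<delta>_pos: "\<delta> > 0"
  obtains s0 where "s0 > 0"
    "\<And>s \<alpha> \<beta>. \<lbrakk>0 < s; s < s0; 0 \<le> \<alpha>; \<alpha> \<le> \<bar>\<beta>\<bar>; \<bar>\<beta>\<bar> \<le> 1; \<beta> \<noteq> 0\<rbrakk> \<Longrightarrow> 0 < \<beta> * \<Phi> (c + s *\<^sub>R (\<alpha> *\<^sub>R h + (\<beta> * \<delta>) *\<^sub>R n))"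
proof -
  define N where "N = norm h + \<delta> * norm n + 1"
  have N: "N > 0" "norm h + \<delta> * norm n < N" using \<delta>_pos unfolding N_def by (auto intro: add_nonneg_pos)
  define \<kappa> where "\<kappa> = \<delta> * (norm n)\<^sup>2 / N"
  have \<kappa>_pos: "\<kappa> > 0" using \<delta>_pos n N by (simp add: \<kappa>_def)
  obtain d where d: "d > 0" "\<And>v. norm v < d \<Longrightarrow> \<bar>\<Phi> (c + v) - n \<bullet> v\<bar> \<le> \<kappa> * norm v"
    using linearization_bound[OF \<Phi> \<kappa>_pos] by blast
  have "0 < \<beta> * \<Phi> (c + v)"
    if s: "0 < s" "s < d / N" and \<alpha>: "0 \<le> \<alpha>" "\<alpha> \<le> \<bar>\<beta>\<bar>" and \<beta>: "\<bar>\<beta>\<bar> \<le> 1" "\<beta> \<noteq> 0"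
      and v: "v = s *\<^sub>R (\<alpha> *\<^sub>R h + (\<beta> * \<delta>) *\<^sub>R n)" for s \<alpha> \<beta> v
  proof -
    have "norm (\<alpha> *\<^sub>R h + (\<beta> * \<delta>) *\<^sub>R n) \<le> \<alpha> * norm h + \<bar>\<beta>\<bar> * (\<delta> * norm n)"
      using norm_triangle_ineq[of "\<alpha> *\<^sub>R h" "(\<beta> * \<delta>) *\<^sub>R n"] \<alpha> \<delta>_pos by (simp add: abs_mult mult.assoc)
    also have "\<dots> \<le> \<bar>\<beta>\<bar> * norm h + \<bar>\<beta>\<bar> * (\<delta> * norm n)" using \<alpha> by (intro add_right_mono mult_right_mono) auto
    finally have "norm (\<alpha> *\<^sub>R h + (\<beta> * \<delta>) *\<^sub>R n) \<le> \<bar>\<beta>\<bar> * (norm h + \<delta> * norm n)" by (simp add: distrib_left)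
    then have "norm v \<le> s * (\<bar>\<beta>\<bar> * (norm h + \<delta> * norm n))" using s by (simp add: v)
    also have "\<dots> < s * (\<bar>\<beta>\<bar> * N)" using s \<beta> N by (intro mult_strict_left_mono) auto
    finally have norm_v_less: "norm v < s * (\<bar>\<beta>\<bar> * N)" .
    also have "\<dots> \<le> s * (1 * N)" using s \<beta> N by (intro mult_left_mono mult_right_mono) auto
    also have "\<dots> < d" using s N by (simp add: field_simps)
    finally have "\<bar>\<Phi> (c + v) - n \<bullet> v\<bar> \<le> \<kappa> * norm v" by (rule d(2))
    also have "\<dots> < \<kappa> * (s * (\<bar>\<beta>\<bar> * N))" using norm_v_less \<kappa>_pos by (rule mult_strict_left_mono)
    also have "\<dots> = s * \<bar>\<beta>\<bar> * (\<delta> * (norm n)\<^sup>2)" using N by (simp add: \<kappa>_def)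
    finally have "\<bar>\<Phi> (c + v) - n \<bullet> v\<bar> < s * \<bar>\<beta>\<bar> * (\<delta> * (norm n)\<^sup>2)" .
    moreover have "n \<bullet> v = s * \<beta> * (\<delta> * (norm n)\<^sup>2)"
      by (simp add: v inner_add_right h power2_norm_eq_inner)
    ultimately have "\<bar>\<beta> * \<Phi> (c + v) - \<beta> * (s * \<beta> * (\<delta> * (norm n)\<^sup>2))\<bar> < \<bar>\<beta>\<bar> * (s * \<bar>\<beta>\<bar> * (\<delta> * (norm n)\<^sup>2))"
      unfolding right_diff_distrib[symmetric] abs_mult[of \<beta>] using \<beta> by (intro mult_strict_left_mono) auto
    moreover have "\<bar>\<beta>\<bar> * (s * \<bar>\<beta>\<bar> * (\<delta> * (norm n)\<^sup>2)) = \<beta> * (s * \<beta> * (\<delta> * (norm n)\<^sup>2))" by (simp add: abs_mult_self_eq)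
    ultimately show ?thesis by linarith
  qed
  with d(1) N(1) show ?thesis by (intro that[of "d / N"]) auto
qed

locale boundary_vanishing = boundary_chart S V c \<Phi> G
  for S V :: "'a::euclidean_space set" and c \<Phi> G +
  fixes z :: "'a \<Rightarrow> real" and Z W :: "'a \<Rightarrow> 'a"
  assumes center_frontier: "c \<in> frontier S"
    and C1_z: "C1_deriv S z (\<lambda>p v. Z p \<bullet> v)" and continuous_on_z: "continuous_on (closure S) z"
    and W_eq: "p \<in> S \<Longrightarrow> W p = Z p" and continuous_on_W: "continuous_on (closure S) W"
    and z_zero: "p \<in> V \<Longrightarrow> p \<in> frontier S \<Longrightarrow> z p = 0"

locale tangential_path = boundary_vanishing S V c \<Phi> G z Z W
  for S V :: "'a::euclidean_space set" and c \<Phi> G z Z W +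
  fixes h :: 'a and \<delta> \<kappa> e s :: real
  assumes \<delta>_pos: "\<delta> > 0" and s_pos: "s > 0"
    and W_near: "p \<in> S \<Longrightarrow> dist p c < e \<Longrightarrow> norm (W p - W c) \<le> \<kappa>"
    and within_radius: "\<lbrakk>0 \<le> \<alpha>; \<alpha> \<le> 1; \<bar>\<beta>\<bar> \<le> 1\<rbrakk> \<Longrightarrow> c + s *\<^sub>R (\<alpha> *\<^sub>R h + (\<beta> * \<delta>) *\<^sub>R G c) \<in> V \<inter> ball c e"
    and sign: "\<lbrakk>0 \<le> \<alpha>; \<alpha> \<le> \<bar>\<beta>\<bar>; \<bar>\<beta>\<bar> \<le> 1; \<beta> \<noteq> 0\<rbrakk> \<Longrightarrow> 0 < \<beta> * \<Phi> (c + s *\<^sub>R (\<alpha> *\<^sub>R h + (\<beta> * \<delta>) *\<^sub>R G c))"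
begin

definition node :: "real \<Rightarrow> real \<Rightarrow> 'a" where
  "node \<alpha> \<beta> = c + s *\<^sub>R (\<alpha> *\<^sub>R h + (\<beta> * \<delta>) *\<^sub>R G c)"

lemma node_center: "node 0 0 = c"
  by (simp add: node_def)

lemma node_diff: "node \<alpha>' \<beta>' - node \<alpha> \<beta> = s *\<^sub>R ((\<alpha>' - \<alpha>) *\<^sub>R h + ((\<beta>' - \<beta>) * \<delta>) *\<^sub>R G c)"
  by (simp add: node_def algebra_simps)

lemma node_convex: "node \<alpha> \<beta> + \<theta> *\<^sub>R (node \<alpha>' \<beta>' - node \<alpha> \<beta>) = node (\<alpha> + \<theta> * (\<alpha>' - \<alpha>)) (\<beta> + \<theta> * (\<beta>' - \<beta>))"
  unfolding node_diff by (simp add: node_def algebra_simps)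

lemma node_near: "\<lbrakk>0 \<le> \<alpha>; \<alpha> \<le> 1; \<bar>\<beta>\<bar> \<le> 1\<rbrakk> \<Longrightarrow> node \<alpha> \<beta> \<in> V" "\<lbrakk>0 \<le> \<alpha>; \<alpha> \<le> 1; \<bar>\<beta>\<bar> \<le> 1\<rbrakk> \<Longrightarrow> dist (node \<alpha> \<beta>) c < e"
  using within_radius[of \<alpha> \<beta>] by (auto simp: node_def dist_commute)

lemma node_in_S: "\<lbrakk>0 \<le> \<alpha>; \<alpha> \<le> - \<beta>; -1 \<le> \<beta>; \<beta> < 0\<rbrakk> \<Longrightarrow> node \<alpha> \<beta> \<in> S"
  using within_radius[of \<alpha> \<beta>] sign[of \<alpha> \<beta>] S_Int_V by (auto simp: node_def zero_less_mult_iff)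

lemma node_increment:
  assumes "\<And>\<theta>. 0 < \<theta> \<Longrightarrow> \<theta> < 1 \<Longrightarrow> node (\<alpha> + \<theta> * (\<alpha>' - \<alpha>)) (\<beta> + \<theta> * (\<beta>' - \<beta>)) \<in> S \<and>
      dist (node (\<alpha> + \<theta> * (\<alpha>' - \<alpha>)) (\<beta> + \<theta> * (\<beta>' - \<beta>))) c < e"
    and "node \<alpha> \<beta> \<in> closure S" "node \<alpha>' \<beta>' \<in> closure S"
  shows "\<bar>z (node \<alpha>' \<beta>') - z (node \<alpha> \<beta>) - W c \<bullet> (node \<alpha>' \<beta>' - node \<alpha> \<beta>)\<bar> \<le> \<kappa> * norm (node \<alpha>' \<beta>' - node \<alpha> \<beta>)"
  using segment_increment_bound[OF C1_z continuous_on_z, of "node \<alpha> \<beta>" "node \<alpha>' \<beta>' - node \<alpha> \<beta>" "W c" \<kappa>]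
    assms W_near W_eq unfolding node_convex by simp

lemma boundary_node:
  obtains \<beta> where "-1 < \<beta>" "\<beta> \<le> 1" "node 1 \<beta> \<in> frontier S" "\<And>\<beta>'. -1 \<le> \<beta>' \<Longrightarrow> \<beta>' < \<beta> \<Longrightarrow> node 1 \<beta>' \<in> S"
proof -
  have convex: "node 1 (-1) + \<theta> *\<^sub>R (node 1 1 - node 1 (-1)) = node 1 (2 * \<theta> - 1)" for \<theta>
    unfolding node_convex by (simp add: mult.commute)
  have "node 1 (-1) \<in> S" by (rule node_in_S) auto
  moreover have "0 < \<Phi> (node 1 1)" "node 1 1 \<in> V" using sign[of 1 1] node_near(1)[of 1 1] by (auto simp: node_def)
  then have "node 1 1 \<notin> S" using S_Int_V by force
  ultimately obtain t where t: "0 < t" "t \<le> 1" "node 1 (2 * t - 1) \<in> frontier S"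
    "\<And>\<theta>. 0 \<le> \<theta> \<Longrightarrow> \<theta> < t \<Longrightarrow> node 1 (2 * \<theta> - 1) \<in> S"
    using first_exit[OF open_S, of "node 1 (-1)" "node 1 1 - node 1 (-1)"] unfolding convex by auto
  show ?thesis
  proof (rule that[of "2 * t - 1"])
    show "node 1 \<beta>' \<in> S" if "-1 \<le> \<beta>'" "\<beta>' < 2 * t - 1" for \<beta>'
      using t(4)[of "(\<beta>' + 1) / 2"] that by (simp add: field_simps)
  qed (use t in auto)
qed

text \<open>The path goes from \<^term>\<open>c\<close> down along the normal, then along \<^term>\<open>h\<close>, then up until the boundary is met.\<close>

lemma tangential_derivative_bound: "\<bar>W c \<bullet> h\<bar> \<le> \<delta> * \<bar>W c \<bullet> G c\<bar> + \<kappa> * (norm h + 3 * \<delta> * norm (G c))"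
proof -
  obtain \<beta> where \<beta>: "-1 < \<beta>" "\<beta> \<le> 1" "node 1 \<beta> \<in> frontier S" "\<And>\<beta>'. -1 \<le> \<beta>' \<Longrightarrow> \<beta>' < \<beta> \<Longrightarrow> node 1 \<beta>' \<in> S"
    by (rule boundary_node) (rule that)
  have closure: "node 0 0 \<in> closure S" "node 0 (-1) \<in> closure S" "node 1 (-1) \<in> closure S" "node 1 \<beta> \<in> closure S"
    using center_frontier \<beta>(3) node_in_S[of 0 "-1"] node_in_S[of 1 "-1"] closure_subset[of S]
    by (auto simp: node_center frontier_def)
  define slope where "slope = s * (\<delta> * (W c \<bullet> G c))"
  define N where "N = s * (\<delta> * norm (G c))"
  have down: "\<bar>z (node 0 (-1)) - z (node 0 0) + slope\<bar> \<le> \<kappa> * N"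
    using node_increment[OF _ closure(1,2)] node_in_S node_near(2) s_pos \<delta>_pos
    by (simp add: node_diff slope_def N_def)
  have along: "\<bar>z (node 1 (-1)) - z (node 0 (-1)) - s * (W c \<bullet> h)\<bar> \<le> \<kappa> * (s * norm h)"
    using node_increment[OF _ closure(2,3)] node_in_S node_near(2) s_pos by (simp add: node_diff)
  have interpolate: "-1 \<le> -1 + \<theta> * (\<beta> + 1)" "-1 + \<theta> * (\<beta> + 1) < \<beta>" "\<bar>-1 + \<theta> * (\<beta> + 1)\<bar> \<le> 1" if "0 < \<theta>" "\<theta> < 1" for \<theta>
  proof -
    have "0 < \<theta> * (\<beta> + 1)" "\<theta> * (\<beta> + 1) < 1 * (\<beta> + 1)"
      using that \<beta>(1) by (auto intro!: mult_strict_right_mono mult_pos_pos)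
    then show "-1 \<le> -1 + \<theta> * (\<beta> + 1)" "-1 + \<theta> * (\<beta> + 1) < \<beta>" "\<bar>-1 + \<theta> * (\<beta> + 1)\<bar> \<le> 1"
      using \<beta>(2) by (auto simp: abs_le_iff)
  qed
  have "\<bar>z (node 1 \<beta>) - z (node 1 (-1)) - (\<beta> + 1) * slope\<bar> \<le> \<kappa> * ((\<beta> + 1) * N)"
    using node_increment[OF _ closure(3,4)] interpolate \<beta> node_near(2)[of 1] s_pos \<delta>_pos
    by (simp add: node_diff slope_def N_def abs_mult mult_ac)
  moreover have "\<kappa> \<ge> 0"
    by (rule order_trans[OF norm_ge_zero W_near[of "node 0 (-1)"]]) (auto intro!: node_in_S node_near)
  then have "\<kappa> * ((\<beta> + 1) * N) \<le> \<kappa> * (2 * N)"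
    using \<beta>(2) s_pos \<delta>_pos by (intro mult_left_mono mult_right_mono) (auto simp: N_def)
  moreover have "z (node 0 0) = 0" "z (node 1 \<beta>) = 0"
    using z_zero center center_frontier \<beta>(1-3) node_near(1)[of 1 \<beta>] by (auto simp: node_center)
  moreover have "\<bar>\<beta> * slope\<bar> \<le> \<bar>slope\<bar>" using \<beta>(1,2) by (simp add: abs_mult mult_left_le_one_le)
  ultimately have "\<bar>s * (W c \<bullet> h)\<bar> \<le> \<bar>slope\<bar> + \<kappa> * (s * norm h + 3 * N)"
    using down along by (simp add: algebra_simps)
  then have "s * \<bar>W c \<bullet> h\<bar> \<le> s * (\<delta> * \<bar>W c \<bullet> G c\<bar> + \<kappa> * (norm h + 3 * \<delta> * norm (G c)))"
    using s_pos \<delta>_pos by (simp add: slope_def N_def abs_mult algebra_simps)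
  then show ?thesis using s_pos by simp
qed

end

context boundary_vanishing
begin

lemma tangential_path_exists:
  assumes h: "G c \<bullet> h = 0" and \<delta>_pos: "\<delta> > 0" and \<kappa>_pos: "\<kappa> > 0"
  obtains e s where "tangential_path S V c \<Phi> G z Z W h \<delta> \<kappa> e s"
proof -
  obtain e where e: "e > 0" "\<And>p. p \<in> closure S \<Longrightarrow> dist p c < e \<Longrightarrow> dist (W p) (W c) < \<kappa>"
    using continuous_on_W \<kappa>_pos center_frontier unfolding continuous_on_iff frontier_def by blast
  obtain e' where e': "e' > 0" "ball c e' \<subseteq> V" using open_V center openE by blast
  obtain s0 where s0: "s0 > 0" "\<And>s \<alpha> \<beta>. \<lbrakk>0 < s; s < s0; 0 \<le> \<alpha>; \<alpha> \<le> \<bar>\<beta>\<bar>; \<bar>\<beta>\<bar> \<le> 1; \<beta> \<noteq> 0\<rbrakk>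
      \<Longrightarrow> 0 < \<beta> * \<Phi> (c + s *\<^sub>R (\<alpha> *\<^sub>R h + (\<beta> * \<delta>) *\<^sub>R G c))"
    using sign_along_tangential_wedge[OF C1_deriv_has_derivative[OF C1_\<Phi> center]
        \<Phi>_frontier_zero[OF center_frontier center] G_center h \<delta>_pos] by blast
  define N where "N = norm h + \<delta> * norm (G c) + 1"
  have N: "N > 0" "norm h + \<delta> * norm (G c) < N" using \<delta>_pos unfolding N_def by (auto intro: add_nonneg_pos)
  define s where "s = min (s0 / 2) (min e e' / N)"
  have s: "0 < s" "s < s0" "s * N \<le> min e e'"
    using s0(1) e(1) e'(1) N(1) by (auto simp: s_def min_def field_simps)
  have near: "c + s *\<^sub>R (\<alpha> *\<^sub>R h + (\<beta> * \<delta>) *\<^sub>R G c) \<in> V \<inter> ball c e" if "0 \<le> \<alpha>" "\<alpha> \<le> 1" "\<bar>\<beta>\<bar> \<le> 1" for \<alpha> \<beta>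
  proof -
    have "norm (\<alpha> *\<^sub>R h + (\<beta> * \<delta>) *\<^sub>R G c) \<le> \<alpha> * norm h + \<bar>\<beta>\<bar> * (\<delta> * norm (G c))"
      using norm_triangle_ineq[of "\<alpha> *\<^sub>R h" "(\<beta> * \<delta>) *\<^sub>R G c"] that \<delta>_pos by (simp add: abs_mult mult.assoc)
    also have "\<dots> \<le> 1 * norm h + 1 * (\<delta> * norm (G c))" using that \<delta>_pos by (intro add_mono mult_right_mono) auto
    also have "\<dots> < N" using N by simp
    finally have "norm (\<alpha> *\<^sub>R h + (\<beta> * \<delta>) *\<^sub>R G c) < N" .
    then have "s * norm (\<alpha> *\<^sub>R h + (\<beta> * \<delta>) *\<^sub>R G c) < s * N" using s(1) by (rule mult_strict_left_mono)
    also note \<open>s * N \<le> min e e'\<close>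
    finally have "dist c (c + s *\<^sub>R (\<alpha> *\<^sub>R h + (\<beta> * \<delta>) *\<^sub>R G c)) < min e e'" using s by (simp add: dist_norm)
    then show ?thesis using e'(2) by auto
  qed
  have W_near: "norm (W p - W c) \<le> \<kappa>" if "p \<in> S" "dist p c < e" for p
    using e(2)[of p] that closure_subset[of S] by (force simp: dist_norm)
  have "tangential_path S V c \<Phi> G z Z W h \<delta> \<kappa> e s"
    by unfold_locales (use h \<delta>_pos s s0(2) near W_near in auto)
  then show ?thesis by (rule that)
qed

lemma tangential_derivative_zero:
  assumes h: "G c \<bullet> h = 0" shows "W c \<bullet> h = 0"
proof -
  have "\<bar>W c \<bullet> h\<bar> \<le> 0 + e" if e_pos: "e > 0" for e
  proof -
    define M where "M = \<bar>W c \<bullet> G c\<bar> + norm h + 3 * norm (G c) + 1"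
    have M: "M \<ge> 1" by (simp add: M_def)
    define \<delta> where "\<delta> = min 1 (e / M)"
    have \<delta>: "\<delta> > 0" "\<delta> \<le> 1" "\<delta> * M \<le> e" using e_pos M by (auto simp: \<delta>_def min_def field_simps)
    obtain r s where "tangential_path S V c \<Phi> G z Z W h \<delta> \<delta> r s"
      using tangential_path_exists[OF h \<delta>(1) \<delta>(1)] by blast
    then have "\<bar>W c \<bullet> h\<bar> \<le> \<delta> * \<bar>W c \<bullet> G c\<bar> + \<delta> * (norm h + 3 * \<delta> * norm (G c))"
      by (rule tangential_path.tangential_derivative_bound)
    also have "\<dots> \<le> \<delta> * \<bar>W c \<bullet> G c\<bar> + \<delta> * (norm h + 3 * 1 * norm (G c))"
      using \<delta> by (intro add_left_mono mult_left_mono mult_right_mono) auto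
    also have "\<dots> \<le> \<delta> * M" using \<delta> by (simp add: M_def distrib_left)
    finally show ?thesis using \<delta>(3) by simp
  qed
  then have "\<bar>W c \<bullet> h\<bar> \<le> 0" by (rule field_le_epsilon)
  then show ?thesis by simp
qed

end

lemma multiple_if_orthogonal:
  fixes w n :: "'a::real_inner"
  assumes "n \<noteq> 0" "\<And>h. n \<bullet> h = 0 \<Longrightarrow> w \<bullet> h = 0"
  shows "\<exists>l. w = l *\<^sub>R n"
proof -
  define l where "l = (w \<bullet> n) / (n \<bullet> n)"
  have "n \<bullet> (w - l *\<^sub>R n) = 0" using assms(1) by (simp add: l_def inner_diff_right inner_commute)
  then have "w \<bullet> (w - l *\<^sub>R n) = 0" "n \<bullet> (w - l *\<^sub>R n) = 0" using assms(2) by auto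
  then have "(w - l *\<^sub>R n) \<bullet> (w - l *\<^sub>R n) = 0" by (simp add: inner_diff_left)
  then show ?thesis by auto
qed

corollary (in boundary_vanishing) gradient_normal: "\<exists>l. W c = l *\<^sub>R G c"
  by (rule multiple_if_orthogonal[OF G_center tangential_derivative_zero])

section \<open>Localization near the outgoing boundary\<close>

lemma nonpos_inner_if_half_space_subset:
  fixes x g g' :: "'a::real_inner"
  assumes "g' \<noteq> 0" "\<And>h. g \<bullet> h < 0 \<Longrightarrow> g' \<bullet> h \<le> 0" "x \<bullet> g' \<le> 0"
  shows "x \<bullet> g \<le> 0"
proof (rule ccontr)
  assume "\<not> x \<bullet> g \<le> 0"
  then have pos: "x \<bullet> g > 0" by simp
  define \<eta> where "\<eta> = (x \<bullet> g) / (2 * (\<bar>g' \<bullet> g\<bar> + 1))"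
  have \<eta>_pos: "\<eta> > 0" using pos by (simp add: \<eta>_def)
  have "\<eta> * (g' \<bullet> g) \<le> \<eta> * (\<bar>g' \<bullet> g\<bar> + 1)" using \<eta>_pos by (intro mult_left_mono) auto
  also have "\<dots> = (x \<bullet> g) / 2" unfolding \<eta>_def by (simp add: field_simps add_nonneg_eq_0_iff)
  finally have "g \<bullet> (\<eta> *\<^sub>R g' - x) < 0" using pos by (simp add: inner_diff_right inner_commute)
  then have "g' \<bullet> (\<eta> *\<^sub>R g' - x) \<le> 0" by (rule assms(2))
  moreover have "0 < \<eta> * (g' \<bullet> g')" using \<eta>_pos assms(1) by simp
  ultimately show False using assms(3) by (simp add: inner_diff_right inner_commute)
qed

lemma local_defining_half_space_subset:
  assumes "local_defining \<Omega> x V \<phi>" "local_defining \<Omega> x V' \<psi>" "open \<Omega>" "x \<in> frontier \<Omega>" "grad \<phi> x \<bullet> h < 0"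
  shows "grad \<psi> x \<bullet> h \<le> 0"
proof (rule ccontr)
  interpret \<phi>: boundary_chart \<Omega> V x \<phi> "grad \<phi>" by (rule local_defining_boundary_chart[OF assms(1,3)])
  interpret \<psi>: boundary_chart \<Omega> V' x \<psi> "grad \<psi>" by (rule local_defining_boundary_chart[OF assms(2,3)])
  assume "\<not> grad \<psi> x \<bullet> h \<le> 0"
  then have "\<forall>\<^sub>F s in at_right 0. x + s *\<^sub>R h \<notin> \<Omega>" by (intro \<psi>.eventually_line_outside[OF assms(4)]) simp
  with \<phi>.eventually_line_inside[OF assms(4,5)] have "\<forall>\<^sub>F s in at_right (0::real). False" by eventually_elim simp
  then show False by simp
qed

lemma inward_radial_outside_Gamma_plus:
  assumes defining: "local_defining \<Omega> x V \<phi>" and "x \<in> frontier \<Omega>" "open \<Omega>" "x \<notin> Gamma_plus \<Omega>"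
  shows "x \<bullet> grad \<phi> x \<le> 0"
proof -
  have "\<exists>U \<phi>. local_defining \<Omega> x U \<phi> \<and> outward_normal \<Omega> x = sgn (grad \<phi> x)"
    unfolding outward_normal_def by (rule someI_ex) (use defining in blast)
  then obtain U \<psi> where \<psi>: "local_defining \<Omega> x U \<psi>" "outward_normal \<Omega> x = sgn (grad \<psi> x)" by blast
  have "x \<bullet> outward_normal \<Omega> x \<le> 0" using assms(2,4) by (simp add: Gamma_plus_def)
  then have "x \<bullet> grad \<psi> x \<le> 0" "grad \<psi> x \<noteq> 0"
    using \<psi> by (auto simp: sgn_div_norm local_defining_def divide_le_0_iff inverse_eq_divide mult_le_0_iff)
  then show ?thesis
    using nonpos_inner_if_half_space_subset local_defining_half_space_subset[OF defining \<psi>(1) assms(3,2)] by blast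
qed

definition hole_cutoff :: "'a::euclidean_space set \<Rightarrow> real \<Rightarrow> 'a \<Rightarrow> real" where
  "hole_cutoff I \<rho> x = (\<Prod>c\<in>I. 1 - bump c \<rho> x)"

definition grad_hole_cutoff :: "'a::euclidean_space set \<Rightarrow> real \<Rightarrow> 'a \<Rightarrow> 'a" where
  "grad_hole_cutoff I \<rho> x = (\<Sum>b\<in>Basis. (\<Sum>c\<in>I. (0 - bump' c \<rho> x b) * (\<Prod>d\<in>I - {c}. 1 - bump d \<rho> x)) *\<^sub>R b)"

lemma C1_deriv_hole_cutoff: "C1_deriv S (hole_cutoff I \<rho>) (\<lambda>x v. grad_hole_cutoff I \<rho> x \<bullet> v)"
proof -
  have product: "C1_deriv S (hole_cutoff I \<rho>) (\<lambda>x v. \<Sum>c\<in>I. (0 - bump' c \<rho> x v) * (\<Prod>d\<in>I - {c}. 1 - bump d \<rho> x))"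
    unfolding hole_cutoff_def[abs_def] by (intro C1_deriv_prod C1_deriv_diff C1_deriv_const C1_deriv_bump)
  show ?thesis
    unfolding grad_hole_cutoff_def
    by (rule C1_deriv_cong_deriv[OF product linear_eq_inner_Basis_sum[OF C1_deriv_linear[OF product]]])
qed

lemma continuous_on_grad_hole_cutoff: "continuous_on S (grad_hole_cutoff I \<rho>)"
  unfolding grad_hole_cutoff_def[abs_def]
  by (intro continuous_intros C1_deriv_continuous_deriv[OF C1_deriv_bump] C1_deriv_continuous_on[OF C1_deriv_bump])

lemma hole_cutoff_range: "0 \<le> hole_cutoff I \<rho> x \<and> hole_cutoff I \<rho> x \<le> 1"
  unfolding hole_cutoff_def by (auto intro!: prod_nonneg prod_le_1)

lemma hole_cutoff_eq_0: "\<lbrakk>finite I; \<rho> > 0; c \<in> I; dist x c \<le> \<rho>\<rbrakk> \<Longrightarrow> hole_cutoff I \<rho> x = 0"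
  unfolding hole_cutoff_def by (rule prod_zero) (auto intro: bump_eq_1)

lemma hole_cutoff_near_centers:
  assumes "\<rho> > 0" "hole_cutoff I \<rho> x \<noteq> 1 \<or> grad_hole_cutoff I \<rho> x \<noteq> 0"
  shows "\<exists>c\<in>I. dist x c < 2 * \<rho>"
proof (rule ccontr)
  assume "\<not> (\<exists>c\<in>I. dist x c < 2 * \<rho>)"
  then have "bump c \<rho> x = 0" "bump' c \<rho> x v = 0" if "c \<in> I" for c v
    using assms(1) that bump_eq_0[of \<rho> x c] bump'_eq_0[of \<rho> x c] by force+
  then have "hole_cutoff I \<rho> x = 1" "grad_hole_cutoff I \<rho> x = 0" by (simp_all add: hole_cutoff_def grad_hole_cutoff_def)
  with assms(2) show False by simp
qed

locale localizing_cutoffs =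
  fixes A :: "'a::euclidean_space set" and \<sigma> :: real and \<theta> \<eta> :: "'a \<Rightarrow> real" and grad_\<theta> grad_\<eta> :: "'a \<Rightarrow> 'a"
  assumes C1_\<theta>: "C1_deriv UNIV \<theta> (\<lambda>x v. grad_\<theta> x \<bullet> v)" and C1_\<eta>: "C1_deriv UNIV \<eta> (\<lambda>x v. grad_\<eta> x \<bullet> v)"
    and continuous_grad_\<theta>: "continuous_on UNIV grad_\<theta>" and continuous_grad_\<eta>: "continuous_on UNIV grad_\<eta>"
    and \<theta>_range: "0 \<le> \<theta> x \<and> \<theta> x \<le> 1" and \<eta>_range: "0 \<le> \<eta> x \<and> \<eta> x \<le> 1"
    and \<theta>_zero: "x \<in> A \<Longrightarrow> \<theta> x = 0" and \<eta>_one: "\<theta> x \<noteq> 1 \<or> grad_\<theta> x \<noteq> 0 \<Longrightarrow> \<eta> x = 1"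
    and \<eta>_support: "\<eta> x \<noteq> 0 \<or> grad_\<eta> x \<noteq> 0 \<Longrightarrow> \<exists>y\<in>A. dist x y < \<sigma>"

lemma localizing_cutoffs_exist:
  fixes A :: "'a::euclidean_space set"
  assumes "bounded A" "\<sigma> > 0"
  shows "\<exists>\<theta> \<eta> grad_\<theta> grad_\<eta>. localizing_cutoffs A \<sigma> \<theta> \<eta> grad_\<theta> grad_\<eta>"
proof -
  define s where "s = \<sigma> / 8"
  have s_pos: "s > 0" using \<open>\<sigma> > 0\<close> by (simp add: s_def)
  have "closure A \<subseteq> (\<Union>c\<in>A. ball c s)" using s_pos by (auto simp: closure_approachable)
  moreover have "compact (closure A)" using \<open>bounded A\<close> by simp
  ultimately obtain I where I: "I \<subseteq> A" "finite I" "closure A \<subseteq> (\<Union>c\<in>I. ball c s)"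
    using compactE_image[of "closure A" A "\<lambda>c. ball c s"] open_ball by metis
  have "localizing_cutoffs A \<sigma> (hole_cutoff I s) (\<lambda>x. 1 - hole_cutoff I (2 * s) x)
      (grad_hole_cutoff I s) (\<lambda>x. - grad_hole_cutoff I (2 * s) x)"
  proof
    show "C1_deriv UNIV (\<lambda>x. 1 - hole_cutoff I (2 * s) x) (\<lambda>x v. - grad_hole_cutoff I (2 * s) x \<bullet> v)"
      by (rule C1_deriv_cong_deriv[OF C1_deriv_diff[OF C1_deriv_const C1_deriv_hole_cutoff]]) simp
    show "hole_cutoff I s x = 0" if "x \<in> A" for x
    proof -
      have "x \<in> closure A" using that closure_subset by (rule subsetD[rotated])
      then obtain c where "c \<in> I" "x \<in> ball c s" using I(3) by blast
      then show ?thesis using s_pos I(2) by (intro hole_cutoff_eq_0[of I s c]) (auto simp: dist_commute)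
    qed
    show "1 - hole_cutoff I (2 * s) x = 1" if active: "hole_cutoff I s x \<noteq> 1 \<or> grad_hole_cutoff I s x \<noteq> 0" for x
    proof -
      obtain c where "c \<in> I" "dist x c < 2 * s" using hole_cutoff_near_centers[OF s_pos active] by blast
      then have "hole_cutoff I (2 * s) x = 0" using s_pos I(2) by (intro hole_cutoff_eq_0[of I "2 * s" c]) auto
      then show ?thesis by simp
    qed
    show "\<exists>y\<in>A. dist x y < \<sigma>" if active: "1 - hole_cutoff I (2 * s) x \<noteq> 0 \<or> - grad_hole_cutoff I (2 * s) x \<noteq> 0" for x
    proof -
      obtain c where "c \<in> I" "dist x c < 2 * (2 * s)" using hole_cutoff_near_centers[of "2 * s" I x] active s_pos by auto
      moreover have "2 * (2 * s) < \<sigma>" using \<open>\<sigma> > 0\<close> by (simp add: s_def)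
      ultimately have "c \<in> A" "dist x c < \<sigma>" using I(1) by auto
      then show ?thesis by blast
    qed
  qed (use hole_cutoff_range in \<open>auto intro!: C1_deriv_hole_cutoff continuous_on_grad_hole_cutoff continuous_on_minus\<close>)
  then show ?thesis by blast
qed

section \<open>The multiplier field and the weight\<close>

definition radial :: "(real^'m) \<times> (real^'n) \<Rightarrow> (real^'m) \<times> (real^'n)" where
  "radial p = (0, snd p /\<^sub>R rr p)"

definition ang_proj :: "(real^'m) \<times> (real^'n) \<Rightarrow> (real^'m) \<times> (real^'n) \<Rightarrow> (real^'m) \<times> (real^'n)" where
  "ang_proj p v = (0, snd v) - (radial p \<bullet> v) *\<^sub>R radial p"

lemma mink_radial [simp]: "mink (radial p) = radial p"
  by (simp add: mink_def radial_def)

lemma mink_ang_proj [simp]: "mink (ang_proj p v) = ang_proj p v"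
  by (simp add: mink_def ang_proj_def radial_def)

lemma ang_proj_mink [simp]: "ang_proj p (mink v) = ang_proj p v"
  by (simp add: mink_def ang_proj_def radial_def inner_prod_def)

lemma radial_inner: "radial p \<bullet> v = snd v \<bullet> sgn (snd p)"
  by (simp add: radial_def inner_prod_def sgn_div_norm rr_def inner_commute)

lemma radial_inner_radial: "p \<in> DD \<Longrightarrow> radial p \<bullet> radial p = 1"
  using rr_pos[of p] by (simp add: radial_def inner_prod_def rr_def power2_norm_eq_inner[symmetric] power2_eq_square)

lemma norm_radial: "p \<in> DD \<Longrightarrow> norm (radial p) = 1"
  using radial_inner_radial[of p] by (simp add: norm_eq_sqrt_inner)

lemma radial_inner_self: "p \<in> DD \<Longrightarrow> radial p \<bullet> p = rr p"
  using rr_pos[of p] by (simp add: radial_def inner_prod_def rr_def power2_norm_eq_inner[symmetric] power2_eq_square)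

lemma radial_inner_mink: "radial p \<bullet> mink v = radial p \<bullet> v"
  by (simp add: inner_mink[symmetric])

lemma self_inner_mink: "p \<bullet> mink p = 4 * ff p"
  by (simp add: ff_eq)

lemma bounded_linear_snd_embed: "bounded_linear (\<lambda>v. (0, snd v))"
  by (intro bounded_linear_Pair bounded_linear_zero bounded_linear_snd)

lemma trace_of_snd_embed: "trace_of (\<lambda>v::(real^'m) \<times> (real^'n). (0, snd v)) = real CARD('n)"
proof -
  have "trace_of (\<lambda>v::(real^'m) \<times> (real^'n). (0, snd v)) = (\<Sum>b\<in>(Basis::(real^'n) set). b \<bullet> b)"
    unfolding trace_of_def Basis_prod_def
    by (subst sum.union_disjoint) (auto simp: inner_prod_def sum.reindex inj_on_def)
  also have "\<dots> = real CARD('n)" by (simp add: inner_Basis)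
  finally show ?thesis .
qed

lemma trace_of_ang_proj:
  fixes p :: "(real^'m) \<times> (real^'n)"
  assumes "p \<in> DD" shows "trace_of (ang_proj p) = real CARD('n) - 1"
  unfolding ang_proj_def[abs_def]
  by (simp add: trace_of_diff trace_of_snd_embed trace_of_inner radial_inner_radial[OF assms])

lemma C1_deriv_rr: "C1_deriv DD rr (\<lambda>p v. radial p \<bullet> v)"
proof (rule C1_derivI)
  fix p :: "(real^'a) \<times> (real^'b)" assume p: "p \<in> DD"
  have "(snd has_derivative snd) (at p)" by (rule bounded_linear_imp_has_derivative[OF bounded_linear_snd])
  moreover have "(norm has_derivative (\<lambda>v. sgn (snd p) \<bullet> v)) (at (snd p))"
    using has_derivative_norm[of "snd p"] rr_pos[OF p] by (simp add: rr_def inner_commute)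
  ultimately have "((\<lambda>p. norm (snd p)) has_derivative (\<lambda>v. sgn (snd p) \<bullet> snd v)) (at p)"
    by (rule has_derivative_compose)
  then show "(rr has_derivative (\<lambda>v. radial p \<bullet> v)) (at p)"
    by (simp add: rr_def[abs_def] radial_inner inner_commute[of _ "sgn _"])
next
  fix v :: "(real^'a) \<times> (real^'b)"
  show "continuous_on DD (\<lambda>p. radial p \<bullet> v)"
    unfolding radial_def rr_def by (intro continuous_intros) (use rr_pos in \<open>auto simp: rr_def\<close>)
qed

lemma C1_deriv_inverse_rr: "C1_deriv DD (\<lambda>p. 1 / rr p) (\<lambda>p v. - (radial p \<bullet> v) / (rr p)\<^sup>2)"
  by (intro C1_deriv_inverse C1_deriv_rr) (use rr_pos in force)

lemma C1_deriv_radial: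
  "C1_deriv (DD :: ((real^'a) \<times> (real^'b)) set) radial (\<lambda>p v. (1 / rr p) *\<^sub>R ang_proj p v)"
proof (rule C1_deriv_cong)
  show "C1_deriv DD (\<lambda>p::(real^'a) \<times> (real^'b). (1 / rr p) *\<^sub>R (0, snd p))
      (\<lambda>p v. (1 / rr p) *\<^sub>R (0, snd v) + (- (radial p \<bullet> v) / (rr p)\<^sup>2) *\<^sub>R (0, snd p))"
    by (intro C1_deriv_scaleR C1_deriv_inverse_rr C1_deriv_bounded_linear bounded_linear_snd_embed)
  show "(1 / rr p) *\<^sub>R (0, snd p) = radial p" for p :: "(real^'a) \<times> (real^'b)"
    by (simp add: radial_def divide_inverse)
  fix p v :: "(real^'a) \<times> (real^'b)" assume p: "p \<in> DD"
  have "(0, snd p) = rr p *\<^sub>R radial p" using rr_pos[OF p] by (simp add: radial_def)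
  then show "(1 / rr p) *\<^sub>R (0, snd v) + (- (radial p \<bullet> v) / (rr p)\<^sup>2) *\<^sub>R (0, snd p) = (1 / rr p) *\<^sub>R ang_proj p v"
    using rr_pos[OF p] by (simp add: ang_proj_def scaleR_diff_right power2_eq_square)
qed (rule open_DD)

definition damp :: "real \<Rightarrow> (real^'m) \<times> (real^'n) \<Rightarrow> real" where
  "damp e p = 1 - e * rr p"

definition exterior :: "real \<Rightarrow> ((real^'m) \<times> (real^'n)) set" where
  "exterior e = {p\<in>DD. damp e p > 0}"

lemma exteriorD:
  assumes "p \<in> exterior e" shows "p \<in> DD" "ff p > 0" "damp e p > 0" "rr p > 0"
  using assms rr_pos[of p] by (auto simp: exterior_def DD_def)

lemma exterior_subset_DD: "exterior e \<subseteq> DD"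
  by (auto simp: exterior_def)

lemma exterior_of_bounded:
  assumes "p \<in> DD" "rr p \<le> R" "e > 0" "e * R \<le> 1 / 4"
  shows "p \<in> exterior e" "3 / 4 \<le> damp e p" "damp e p \<le> 1"
proof -
  have "0 \<le> e * rr p" "e * rr p \<le> e * R" using assms by (auto simp: rr_def intro!: mult_left_mono)
  then show "3 / 4 \<le> damp e p" "damp e p \<le> 1" using assms(4) by (auto simp: damp_def)
  then show "p \<in> exterior e" using assms(1) by (simp add: exterior_def)
qed

lemma C1_deriv_damp: "C1_deriv DD (damp e) (\<lambda>p v. - e * (radial p \<bullet> v))"
  using C1_deriv_diff[OF C1_deriv_const[of _ 1] C1_deriv_cmult[OF C1_deriv_rr, of e]]
  unfolding damp_def[abs_def] by simp

lemma C1_deriv_inverse_ff: "C1_deriv (exterior e) (\<lambda>p. 1 / ff p) (\<lambda>p v. - ((mink p \<bullet> v) / 2) / (ff p)\<^sup>2)"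
  by (intro C1_deriv_inverse C1_deriv_ff) (use exteriorD(2) in force)

lemma C1_deriv_inverse_damp: "C1_deriv (exterior e) (\<lambda>p. 1 / damp e p) (\<lambda>p v. e * (radial p \<bullet> v) / (damp e p)\<^sup>2)"
proof -
  have "C1_deriv (exterior e) (\<lambda>p. 1 / damp e p) (\<lambda>p v. - (- e * (radial p \<bullet> v)) / (damp e p)\<^sup>2)"
    by (intro C1_deriv_inverse C1_deriv_subset[OF C1_deriv_damp exterior_subset_DD]) (use exteriorD(3) in force)
  then show ?thesis by simp
qed

text \<open>\<^term>\<open>mult_field e\<close> is \<^term>\<open>(damp e p)\<^sup>2\<close> times the \<^term>\<open>mink\<close>-gradient of \<open>ff / damp e\<close>.\<close>

definition mult_field :: "real \<Rightarrow> (real^'m) \<times> (real^'n) \<Rightarrow> (real^'m) \<times> (real^'n)" where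
  "mult_field e p = (damp e p / 2) *\<^sub>R p + (e * ff p) *\<^sub>R radial p"

definition mult_field_deriv :: "real \<Rightarrow> (real^'m) \<times> (real^'n) \<Rightarrow> (real^'m) \<times> (real^'n) \<Rightarrow> (real^'m) \<times> (real^'n)" where
  "mult_field_deriv e p v = (- (e / 2) * (radial p \<bullet> v)) *\<^sub>R p + (damp e p / 2) *\<^sub>R v
     + (e / 2 * (mink p \<bullet> v)) *\<^sub>R radial p + (e * ff p / rr p) *\<^sub>R ang_proj p v"

definition mult_field_div :: "real \<Rightarrow> (real^'m) \<times> (real^'n) \<Rightarrow> real" where
  "mult_field_div e p = real (CARD('m) + CARD('n)) * damp e p / 2 + e * ff p / rr p * (real CARD('n) - 1)"

lemma C1_deriv_mult_field: "C1_deriv DD (mult_field e) (mult_field_deriv e)"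
proof -
  have "C1_deriv DD (\<lambda>p. ((1 / 2) * damp e p) *\<^sub>R p + (e * ff p) *\<^sub>R radial p)
    (\<lambda>p v. (((1 / 2) * damp e p) *\<^sub>R v + ((1 / 2) * (- e * (radial p \<bullet> v))) *\<^sub>R p)
      + ((e * ff p) *\<^sub>R ((1 / rr p) *\<^sub>R ang_proj p v) + (e * ((mink p \<bullet> v) / 2)) *\<^sub>R radial p))"
    by (intro C1_deriv_add C1_deriv_scaleR C1_deriv_cmult C1_deriv_damp C1_deriv_ff C1_deriv_radial
        C1_deriv_bounded_linear bounded_linear_ident)
  then have "C1_deriv DD (mult_field e)
    (\<lambda>p v. (((1 / 2) * damp e p) *\<^sub>R v + ((1 / 2) * (- e * (radial p \<bullet> v))) *\<^sub>R p)
      + ((e * ff p) *\<^sub>R ((1 / rr p) *\<^sub>R ang_proj p v) + (e * ((mink p \<bullet> v) / 2)) *\<^sub>R radial p))"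
    by (simp add: mult_field_def[abs_def])
  then show ?thesis by (rule C1_deriv_cong_deriv) (simp add: mult_field_deriv_def algebra_simps)
qed

lemma linear_inner_left: "linear (\<lambda>v. c * (q \<bullet> v))" for q :: "'a::real_inner"
  by (simp add: linear_iff inner_add_right algebra_simps)

lemma
  assumes p: "p \<in> DD"
  shows mink_inner_self: "mink p \<bullet> p = 4 * ff p" and mink_inner_radial: "mink p \<bullet> radial p = rr p"
  using radial_inner_self[OF p] self_inner_mink[of p] by (simp_all add: inner_mink inner_commute)

lemma trace_of_mult_field_deriv:
  fixes p :: "(real^'m) \<times> (real^'n)"
  assumes p: "p \<in> DD" shows "trace_of (mult_field_deriv e p) = mult_field_div e p"
  unfolding mult_field_deriv_def[abs_def]
  by (simp only: trace_of_add trace_of_scaleR trace_of_id trace_of_ang_proj[OF p] trace_of_rank_one[OF linear_inner_left])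
    (simp add: mult_field_div_def radial_inner_self[OF p] mink_inner_radial[OF p] field_simps)

lemma
  assumes p: "p \<in> DD"
  shows radial_inner_mult_field: "radial p \<bullet> mult_field e p = damp e p * rr p / 2 + e * ff p"
    and ff_along_mult_field: "(mink p \<bullet> mult_field e p) / 2 = damp e p * ff p + e * ff p * rr p / 2"
    and mult_field_inner_mink: "mult_field e p \<bullet> mink (mult_field e p) = ff p * (damp e p + e\<^sup>2 * ff p)"
proof -
  note inner = radial_inner_self[OF p] radial_inner_self[OF p, unfolded inner_commute[of "radial p"]]
    radial_inner_radial[OF p] mink_inner_self[OF p] mink_inner_radial[OF p]
    self_inner_mink[of p] radial_inner_mink[of p p]
  show "radial p \<bullet> mult_field e p = damp e p * rr p / 2 + e * ff p" by (simp add: mult_field_def inner_add_right inner)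
  show "(mink p \<bullet> mult_field e p) / 2 = damp e p * ff p + e * ff p * rr p / 2"
    by (simp add: mult_field_def inner_add_right inner)
  have "mult_field e p \<bullet> mink (mult_field e p) = ff p * (damp e p * (damp e p + e * rr p) + e\<^sup>2 * ff p)"
    by (simp add: mult_field_def mink_linear inner_add_left inner_add_right inner algebra_simps power2_eq_square)
  moreover have "damp e p + e * rr p = 1" by (simp add: damp_def)
  ultimately show "mult_field e p \<bullet> mink (mult_field e p) = ff p * (damp e p + e\<^sup>2 * ff p)" by simp
qed

lemma mult_field_deriv_mink_inner:
  assumes p: "p \<in> DD"
  shows "mult_field_deriv e p (mink \<xi>) \<bullet> \<xi>
    = damp e p / 2 * (\<xi> \<bullet> mink \<xi>) + e * ff p / rr p * (snd \<xi> \<bullet> snd \<xi> - (radial p \<bullet> \<xi>)\<^sup>2)"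
proof -
  have mink_inner_mink: "mink p \<bullet> mink \<xi> = p \<bullet> \<xi>" by (simp add: inner_mink)
  have ang_proj_inner: "ang_proj p \<xi> \<bullet> \<xi> = snd \<xi> \<bullet> snd \<xi> - (radial p \<bullet> \<xi>)\<^sup>2"
    by (simp add: ang_proj_def inner_diff_left power2_eq_square) (simp add: inner_prod_def)
  show ?thesis
    unfolding mult_field_deriv_def inner_add_left inner_scaleR_left radial_inner_mink ang_proj_mink inner_mink[of \<xi>]
      mink_inner_mink ang_proj_inner
    by (simp add: algebra_simps)
qed

definition mult_fun_coeff0 :: "nat \<Rightarrow> nat \<Rightarrow> real" where "mult_fun_coeff0 m n = (real (m + n) - 2) / 4"
definition mult_fun_coeff1 :: "nat \<Rightarrow> real" where "mult_fun_coeff1 n = (real n - 2) / 2"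

definition mult_fun :: "real \<Rightarrow> (real^'m) \<times> (real^'n) \<Rightarrow> real" where
  "mult_fun e p = mult_fun_coeff0 CARD('m) CARD('n) * damp e p + e * mult_fun_coeff1 CARD('n) * (ff p * (1 / rr p))"

definition grad_mult_fun :: "real \<Rightarrow> (real^'m) \<times> (real^'n) \<Rightarrow> (real^'m) \<times> (real^'n)" where
  "grad_mult_fun e p =
      (- e * mult_fun_coeff0 CARD('m) CARD('n) - e * mult_fun_coeff1 CARD('n) * (ff p * (1 / rr p * (1 / rr p)))) *\<^sub>R radial p
      + (e * mult_fun_coeff1 CARD('n) / 2 * (1 / rr p)) *\<^sub>R mink p"

definition box_mult_fun :: "real \<Rightarrow> (real^'m) \<times> (real^'n) \<Rightarrow> real" where
  "box_mult_fun e p = - e * mult_fun_coeff0 CARD('m) CARD('n) * (real CARD('n) - 1) / rr p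
     + e * mult_fun_coeff1 CARD('n) * ((real (CARD('m) + CARD('n)) / 2 - 1) / rr p - (real CARD('n) - 3) * ff p / (rr p) ^ 3)"

lemma mult_field_div_eq:
  assumes "p \<in> DD" shows "mult_field_div e p = 2 * mult_fun e p + damp e p + e * ff p / rr p"
  using rr_pos[OF assms]
  by (simp add: mult_field_div_def mult_fun_def mult_fun_coeff0_def mult_fun_coeff1_def field_simps)

lemma C1_deriv_mult_fun: "C1_deriv DD (mult_fun e) (\<lambda>p v. grad_mult_fun e p \<bullet> v)"
proof -
  have "C1_deriv DD (mult_fun e :: (real^'m) \<times> (real^'n) \<Rightarrow> real)
    (\<lambda>p v. mult_fun_coeff0 CARD('m) CARD('n) * (- e * (radial p \<bullet> v))
     + (e * mult_fun_coeff1 CARD('n)) * (ff p * (- (radial p \<bullet> v) / (rr p)\<^sup>2) + ((mink p \<bullet> v) / 2) * (1 / rr p)))"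
    unfolding mult_fun_def[abs_def]
    by (intro C1_deriv_add C1_deriv_mult C1_deriv_cmult C1_deriv_damp C1_deriv_ff C1_deriv_inverse_rr)
  then show ?thesis
    by (rule C1_deriv_cong_deriv) (simp add: grad_mult_fun_def inner_add_left algebra_simps power2_eq_square)
qed

lemma C1_div_radial: "C1_div (DD :: ((real^'m) \<times> (real^'n)) set) radial (\<lambda>p. (real CARD('n) - 1) / rr p)"
  by (rule C1_divI[OF C1_deriv_radial]) (simp add: trace_of_scaleR trace_of_ang_proj)

lemma C1_div_ident: "C1_div S (\<lambda>p. p) (\<lambda>p::'a::euclidean_space. real DIM('a))"
  by (rule C1_divI[OF C1_deriv_bounded_linear[OF bounded_linear_ident]]) (simp add: trace_of_id)

lemma C1_div_grad_mult_fun: "C1_div (DD :: ((real^'m) \<times> (real^'n)) set) (\<lambda>p. mink (grad_mult_fun e p)) (box_mult_fun e)"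
proof -
  let ?A = "mult_fun_coeff0 CARD('m) CARD('n)" and ?E = "mult_fun_coeff1 CARD('n)"
  have radial_coeff: "C1_deriv DD (\<lambda>p::(real^'m) \<times> (real^'n). - e * ?A - e * ?E * (ff p * (1 / rr p * (1 / rr p))))
    (\<lambda>p v. 0 - e * ?E * (ff p * (1 / rr p * (- (radial p \<bullet> v) / (rr p)\<^sup>2) + (- (radial p \<bullet> v) / (rr p)\<^sup>2) * (1 / rr p))
        + ((mink p \<bullet> v) / 2) * (1 / rr p * (1 / rr p))))"
    by (intro C1_deriv_diff C1_deriv_mult C1_deriv_cmult C1_deriv_const C1_deriv_ff C1_deriv_inverse_rr)
  have ident_coeff: "C1_deriv DD (\<lambda>p::(real^'m) \<times> (real^'n). e * ?E / 2 * (1 / rr p))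
      (\<lambda>p v. e * ?E / 2 * (- (radial p \<bullet> v) / (rr p)\<^sup>2))"
    by (intro C1_deriv_cmult C1_deriv_inverse_rr)
  have "C1_div DD (\<lambda>p::(real^'m) \<times> (real^'n). (- e * ?A - e * ?E * (ff p * (1 / rr p * (1 / rr p)))) *\<^sub>R radial p
      + (e * ?E / 2 * (1 / rr p)) *\<^sub>R p) (box_mult_fun e)"
  proof (rule C1_div_cong_div[OF C1_div_add[OF C1_div_scaleR[OF radial_coeff C1_div_radial] C1_div_scaleR[OF ident_coeff C1_div_ident]]])
    fix p :: "(real^'m) \<times> (real^'n)" assume p: "p \<in> DD"
    show "((- e * ?A - e * ?E * (ff p * (1 / rr p * (1 / rr p)))) * ((real CARD('n) - 1) / rr p)
       + (0 - e * ?E * (ff p * (1 / rr p * (- (radial p \<bullet> radial p) / (rr p)\<^sup>2) + (- (radial p \<bullet> radial p) / (rr p)\<^sup>2) * (1 / rr p))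
        + ((mink p \<bullet> radial p) / 2) * (1 / rr p * (1 / rr p)))))
       + (e * ?E / 2 * (1 / rr p) * real DIM((real^'m) \<times> (real^'n)) + e * ?E / 2 * (- (radial p \<bullet> p) / (rr p)\<^sup>2)) = box_mult_fun e p"
      using rr_pos[OF p]
      by (simp add: radial_inner_radial[OF p] radial_inner_self[OF p] mink_inner_radial[OF p] box_mult_fun_def
          field_simps power2_eq_square power3_eq_cube)
  qed
  then show ?thesis unfolding grad_mult_fun_def mink_linear mink_mink mink_radial by simp
qed

definition weight :: "real \<Rightarrow> real \<Rightarrow> (real^'m) \<times> (real^'n) \<Rightarrow> real" where
  "weight a e p = (ff p * (1 / damp e p)) powr a"

definition dlog_weight :: "real \<Rightarrow> real \<Rightarrow> (real^'m) \<times> (real^'n) \<Rightarrow> (real^'m) \<times> (real^'n)" where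
  "dlog_weight a e p = (a / 2 * (1 / ff p)) *\<^sub>R mink p + (a * e * (1 / damp e p)) *\<^sub>R radial p"

definition hess_log_weight :: "real \<Rightarrow> real \<Rightarrow> (real^'m) \<times> (real^'n) \<Rightarrow> (real^'m) \<times> (real^'n) \<Rightarrow> (real^'m) \<times> (real^'n)" where
  "hess_log_weight a e p v =
     ((a / 2 * (1 / ff p)) *\<^sub>R mink v + (a / 2 * (- ((mink p \<bullet> v) / 2) / (ff p)\<^sup>2)) *\<^sub>R mink p)
     + ((a * e * (1 / damp e p)) *\<^sub>R ((1 / rr p) *\<^sub>R ang_proj p v) + (a * e * (e * (radial p \<bullet> v) / (damp e p)\<^sup>2)) *\<^sub>R radial p)"

lemma C1_deriv_weight:
  "C1_deriv (exterior e :: ((real^'a) \<times> (real^'b)) set) (weight a e) (\<lambda>p v. weight a e p * (dlog_weight a e p \<bullet> v))"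
proof -
  have base: "C1_deriv (exterior e) (\<lambda>p::(real^'a) \<times> (real^'b). ff p * (1 / damp e p))
     (\<lambda>p v. ff p * (e * (radial p \<bullet> v) / (damp e p)\<^sup>2) + ((mink p \<bullet> v) / 2) * (1 / damp e p))"
    by (intro C1_deriv_mult C1_deriv_inverse_damp C1_deriv_ff)
  have base_pos: "ff p * (1 / damp e p) > 0" if "p \<in> exterior e" for p :: "(real^'a) \<times> (real^'b)"
    using exteriorD[OF that] by simp
  show ?thesis
  proof (rule C1_deriv_cong_deriv[OF C1_deriv_powr[OF base base_pos, where c=a, folded weight_def]])
    fix p v :: "(real^'a) \<times> (real^'b)" assume p: "p \<in> exterior e"
    have weight_shift: "weight (a - 1) e p = weight a e p / (ff p * (1 / damp e p))"
      unfolding weight_def using base_pos[OF p] exteriorD[OF p] by (simp add: powr_diff)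
    show "a * weight (a - 1) e p *
        (ff p * (e * (radial p \<bullet> v) / (damp e p)\<^sup>2) + ((mink p \<bullet> v) / 2) * (1 / damp e p)) = weight a e p * (dlog_weight a e p \<bullet> v)"
      unfolding weight_shift using exteriorD[OF p] by (simp add: dlog_weight_def inner_add_left field_simps power2_eq_square)
  qed
qed

lemma C1_deriv_dlog_weight: "C1_deriv (exterior e) (dlog_weight a e) (hess_log_weight a e)"
  unfolding dlog_weight_def[abs_def] hess_log_weight_def[abs_def]
  by (intro C1_deriv_add C1_deriv_scaleR C1_deriv_cmult C1_deriv_inverse_ff C1_deriv_inverse_damp
      C1_deriv_subset[OF C1_deriv_radial exterior_subset_DD] C1_deriv_bounded_linear bounded_linear_mink)

lemma trace_of_mink_hess_log_weight:
  fixes p :: "(real^'m) \<times> (real^'n)"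
  assumes p: "p \<in> exterior e"
  shows "trace_of (\<lambda>v. mink (hess_log_weight a e p v)) = a * ((real (CARD('m) + CARD('n)) / 2 - 1) / ff p
     + e * (real CARD('n) - 1) / (rr p * damp e p) + e\<^sup>2 / (damp e p)\<^sup>2)"
proof -
  have linear: "linear (\<lambda>v. c * (- ((q \<bullet> v) / 2) / b))" "linear (\<lambda>v. c * (e * (q \<bullet> v) / b))"
    for c b and q :: "(real^'m) \<times> (real^'n)"
    by (simp_all add: linear_iff inner_add_right algebra_simps add_divide_distrib diff_divide_distrib)
  have p': "p \<in> DD" by (rule exteriorD(1)[OF p])
  show ?thesis
    using exteriorD[OF p] unfolding hess_log_weight_def
    by (simp only: mink_linear mink_mink mink_radial mink_ang_proj trace_of_add trace_of_scaleR trace_of_id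
        trace_of_ang_proj trace_of_rank_one[OF linear(1)] trace_of_rank_one[OF linear(2)])
      (simp add: mink_inner_self[OF p'] radial_inner_radial[OF p'] field_simps power2_eq_square)
qed

lemma mink_dlog_weight:
  assumes "p \<in> exterior e" shows "mink (dlog_weight a e p) = (a / (damp e p * ff p)) *\<^sub>R mult_field e p"
  using exteriorD[OF assms] by (simp add: dlog_weight_def mult_field_def mink_linear scaleR_add_right)

lemma dlog_weight_inner_mink:
  assumes "p \<in> exterior e"
  shows "dlog_weight a e p \<bullet> mink v = a / (damp e p * ff p) * (mult_field e p \<bullet> v)"
  using mink_dlog_weight[OF assms, of a] by (metis inner_mink inner_scaleR_left)

lemma dlog_weight_inner_mink_self:
  assumes p: "p \<in> exterior e"
  shows "dlog_weight a e p \<bullet> mink (dlog_weight a e p) = a\<^sup>2 * (damp e p + e\<^sup>2 * ff p) / ((damp e p)\<^sup>2 * ff p)"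
proof -
  have "dlog_weight a e p = (a / (damp e p * ff p)) *\<^sub>R mink (mult_field e p)"
    using arg_cong[OF mink_dlog_weight[OF p, of a], of mink] by (simp add: mink_linear)
  then have "dlog_weight a e p \<bullet> mink (dlog_weight a e p)
      = (a / (damp e p * ff p)) * ((a / (damp e p * ff p)) * (mult_field e p \<bullet> mink (mult_field e p)))"
    by (simp add: mink_linear inner_commute)
  also have "\<dots> = a\<^sup>2 * (damp e p + e\<^sup>2 * ff p) / ((damp e p)\<^sup>2 * ff p)"
    unfolding mult_field_inner_mink[OF exteriorD(1)[OF p]] using exteriorD[OF p] by (simp add: field_simps power2_eq_square)
  finally show ?thesis .
qed

text \<open>Hence \<^term>\<open>weight\<close> conjugates the wave operator into a first-order term \<open>mult_field + mult_fun\<close> plus a potential.\<close>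

lemma box_log_weight:
  fixes p :: "(real^'m) \<times> (real^'n)"
  assumes p: "p \<in> exterior e"
  shows "trace_of (\<lambda>v. mink (hess_log_weight a e p v)) - dlog_weight a e p \<bullet> mink (dlog_weight a e p)
    = 2 * (a / (damp e p * ff p)) * mult_fun e p
      - (a\<^sup>2 / (damp e p * ff p) + (a\<^sup>2 - a) * e\<^sup>2 / (damp e p)\<^sup>2 - a * e / (damp e p * rr p))"
  unfolding trace_of_mink_hess_log_weight[OF p] dlog_weight_inner_mink_self[OF p] using exteriorD[OF p]
  by (simp add: mult_fun_def mult_fun_coeff0_def mult_fun_coeff1_def field_simps power2_eq_square)

section \<open>The current and its divergence\<close>

definition multiplier_current ::
    "(real^'m) \<times> (real^'n) \<Rightarrow> real \<Rightarrow> (real^'m) \<times> (real^'n) \<Rightarrow> real \<Rightarrow> real \<Rightarrow> (real^'m) \<times> (real^'n) \<Rightarrow> (real^'m) \<times> (real^'n)" where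
  "multiplier_current Y q grad_q T \<psi> \<xi> = (Y \<bullet> \<xi>) *\<^sub>R mink \<xi> - (1 / 2 * (\<xi> \<bullet> mink \<xi>)) *\<^sub>R Y + (q * \<psi>) *\<^sub>R mink \<xi>
     - (1 / 2 * (\<psi> * \<psi>)) *\<^sub>R mink grad_q + (T * (\<psi> * \<psi>)) *\<^sub>R Y"

lemma C1_div_multiplier_current:
  fixes Y :: "(real^'m) \<times> (real^'n) \<Rightarrow> (real^'m) \<times> (real^'n)"
  assumes S: "open S"
    and Y: "C1_deriv S Y DY"
    and q: "C1_deriv S q (\<lambda>p v. grad_q p \<bullet> v)" and grad_q: "C1_div S (\<lambda>p. mink (grad_q p)) box_q"
    and T: "C1_deriv S T DT"
    and \<psi>: "C1_deriv S \<psi> (\<lambda>p v. \<xi> p \<bullet> v)" and \<xi>: "C1_deriv S \<xi> D\<xi>"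
  shows "C1_div S (\<lambda>p. multiplier_current (Y p) (q p) (grad_q p) (T p) (\<psi> p) (\<xi> p))
    (\<lambda>p. (Y p \<bullet> \<xi> p + q p * \<psi> p) * trace_of (\<lambda>v. mink (D\<xi> p v)) + DY p (mink (\<xi> p)) \<bullet> \<xi> p
       + (q p - trace_of (DY p) / 2) * (\<xi> p \<bullet> mink (\<xi> p))
       + (DT p (Y p) + T p * trace_of (DY p) - box_q p / 2) * (\<psi> p)\<^sup>2 + 2 * T p * \<psi> p * (Y p \<bullet> \<xi> p))"
proof -
  let ?B = "\<lambda>p. trace_of (\<lambda>v. mink (D\<xi> p v))"
  note mink_\<xi> = C1_deriv_linear_compose[OF bounded_linear_mink \<xi>]
  note sq_\<psi> = C1_deriv_mult[OF \<psi> \<psi>]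
  have div_Y: "C1_div S Y (\<lambda>p. trace_of (DY p))" by (rule C1_divI[OF Y]) simp
  have div_\<xi>: "C1_div S (\<lambda>p. mink (\<xi> p)) ?B" by (rule C1_divI[OF mink_\<xi>]) simp
  note product_rule = C1_div_add[OF C1_div_diff[OF C1_div_add[OF C1_div_diff[
        OF C1_div_scaleR[OF C1_deriv_inner[OF Y \<xi>] div_\<xi>]
           C1_div_scaleR[OF C1_deriv_cmult[OF C1_deriv_inner[OF \<xi> mink_\<xi>], where c="1 / 2"] div_Y]]
        C1_div_scaleR[OF C1_deriv_mult[OF q \<psi>] div_\<xi>]]
        C1_div_scaleR[OF C1_deriv_cmult[OF sq_\<psi>, where c="1 / 2"] grad_q]]
        C1_div_scaleR[OF C1_deriv_mult[OF T sq_\<psi>] div_Y]]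
  show ?thesis
    unfolding multiplier_current_def
  proof (rule C1_div_cong_div[OF product_rule])
    fix p assume p: "p \<in> S"
    have "Y p \<bullet> D\<xi> p (mink (\<xi> p)) = D\<xi> p (Y p) \<bullet> mink (\<xi> p)"
      using second_derivative_symmetric[OF S p \<psi> \<xi>, of "mink (\<xi> p)" "Y p"] by (simp add: inner_commute)
    moreover have "\<xi> p \<bullet> mink (D\<xi> p (Y p)) = D\<xi> p (Y p) \<bullet> mink (\<xi> p)" "grad_q p \<bullet> mink (\<xi> p) = \<xi> p \<bullet> mink (grad_q p)"
      by (metis inner_commute inner_mink)+
    ultimately show "Y p \<bullet> \<xi> p * ?B p + (Y p \<bullet> D\<xi> p (mink (\<xi> p)) + DY p (mink (\<xi> p)) \<bullet> \<xi> p)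
        - (1 / 2 * (\<xi> p \<bullet> mink (\<xi> p)) * trace_of (DY p)
           + 1 / 2 * (\<xi> p \<bullet> mink (D\<xi> p (Y p)) + D\<xi> p (Y p) \<bullet> mink (\<xi> p)))
        + (q p * \<psi> p * ?B p + (q p * (\<xi> p \<bullet> mink (\<xi> p)) + grad_q p \<bullet> mink (\<xi> p) * \<psi> p))
        - (1 / 2 * (\<psi> p * \<psi> p) * box_q p + 1 / 2 * (\<psi> p * (\<xi> p \<bullet> mink (grad_q p)) + \<xi> p \<bullet> mink (grad_q p) * \<psi> p))
        + (T p * (\<psi> p * \<psi> p) * trace_of (DY p) + (T p * (\<psi> p * (\<xi> p \<bullet> Y p) + \<xi> p \<bullet> Y p * \<psi> p) + DT p (Y p) * (\<psi> p * \<psi> p)))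
      = (Y p \<bullet> \<xi> p + q p * \<psi> p) * ?B p + DY p (mink (\<xi> p)) \<bullet> \<xi> p
        + (q p - trace_of (DY p) / 2) * (\<xi> p \<bullet> mink (\<xi> p))
        + (DT p (Y p) + T p * trace_of (DY p) - box_q p / 2) * (\<psi> p)\<^sup>2 + 2 * T p * \<psi> p * (Y p \<bullet> \<xi> p)"
      by (simp add: inner_commute[of "\<xi> p" "Y p"] algebra_simps power2_eq_square)
  qed
qed

definition conj_grad :: "real \<Rightarrow> real \<Rightarrow> (real^'m) \<times> (real^'n) \<Rightarrow> real \<Rightarrow> (real^'m) \<times> (real^'n) \<Rightarrow> (real^'m) \<times> (real^'n)" where
  "conj_grad a e p s g = weight a e p *\<^sub>R g + (weight a e p * s) *\<^sub>R dlog_weight a e p"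

lemma C1_deriv_conj:
  assumes S: "S \<subseteq> exterior e" and z: "C1_deriv S z (\<lambda>p v. G p \<bullet> v)"
  shows "C1_deriv S (\<lambda>p. weight a e p * z p) (\<lambda>p v. conj_grad a e p (z p) (G p) \<bullet> v)"
  by (rule C1_deriv_cong_deriv[OF C1_deriv_mult[OF C1_deriv_subset[OF C1_deriv_weight S] z]])
    (simp add: conj_grad_def inner_add_left)

lemma C1_deriv_conj_grad:
  assumes S: "S \<subseteq> exterior e" and z: "C1_deriv S z (\<lambda>p v. G p \<bullet> v)" and G: "C1_deriv S G H"
  shows "C1_deriv S (\<lambda>p. conj_grad a e p (z p) (G p))
    (\<lambda>p v. weight a e p *\<^sub>R H p v + (weight a e p * (dlog_weight a e p \<bullet> v)) *\<^sub>R G p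
       + ((weight a e p * z p) *\<^sub>R hess_log_weight a e p v + (conj_grad a e p (z p) (G p) \<bullet> v) *\<^sub>R dlog_weight a e p))"
proof -
  note weight = C1_deriv_subset[OF C1_deriv_weight S] and dlog = C1_deriv_subset[OF C1_deriv_dlog_weight S]
  show ?thesis
    using C1_deriv_add[OF C1_deriv_scaleR[OF weight G] C1_deriv_scaleR[OF C1_deriv_conj[OF S z] dlog]]
    unfolding conj_grad_def .
qed

lemma box_conj:
  fixes p g :: "(real^'m) \<times> (real^'n)" and a s :: real
  assumes p: "p \<in> exterior e"
  defines "\<psi> \<equiv> weight a e p * s" and "\<xi> \<equiv> conj_grad a e p s g"
  shows "trace_of (\<lambda>v. mink (weight a e p *\<^sub>R D v + (weight a e p * (dlog_weight a e p \<bullet> v)) *\<^sub>R g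
       + (\<psi> *\<^sub>R hess_log_weight a e p v + (\<xi> \<bullet> v) *\<^sub>R dlog_weight a e p)))
    = weight a e p * trace_of (\<lambda>v. mink (D v))
      + 2 * (a / (damp e p * ff p)) * (mult_field e p \<bullet> \<xi> + mult_fun e p * \<psi>)
      - (a\<^sup>2 / (damp e p * ff p) + (a\<^sup>2 - a) * e\<^sup>2 / (damp e p)\<^sup>2 - a * e / (damp e p * rr p)) * \<psi>"
    (is "?box = _ + 2 * ?\<mu> * _ - ?\<kappa> * \<psi>")
proof -
  let ?L = "dlog_weight a e p"
  have linear: "linear (\<lambda>v. q \<bullet> v)" for q :: "(real^'m) \<times> (real^'n)" by (simp add: linear_iff inner_add_right)
  have "?box = weight a e p * trace_of (\<lambda>v. mink (D v)) + weight a e p * (?L \<bullet> mink g)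
     + (\<psi> * trace_of (\<lambda>v. mink (hess_log_weight a e p v)) + \<xi> \<bullet> mink ?L)"
    unfolding mink_linear
    by (simp only: trace_of_add trace_of_scaleR trace_of_rank_one[OF linear_inner_left] trace_of_rank_one[OF linear])
  also have "\<xi> \<bullet> mink ?L = ?L \<bullet> mink \<xi>" by (metis inner_commute inner_mink)
  also have "weight a e p * (?L \<bullet> mink g) = ?L \<bullet> mink \<xi> - \<psi> * (?L \<bullet> mink ?L)"
    by (simp add: \<xi>_def \<psi>_def conj_grad_def mink_linear inner_add_right)
  also have "?L \<bullet> mink \<xi> = ?\<mu> * (mult_field e p \<bullet> \<xi>)" by (rule dlog_weight_inner_mink[OF p])
  also have "weight a e p * trace_of (\<lambda>v. mink (D v)) + (?\<mu> * (mult_field e p \<bullet> \<xi>) - \<psi> * (?L \<bullet> mink ?L))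
      + (\<psi> * trace_of (\<lambda>v. mink (hess_log_weight a e p v)) + ?\<mu> * (mult_field e p \<bullet> \<xi>))
    = weight a e p * trace_of (\<lambda>v. mink (D v)) + 2 * ?\<mu> * (mult_field e p \<bullet> \<xi>)
      + (trace_of (\<lambda>v. mink (hess_log_weight a e p v)) - ?L \<bullet> mink ?L) * \<psi>"
    by (simp add: algebra_simps)
  also have "\<dots> = weight a e p * trace_of (\<lambda>v. mink (D v)) + 2 * ?\<mu> * (mult_field e p \<bullet> \<xi> + mult_fun e p * \<psi>) - ?\<kappa> * \<psi>"
    unfolding box_log_weight[OF p] by (simp only: algebra_simps)
  finally show ?thesis .
qed

definition hardy_coeff :: "real \<Rightarrow> real \<Rightarrow> real \<Rightarrow> (real^'m) \<times> (real^'n) \<Rightarrow> real" where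
  "hardy_coeff a e d p = a\<^sup>2 / 2 * ((1 / damp e p) * (1 / ff p)) + d * (rr p * (1 / ff p))"

definition hardy_coeff_deriv :: "real \<Rightarrow> real \<Rightarrow> real \<Rightarrow> (real^'m) \<times> (real^'n) \<Rightarrow> (real^'m) \<times> (real^'n) \<Rightarrow> real" where
  "hardy_coeff_deriv a e d p v =
     a\<^sup>2 / 2 * ((1 / damp e p) * (- ((mink p \<bullet> v) / 2) / (ff p)\<^sup>2) + (e * (radial p \<bullet> v) / (damp e p)\<^sup>2) * (1 / ff p))
     + d * (rr p * (- ((mink p \<bullet> v) / 2) / (ff p)\<^sup>2) + (radial p \<bullet> v) * (1 / ff p))"

lemma C1_deriv_hardy_coeff: "C1_deriv (exterior e) (hardy_coeff a e d) (hardy_coeff_deriv a e d)"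
  unfolding hardy_coeff_def[abs_def] hardy_coeff_deriv_def[abs_def]
  by (intro C1_deriv_add C1_deriv_mult C1_deriv_cmult C1_deriv_inverse_ff C1_deriv_inverse_damp
      C1_deriv_subset[OF C1_deriv_rr exterior_subset_DD])

lemma hardy_coeff_divergence:
  assumes p: "p \<in> exterior e"
  shows "hardy_coeff_deriv a e d p (mult_field e p) + hardy_coeff a e d p * (damp e p + e * ff p / rr p)
    = a\<^sup>2 / 2 * (e\<^sup>2 / (damp e p)\<^sup>2 + e / (damp e p * rr p))
      + d * (rr p / (2 * ff p) * (1 - 2 * e * rr p) + 2 * e)"
proof -
  define f k r where "f = ff p" and "k = damp e p" and "r = rr p"
  have pos: "f > 0" "k > 0" "r > 0" and k_eq: "k = 1 - e * r" using exteriorD[OF p] by (auto simp: f_def k_def r_def damp_def)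
  have "hardy_coeff_deriv a e d p (mult_field e p) + hardy_coeff a e d p * (k + e * f / r)
    = a\<^sup>2 / 2 * ((1 / k) * (- (k * f + e * f * r / 2) / f\<^sup>2) + (e * (k * r / 2 + e * f) / k\<^sup>2) * (1 / f) + (k + e * f / r) / (k * f))
      + d * (r * (- (k * f + e * f * r / 2) / f\<^sup>2) + (k * r / 2 + e * f) * (1 / f) + (r / f) * (k + e * f / r))"
    unfolding hardy_coeff_deriv_def hardy_coeff_def ff_along_mult_field[OF exteriorD(1)[OF p]]
      radial_inner_mult_field[OF exteriorD(1)[OF p]] f_def[symmetric] k_def[symmetric] r_def[symmetric]
    by (simp add: algebra_simps add_divide_distrib)
  also have "(1 / k) * (- (k * f + e * f * r / 2) / f\<^sup>2) + (e * (k * r / 2 + e * f) / k\<^sup>2) * (1 / f) + (k + e * f / r) / (k * f)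
    = e\<^sup>2 / k\<^sup>2 + e / (k * r)"
    using pos by (simp add: field_simps power2_eq_square)
  also have "r * (- (k * f + e * f * r / 2) / f\<^sup>2) + (k * r / 2 + e * f) * (1 / f) + (r / f) * (k + e * f / r)
    = r / (2 * f) * (1 - 2 * e * r) + 2 * e"
    unfolding k_eq using pos by (simp add: field_simps power2_eq_square)
  finally show ?thesis by (simp add: f_def k_def r_def)
qed

text \<open>As a function of the point, the value and the gradient of the unknown, the current also makes sense on the boundary.\<close>

definition current :: "real \<Rightarrow> real \<Rightarrow> real \<Rightarrow> (real^'m) \<times> (real^'n) \<Rightarrow> real \<Rightarrow> (real^'m) \<times> (real^'n) \<Rightarrow> (real^'m) \<times> (real^'n)" where
  "current a e d p s g = multiplier_current (mult_field e p) (mult_fun e p) (grad_mult_fun e p) (hardy_coeff a e d p)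
     (weight a e p * s) (conj_grad a e p s g)"

definition current_div :: "real \<Rightarrow> real \<Rightarrow> real \<Rightarrow> (real^'m) \<times> (real^'n) \<Rightarrow> real \<Rightarrow> (real^'m) \<times> (real^'n) \<Rightarrow> real \<Rightarrow> real" where
  "current_div a e d p s g b = (let \<xi> = conj_grad a e p s g; \<psi> = weight a e p * s; x = mult_field e p \<bullet> \<xi> + mult_fun e p * \<psi>;
       f = ff p; k = damp e p; r = rr p in
     weight a e p * b * x + 2 * (a / (k * f)) * x\<^sup>2
     + (a * e / (k * r) - (a\<^sup>2 - a) * e\<^sup>2 / k\<^sup>2 + 2 * d * (r / f)) * \<psi> * x
     + e * f / r * (snd \<xi> \<bullet> snd \<xi> - (radial p \<bullet> \<xi>)\<^sup>2 - (\<xi> \<bullet> mink \<xi>) / 2)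
     + \<psi>\<^sup>2 * (a\<^sup>2 / 2 * (e\<^sup>2 / k\<^sup>2 + e / (k * r)) + d * (r / (2 * f) * (1 - 2 * e * r) + 2 * e) - box_mult_fun e p / 2))"

lemma C1_div_current:
  fixes z :: "(real^'m) \<times> (real^'n) \<Rightarrow> real"
  assumes S: "open S" "S \<subseteq> exterior e" and z: "C1_deriv S z (\<lambda>p v. G p \<bullet> v)" and G: "C1_deriv S G H"
  shows "C1_div S (\<lambda>p. current a e d p (z p) (G p)) (\<lambda>p. current_div a e d p (z p) (G p) (trace_of (\<lambda>v. mink (H p v))))"
proof -
  have S_DD: "S \<subseteq> DD" using S(2) exterior_subset_DD by blast
  note multiplier = C1_div_multiplier_current[OF S(1) C1_deriv_subset[OF C1_deriv_mult_field S_DD]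
      C1_deriv_subset[OF C1_deriv_mult_fun S_DD] C1_div_subset[OF C1_div_grad_mult_fun S_DD]
      C1_deriv_subset[OF C1_deriv_hardy_coeff S(2)] C1_deriv_conj[OF S(2) z] C1_deriv_conj_grad[OF S(2) z G]]
  show ?thesis
    unfolding current_def
  proof (rule C1_div_cong_div[OF multiplier])
    fix p assume "p \<in> S"
    then have p: "p \<in> exterior e" and p_DD: "p \<in> DD" using S(2) S_DD by auto
    define \<psi> \<xi> where "\<psi> = weight a e p * z p" and "\<xi> = conj_grad a e p (z p) (G p)"
    define \<mu> where "\<mu> = a / (damp e p * ff p)"
    define \<kappa> where "\<kappa> = a\<^sup>2 / (damp e p * ff p) + (a\<^sup>2 - a) * e\<^sup>2 / (damp e p)\<^sup>2 - a * e / (damp e p * rr p)"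
    define T where "T = hardy_coeff a e d p"
    have "a * e / (damp e p * rr p) - (a\<^sup>2 - a) * e\<^sup>2 / (damp e p)\<^sup>2 + 2 * d * (rr p / ff p) = 2 * T - \<kappa>"
      by (simp add: T_def hardy_coeff_def \<kappa>_def)
    note div_eq = current_div_def[of a e d p, unfolded Let_def this hardy_coeff_divergence[OF p, symmetric]]
    show "(mult_field e p \<bullet> conj_grad a e p (z p) (G p) + mult_fun e p * (weight a e p * z p))
         * trace_of (\<lambda>v. mink (weight a e p *\<^sub>R H p v + (weight a e p * (dlog_weight a e p \<bullet> v)) *\<^sub>R G p
             + ((weight a e p * z p) *\<^sub>R hess_log_weight a e p v + (conj_grad a e p (z p) (G p) \<bullet> v) *\<^sub>R dlog_weight a e p)))
       + mult_field_deriv e p (mink (conj_grad a e p (z p) (G p))) \<bullet> conj_grad a e p (z p) (G p)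
       + (mult_fun e p - trace_of (mult_field_deriv e p) / 2) * (conj_grad a e p (z p) (G p) \<bullet> mink (conj_grad a e p (z p) (G p)))
       + (hardy_coeff_deriv a e d p (mult_field e p) + hardy_coeff a e d p * trace_of (mult_field_deriv e p) - box_mult_fun e p / 2)
         * (weight a e p * z p)\<^sup>2
       + 2 * hardy_coeff a e d p * (weight a e p * z p) * (mult_field e p \<bullet> conj_grad a e p (z p) (G p))
      = current_div a e d p (z p) (G p) (trace_of (\<lambda>v. mink (H p v)))"
      unfolding div_eq box_conj[OF p] trace_of_mult_field_deriv[OF p_DD] mult_field_div_eq[OF p_DD]
        mult_field_deriv_mink_inner[OF p_DD]
      unfolding \<psi>_def[symmetric] \<xi>_def[symmetric] \<mu>_def[symmetric] \<kappa>_def[symmetric] T_def[symmetric]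
      by (simp add: algebra_simps power2_eq_square add_divide_distrib)
  qed
qed

section \<open>The pointwise Carleman inequality\<close>

definition mult_fun_bound :: "nat \<Rightarrow> nat \<Rightarrow> real" where
  "mult_fun_bound m n = \<bar>mult_fun_coeff0 m n\<bar> + \<bar>mult_fun_coeff1 n\<bar>"

definition box_mult_fun_bound :: "nat \<Rightarrow> nat \<Rightarrow> real" where
  "box_mult_fun_bound m n = \<bar>mult_fun_coeff0 m n\<bar> * \<bar>real n - 1\<bar>
     + \<bar>mult_fun_coeff1 n\<bar> * (\<bar>real (m + n) / 2 - 1\<bar> + \<bar>real n - 3\<bar>)"

lemma ff_div_rr_le:
  assumes "p \<in> DD" shows "ff p / rr p \<le> rr p / 4" "ff p / rr p ^ 3 \<le> 1 / rr p"
proof -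
  have pos: "ff p > 0" "rr p > 0" using assms rr_pos[OF assms] by (auto simp: DD_def)
  then show "ff p / rr p \<le> rr p / 4" using rr_sq_ge[of p] by (simp add: field_simps power2_eq_square)
  have "ff p \<le> (rr p)\<^sup>2" using pos rr_sq_ge[of p] by simp
  then show "ff p / rr p ^ 3 \<le> 1 / rr p" using pos by (simp add: field_simps power2_eq_square power3_eq_cube)
qed

lemma abs_mult_fun_le:
  fixes p :: "(real^'m) \<times> (real^'n)"
  assumes p: "p \<in> DD" "rr p \<le> R" and e: "e > 0" "e * R \<le> 1 / 4"
  shows "\<bar>mult_fun e p\<bar> \<le> mult_fun_bound CARD('m) CARD('n)"
proof -
  have pos: "ff p > 0" "rr p > 0" using p(1) rr_pos[OF p(1)] by (auto simp: DD_def)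
  have damp: "3 / 4 \<le> damp e p" "damp e p \<le> 1" using exterior_of_bounded[OF p e] by auto
  have "e * (ff p / rr p) \<le> e * (rr p / 4)" using ff_div_rr_le(1)[OF p(1)] e by (intro mult_left_mono) auto
  also have "\<dots> \<le> 1" using damp(1) by (simp add: damp_def)
  finally have quotient: "e * (ff p / rr p) \<le> 1" .
  have "\<bar>mult_fun e p\<bar> \<le> \<bar>mult_fun_coeff0 CARD('m) CARD('n) * damp e p\<bar> + \<bar>e * mult_fun_coeff1 CARD('n) * (ff p * (1 / rr p))\<bar>"
    unfolding mult_fun_def by (rule abs_triangle_ineq)
  also have "\<dots> = \<bar>mult_fun_coeff0 CARD('m) CARD('n)\<bar> * damp e p + \<bar>mult_fun_coeff1 CARD('n)\<bar> * (e * (ff p / rr p))"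
    using pos e damp by (simp add: abs_mult)
  also have "\<dots> \<le> \<bar>mult_fun_coeff0 CARD('m) CARD('n)\<bar> * 1 + \<bar>mult_fun_coeff1 CARD('n)\<bar> * 1"
    using quotient damp by (intro add_mono mult_left_mono) auto
  finally show ?thesis by (simp add: mult_fun_bound_def)
qed

lemma abs_box_mult_fun_le:
  fixes p :: "(real^'m) \<times> (real^'n)"
  assumes p: "p \<in> DD" and e_pos: "e > 0"
  shows "\<bar>box_mult_fun e p\<bar> \<le> box_mult_fun_bound CARD('m) CARD('n) * (e / rr p)"
proof -
  let ?A = "mult_fun_coeff0 CARD('m) CARD('n)" and ?E = "mult_fun_coeff1 CARD('n)"
    and ?N = "real (CARD('m) + CARD('n)) / 2 - 1" and ?f = "ff p" and ?r = "rr p"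
  have pos: "?f > 0" "?r > 0" using p rr_pos[OF p] by (auto simp: DD_def)
  have "\<bar>?N / ?r - (real CARD('n) - 3) * ?f / ?r ^ 3\<bar> \<le> \<bar>?N / ?r\<bar> + \<bar>(real CARD('n) - 3) * ?f / ?r ^ 3\<bar>"
    by (rule abs_triangle_ineq4)
  also have "\<dots> = \<bar>?N\<bar> * (1 / ?r) + \<bar>real CARD('n) - 3\<bar> * (?f / ?r ^ 3)" using pos by (simp add: abs_mult)
  also have "\<dots> \<le> \<bar>?N\<bar> * (1 / ?r) + \<bar>real CARD('n) - 3\<bar> * (1 / ?r)"
    by (intro add_left_mono mult_left_mono ff_div_rr_le(2)[OF p]) auto
  finally have bracket: "\<bar>?N / ?r - (real CARD('n) - 3) * ?f / ?r ^ 3\<bar> \<le> (\<bar>?N\<bar> + \<bar>real CARD('n) - 3\<bar>) * (1 / ?r)"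
    by (simp only: distrib_right)
  have "\<bar>box_mult_fun e p\<bar> \<le> \<bar>- e * ?A * (real CARD('n) - 1) / ?r\<bar> + \<bar>e * ?E * (?N / ?r - (real CARD('n) - 3) * ?f / ?r ^ 3)\<bar>"
    unfolding box_mult_fun_def by (rule abs_triangle_ineq)
  also have "\<dots> = \<bar>?A\<bar> * \<bar>real CARD('n) - 1\<bar> * (e / ?r) + e * \<bar>?E\<bar> * \<bar>?N / ?r - (real CARD('n) - 3) * ?f / ?r ^ 3\<bar>"
    using e_pos pos(2) by (simp add: abs_mult)
  also have "\<dots> \<le> \<bar>?A\<bar> * \<bar>real CARD('n) - 1\<bar> * (e / ?r) + e * \<bar>?E\<bar> * ((\<bar>?N\<bar> + \<bar>real CARD('n) - 3\<bar>) * (1 / ?r))"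
    using e_pos bracket by (intro add_left_mono mult_left_mono) auto
  also have "\<dots> = box_mult_fun_bound CARD('m) CARD('n) * (e / ?r)"
    by (simp add: box_mult_fun_bound_def algebra_simps add_divide_distrib)
  finally show ?thesis .
qed

locale carleman_constants =
  fixes a R e d Q K :: real
  assumes a_pos: "a > 0" and R_pos: "R > 0" and e_pos: "e > 0" and e_small: "e * R \<le> 1 / 4"
    and d_eq: "d = a / (16 * R)" and K_nonneg: "K \<ge> 0"
    and absorb_x: "(a\<^sup>2 + a + 2) * (e * R) \<le> 2 * a"
    and absorb_s: "4 * (e * (a\<^sup>2 + a + 2 * Q\<^sup>2 + K / 2)) \<le> d"
begin

lemma d_pos: "d > 0"
  using a_pos R_pos by (simp add: d_eq)

end

lemma carleman_constants_exist:
  assumes a_pos: "a > 0" and R_pos: "R > 0" and K_nonneg: "K \<ge> 0"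
  obtains e where "carleman_constants a R e (a / (16 * R)) Q K"
proof -
  define d where "d = a / (16 * R)"
  define A where "A = a\<^sup>2 + a + 2"
  define B where "B = a\<^sup>2 + a + 2 * Q\<^sup>2 + K / 2"
  have d_pos: "d > 0" and A_pos: "A > 0" and B_pos: "B > 0"
    using a_pos R_pos K_nonneg by (auto simp: d_def A_def B_def intro!: add_pos_nonneg)
  define e where "e = min (1 / (4 * R)) (min (2 * a / (A * R)) (d / (4 * B)))"
  have e_le: "e \<le> 1 / (4 * R)" "e \<le> 2 * a / (A * R)" "e \<le> d / (4 * B)" by (simp_all add: e_def)
  have "carleman_constants a R e d Q K"
  proof
    show "e > 0" using a_pos R_pos d_pos A_pos B_pos by (simp add: e_def)
    show "e * R \<le> 1 / 4" using e_le(1) R_pos by (simp add: field_simps)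
    show "(a\<^sup>2 + a + 2) * (e * R) \<le> 2 * a" using e_le(2) R_pos A_pos unfolding A_def[symmetric] by (simp add: field_simps)
    show "4 * (e * (a\<^sup>2 + a + 2 * Q\<^sup>2 + K / 2)) \<le> d" using e_le(3) B_pos unfolding B_def[symmetric] by (simp add: field_simps)
  qed (use a_pos R_pos K_nonneg d_def in auto)
  then show ?thesis using that by (simp add: d_def)
qed

lemma sq_diff_le: "(x - y)\<^sup>2 \<le> 2 * x\<^sup>2 + 2 * y\<^sup>2" for x y :: real
  using zero_le_power2[of "x + y"] by (simp add: power2_sum power2_diff)

lemma sq_le_two_mult_sq:
  fixes x y c :: real
  assumes "x * c = y" "c \<ge> 3 / 4" shows "x\<^sup>2 \<le> 2 * y\<^sup>2"
proof -
  have "(3 / 4)\<^sup>2 \<le> c\<^sup>2" using assms by (intro power_mono) auto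
  then have "x\<^sup>2 * (1 / 2) \<le> x\<^sup>2 * c\<^sup>2" by (intro mult_left_mono) (auto simp: power_divide)
  then show ?thesis using assms(1) by (simp add: power_mult_distrib[symmetric])
qed

definition coercive_form :: "real \<Rightarrow> real \<Rightarrow> real \<Rightarrow> real \<Rightarrow> real \<Rightarrow> real \<Rightarrow> real \<Rightarrow> real \<Rightarrow> real" where
  "coercive_form a e d f r x A s = a / (2 * f) * x\<^sup>2 + e / (2 * r) * A + d * (r / (16 * f)) * s\<^sup>2"

locale carleman_scalars = carleman_constants +
  fixes f r k :: real
  assumes f_pos: "f > 0" and r_pos: "r > 0" and r_le: "r \<le> R" and f_le: "4 * f \<le> r\<^sup>2" and k_eq: "k = 1 - e * r"
begin

lemma er_bounds: "0 < e * r" "e * r \<le> 1 / 4"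
proof -
  have "e * r \<le> e * R" using e_pos r_le by (intro mult_left_mono) auto
  then show "0 < e * r" "e * r \<le> 1 / 4" using e_pos r_pos e_small by (simp, linarith)
qed

lemma k_bounds: "3 / 4 \<le> k" "k \<le> 1" "k > 0"
  using er_bounds by (auto simp: k_eq)

lemma inverse_r_le: "1 / r \<le> r / f / 4"
  using f_pos r_pos f_le by (simp add: field_simps power2_eq_square)

lemma e_div_r_le: "e / r \<le> e * (r / f / 4)"
  using mult_left_mono[OF inverse_r_le, of e] e_pos by simp

lemma r_div_f_le: "r / f \<le> R / f"
  using f_pos r_le by (simp add: divide_right_mono)

lemma denominator_bounds: "3 / 4 \<le> k + e\<^sup>2 * f" "k + e\<^sup>2 * f \<le> 1"
proof -
  have "0 \<le> e\<^sup>2 * f" using f_pos by simp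
  then show "3 / 4 \<le> k + e\<^sup>2 * f" using k_bounds by simp
  have "e\<^sup>2 * f \<le> e\<^sup>2 * (r\<^sup>2 / 4)" using f_le by (intro mult_left_mono) auto
  also have "\<dots> = (e * r) * (e * r / 4)" by (simp add: power2_eq_square)
  also have "\<dots> \<le> (e * r) * 1" using er_bounds by (intro mult_left_mono) auto
  finally show "k + e\<^sup>2 * f \<le> 1" by (simp add: k_eq)
qed

lemma source_term_ge: "S * x + f / (2 * a) * S\<^sup>2 \<ge> - (a / (2 * f) * x\<^sup>2)"
proof -
  have "0 \<le> (f * S + a * x)\<^sup>2 / (2 * a * f)" using a_pos f_pos by simp
  also have "\<dots> = S * x + f / (2 * a) * S\<^sup>2 + a / (2 * f) * x\<^sup>2"
    using a_pos f_pos by (simp add: field_simps power2_eq_square)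
  finally show ?thesis by simp
qed

lemma main_term_ge: "2 * (a / (k * f)) * x\<^sup>2 \<ge> 4 * (a / (2 * f) * x\<^sup>2)"
proof -
  have "a / f \<le> a / (k * f)" using a_pos f_pos k_bounds by (intro divide_left_mono) (auto simp: mult_le_cancel_right1)
  then have "2 * (a / f) * x\<^sup>2 \<le> 2 * (a / (k * f)) * x\<^sup>2" by (intro mult_right_mono) auto
  then show ?thesis by simp
qed

lemma conjugation_error_le: "\<bar>a * e / (k * r) - (a\<^sup>2 - a) * e\<^sup>2 / k\<^sup>2\<bar> \<le> (2 * a\<^sup>2 + 2 * a) * (e / r)"
proof -
  have "\<bar>a * e / (k * r)\<bar> = (a * (e / r)) * (1 / k)" using a_pos e_pos k_bounds r_pos by (simp add: abs_mult)
  also have "\<dots> \<le> (a * (e / r)) * (4 / 3)"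
    using k_bounds a_pos e_pos r_pos by (intro mult_left_mono) (auto simp: field_simps)
  finally have first: "\<bar>a * e / (k * r)\<bar> \<le> 4 / 3 * (a * (e / r))" by simp
  have "\<bar>(a\<^sup>2 - a) * e\<^sup>2 / k\<^sup>2\<bar> = \<bar>a\<^sup>2 - a\<bar> * (e / r) * (e * r) * (1 / k\<^sup>2)"
    using r_pos by (simp add: abs_mult power2_eq_square)
  also have "\<dots> \<le> (a\<^sup>2 + a) * (e / r) * (1 / 4) * (16 / 9)"
  proof (intro mult_mono)
    have "(3 / 4)\<^sup>2 \<le> k\<^sup>2" using k_bounds by (intro power_mono) auto
    then show "1 / k\<^sup>2 \<le> 16 / 9" using k_bounds by (simp add: field_simps)
    show "\<bar>a\<^sup>2 - a\<bar> \<le> a\<^sup>2 + a" using a_pos by (simp add: abs_if)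
  qed (use a_pos e_pos r_pos er_bounds in auto)
  finally have second: "\<bar>(a\<^sup>2 - a) * e\<^sup>2 / k\<^sup>2\<bar> \<le> 4 / 9 * (a\<^sup>2 * (e / r)) + 4 / 9 * (a * (e / r))"
    by (simp add: algebra_simps)
  have "0 \<le> a\<^sup>2 * (e / r)" "0 \<le> a * (e / r)" using a_pos e_pos r_pos by auto
  then show ?thesis using first second unfolding distrib_right by linarith
qed

lemma cross_term_ge:
  "(a * e / (k * r) - (a\<^sup>2 - a) * e\<^sup>2 / k\<^sup>2 + 2 * d * (r / f)) * s * x
   \<ge> - ((a\<^sup>2 + a) * (e / r * s\<^sup>2) + (a\<^sup>2 + a) * (e / r * x\<^sup>2) + 1 / 8 * (d * (r / f) * s\<^sup>2) + 8 * (d * (r / f) * x\<^sup>2))"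
proof -
  define c where "c = a * e / (k * r) - (a\<^sup>2 - a) * e\<^sup>2 / k\<^sup>2"
  have d\<rho>: "d * (r / f) > 0" using d_pos f_pos r_pos by simp
  have "\<bar>c * (s * x)\<bar> \<le> ((2 * a\<^sup>2 + 2 * a) * (e / r)) * \<bar>s * x\<bar>"
    unfolding abs_mult[of c] using conjugation_error_le by (intro mult_right_mono) (auto simp: c_def)
  also have "\<dots> \<le> ((2 * a\<^sup>2 + 2 * a) * (e / r)) * ((s\<^sup>2 + x\<^sup>2) / 2)"
  proof (rule mult_left_mono)
    show "\<bar>s * x\<bar> \<le> (s\<^sup>2 + x\<^sup>2) / 2"
      using zero_le_power2[of "\<bar>s\<bar> - \<bar>x\<bar>"] by (simp add: power2_diff abs_mult)
  qed (use a_pos e_pos r_pos in auto)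
  also have "\<dots> = (a\<^sup>2 + a) * (e / r * s\<^sup>2) + (a\<^sup>2 + a) * (e / r * x\<^sup>2)" by (simp add: algebra_simps add_divide_distrib)
  finally have small: "c * (s * x) \<ge> - ((a\<^sup>2 + a) * (e / r * s\<^sup>2) + (a\<^sup>2 + a) * (e / r * x\<^sup>2))" by (simp add: abs_le_iff)
  have "0 \<le> s\<^sup>2 / 8 + 2 * (s * x) + 8 * x\<^sup>2"
    using zero_le_power2[of "s + 8 * x"] by (simp add: power2_sum power_mult_distrib)
  then have "0 \<le> (d * (r / f)) * (s\<^sup>2 / 8 + 2 * (s * x) + 8 * x\<^sup>2)" by (rule mult_nonneg_nonneg[OF less_imp_le[OF d\<rho>]])
  then have hardy: "2 * d * (r / f) * (s * x) \<ge> - (1 / 8 * (d * (r / f) * s\<^sup>2) + 8 * (d * (r / f) * x\<^sup>2))"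
    by (simp add: algebra_simps)
  have "(c + 2 * d * (r / f)) * s * x = c * (s * x) + 2 * d * (r / f) * (s * x)" by (simp add: algebra_simps)
  then show ?thesis using small hardy by (simp add: c_def)
qed

lemma derivative_term_ge:
  assumes q: "\<bar>q\<bar> \<le> Q"
  shows "e / (2 * r) * (A + (B\<^sup>2 - (x - q * s)\<^sup>2) / (k + e\<^sup>2 * f))
    \<ge> e / (2 * r) * (A + B\<^sup>2) - (2 * (e / r * x\<^sup>2) + 2 * Q\<^sup>2 * (e / r * s\<^sup>2))"
proof -
  define D where "D = k + e\<^sup>2 * f"
  have D_bounds: "3 / 4 \<le> D" "D \<le> 1" using denominator_bounds by (auto simp: D_def)
  have "q\<^sup>2 \<le> Q\<^sup>2" using q by (metis abs_ge_zero power2_abs power_mono)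
  then have "(q * s)\<^sup>2 \<le> Q\<^sup>2 * s\<^sup>2" by (simp add: power_mult_distrib mult_right_mono)
  moreover have "(x - q * s)\<^sup>2 \<le> 2 * x\<^sup>2 + 2 * (q * s)\<^sup>2" by (rule sq_diff_le)
  moreover have "(x - q * s)\<^sup>2 / D \<le> 2 * (x - q * s)\<^sup>2"
  proof -
    have "(x - q * s)\<^sup>2 / D \<le> (x - q * s)\<^sup>2 / (3 / 4)" using D_bounds by (intro divide_left_mono) auto
    also have "\<dots> \<le> 2 * (x - q * s)\<^sup>2" by simp
    finally show ?thesis .
  qed
  ultimately have "(x - q * s)\<^sup>2 / D \<le> 4 * x\<^sup>2 + 4 * (Q\<^sup>2 * s\<^sup>2)" by linarith
  moreover have "B\<^sup>2 \<le> B\<^sup>2 / D" using D_bounds by (simp add: le_divide_eq mult_left_le)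
  ultimately have "A + B\<^sup>2 - (4 * x\<^sup>2 + 4 * (Q\<^sup>2 * s\<^sup>2)) \<le> A + (B\<^sup>2 - (x - q * s)\<^sup>2) / D"
    by (simp add: diff_divide_distrib)
  then have "e / (2 * r) * (A + B\<^sup>2 - (4 * x\<^sup>2 + 4 * (Q\<^sup>2 * s\<^sup>2))) \<le> e / (2 * r) * (A + (B\<^sup>2 - (x - q * s)\<^sup>2) / D)"
    using e_pos r_pos by (intro mult_left_mono) auto
  then show ?thesis by (simp add: D_def algebra_simps)
qed

lemma potential_term_ge:
  assumes box_le: "\<bar>\<beta>\<bar> \<le> K * (e / r)"
  shows "s\<^sup>2 * (a\<^sup>2 / 2 * (e\<^sup>2 / k\<^sup>2 + e / (k * r)) + d * (r / (2 * f) * (1 - 2 * e * r) + 2 * e) - \<beta> / 2)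
    \<ge> 1 / 4 * (d * (r / f) * s\<^sup>2) - K / 2 * (e / r * s\<^sup>2)"
proof -
  have curvature: "0 \<le> a\<^sup>2 / 2 * (e\<^sup>2 / k\<^sup>2 + e / (k * r))" using e_pos r_pos k_bounds by simp
  have "r / f / 2 * (1 / 2) \<le> r / f / 2 * (1 - 2 * e * r)"
    using er_bounds f_pos r_pos by (intro mult_left_mono) auto
  then have "r / f / 4 \<le> r / (2 * f) * (1 - 2 * e * r) + 2 * e" using e_pos by (simp add: mult.commute)
  then have hardy: "d * (r / f / 4) \<le> d * (r / (2 * f) * (1 - 2 * e * r) + 2 * e)"
    using d_pos by (intro mult_left_mono) auto
  define E where "E = e / r"
  have "d * (r / f / 4) - K * E / 2
    \<le> a\<^sup>2 / 2 * (e\<^sup>2 / k\<^sup>2 + e / (k * r)) + d * (r / (2 * f) * (1 - 2 * e * r) + 2 * e) - \<beta> / 2"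
    using curvature hardy abs_le_D1[OF box_le, folded E_def] by linarith
  then have "s\<^sup>2 * (d * (r / f / 4) - K * E / 2)
    \<le> s\<^sup>2 * (a\<^sup>2 / 2 * (e\<^sup>2 / k\<^sup>2 + e / (k * r)) + d * (r / (2 * f) * (1 - 2 * e * r) + 2 * e) - \<beta> / 2)"
    by (rule mult_left_mono) simp
  then show ?thesis by (simp add: E_def[symmetric] algebra_simps)
qed

lemma x_errors_absorbed:
  "(a\<^sup>2 + a) * (e / r * x\<^sup>2) + 2 * (e / r * x\<^sup>2) + 8 * (d * (r / f) * x\<^sup>2) \<le> 2 * (a / (2 * f) * x\<^sup>2)"
proof -
  have "(a\<^sup>2 + a + 2) * (e / r) \<le> (a\<^sup>2 + a + 2) * (e * (R / f / 4))"
  proof (rule mult_left_mono)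
    have "e * (r / f / 4) \<le> e * (R / f / 4)" using r_div_f_le e_pos by (intro mult_left_mono) auto
    then show "e / r \<le> e * (R / f / 4)" using e_div_r_le by linarith
  qed (use a_pos in auto)
  also have "\<dots> = ((a\<^sup>2 + a + 2) * (e * R)) / (4 * f)" by simp
  also have "\<dots> \<le> (2 * a) / (4 * f)" using absorb_x f_pos by (intro divide_right_mono) auto
  finally have "(a\<^sup>2 + a + 2) * (e / r) * x\<^sup>2 \<le> a / (2 * f) * x\<^sup>2" by (intro mult_right_mono) auto
  moreover have "8 * (d * (r / f)) \<le> 8 * (d * (R / f))" using r_div_f_le d_pos by (intro mult_left_mono) auto
  then have "8 * (d * (r / f)) \<le> a / (2 * f)" using R_pos f_pos by (simp add: d_eq)
  then have "8 * (d * (r / f)) * x\<^sup>2 \<le> a / (2 * f) * x\<^sup>2" by (intro mult_right_mono) auto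
  moreover have "(a\<^sup>2 + a) * (e / r * x\<^sup>2) + 2 * (e / r * x\<^sup>2) = (a\<^sup>2 + a + 2) * (e / r) * x\<^sup>2"
    by (simp add: algebra_simps add_divide_distrib)
  ultimately show ?thesis by simp
qed

lemma s_errors_absorbed:
  "(a\<^sup>2 + a) * (e / r * s\<^sup>2) + 2 * Q\<^sup>2 * (e / r * s\<^sup>2) + K / 2 * (e / r * s\<^sup>2) \<le> 1 / 16 * (d * (r / f) * s\<^sup>2)"
proof -
  define c where "c = a\<^sup>2 + a + 2 * Q\<^sup>2 + K / 2"
  have "c \<ge> 0" using a_pos K_nonneg by (simp add: c_def)
  then have "c * (e / r) \<le> c * (e * (r / f / 4))" using e_div_r_le by (intro mult_left_mono) auto
  also have "\<dots> = (4 * (e * c)) * (r / f / 16)" by simp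
  also have "\<dots> \<le> d * (r / f / 16)" using absorb_s r_pos f_pos unfolding c_def by (intro mult_right_mono) auto
  finally have "c * (e / r) * s\<^sup>2 \<le> d * (r / f / 16) * s\<^sup>2" by (intro mult_right_mono) auto
  moreover have "c * (e / r) * s\<^sup>2 = (a\<^sup>2 + a) * (e / r * s\<^sup>2) + 2 * Q\<^sup>2 * (e / r * s\<^sup>2) + K / 2 * (e / r * s\<^sup>2)"
    by (simp add: c_def algebra_simps add_divide_distrib)
  ultimately show ?thesis by simp
qed

lemma coercive_form_le:
  assumes q: "\<bar>q\<bar> \<le> Q" and box_le: "\<bar>\<beta>\<bar> \<le> K * (e / r)"
  shows "coercive_form a e d f r x (A + B\<^sup>2) s
    \<le> S * x + 2 * (a / (k * f)) * x\<^sup>2 + (a * e / (k * r) - (a\<^sup>2 - a) * e\<^sup>2 / k\<^sup>2 + 2 * d * (r / f)) * s * x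
     + e / (2 * r) * (A + (B\<^sup>2 - (x - q * s)\<^sup>2) / (k + e\<^sup>2 * f))
     + s\<^sup>2 * (a\<^sup>2 / 2 * (e\<^sup>2 / k\<^sup>2 + e / (k * r)) + d * (r / (2 * f) * (1 - 2 * e * r) + 2 * e) - \<beta> / 2)
     + f / (2 * a) * S\<^sup>2"
proof -
  have "d * (r / (16 * f)) * s\<^sup>2 = 1 / 16 * (d * (r / f) * s\<^sup>2)" by simp
  then show ?thesis
    unfolding coercive_form_def
    using source_term_ge[of x S] main_term_ge[of x] cross_term_ge[of s x] derivative_term_ge[OF q, of A B x s]
      potential_term_ge[OF box_le, of s] x_errors_absorbed[of x] s_errors_absorbed[of s] by linarith
qed

lemma
  assumes A_nonneg: "A \<ge> 0"
  shows le_coercive_form_x: "1 / r * x\<^sup>2 \<le> R / a * coercive_form a e d f r x A s"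
    and le_coercive_form_s: "1 / r * s\<^sup>2 \<le> 8 / d * coercive_form a e d f r x A s" "1 / sqrt f * s\<^sup>2 \<le> 8 / d * coercive_form a e d f r x A s"
    and le_coercive_form_A: "1 / r * A \<le> 2 / e * coercive_form a e d f r x A s"
proof -
  define lx where "lx = a / (2 * f) * x\<^sup>2"
  define lA where "lA = e / (2 * r) * A"
  define ls where "ls = d * (r / (16 * f)) * s\<^sup>2"
  have form_eq: "coercive_form a e d f r x A s = lx + lA + ls" by (simp add: coercive_form_def lx_def lA_def ls_def)
  have nonneg: "lx \<ge> 0" "lA \<ge> 0" "ls \<ge> 0"
    unfolding lx_def lA_def ls_def using a_pos f_pos e_pos r_pos d_pos A_nonneg by auto
  have inverse_sqrt_le: "1 / sqrt f \<le> r / f / 2"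
  proof -
    have "(2 * sqrt f)\<^sup>2 \<le> r\<^sup>2" using f_le f_pos by (simp add: power_mult_distrib)
    then have "2 * sqrt f \<le> r" by (rule power2_le_imp_le) (use r_pos in linarith)
    then have "2 * sqrt f / (2 * f) \<le> r / (2 * f)" using f_pos by (intro divide_right_mono) auto
    moreover have "2 * sqrt f / (2 * f) = 1 / sqrt f" using f_pos by (simp add: field_simps)
    ultimately show ?thesis by (simp add: mult.commute)
  qed
  have "0 < r / f" using f_pos r_pos by simp
  then have "1 / r \<le> r / f / 2" by (intro order_trans[OF inverse_r_le] divide_left_mono) auto
  moreover have "r / f / 2 \<le> R / f / 2" using r_div_f_le by (rule divide_right_mono) simp
  ultimately have inverse_r_mult_le: "1 / r * s\<^sup>2 \<le> r / f / 2 * s\<^sup>2" "1 / r * x\<^sup>2 \<le> R / f / 2 * x\<^sup>2"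
    by (intro mult_right_mono; simp)+
  note inverse_r_mult_le(2)
  also have "\<dots> = R / a * lx" using a_pos f_pos by (simp add: lx_def)
  also have "\<dots> \<le> R / a * coercive_form a e d f r x A s" using nonneg R_pos a_pos by (intro mult_left_mono) (auto simp: form_eq)
  finally show "1 / r * x\<^sup>2 \<le> R / a * coercive_form a e d f r x A s" .
  have "r / f / 2 * s\<^sup>2 = 8 / d * ls" using d_pos by (simp add: ls_def)
  also have "\<dots> \<le> 8 / d * coercive_form a e d f r x A s" using nonneg d_pos by (intro mult_left_mono) (auto simp: form_eq)
  finally have s_le: "r / f / 2 * s\<^sup>2 \<le> 8 / d * coercive_form a e d f r x A s" .
  then show "1 / r * s\<^sup>2 \<le> 8 / d * coercive_form a e d f r x A s" using inverse_r_mult_le(1) by linarith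
  have "1 / sqrt f * s\<^sup>2 \<le> r / f / 2 * s\<^sup>2" using inverse_sqrt_le by (intro mult_right_mono) auto
  then show "1 / sqrt f * s\<^sup>2 \<le> 8 / d * coercive_form a e d f r x A s" using s_le by linarith
  have "1 / r * A = 2 / e * lA" using e_pos by (simp add: lA_def)
  also have "\<dots> \<le> 2 / e * coercive_form a e d f r x A s" using nonneg e_pos by (intro mult_left_mono) (auto simp: form_eq)
  finally show "1 / r * A \<le> 2 / e * coercive_form a e d f r x A s" .
qed

end

lemma sgn_inner_sq_le: "(v \<bullet> sgn w)\<^sup>2 \<le> v \<bullet> v" for v w :: "'a::real_inner"
proof -
  have "\<bar>v \<bullet> sgn w\<bar> \<le> norm v * norm (sgn w)" by (rule Cauchy_Schwarz_ineq2)
  also have "\<dots> \<le> norm v" by (simp add: norm_sgn mult_left_le)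
  finally have "\<bar>v \<bullet> sgn w\<bar>\<^sup>2 \<le> (norm v)\<^sup>2" by (intro power_mono) auto
  then show ?thesis by (simp add: power2_norm_eq_inner)
qed

lemma orthogonal_part_add_parallel:
  fixes v w :: "'a::real_inner" and \<alpha> \<beta> :: real
  defines "u \<equiv> \<alpha> *\<^sub>R v + \<beta> *\<^sub>R w"
  shows "u \<bullet> u - (u \<bullet> sgn w)\<^sup>2 = \<alpha>\<^sup>2 * (v \<bullet> v - (v \<bullet> sgn w)\<^sup>2)"
proof (cases "w = 0")
  case False
  have "sgn w \<bullet> sgn w = 1" using norm_sgn[of w] False by (simp add: norm_eq_1)
  moreover have "u = \<alpha> *\<^sub>R v + (\<beta> * norm w) *\<^sub>R sgn w" using False by (simp add: u_def sgn_div_norm)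
  ultimately show ?thesis
    by (simp add: inner_add_left inner_add_right inner_commute[of "sgn w" v] power2_eq_square algebra_simps)
qed (simp add: u_def power2_eq_square)

definition angular_energy :: "(real^'m) \<times> (real^'n) \<Rightarrow> (real^'m) \<times> (real^'n) \<Rightarrow> real" where
  "angular_energy p g = ff p * (snd g \<bullet> snd g - (snd g \<bullet> sgn (snd p))\<^sup>2) + ff p * (fst g \<bullet> fst g - (fst g \<bullet> sgn (fst p))\<^sup>2)"

definition energy_density :: "(real^'m) \<times> (real^'n) \<Rightarrow> (real^'m) \<times> (real^'n) \<Rightarrow> real" where
  "energy_density p g = (uu p * (fst g \<bullet> sgn (fst p) - snd g \<bullet> sgn (snd p)))\<^sup>2
     + (vv p * (fst g \<bullet> sgn (fst p) + snd g \<bullet> sgn (snd p)))\<^sup>2 + angular_energy p g"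

lemma angular_energy_nonneg: "p \<in> DD \<Longrightarrow> angular_energy p g \<ge> 0"
  using sgn_inner_sq_le[of "snd g" "snd p"] sgn_inner_sq_le[of "fst g" "fst p"]
  by (auto simp: angular_energy_def DD_def intro!: add_nonneg_nonneg mult_nonneg_nonneg)

lemma mult_field_polar:
  assumes "p \<in> DD"
  shows "mult_field e p = ((damp e p * tau p / 2) *\<^sub>R sgn (fst p), (damp e p * rr p / 2 + e * ff p) *\<^sub>R sgn (snd p))"
proof -
  have "(damp e p / 2) *\<^sub>R fst p = (damp e p * tau p / 2) *\<^sub>R sgn (fst p)"
    by (cases "fst p = 0") (simp_all add: tau_def sgn_div_norm)
  moreover have "(damp e p / 2) *\<^sub>R snd p = (damp e p * rr p / 2) *\<^sub>R sgn (snd p)"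
    using rr_pos[OF assms] by (simp add: rr_def sgn_div_norm)
  moreover have "snd p /\<^sub>R rr p = sgn (snd p)" by (simp add: rr_def sgn_div_norm)
  ultimately show ?thesis by (simp add: mult_field_def radial_def prod_eq_iff scaleR_add_left)
qed

definition cross_field :: "real \<Rightarrow> (real^'m) \<times> (real^'n) \<Rightarrow> (real^'m) \<times> (real^'n)" where
  "cross_field e p = ((damp e p * rr p / 2 + e * ff p) *\<^sub>R sgn (fst p), (damp e p * tau p / 2) *\<^sub>R sgn (snd p))"

lemma cross_field_inner_mink_mult_field:
  assumes "p \<in> DD" shows "cross_field e p \<bullet> mink (mult_field e p) = 0"
proof -
  have "tau p * (sgn (fst p) \<bullet> sgn (fst p)) = tau p"
    using norm_sgn[of "fst p"] by (cases "fst p = 0") (simp_all add: tau_def norm_eq_1)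
  moreover have "sgn (snd p) \<bullet> sgn (snd p) = 1"
    using norm_sgn[of "snd p"] rr_pos[OF assms] by (simp add: rr_def norm_eq_1)
  ultimately show ?thesis
    by (auto simp: mult_field_polar[OF assms] cross_field_def mink_def inner_prod_def algebra_simps)
qed

lemma cross_field_sq_diff:
  assumes "p \<in> DD"
  shows "(cross_field e p \<bullet> v)\<^sup>2 - (mult_field e p \<bullet> v)\<^sup>2
    = (damp e p + e\<^sup>2 * ff p) * (ff p * ((fst v \<bullet> sgn (fst p))\<^sup>2 - (snd v \<bullet> sgn (snd p))\<^sup>2))"
proof -
  define k r \<tau> f where "k = damp e p" and "r = rr p" and "\<tau> = tau p" and "f = ff p"
  have f: "4 * f = r\<^sup>2 - \<tau>\<^sup>2" using ff_eq_tau_rr[of p] by (simp add: f_def r_def \<tau>_def)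
  have "k + e * r = 1" by (simp add: k_def r_def damp_def)
  have "(k * r / 2 + e * f)\<^sup>2 - (k * \<tau> / 2)\<^sup>2 = k\<^sup>2 * (r\<^sup>2 - \<tau>\<^sup>2) / 4 + k * r * e * f + e\<^sup>2 * f\<^sup>2"
    by (simp add: power2_eq_square field_simps)
  also have "\<dots> = f * (k * (k + e * r) + e\<^sup>2 * f)" unfolding f[symmetric] by (simp add: power2_eq_square algebra_simps)
  finally have square_diff: "(k * r / 2 + e * f)\<^sup>2 - (k * \<tau> / 2)\<^sup>2 = (k + e\<^sup>2 * f) * f" unfolding \<open>k + e * r = 1\<close> by simp
  have "(cross_field e p \<bullet> v)\<^sup>2 - (mult_field e p \<bullet> v)\<^sup>2
    = ((k * r / 2 + e * f)\<^sup>2 - (k * \<tau> / 2)\<^sup>2) * ((fst v \<bullet> sgn (fst p))\<^sup>2 - (snd v \<bullet> sgn (snd p))\<^sup>2)"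
    unfolding mult_field_polar[OF assms] cross_field_def k_def[symmetric] r_def[symmetric] \<tau>_def[symmetric] f_def[symmetric]
    by (simp add: inner_prod_def inner_commute[of _ "fst v"] inner_commute[of _ "snd v"] power2_eq_square algebra_simps)
  then show ?thesis unfolding square_diff by (simp add: k_def f_def)
qed

lemma angular_energy_cross_field:
  assumes p: "p \<in> DD" and denominator_pos: "damp e p + e\<^sup>2 * ff p > 0"
  shows "angular_energy p v + ((cross_field e p \<bullet> v)\<^sup>2 - (mult_field e p \<bullet> v)\<^sup>2) / (damp e p + e\<^sup>2 * ff p)
    = 2 * ff p * (snd v \<bullet> snd v - (radial p \<bullet> v)\<^sup>2 - (v \<bullet> mink v) / 2)"
  using denominator_pos unfolding cross_field_sq_diff[OF p] angular_energy_def inner_mink_self radial_inner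
  by (subst nonzero_mult_div_cancel_left) (simp_all add: algebra_simps diff_divide_distrib)

lemma energy_density_le:
  assumes p: "p \<in> DD" "rr p \<le> R" and e: "e > 0" "e * R \<le> 1 / 4"
  shows "energy_density p g \<le> 4 * ((mult_field e p \<bullet> g)\<^sup>2 + (cross_field e p \<bullet> g)\<^sup>2) + angular_energy p g"
proof -
  define u v r \<tau> where "u = uu p" and "v = vv p" and "r = rr p" and "\<tau> = tau p"
  define \<alpha> \<beta> where "\<alpha> = fst g \<bullet> sgn (fst p)" and "\<beta> = snd g \<bullet> sgn (snd p)"
  have null_coordinates: "\<tau> = u + v" "r = v - u" "ff p = - u * v" by (simp_all add: u_def v_def \<tau>_def r_def uu_def vv_def ff_def field_simps)
  have "\<tau> < r" "0 \<le> \<tau>" using tau_less_rr[OF p(1)] by (simp_all add: \<tau>_def r_def tau_def)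
  then have "- r \<le> u" "v \<le> r" using null_coordinates by auto
  then have "e * (- r) \<le> e * u" "e * v \<le> e * r" using e by (intro mult_left_mono; simp)+
  moreover have "3 / 4 \<le> 1 - e * r" using exterior_of_bounded(2)[OF p e] by (simp add: damp_def r_def)
  ultimately have factors_ge: "1 + e * u \<ge> 3 / 4" "1 - e * v \<ge> 3 / 4" by auto
  have polar: "mult_field e p \<bullet> g = (1 - e * r) * \<tau> / 2 * \<alpha> + ((1 - e * r) * r / 2 + e * ff p) * \<beta>"
    "cross_field e p \<bullet> g = ((1 - e * r) * r / 2 + e * ff p) * \<alpha> + (1 - e * r) * \<tau> / 2 * \<beta>"
    by (simp_all add: mult_field_polar[OF p(1)] cross_field_def inner_prod_def damp_def r_def \<tau>_def \<alpha>_def \<beta>_def inner_commute)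
  have "u * (\<alpha> - \<beta>) * (1 + e * u) = mult_field e p \<bullet> g - cross_field e p \<bullet> g"
    "v * (\<alpha> + \<beta>) * (1 - e * v) = mult_field e p \<bullet> g + cross_field e p \<bullet> g"
    unfolding polar null_coordinates by (simp_all add: field_simps)
  from sq_le_two_mult_sq[OF this(1) factors_ge(1)] sq_le_two_mult_sq[OF this(2) factors_ge(2)]
  have "(u * (\<alpha> - \<beta>))\<^sup>2 + (v * (\<alpha> + \<beta>))\<^sup>2 \<le> 4 * ((mult_field e p \<bullet> g)\<^sup>2 + (cross_field e p \<bullet> g)\<^sup>2)"
    by (simp add: power2_sum power2_diff)
  then show ?thesis by (simp add: energy_density_def u_def v_def \<alpha>_def \<beta>_def)
qed

lemma
  assumes p: "p \<in> exterior e"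
  shows mult_field_inner_conj_grad: "mult_field e p \<bullet> conj_grad a e p s g
      = weight a e p * (mult_field e p \<bullet> g) + weight a e p * s * (a * (damp e p + e\<^sup>2 * ff p) / damp e p)"
    and cross_field_inner_conj_grad: "cross_field e p \<bullet> conj_grad a e p s g = weight a e p * (cross_field e p \<bullet> g)"
    and angular_energy_conj_grad: "angular_energy p (conj_grad a e p s g) = (weight a e p)\<^sup>2 * angular_energy p g"
proof -
  have p_DD: "p \<in> DD" by (rule exteriorD(1)[OF p])
  have along: "v \<bullet> dlog_weight a e p = a / (damp e p * ff p) * (v \<bullet> mink (mult_field e p))" for v
    using dlog_weight_inner_mink[OF p, of a "mink v"] by (simp add: inner_commute inner_mink)
  show "mult_field e p \<bullet> conj_grad a e p s g
      = weight a e p * (mult_field e p \<bullet> g) + weight a e p * s * (a * (damp e p + e\<^sup>2 * ff p) / damp e p)"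
    using exteriorD[OF p] by (simp add: conj_grad_def inner_add_right along mult_field_inner_mink[OF p_DD])
  show "cross_field e p \<bullet> conj_grad a e p s g = weight a e p * (cross_field e p \<bullet> g)"
    by (simp add: conj_grad_def inner_add_right along cross_field_inner_mink_mult_field[OF p_DD])
  have fst_conj_grad: "fst (conj_grad a e p s g)
      = weight a e p *\<^sub>R fst g + (- (weight a e p * s * (a / 2 * (1 / ff p)))) *\<^sub>R fst p"
    and snd_conj_grad: "snd (conj_grad a e p s g)
      = weight a e p *\<^sub>R snd g + (weight a e p * s * (a / 2 * (1 / ff p) + a * e * (1 / damp e p) * inverse (rr p))) *\<^sub>R snd p"
    by (simp_all add: conj_grad_def dlog_weight_def mink_def radial_def algebra_simps)
  show "angular_energy p (conj_grad a e p s g) = (weight a e p)\<^sup>2 * angular_energy p g"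
    unfolding angular_energy_def fst_conj_grad snd_conj_grad orthogonal_part_add_parallel by (simp only: distrib_left mult_ac)
qed

lemma (in carleman_constants) carleman_scalars_at:
  assumes p: "p \<in> DD" "rr p \<le> R"
  shows "carleman_scalars a R e d Q K (ff p) (rr p) (damp e p)"
proof
  show "ff p > 0" "rr p > 0" "rr p \<le> R" "4 * ff p \<le> (rr p)\<^sup>2" "damp e p = 1 - e * rr p"
    using p rr_pos[OF p(1)] rr_sq_ge[of p] by (auto simp: DD_def damp_def)
qed

definition conj_form :: "real \<Rightarrow> real \<Rightarrow> real \<Rightarrow> (real^'m) \<times> (real^'n) \<Rightarrow> real \<Rightarrow> (real^'m) \<times> (real^'n) \<Rightarrow> real" where
  "conj_form a e d p s g = (let \<xi> = conj_grad a e p s g; \<psi> = weight a e p * s in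
     coercive_form a e d (ff p) (rr p) (mult_field e p \<bullet> \<xi> + mult_fun e p * \<psi>) (angular_energy p \<xi> + (cross_field e p \<bullet> \<xi>)\<^sup>2) \<psi>)"

lemma conj_form_le_current_div:
  fixes p :: "(real^'m) \<times> (real^'n)"
  assumes "carleman_constants a R e d (mult_fun_bound CARD('m) CARD('n)) (box_mult_fun_bound CARD('m) CARD('n))"
    and p: "p \<in> DD" "rr p \<le> R"
  shows "conj_form a e d p s g \<le> current_div a e d p s g b + ff p / (2 * a) * (weight a e p * b)\<^sup>2"
proof -
  interpret carleman_scalars a R e d "mult_fun_bound CARD('m) CARD('n)" "box_mult_fun_bound CARD('m) CARD('n)"
      "ff p" "rr p" "damp e p"
    by (rule carleman_constants.carleman_scalars_at[OF assms])
  let ?\<xi> = "conj_grad a e p s g" and ?\<psi> = "weight a e p * s" and ?D = "damp e p + e\<^sup>2 * ff p"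
  let ?x = "mult_field e p \<bullet> ?\<xi> + mult_fun e p * ?\<psi>"
  have D_pos: "?D > 0" using denominator_bounds(1) by linarith
  have "e * ff p / rr p * (snd ?\<xi> \<bullet> snd ?\<xi> - (radial p \<bullet> ?\<xi>)\<^sup>2 - (?\<xi> \<bullet> mink ?\<xi>) / 2)
    = e / (2 * rr p) * (2 * ff p * (snd ?\<xi> \<bullet> snd ?\<xi> - (radial p \<bullet> ?\<xi>)\<^sup>2 - (?\<xi> \<bullet> mink ?\<xi>) / 2))"
    using r_pos by (simp add: field_simps)
  also have "\<dots> = e / (2 * rr p) * (angular_energy p ?\<xi> + ((cross_field e p \<bullet> ?\<xi>)\<^sup>2 - (?x - mult_fun e p * ?\<psi>)\<^sup>2) / ?D)"
    unfolding angular_energy_cross_field[OF p(1) D_pos, symmetric] by simp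
  finally have derivative_terms: "e * ff p / rr p * (snd ?\<xi> \<bullet> snd ?\<xi> - (radial p \<bullet> ?\<xi>)\<^sup>2 - (?\<xi> \<bullet> mink ?\<xi>) / 2)
    = e / (2 * rr p) * (angular_energy p ?\<xi> + ((cross_field e p \<bullet> ?\<xi>)\<^sup>2 - (?x - mult_fun e p * ?\<psi>)\<^sup>2) / ?D)" .
  show ?thesis
    unfolding conj_form_def current_div_def Let_def derivative_terms
    using coercive_form_le[OF abs_mult_fun_le[OF p e_pos e_small] abs_box_mult_fun_le[OF p(1) e_pos],
        of ?x "angular_energy p ?\<xi>" "cross_field e p \<bullet> ?\<xi>" ?\<psi> "weight a e p * b"]
    by linarith
qed

lemma weighted_energy_density_le:
  fixes p g :: "(real^'m) \<times> (real^'n)" and s :: real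
  assumes "carleman_constants a R e d (mult_fun_bound CARD('m) CARD('n)) (box_mult_fun_bound CARD('m) CARD('n))"
    and p: "p \<in> DD" "rr p \<le> R"
  defines "\<xi> \<equiv> conj_grad a e p s g" and "\<psi> \<equiv> weight a e p * s"
  shows "(weight a e p)\<^sup>2 * energy_density p g
    \<le> 8 * (mult_field e p \<bullet> \<xi> + mult_fun e p * \<psi>)\<^sup>2 + 8 * (mult_fun_bound CARD('m) CARD('n) + 2 * a)\<^sup>2 * \<psi>\<^sup>2
      + 8 * (angular_energy p \<xi> + (cross_field e p \<bullet> \<xi>)\<^sup>2)"
proof -
  let ?Q = "mult_fun_bound CARD('m) CARD('n)"
  interpret carleman_scalars a R e d ?Q "box_mult_fun_bound CARD('m) CARD('n)" "ff p" "rr p" "damp e p"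
    by (rule carleman_constants.carleman_scalars_at[OF assms(1-3)])
  note e = e_pos e_small
  let ?w = "weight a e p" and ?x = "mult_field e p \<bullet> \<xi> + mult_fun e p * \<psi>"
  have in_exterior: "p \<in> exterior e" by (rule exterior_of_bounded(1)[OF p e])
  define c where "c = a * (damp e p + e\<^sup>2 * ff p) / damp e p"
  have along: "?w * (mult_field e p \<bullet> g) = ?x - (mult_fun e p + c) * \<psi>"
    by (simp add: \<xi>_def \<psi>_def c_def mult_field_inner_conj_grad[OF in_exterior] algebra_simps)
  have "(damp e p + e\<^sup>2 * ff p) / damp e p \<le> 2" "0 \<le> (damp e p + e\<^sup>2 * ff p) / damp e p"
    using denominator_bounds k_bounds by (auto simp: field_simps)
  then have "a * ((damp e p + e\<^sup>2 * ff p) / damp e p) \<le> a * 2" "0 \<le> a * ((damp e p + e\<^sup>2 * ff p) / damp e p)"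
    using a_pos by (intro mult_left_mono mult_nonneg_nonneg; simp)+
  then have "\<bar>mult_fun e p + c\<bar> \<le> ?Q + 2 * a" using abs_mult_fun_le[OF p e] by (simp add: c_def abs_le_iff)
  then have "(mult_fun e p + c)\<^sup>2 \<le> (?Q + 2 * a)\<^sup>2" by (metis abs_ge_zero power2_abs power_mono)
  then have "((mult_fun e p + c) * \<psi>)\<^sup>2 \<le> (?Q + 2 * a)\<^sup>2 * \<psi>\<^sup>2" by (simp add: power_mult_distrib mult_right_mono)
  then have along_sq: "(?w * (mult_field e p \<bullet> g))\<^sup>2 \<le> 2 * ?x\<^sup>2 + 2 * ((?Q + 2 * a)\<^sup>2 * \<psi>\<^sup>2)"
    unfolding along using sq_diff_le[of ?x "(mult_fun e p + c) * \<psi>"] by linarith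
  have "?w\<^sup>2 * energy_density p g \<le> ?w\<^sup>2 * (4 * ((mult_field e p \<bullet> g)\<^sup>2 + (cross_field e p \<bullet> g)\<^sup>2) + angular_energy p g)"
    by (rule mult_left_mono[OF energy_density_le[OF p e]]) simp
  also have "\<dots> = 4 * (?w * (mult_field e p \<bullet> g))\<^sup>2 + 4 * (cross_field e p \<bullet> \<xi>)\<^sup>2 + angular_energy p \<xi>"
    by (simp add: \<xi>_def cross_field_inner_conj_grad[OF in_exterior] angular_energy_conj_grad[OF in_exterior] power_mult_distrib algebra_simps)
  also have "\<dots> \<le> 8 * ?x\<^sup>2 + 8 * ((?Q + 2 * a)\<^sup>2 * \<psi>\<^sup>2) + 8 * (angular_energy p \<xi> + (cross_field e p \<bullet> \<xi>)\<^sup>2)"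
    using along_sq angular_energy_nonneg[OF p(1), of \<xi>] zero_le_power2[of "cross_field e p \<bullet> \<xi>"]
    unfolding distrib_left by linarith
  finally show ?thesis by (simp only: mult.assoc)
qed

lemma weighted_density_le_conj_form:
  fixes p :: "(real^'m) \<times> (real^'n)"
  assumes "carleman_constants a R e d (mult_fun_bound CARD('m) CARD('n)) (box_mult_fun_bound CARD('m) CARD('n))"
    and p: "p \<in> DD" "rr p \<le> R"
  shows "(weight a e p)\<^sup>2 * (1 / rr p * energy_density p g + 1 / sqrt (ff p) * s\<^sup>2)
    \<le> (8 * (R / a) + 8 * (mult_fun_bound CARD('m) CARD('n) + 2 * a)\<^sup>2 * (8 / d) + 16 / e + 8 / d) * conj_form a e d p s g"
proof -
  let ?Q = "mult_fun_bound CARD('m) CARD('n)" and ?\<xi> = "conj_grad a e p s g" and ?\<psi> = "weight a e p * s"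
    and ?L = "conj_form a e d p s g"
  interpret carleman_scalars a R e d ?Q "box_mult_fun_bound CARD('m) CARD('n)" "ff p" "rr p" "damp e p"
    by (rule carleman_constants.carleman_scalars_at[OF assms])
  let ?x = "mult_field e p \<bullet> ?\<xi> + mult_fun e p * ?\<psi>" and ?A = "angular_energy p ?\<xi> + (cross_field e p \<bullet> ?\<xi>)\<^sup>2"
  have "?A \<ge> 0" using angular_energy_nonneg[OF p(1)] by simp
  note le_form = le_coercive_form_x[OF this, of ?x ?\<psi>] le_coercive_form_s[OF this, of ?\<psi> ?x] le_coercive_form_A[OF this, of ?x ?\<psi>]
  have conj_form_eq: "?L = coercive_form a e d (ff p) (rr p) ?x ?A ?\<psi>" by (simp add: conj_form_def Let_def)
  have "(weight a e p)\<^sup>2 * (1 / rr p * energy_density p g + 1 / sqrt (ff p) * s\<^sup>2)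
    = 1 / rr p * ((weight a e p)\<^sup>2 * energy_density p g) + 1 / sqrt (ff p) * ?\<psi>\<^sup>2"
    by (simp add: power_mult_distrib algebra_simps)
  also have "\<dots> \<le> 1 / rr p * (8 * ?x\<^sup>2 + 8 * (?Q + 2 * a)\<^sup>2 * ?\<psi>\<^sup>2 + 8 * ?A) + 1 / sqrt (ff p) * ?\<psi>\<^sup>2"
    using weighted_energy_density_le[OF assms] r_pos by (intro add_right_mono mult_left_mono) auto
  also have "\<dots> = 8 * (1 / rr p * ?x\<^sup>2) + 8 * (?Q + 2 * a)\<^sup>2 * (1 / rr p * ?\<psi>\<^sup>2) + 8 * (1 / rr p * ?A) + 1 / sqrt (ff p) * ?\<psi>\<^sup>2"
    by (simp add: algebra_simps add_divide_distrib)
  also have "\<dots> \<le> 8 * (R / a * ?L) + 8 * (?Q + 2 * a)\<^sup>2 * (8 / d * ?L) + 8 * (2 / e * ?L) + 8 / d * ?L"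
    unfolding conj_form_eq by (intro add_mono mult_left_mono le_form) auto
  also have "\<dots> = (8 * (R / a) + 8 * (?Q + 2 * a)\<^sup>2 * (8 / d) + 16 / e + 8 / d) * ?L" by (simp add: algebra_simps)
  finally show ?thesis .
qed

lemma carleman_pointwise:
  fixes a R :: real
  assumes a_pos: "a > 0" and R_pos: "R > 0"
  obtains e d C where "e > 0" "d \<ge> 0" "C > 0" "e * R \<le> 1 / 4"
    "\<And>p s g b. \<lbrakk>p \<in> (DD :: ((real^'m) \<times> (real^'n)) set); rr p < R\<rbrakk> \<Longrightarrow>
       (weight a e p)\<^sup>2 * (1 / rr p * energy_density p g + 1 / sqrt (ff p) * s\<^sup>2)
        \<le> C * (current_div a e d p s g b + ff p / (2 * a) * (weight a e p * b)\<^sup>2)"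
proof -
  let ?Q = "mult_fun_bound CARD('m) CARD('n)" and ?K = "box_mult_fun_bound CARD('m) CARD('n)"
  have "?K \<ge> 0" by (simp add: box_mult_fun_bound_def)
  then obtain e where constants: "carleman_constants a R e (a / (16 * R)) ?Q ?K"
    using carleman_constants_exist[OF a_pos R_pos, of ?K ?Q] by blast
  define d where "d = a / (16 * R)"
  note constants = constants[folded d_def]
  interpret carleman_constants a R e d ?Q ?K by (rule constants)
  define C where "C = 8 * (R / a) + 8 * (?Q + 2 * a)\<^sup>2 * (8 / d) + 16 / e + 8 / d"
  have C_pos: "C > 0" unfolding C_def using a_pos R_pos d_pos e_pos by (intro add_nonneg_pos) auto
  have "(weight a e p)\<^sup>2 * (1 / rr p * energy_density p g + 1 / sqrt (ff p) * s\<^sup>2)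
        \<le> C * (current_div a e d p s g b + ff p / (2 * a) * (weight a e p * b)\<^sup>2)"
    if p: "p \<in> DD" "rr p < R" for p :: "(real^'m) \<times> (real^'n)" and s g b
  proof -
    have p_le: "p \<in> DD" "rr p \<le> R" using p by auto
    have "C * conj_form a e d p s g \<le> C * (current_div a e d p s g b + ff p / (2 * a) * (weight a e p * b)\<^sup>2)"
      using C_pos by (intro mult_left_mono conj_form_le_current_div[OF constants p_le]) auto
    then show ?thesis using weighted_density_le_conj_form[OF constants p_le, folded C_def] by (rule order_trans[rotated])
  qed
  then show ?thesis by (rule that[OF e_pos less_imp_le[OF d_pos] C_pos e_small])
qed

section \<open>Bounds for the current\<close>

lemma powr_add_nat: "x > 0 \<Longrightarrow> x powr (c + real n) = x ^ n * x powr c" for x c :: real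
  by (simp add: powr_add powr_realpow mult.commute)

definition weighted_energy :: "real \<Rightarrow> (real^'m) \<times> (real^'n) \<Rightarrow> real \<Rightarrow> (real^'m) \<times> (real^'n) \<Rightarrow> real" where
  "weighted_energy a p s g = ff p powr (2 * a) * (g \<bullet> g) + ff p powr (2 * a - 2) * s\<^sup>2"

lemma weighted_energy_nonneg: "0 \<le> weighted_energy a p s g"
  by (simp add: weighted_energy_def)

lemma
  assumes "p \<in> DD"
  shows ff_powr_gradient_le: "ff p powr (2 * a) * (g \<bullet> g) \<le> weighted_energy a p s g"
    and ff_powr_value_le: "ff p powr (2 * a) * s\<^sup>2 \<le> (ff p)\<^sup>2 * weighted_energy a p s g"
proof -
  show "ff p powr (2 * a) * (g \<bullet> g) \<le> weighted_energy a p s g" by (simp add: weighted_energy_def)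
  have "ff p powr (2 * a) = (ff p)\<^sup>2 * ff p powr (2 * a - 2)"
    using powr_add_nat[of "ff p" "2 * a - 2" 2] assms by (simp add: DD_def)
  then have "ff p powr (2 * a) * s\<^sup>2 = (ff p)\<^sup>2 * (ff p powr (2 * a - 2) * s\<^sup>2)" by simp
  also have "\<dots> \<le> (ff p)\<^sup>2 * weighted_energy a p s g" by (intro mult_left_mono) (auto simp: weighted_energy_def)
  finally show "ff p powr (2 * a) * s\<^sup>2 \<le> (ff p)\<^sup>2 * weighted_energy a p s g" .
qed

lemma weighted_energy_le_ff_sq:
  assumes p: "p \<in> DD" "rr p \<le> R" and a_ge_2: "a \<ge> 2" and s: "\<bar>s\<bar> \<le> M" and g: "norm g \<le> M"
  shows "weighted_energy a p s g \<le> ((R\<^sup>2) powr (2 * a - 2) + (R\<^sup>2) powr (2 * a - 4)) * M\<^sup>2 * (ff p)\<^sup>2"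
proof -
  have f: "ff p > 0" "ff p \<le> R\<^sup>2" using p ff_le_sq[OF p(2)] by (auto simp: DD_def)
  have shift: "ff p powr (2 * a) = (ff p)\<^sup>2 * ff p powr (2 * a - 2)" "ff p powr (2 * a - 2) = (ff p)\<^sup>2 * ff p powr (2 * a - 4)"
    using powr_add_nat[OF f(1), of "2 * a - 2" 2] powr_add_nat[OF f(1), of "2 * a - 4" 2] by simp_all
  have value_sq: "s\<^sup>2 \<le> M\<^sup>2" using s by (metis abs_ge_zero power2_abs power_mono)
  have gradient_sq: "g \<bullet> g \<le> M\<^sup>2" using g by (metis norm_ge_zero power2_norm_eq_inner power_mono)
  have "weighted_energy a p s g = (ff p)\<^sup>2 * (ff p powr (2 * a - 2) * (g \<bullet> g) + ff p powr (2 * a - 4) * s\<^sup>2)"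
    unfolding weighted_energy_def by (subst shift(1), subst shift(2)) (simp add: algebra_simps)
  also have "\<dots> \<le> (ff p)\<^sup>2 * ((R\<^sup>2) powr (2 * a - 2) * M\<^sup>2 + (R\<^sup>2) powr (2 * a - 4) * M\<^sup>2)"
    using f a_ge_2 value_sq gradient_sq by (intro mult_left_mono add_mono mult_mono powr_mono2) auto
  finally show ?thesis by (simp add: algebra_simps)
qed

lemma weight_sq_bounds:
  assumes p: "p \<in> DD" and damp: "3 / 4 \<le> damp e p" "damp e p \<le> 1" and a_pos: "a > 0"
  shows "ff p powr (2 * a) \<le> (weight a e p)\<^sup>2" "(weight a e p)\<^sup>2 \<le> 2 powr (2 * a) * ff p powr (2 * a)"
proof -
  have ff_pos: "ff p > 0" using p by (simp add: DD_def)
  have weight_sq: "(weight a e p)\<^sup>2 = (ff p / damp e p) powr (2 * a)"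
    by (simp add: weight_def power2_eq_square powr_add[symmetric])
  have "ff p \<le> ff p / damp e p" using ff_pos damp by (simp add: le_divide_eq mult_left_le)
  then show "ff p powr (2 * a) \<le> (weight a e p)\<^sup>2" unfolding weight_sq using ff_pos a_pos by (intro powr_mono2) auto
  have "ff p / damp e p \<le> 2 * ff p" using ff_pos damp by (simp add: divide_le_eq)
  then have "(ff p / damp e p) powr (2 * a) \<le> (2 * ff p) powr (2 * a)" using ff_pos damp a_pos by (intro powr_mono2) auto
  then show "(weight a e p)\<^sup>2 \<le> 2 powr (2 * a) * ff p powr (2 * a)" unfolding weight_sq using ff_pos by (simp add: powr_mult)
qed

lemma norm_multiplier_current_le:
  "norm (multiplier_current Y q grad_q T \<psi> \<xi>)
    \<le> 2 * norm Y * (norm \<xi>)\<^sup>2 + \<bar>q\<bar> * (\<bar>\<psi>\<bar> * norm \<xi>) + norm grad_q * \<psi>\<^sup>2 + norm Y * (\<bar>T\<bar> * \<psi>\<^sup>2)"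
proof -
  have "norm (multiplier_current Y q grad_q T \<psi> \<xi>)
    \<le> \<bar>Y \<bullet> \<xi>\<bar> * norm \<xi> + \<bar>1 / 2 * (\<xi> \<bullet> mink \<xi>)\<bar> * norm Y + \<bar>q * \<psi>\<bar> * norm \<xi> + \<bar>1 / 2 * (\<psi> * \<psi>)\<bar> * norm grad_q + \<bar>T * (\<psi> * \<psi>)\<bar> * norm Y"
    unfolding multiplier_current_def
    by (intro order_trans[OF norm_triangle_ineq] order_trans[OF norm_triangle_ineq4] add_mono) (simp_all add: norm_mink)
  also have "\<dots> \<le> (norm Y * norm \<xi>) * norm \<xi> + (norm \<xi> * norm \<xi>) * norm Y + (\<bar>q\<bar> * \<bar>\<psi>\<bar>) * norm \<xi> + \<psi>\<^sup>2 * norm grad_q + (\<bar>T\<bar> * \<psi>\<^sup>2) * norm Y"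
  proof (intro add_mono mult_right_mono)
    show "\<bar>Y \<bullet> \<xi>\<bar> \<le> norm Y * norm \<xi>" by (rule Cauchy_Schwarz_ineq2)
    have "\<bar>\<xi> \<bullet> mink \<xi>\<bar> \<le> norm \<xi> * norm \<xi>" using Cauchy_Schwarz_ineq2[of \<xi> "mink \<xi>"] by (simp add: norm_mink)
    then show "\<bar>1 / 2 * (\<xi> \<bullet> mink \<xi>)\<bar> \<le> norm \<xi> * norm \<xi>" using abs_ge_zero[of "\<xi> \<bullet> mink \<xi>"] unfolding abs_mult by linarith
  qed (auto simp: abs_mult power2_eq_square)
  also have "\<dots> = 2 * norm Y * (norm \<xi>)\<^sup>2 + \<bar>q\<bar> * (\<bar>\<psi>\<bar> * norm \<xi>) + norm grad_q * \<psi>\<^sup>2 + norm Y * (\<bar>T\<bar> * \<psi>\<^sup>2)"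
    by (simp add: power2_eq_square algebra_simps)
  finally show ?thesis .
qed

context
  fixes e R :: real and p :: "(real^'m) \<times> (real^'n)"
  assumes p: "p \<in> DD" "rr p \<le> R" and e: "e > 0" "e * R \<le> 1 / 4"
begin

lemma norm_mult_field_le: "norm (mult_field e p) \<le> 2 * R"
proof -
  have f: "ff p > 0" "4 * ff p \<le> (rr p)\<^sup>2" and r_pos: "rr p > 0" using p(1) rr_sq_ge[of p] rr_pos[OF p(1)] by (auto simp: DD_def)
  have damp: "3 / 4 \<le> damp e p" "damp e p \<le> 1" using exterior_of_bounded[OF p e] by auto
  have "e * ff p = (e * rr p) * (ff p / rr p)" using r_pos by simp
  also have "\<dots> \<le> 1 * (rr p / 4)"
    using damp ff_div_rr_le(1)[OF p(1)] e f r_pos by (intro mult_mono) (auto simp: damp_def)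
  finally have radial_part: "e * ff p \<le> R" using p(2) r_pos by simp
  have "norm (mult_field e p) \<le> norm ((damp e p / 2) *\<^sub>R p) + norm ((e * ff p) *\<^sub>R radial p)"
    unfolding mult_field_def by (rule norm_triangle_ineq)
  also have "\<dots> = damp e p / 2 * norm p + e * ff p" using damp e f by (simp add: norm_radial[OF p(1)])
  also have "\<dots> \<le> 1 / 2 * (2 * rr p) + e * ff p"
    using damp norm_le_2_rr[OF p(1)] by (intro add_right_mono mult_mono) auto
  also have "\<dots> \<le> 2 * R" using radial_part p(2) by simp
  finally show ?thesis .
qed

lemma norm_dlog_weight_le:
  assumes a_pos: "a > 0" shows "norm (dlog_weight a e p) \<le> 4 * a * R / ff p"
proof -
  note exterior_bounds = exterior_of_bounded[OF p e]
  have ff_pos: "ff p > 0" using p(1) by (simp add: DD_def)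
  have "norm (dlog_weight a e p) = norm (mink (dlog_weight a e p))" by (simp add: norm_mink)
  also have "\<dots> = a / (damp e p * ff p) * norm (mult_field e p)"
    unfolding mink_dlog_weight[OF exterior_bounds(1)] using a_pos exterior_bounds ff_pos by simp
  also have "\<dots> \<le> (2 * a / ff p) * (2 * R)"
    using a_pos exterior_bounds ff_pos by (intro mult_mono norm_mult_field_le) (auto simp: field_simps)
  finally show ?thesis by simp
qed

lemma norm_grad_mult_fun_le: "norm (grad_mult_fun e p) \<le> 2 * e * mult_fun_bound CARD('m) CARD('n)"
proof -
  let ?A = "mult_fun_coeff0 CARD('m) CARD('n)" and ?E = "mult_fun_coeff1 CARD('n)"
  have ff_pos: "ff p > 0" and r_pos: "rr p > 0" using p(1) rr_pos[OF p(1)] by (auto simp: DD_def)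
  have quotient: "0 \<le> ff p / (rr p)\<^sup>2" "ff p / (rr p)\<^sup>2 \<le> 1" using rr_sq_ge[of p] ff_pos r_pos by (auto simp: divide_le_eq)
  have "norm (grad_mult_fun e p)
    \<le> \<bar>- e * ?A - e * ?E * (ff p / (rr p)\<^sup>2)\<bar> * norm (radial p) + \<bar>e * ?E / 2 * (1 / rr p)\<bar> * norm (mink p)"
    unfolding grad_mult_fun_def by (rule order_trans[OF norm_triangle_ineq]) (simp add: power2_eq_square)
  also have "\<dots> \<le> (\<bar>- e * ?A\<bar> + \<bar>e * ?E * (ff p / (rr p)\<^sup>2)\<bar>) * 1 + \<bar>e * ?E / 2 * (1 / rr p)\<bar> * (2 * rr p)"
    using norm_le_2_rr[OF p(1)]
    by (intro add_mono mult_mono abs_triangle_ineq4) (auto simp: norm_radial[OF p(1)] norm_mink)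
  also have "\<dots> = e * \<bar>?A\<bar> + e * \<bar>?E\<bar> * (ff p / (rr p)\<^sup>2) + e * \<bar>?E\<bar>"
    using e r_pos ff_pos by (simp add: abs_mult)
  also have "\<dots> \<le> e * \<bar>?A\<bar> + e * \<bar>?E\<bar> * 1 + e * \<bar>?E\<bar>"
    using e quotient by (intro add_mono mult_left_mono order_refl) auto
  also have "\<dots> \<le> 2 * e * mult_fun_bound CARD('m) CARD('n)"
    using e by (simp add: mult_fun_bound_def algebra_simps)
  finally show ?thesis .
qed

lemma abs_hardy_coeff_le:
  assumes d_nonneg: "d \<ge> 0" shows "\<bar>hardy_coeff a e d p\<bar> \<le> (a\<^sup>2 + d * R) / ff p"
proof -
  note exterior_bounds = exterior_of_bounded[OF p e]
  have ff_pos: "ff p > 0" and r_pos: "rr p > 0" using p(1) rr_pos[OF p(1)] by (auto simp: DD_def)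
  have "a\<^sup>2 / 2 * (1 / damp e p) \<le> a\<^sup>2 / 2 * 2" using exterior_bounds by (intro mult_left_mono) (auto simp: field_simps)
  moreover have "d * rr p \<le> d * R" using p(2) d_nonneg by (intro mult_left_mono) auto
  ultimately have "(a\<^sup>2 / 2 * (1 / damp e p) + d * rr p) / ff p \<le> (a\<^sup>2 + d * R) / ff p"
    using ff_pos by (intro divide_right_mono) auto
  moreover have "hardy_coeff a e d p = (a\<^sup>2 / 2 * (1 / damp e p) + d * rr p) / ff p"
    unfolding hardy_coeff_def by (simp add: add_divide_distrib)
  moreover have "0 \<le> hardy_coeff a e d p" unfolding hardy_coeff_def using exterior_bounds d_nonneg ff_pos r_pos by simp
  ultimately show ?thesis by simp
qed

lemma conj_sq_le:
  assumes a_pos: "a > 0" shows "(weight a e p * s)\<^sup>2 \<le> 2 powr (2 * a) * ((ff p)\<^sup>2 * weighted_energy a p s g)"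
proof -
  have "(weight a e p * s)\<^sup>2 = (weight a e p)\<^sup>2 * s\<^sup>2" by (simp add: power_mult_distrib)
  also have "\<dots> \<le> 2 powr (2 * a) * ff p powr (2 * a) * s\<^sup>2"
    using weight_sq_bounds(2)[OF p(1) exterior_of_bounded(2,3)[OF p e] a_pos] by (intro mult_right_mono) auto
  also have "\<dots> \<le> 2 powr (2 * a) * ((ff p)\<^sup>2 * weighted_energy a p s g)"
    using ff_powr_value_le[OF p(1)] unfolding mult.assoc by (intro mult_left_mono) auto
  finally show ?thesis .
qed

lemma norm_conj_grad_sq_le:
  assumes a_pos: "a > 0"
  shows "(norm (conj_grad a e p s g))\<^sup>2 \<le> 2 powr (2 * a) * (2 + 2 * (4 * a * R)\<^sup>2) * weighted_energy a p s g"
proof -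
  let ?w = "weight a e p" and ?E = "weighted_energy a p s g"
  have ff_pos: "ff p > 0" using p(1) by (simp add: DD_def)
  have gradient_part: "?w\<^sup>2 * (g \<bullet> g) \<le> 2 powr (2 * a) * ?E"
  proof -
    have "?w\<^sup>2 * (g \<bullet> g) \<le> 2 powr (2 * a) * ff p powr (2 * a) * (g \<bullet> g)"
      using weight_sq_bounds(2)[OF p(1) exterior_of_bounded(2,3)[OF p e] a_pos] by (intro mult_right_mono) auto
    also have "\<dots> \<le> 2 powr (2 * a) * ?E"
      using ff_powr_gradient_le[OF p(1)] unfolding mult.assoc by (intro mult_left_mono) auto
    finally show ?thesis .
  qed
  have value_part: "(?w * s)\<^sup>2 / (ff p)\<^sup>2 \<le> 2 powr (2 * a) * ?E"
    using conj_sq_le[OF a_pos, of s g] ff_pos by (simp add: divide_le_eq mult_ac)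
  have "norm (conj_grad a e p s g) \<le> norm (?w *\<^sub>R g) + norm ((?w * s) *\<^sub>R dlog_weight a e p)"
    unfolding conj_grad_def by (rule norm_triangle_ineq)
  also have "\<dots> \<le> \<bar>?w\<bar> * norm g + \<bar>?w * s\<bar> * (4 * a * R / ff p)"
    using mult_left_mono[OF norm_dlog_weight_le[OF a_pos], of "\<bar>?w * s\<bar>"] by simp
  finally have "(norm (conj_grad a e p s g))\<^sup>2 \<le> (\<bar>?w\<bar> * norm g + \<bar>?w * s\<bar> * (4 * a * R / ff p))\<^sup>2"
    by (intro power_mono) auto
  also have "\<dots> \<le> 2 * (\<bar>?w\<bar> * norm g)\<^sup>2 + 2 * (\<bar>?w * s\<bar> * (4 * a * R / ff p))\<^sup>2"
    using sq_diff_le[of "\<bar>?w\<bar> * norm g" "- (\<bar>?w * s\<bar> * (4 * a * R / ff p))"] by simp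
  also have "\<dots> = 2 * (?w\<^sup>2 * (g \<bullet> g)) + 2 * ((4 * a * R)\<^sup>2 * ((?w * s)\<^sup>2 / (ff p)\<^sup>2))"
    by (simp add: power_mult_distrib power_divide power2_norm_eq_inner)
  also have "\<dots> \<le> 2 * (2 powr (2 * a) * ?E) + 2 * ((4 * a * R)\<^sup>2 * (2 powr (2 * a) * ?E))"
    by (intro add_mono mult_left_mono gradient_part value_part) auto
  also have "\<dots> = 2 powr (2 * a) * (2 + 2 * (4 * a * R)\<^sup>2) * ?E" by (simp only: algebra_simps)
  finally show ?thesis .
qed

lemma norm_current_le_squares:
  assumes d_nonneg: "d \<ge> 0" and R_pos: "R > 0"
  shows "norm (current a e d p s g)
    \<le> (4 * R + mult_fun_bound CARD('m) CARD('n)) * (norm (conj_grad a e p s g))\<^sup>2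
      + (1 + 2 * e) * mult_fun_bound CARD('m) CARD('n) * (weight a e p * s)\<^sup>2
      + 2 * R * (a\<^sup>2 + d * R) * ((weight a e p * s)\<^sup>2 / ff p)"
proof -
  let ?Q = "mult_fun_bound CARD('m) CARD('n)" and ?\<psi> = "weight a e p * s" and ?n = "norm (conj_grad a e p s g)"
    and ?T = "hardy_coeff a e d p"
  have Q: "\<bar>mult_fun e p\<bar> \<le> ?Q" by (rule abs_mult_fun_le[OF p e])
  have mixed: "\<bar>?\<psi>\<bar> * ?n \<le> ?\<psi>\<^sup>2 + ?n\<^sup>2"
    using zero_le_power2[of "\<bar>?\<psi>\<bar> - ?n"] zero_le_power2[of ?\<psi>] zero_le_power2[of ?n]
    unfolding power2_diff power2_abs by linarith
  have hardy: "\<bar>?T\<bar> * ?\<psi>\<^sup>2 \<le> (a\<^sup>2 + d * R) / ff p * ?\<psi>\<^sup>2" by (intro mult_right_mono abs_hardy_coeff_le d_nonneg) simp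
  have "norm (current a e d p s g)
    \<le> 2 * norm (mult_field e p) * ?n\<^sup>2 + \<bar>mult_fun e p\<bar> * (\<bar>?\<psi>\<bar> * ?n)
      + norm (grad_mult_fun e p) * ?\<psi>\<^sup>2 + norm (mult_field e p) * (\<bar>?T\<bar> * ?\<psi>\<^sup>2)"
    unfolding current_def by (rule norm_multiplier_current_le)
  also have "\<dots> \<le> 2 * (2 * R) * ?n\<^sup>2 + ?Q * (?\<psi>\<^sup>2 + ?n\<^sup>2) + 2 * e * ?Q * ?\<psi>\<^sup>2 + 2 * R * ((a\<^sup>2 + d * R) / ff p * ?\<psi>\<^sup>2)"
    using Q R_pos norm_mult_field_le norm_grad_mult_fun_le
    by (intro add_mono mult_mono[OF _ hardy] mult_mono[OF _ mixed] mult_right_mono mult_left_mono) auto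
  also have "\<dots> = (4 * R + ?Q) * ?n\<^sup>2 + (1 + 2 * e) * ?Q * ?\<psi>\<^sup>2 + 2 * R * (a\<^sup>2 + d * R) * (?\<psi>\<^sup>2 / ff p)"
    by (simp add: algebra_simps add_divide_distrib)
  finally show ?thesis .
qed

end

lemma norm_current_le:
  fixes a R e d :: real
  assumes a_pos: "a > 0" and R_pos: "R > 0" and e: "e > 0" "e * R \<le> 1 / 4" and d_nonneg: "d \<ge> 0"
  obtains C where "C > 0" "\<And>p s g. \<lbrakk>p \<in> (DD :: ((real^'m) \<times> (real^'n)) set); rr p \<le> R\<rbrakk> \<Longrightarrow>
     norm (current a e d p s g) \<le> C * weighted_energy a p s g"
proof -
  let ?Q = "mult_fun_bound CARD('m) CARD('n)" and ?W = "2 powr (2 * a)"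
  define C where "C = (4 * R + ?Q) * (?W * (2 + 2 * (4 * a * R)\<^sup>2))
     + (1 + 2 * e) * ?Q * (?W * R ^ 4) + 2 * R * (a\<^sup>2 + d * R) * (?W * R\<^sup>2)"
  have Q_nonneg: "?Q \<ge> 0" by (simp add: mult_fun_bound_def)
  have C_pos: "C > 0"
    unfolding C_def using R_pos Q_nonneg e d_nonneg by (intro add_pos_nonneg mult_pos_pos mult_nonneg_nonneg) (auto intro: add_pos_nonneg)
  have "norm (current a e d p s g) \<le> C * weighted_energy a p s g"
    if p: "p \<in> DD" "rr p \<le> R" for p :: "(real^'m) \<times> (real^'n)" and s g
  proof -
    let ?E = "weighted_energy a p s g" and ?\<psi> = "weight a e p * s"
    have f: "0 < ff p" "ff p \<le> R\<^sup>2" using p ff_le_sq[OF p(2)] by (auto simp: DD_def)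
    have energy_nonneg: "0 \<le> ?E" by (rule weighted_energy_nonneg)
    have conj_sq: "?\<psi>\<^sup>2 \<le> ?W * ((ff p)\<^sup>2 * ?E)" by (rule conj_sq_le[OF p e a_pos])
    also have "\<dots> \<le> ?W * ((R\<^sup>2)\<^sup>2 * ?E)" using f energy_nonneg by (intro mult_left_mono mult_right_mono power_mono) auto
    finally have conj_sq_le_energy: "?\<psi>\<^sup>2 \<le> ?W * R ^ 4 * ?E" by simp
    have "?\<psi>\<^sup>2 / ff p \<le> ?W * (ff p * ?E)" using conj_sq f(1) by (simp add: divide_le_eq power2_eq_square mult_ac)
    also have "\<dots> \<le> ?W * (R\<^sup>2 * ?E)" using f energy_nonneg by (intro mult_left_mono mult_right_mono) auto
    finally have conj_sq_div_le: "?\<psi>\<^sup>2 / ff p \<le> ?W * R\<^sup>2 * ?E" by simp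
    have "norm (current a e d p s g)
      \<le> (4 * R + ?Q) * (?W * (2 + 2 * (4 * a * R)\<^sup>2) * ?E) + (1 + 2 * e) * ?Q * (?W * R ^ 4 * ?E)
        + 2 * R * (a\<^sup>2 + d * R) * (?W * R\<^sup>2 * ?E)"
      using R_pos Q_nonneg e d_nonneg conj_sq_le_energy conj_sq_div_le norm_conj_grad_sq_le[OF p e a_pos, of s g]
      by (intro order_trans[OF norm_current_le_squares[OF p e d_nonneg R_pos]] add_mono mult_left_mono) auto
    also have "\<dots> = C * ?E" by (simp add: C_def algebra_simps)
    finally show ?thesis .
  qed
  then show ?thesis using that C_pos by blast
qed

lemma current_boundary_sign:
  assumes p: "p \<in> exterior e" and e_pos: "e > 0" and inward: "snd p \<bullet> n \<le> 0"
  shows "snd (current a e d p 0 (0, l *\<^sub>R n)) \<bullet> n \<le> 0"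
proof -
  define c where "c = weight a e p * l"
  define \<beta> where "\<beta> = damp e p / 2 + e * ff p / rr p"
  have \<beta>_nonneg: "\<beta> \<ge> 0" unfolding \<beta>_def using exteriorD[OF p] e_pos by simp
  have "snd (mult_field e p) = (damp e p / 2) *\<^sub>R snd p + (e * ff p * inverse (rr p)) *\<^sub>R snd p"
    by (simp add: mult_field_def radial_def)
  then have snd_mult_field: "snd (mult_field e p) = \<beta> *\<^sub>R snd p"
    unfolding \<beta>_def scaleR_add_left by (simp only: divide_inverse)
  have "conj_grad a e p 0 (0, l *\<^sub>R n) = (0, c *\<^sub>R n)" by (simp add: conj_grad_def c_def)
  then have "snd (current a e d p 0 (0, l *\<^sub>R n)) \<bullet> n = (1 / 2 * c\<^sup>2 * (n \<bullet> n) * \<beta>) * (snd p \<bullet> n)"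
    by (simp add: current_def multiplier_current_def mink_def inner_prod_def snd_mult_field inner_diff_left
        power2_eq_square algebra_simps)
  also have "\<dots> \<le> 0" using \<beta>_nonneg inward by (intro mult_nonneg_nonpos) auto
  finally show ?thesis .
qed

lemma continuous_on_current:
  assumes T: "T \<subseteq> exterior e" and z: "continuous_on T z" and W: "continuous_on T W"
  shows "continuous_on T (\<lambda>p. current a e d p (z p) (W p))"
proof -
  have T_DD: "T \<subseteq> DD" using T exterior_subset_DD by blast
  note weights = continuous_on_subset[OF C1_deriv_continuous_on[OF C1_deriv_weight] T]
    continuous_on_subset[OF C1_deriv_continuous_on[OF C1_deriv_dlog_weight] T]
    continuous_on_subset[OF C1_deriv_continuous_on[OF C1_deriv_hardy_coeff] T]
  note multipliers = continuous_on_subset[OF C1_deriv_continuous_on[OF C1_deriv_mult_field] T_DD]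
    continuous_on_subset[OF C1_deriv_continuous_on[OF C1_deriv_mult_fun] T_DD]
    continuous_on_subset[OF C1_div_continuous_on[OF C1_div_grad_mult_fun] T_DD]
  have conj_grad: "continuous_on T (\<lambda>p. conj_grad a e p (z p) (W p))"
    unfolding conj_grad_def by (intro continuous_intros weights z W)
  have mink_conj_grad: "continuous_on T (\<lambda>p. mink (conj_grad a e p (z p) (W p)))"
    by (rule bounded_linear.continuous_on[OF bounded_linear_mink conj_grad])
  show ?thesis
    unfolding current_def multiplier_current_def by (intro continuous_intros weights multipliers conj_grad mink_conj_grad z)
qed

lemma energy_density_bounds:
  assumes p: "p \<in> DD" and R: "rr p < R"
  shows "0 \<le> energy_density p g" "1 / rr p * energy_density p g \<le> 5 * R * (g \<bullet> g)"
proof -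
  let ?r = "rr p"
  have r: "?r > 0" "?r \<le> R" using rr_pos[OF p] R by auto
  have f: "ff p > 0" "ff p \<le> ?r\<^sup>2" using ff_le_sq[OF order_refl, of p] p by (auto simp: DD_def)
  define \<alpha> \<beta> where "\<alpha> = fst g \<bullet> sgn (fst p)" and "\<beta> = snd g \<bullet> sgn (snd p)"
  have split: "g \<bullet> g = fst g \<bullet> fst g + snd g \<bullet> snd g" by (simp add: inner_prod_def)
  have \<alpha>\<beta>: "\<alpha>\<^sup>2 \<le> fst g \<bullet> fst g" "\<beta>\<^sup>2 \<le> snd g \<bullet> snd g" unfolding \<alpha>_def \<beta>_def by (rule sgn_inner_sq_le)+
  show "0 \<le> energy_density p g" using angular_energy_nonneg[OF p, of g] by (simp add: energy_density_def)
  have "tau p < ?r" "0 \<le> tau p" using tau_less_rr[OF p] by (auto simp: tau_def)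
  then have null_coordinates_le: "(uu p)\<^sup>2 \<le> ?r\<^sup>2" "(vv p)\<^sup>2 \<le> ?r\<^sup>2" by (auto simp: abs_le_square_iff[symmetric] uu_def vv_def)
  have null_directions: "(\<alpha> - \<beta>)\<^sup>2 \<le> 2 * (g \<bullet> g)" "(\<alpha> + \<beta>)\<^sup>2 \<le> 2 * (g \<bullet> g)"
    using sq_diff_le[of \<alpha> \<beta>] sq_diff_le[of \<alpha> "- \<beta>"] \<alpha>\<beta> split by auto
  have "energy_density p g = (uu p)\<^sup>2 * (\<alpha> - \<beta>)\<^sup>2 + (vv p)\<^sup>2 * (\<alpha> + \<beta>)\<^sup>2 + (ff p * (snd g \<bullet> snd g - \<beta>\<^sup>2) + ff p * (fst g \<bullet> fst g - \<alpha>\<^sup>2))"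
    by (simp add: energy_density_def angular_energy_def \<alpha>_def \<beta>_def power_mult_distrib)
  also have "\<dots> \<le> ?r\<^sup>2 * (2 * (g \<bullet> g)) + ?r\<^sup>2 * (2 * (g \<bullet> g)) + (?r\<^sup>2 * (snd g \<bullet> snd g) + ?r\<^sup>2 * (fst g \<bullet> fst g))"
    using null_coordinates_le null_directions f \<alpha>\<beta> by (intro add_mono mult_mono) auto
  also have "\<dots> = 5 * ?r\<^sup>2 * (g \<bullet> g)" by (simp add: split algebra_simps)
  finally have "1 / ?r * energy_density p g \<le> 1 / ?r * (5 * ?r\<^sup>2 * (g \<bullet> g))" using r by (intro mult_left_mono) auto
  also have "\<dots> = 5 * ?r * (g \<bullet> g)" using r by (simp add: power2_eq_square)
  also have "\<dots> \<le> 5 * R * (g \<bullet> g)" using r by (intro mult_right_mono) auto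
  finally show "1 / ?r * energy_density p g \<le> 5 * R * (g \<bullet> g)" .
qed

lemma box_eq_trace:
  fixes z :: "(real^'m) \<times> (real^'n) \<Rightarrow> real"
  shows "box z p = trace_of (\<lambda>v. mink (hess z p v))"
proof -
  let ?H = "hess z p"
  have component: "?H v \<bullet> b = dder (dder z b) v p" if "b \<in> Basis" for v b
    unfolding hess_def inner_sum_left using that by (simp add: inner_Basis if_distrib cong: if_cong)
  have time: "?H (u, 0) \<bullet> mink (u, 0) = - dder (dder z (u, 0)) (u, 0) p" if "u \<in> Basis" for u :: "real^'m"
  proof -
    have "?H (u, 0) \<bullet> mink (u, 0) = - (?H (u, 0) \<bullet> (u, 0))" by (simp add: mink_def inner_prod_def)
    then show ?thesis using that component[of "(u, 0)"] by (simp add: Basis_prod_def)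
  qed
  have space: "?H (0, v) \<bullet> mink (0, v) = dder (dder z (0, v)) (0, v) p" if "v \<in> Basis" for v :: "real^'n"
    using that by (simp add: mink_def component Basis_prod_def)
  have "trace_of (\<lambda>v. mink (?H v)) = (\<Sum>b\<in>Basis. ?H b \<bullet> mink b)" by (simp add: trace_of_def inner_mink)
  also have "\<dots> = (\<Sum>u\<in>Basis. ?H (u, 0) \<bullet> mink (u, 0)) + (\<Sum>v\<in>Basis. ?H (0, v) \<bullet> mink (0, v))"
    unfolding Basis_prod_def by (subst sum.union_disjoint) (auto simp: sum.reindex inj_on_def)
  also have "\<dots> = - (\<Sum>u\<in>Basis. dder (dder z (u, 0)) (u, 0) p) + (\<Sum>v\<in>Basis. dder (dder z (0, v)) (0, v) p)"
    by (simp add: time space sum_negf)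
  also have "\<dots> = box z p"
    unfolding Basis_vec_def dt_def[abs_def] dx_def[abs_def] box_def
    by (simp add: UNION_singleton_eq_range sum.reindex axis_eq_axis inj_on_def)
  finally show ?thesis by simp
qed

lemma
  assumes "z differentiable (at p)"
  shows gradt_sq_eq: "gradt_sq z p = fst (egrad z p) \<bullet> fst (egrad z p)"
    and gradx_sq_eq: "gradx_sq z p = snd (egrad z p) \<bullet> snd (egrad z p)"
    and dtau_eq: "dtau z p = fst (egrad z p) \<bullet> sgn (fst p)"
    and dr_eq: "dr z p = snd (egrad z p) \<bullet> sgn (snd p)"
  by (simp_all add: gradt_sq_def gradx_sq_def dt_def dx_def dtau_def dr_def dder_eq_egrad_inner[OF assms] inner_prod_def inner_axis)
    (simp_all add: inner_vec_def power2_eq_square)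

lemma energy_density_egrad:
  assumes "z differentiable (at p)"
  shows "energy_density p (egrad z p) = (uu p * du z p)\<^sup>2 + (vv p * dv z p)\<^sup>2 + ff p * ang_x z p - ff p * ang_t z p"
  by (simp add: energy_density_def angular_energy_def du_def dv_def ang_x_def ang_t_def gradt_sq_eq[OF assms]
      gradx_sq_eq[OF assms] dtau_eq[OF assms] dr_eq[OF assms] algebra_simps)

section \<open>Functions vanishing on the lateral boundary\<close>

lemma (in cylinder) bounded_on_slab:
  fixes h :: "(real^'m) \<times> (real^'n) \<Rightarrow> 'b::real_normed_vector"
  assumes h: "continuous_on (closure (UNIV \<times> \<Omega>)) h"
  obtains M where "M > 0" "\<And>p. p \<in> slab \<Omega> \<Longrightarrow> norm (h p) \<le> M"
proof -
  define K where "K = cball 0 (2 * R) \<inter> closure (UNIV \<times> \<Omega> :: ((real^'m) \<times> (real^'n)) set)"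
  have "compact K" unfolding K_def by (intro compact_Int_closed) auto
  moreover have "continuous_on K h" by (rule continuous_on_subset[OF h]) (auto simp: K_def)
  ultimately obtain M where M: "\<forall>p\<in>K. norm (h p) \<le> M"
    using compact_imp_bounded[OF compact_continuous_image] by (metis bounded_iff imageI)
  have "slab \<Omega> \<subseteq> K"
    using slab_bounds(5) slab_subset(1) closure_subset[of "UNIV \<times> \<Omega>"] unfolding K_def by fastforce
  then have "norm (h p) \<le> max M 1" if "p \<in> slab \<Omega>" for p using M that by (auto simp: le_max_iff_disj)
  then show ?thesis using that[of "max M 1"] by simp
qed

locale dirichlet_function = cylinder \<Omega> R
  for \<Omega> :: "(real^'n) set" and R :: real +
  fixes z :: "(real^'m) \<times> (real^'n) \<Rightarrow> real"
  assumes Ck_2: "Ck 2 (UNIV \<times> \<Omega>) z" and C1_closure: "C1_closure (UNIV \<times> \<Omega>) z"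
    and zero_on_boundary: "p \<in> frontier (UNIV \<times> \<Omega>) \<Longrightarrow> p \<in> DD \<Longrightarrow> z p = 0"
begin

lemma C1_deriv_z: "C1_deriv (slab \<Omega>) z (\<lambda>p v. egrad z p \<bullet> v)"
  by (rule C1_deriv_subset[OF Ck_2_C1_deriv[OF Ck_2] slab_subset(1)])

lemma C1_deriv_egrad: "C1_deriv (slab \<Omega>) (egrad z) (hess z)"
  by (rule C1_deriv_subset[OF Ck_2_C1_deriv_egrad[OF Ck_2] slab_subset(1)])

lemma differentiable_z: "p \<in> slab \<Omega> \<Longrightarrow> z differentiable (at p)"
  using Ck_2_differentiable[OF Ck_2] slab_subset(1) by blast

lemma C1_div_mink_egrad: "C1_div (slab \<Omega>) (\<lambda>p. mink (egrad z p)) (box z)"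
  by (rule C1_divI[OF C1_deriv_linear_compose[OF bounded_linear_mink C1_deriv_egrad]]) (simp add: box_eq_trace)

lemmas continuous_on_z = C1_deriv_continuous_on[OF C1_deriv_z]
lemmas continuous_on_egrad = C1_deriv_continuous_on[OF C1_deriv_egrad]
lemmas continuous_on_box = C1_div_continuous_div[OF C1_div_mink_egrad]

lemma continuous_on_closure_z: "continuous_on (closure (UNIV \<times> \<Omega>)) z"
  using C1_closure by (simp add: C1_closure_def)

definition closure_grad :: "(real^'m) \<times> (real^'n) \<Rightarrow> (real^'m) \<times> (real^'n)" where
  "closure_grad = (SOME W. continuous_on (closure (UNIV \<times> \<Omega>)) W \<and> (\<forall>p\<in>UNIV \<times> \<Omega>. W p = egrad z p))"

lemma continuous_on_closure_grad: "continuous_on (closure (UNIV \<times> \<Omega>)) closure_grad"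
  and closure_grad_eq: "p \<in> slab \<Omega> \<Longrightarrow> closure_grad p = egrad z p"
proof -
  have "\<exists>W. continuous_on (closure (UNIV \<times> \<Omega>)) W \<and> (\<forall>p\<in>UNIV \<times> \<Omega>. W p = egrad z p)"
    by (rule C1_closure_gradient[OF C1_closure]) auto
  then have "continuous_on (closure (UNIV \<times> \<Omega>)) closure_grad \<and> (\<forall>p\<in>UNIV \<times> \<Omega>. closure_grad p = egrad z p)"
    unfolding closure_grad_def by (rule someI_ex)
  then show "continuous_on (closure (UNIV \<times> \<Omega>)) closure_grad" "p \<in> slab \<Omega> \<Longrightarrow> closure_grad p = egrad z p"
    by (auto simp: slab_def)
qed

lemma bounded_z_egrad:
  obtains M where "M > 0" "\<And>p. p \<in> slab \<Omega> \<Longrightarrow> \<bar>z p\<bar> \<le> M" "\<And>p. p \<in> slab \<Omega> \<Longrightarrow> norm (egrad z p) \<le> M"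
proof -
  obtain M N where M: "M > 0" "\<And>p. p \<in> slab \<Omega> \<Longrightarrow> norm (z p) \<le> M"
    and N: "N > 0" "\<And>p. p \<in> slab \<Omega> \<Longrightarrow> norm (closure_grad p) \<le> N"
    using bounded_on_slab[OF continuous_on_closure_z] bounded_on_slab[OF continuous_on_closure_grad] by metis
  show ?thesis
    by (rule that[of "max M N"]) (use M N in \<open>auto simp: closure_grad_eq le_max_iff_disj\<close>)
qed

lemma closure_grad_normal:
  assumes p: "p \<in> frontier (UNIV \<times> \<Omega>)" "p \<in> DD" and defining: "local_defining \<Omega> (snd p) V \<phi>"
  obtains l where "closure_grad p = (0, l *\<^sub>R grad \<phi> (snd p))"
proof -
  interpret chart: boundary_chart "slab \<Omega>" "slab V" p "\<lambda>q. \<phi> (snd q)" "\<lambda>q. (0, grad \<phi> (snd q))"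
    by (rule slab_boundary_chart[OF open_\<Omega> defining p(2)])
  have closure: "closure (slab \<Omega>) \<subseteq> closure (UNIV \<times> \<Omega>)" by (rule closure_mono[OF slab_subset(1)])
  have "p \<in> closure (DD \<inter> (UNIV \<times> \<Omega>))"
    using p open_Int_closure_subset[OF open_DD, of "UNIV \<times> \<Omega>"] by (auto simp: frontier_def)
  moreover have "p \<notin> UNIV \<times> \<Omega>"
    using p(1) open_\<Omega> unfolding frontier_cylinder by (auto simp: frontier_def interior_open)
  ultimately have frontier: "p \<in> frontier (slab \<Omega>)"
    by (simp add: frontier_def interior_open[OF open_slab[OF open_\<Omega>]]) (simp add: slab_def Int_commute)
  interpret boundary_vanishing "slab \<Omega>" "slab V" p "\<lambda>q. \<phi> (snd q)" "\<lambda>q. (0, grad \<phi> (snd q))" z "egrad z" closure_grad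
  proof
    show "z q = 0" if "q \<in> slab V" "q \<in> frontier (slab \<Omega>)" for q
      using that zero_on_boundary frontier_slab[OF open_\<Omega> that(2)] slab_subset(2) by blast
  qed (use frontier C1_deriv_z closure_grad_eq continuous_on_subset[OF continuous_on_closure_z closure]
      continuous_on_subset[OF continuous_on_closure_grad closure] in auto)
  from gradient_normal show ?thesis using that by (metis scaleR_Pair scaleR_zero_right)
qed

end

lemma C1_deriv_snd: "C1_deriv UNIV \<eta> (\<lambda>x v. N x \<bullet> v) \<Longrightarrow> C1_deriv S (\<lambda>p. \<eta> (snd p)) (\<lambda>p v. N (snd p) \<bullet> snd v)"
  by (rule C1_deriv_compose_linear[where T=UNIV and L=snd]) (auto intro: bounded_linear_snd)

lemma continuous_on_snd_compose: "continuous_on UNIV N \<Longrightarrow> continuous_on S (\<lambda>p. N (snd p))"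
  by (rule continuous_on_compose2[where t=UNIV]) (auto intro: continuous_intros)

lemma C1_deriv_ff_powr:
  "S \<subseteq> DD \<Longrightarrow> C1_deriv S (\<lambda>p. ff p powr c) (\<lambda>p v. c * ff p powr (c - 1) * ((mink p \<bullet> v) / 2))"
  by (rule C1_deriv_powr[OF C1_deriv_ff]) (auto simp: DD_def)

lemma continuous_on_ff_powr: "S \<subseteq> DD \<Longrightarrow> continuous_on S (\<lambda>p. ff p powr c)"
  by (rule C1_deriv_continuous_on[OF C1_deriv_ff_powr])

section \<open>A Caccioppoli inequality\<close>

definition slab_integral :: "(real^'n) set \<Rightarrow> ((real^'m) \<times> (real^'n) \<Rightarrow> real) \<Rightarrow> ennreal" where
  "slab_integral \<Omega> h = (\<integral>\<^sup>+p\<in>slab \<Omega>. ennreal (h p) \<partial>lborel)"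

lemma slab_integral_mono: "(\<And>p. p \<in> slab \<Omega> \<Longrightarrow> g p \<le> h p) \<Longrightarrow> slab_integral \<Omega> g \<le> slab_integral \<Omega> h"
  unfolding slab_integral_def by (intro nn_integral_mono) (auto simp: indicator_def intro: ennreal_leI)

text \<open>The bracket on the right-hand side is the divergence of \<^term>\<open>(h * h * f powr (2 * a) * s) *\<^sub>R mink g\<close>,
  divided by \<^term>\<open>f powr (2 * a - 2)\<close>.\<close>

lemma caccioppoli_pointwise:
  fixes p g :: "(real^'m) \<times> (real^'n)" and N :: "real^'n"
  assumes f: "0 < f" "f \<le> R\<^sup>2" and p: "norm p \<le> 2 * R"
  shows "h\<^sup>2 * f\<^sup>2 * (snd g \<bullet> snd g) / 2
    \<le> 2 * (h\<^sup>2 * f\<^sup>2 * (fst g \<bullet> fst g)) + h\<^sup>2 * (f ^ 3 * b\<^sup>2) + (R\<^sup>2 + 4 * a\<^sup>2 * R\<^sup>2) * (h\<^sup>2 * s\<^sup>2) + 4 * ((N \<bullet> N) * f\<^sup>2 * s\<^sup>2)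
      + (h\<^sup>2 * (f\<^sup>2 * (s * b) + f\<^sup>2 * (g \<bullet> mink g) + a * f * (s * (p \<bullet> g))) + 2 * h * f\<^sup>2 * s * (N \<bullet> snd g))"
proof -
  have split: "g \<bullet> g = snd g \<bullet> snd g + fst g \<bullet> fst g" "g \<bullet> mink g = snd g \<bullet> snd g - fst g \<bullet> fst g"
    by (simp add: inner_prod_def) (simp add: inner_mink_self)
  have "0 \<le> f * (f * b + s / 2)\<^sup>2" using f by simp
  also have "\<dots> = f ^ 3 * b\<^sup>2 + f\<^sup>2 * (s * b) + f / 4 * s\<^sup>2"
    by (simp add: power2_eq_square power3_eq_cube algebra_simps)
  also have "\<dots> \<le> f ^ 3 * b\<^sup>2 + f\<^sup>2 * (s * b) + R\<^sup>2 * s\<^sup>2" using f by (intro add_left_mono mult_right_mono) auto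
  finally have source: "0 \<le> f ^ 3 * b\<^sup>2 + f\<^sup>2 * (s * b) + R\<^sup>2 * s\<^sup>2" .
  have "p \<bullet> p \<le> 4 * R\<^sup>2" using power_mono[OF p, of 2] by (simp add: power2_norm_eq_inner power_mult_distrib)
  then have "(a * s)\<^sup>2 * (p \<bullet> p) \<le> (a * s)\<^sup>2 * (4 * R\<^sup>2)" by (intro mult_left_mono) auto
  moreover have "0 \<le> ((f / 2) *\<^sub>R g + (a * s) *\<^sub>R p) \<bullet> ((f / 2) *\<^sub>R g + (a * s) *\<^sub>R p)" by (rule inner_ge_zero)
  ultimately have weight: "0 \<le> f\<^sup>2 * (g \<bullet> g) / 4 + a * f * (s * (p \<bullet> g)) + 4 * a\<^sup>2 * R\<^sup>2 * s\<^sup>2"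
    by (simp add: inner_add_left inner_add_right inner_commute[of g p] power2_eq_square algebra_simps)
  have "0 \<le> ((h / 2) *\<^sub>R snd g + (2 * s) *\<^sub>R N) \<bullet> ((h / 2) *\<^sub>R snd g + (2 * s) *\<^sub>R N)" by (rule inner_ge_zero)
  then have cutoff: "0 \<le> h\<^sup>2 * (snd g \<bullet> snd g) / 4 + 2 * h * (s * (N \<bullet> snd g)) + 4 * (N \<bullet> N) * s\<^sup>2"
    by (simp add: inner_add_left inner_add_right inner_commute[of "snd g" N] power2_eq_square algebra_simps)
  have "0 \<le> 3 / 4 * (h\<^sup>2 * f\<^sup>2 * (fst g \<bullet> fst g))" by simp
  then have "0 \<le> h\<^sup>2 * (f ^ 3 * b\<^sup>2 + f\<^sup>2 * (s * b) + R\<^sup>2 * s\<^sup>2)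
      + h\<^sup>2 * (f\<^sup>2 * (g \<bullet> g) / 4 + a * f * (s * (p \<bullet> g)) + 4 * a\<^sup>2 * R\<^sup>2 * s\<^sup>2)
      + f\<^sup>2 * (h\<^sup>2 * (snd g \<bullet> snd g) / 4 + 2 * h * (s * (N \<bullet> snd g)) + 4 * (N \<bullet> N) * s\<^sup>2)
      + 3 / 4 * (h\<^sup>2 * f\<^sup>2 * (fst g \<bullet> fst g))"
    by (intro add_nonneg_nonneg mult_nonneg_nonneg[OF zero_le_power2] source weight cutoff)
  then show ?thesis unfolding split by (simp add: algebra_simps add_divide_distrib)
qed

context dirichlet_function
begin

lemma C1_div_caccioppoli_field:
  assumes \<eta>: "C1_deriv UNIV \<eta> (\<lambda>x v. N x \<bullet> v)"
  shows "C1_div (slab \<Omega>) (\<lambda>p. ((\<eta> (snd p) * \<eta> (snd p)) * (ff p powr (2 * a) * z p)) *\<^sub>R mink (closure_grad p))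
    (\<lambda>p. ff p powr (2 * a - 2) * ((\<eta> (snd p))\<^sup>2 * ((ff p)\<^sup>2 * (z p * box z p) + (ff p)\<^sup>2 * (egrad z p \<bullet> mink (egrad z p))
        + a * ff p * (z p * (p \<bullet> egrad z p))) + 2 * \<eta> (snd p) * (ff p)\<^sup>2 * z p * (N (snd p) \<bullet> snd (egrad z p))))"
proof -
  note factor = C1_deriv_mult[OF C1_deriv_mult[OF C1_deriv_snd[OF \<eta>] C1_deriv_snd[OF \<eta>]]
      C1_deriv_mult[OF C1_deriv_ff_powr[OF slab_subset(2), where c="2 * a"] C1_deriv_z]]
  show ?thesis
  proof (rule C1_div_cong[OF C1_div_cong_div[OF C1_div_scaleR[OF factor C1_div_mink_egrad]] open_slab[OF open_\<Omega>]])
    fix p :: "(real^'m) \<times> (real^'n)" assume "p \<in> slab \<Omega>"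
    then have ff_pos: "ff p > 0" and grad: "closure_grad p = egrad z p" by (auto simp: slab_bounds closure_grad_eq)
    have shift: "ff p powr (2 * a) = (ff p)\<^sup>2 * ff p powr (2 * a - 2)" "ff p powr (2 * a - 1) = ff p * ff p powr (2 * a - 2)"
      using powr_add_nat[OF ff_pos, of "2 * a - 2" 2] powr_add_nat[OF ff_pos, of "2 * a - 2" 1] by simp_all
    have mink: "mink p \<bullet> mink (egrad z p) = p \<bullet> egrad z p" by (simp add: inner_mink)
    show "\<eta> (snd p) * \<eta> (snd p) * (ff p powr (2 * a) * z p) * box z p
        + (\<eta> (snd p) * \<eta> (snd p) * (ff p powr (2 * a) * (egrad z p \<bullet> mink (egrad z p))
             + 2 * a * ff p powr (2 * a - 1) * (mink p \<bullet> mink (egrad z p) / 2) * z p)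
           + (\<eta> (snd p) * (N (snd p) \<bullet> snd (mink (egrad z p))) + N (snd p) \<bullet> snd (mink (egrad z p)) * \<eta> (snd p))
             * (ff p powr (2 * a) * z p))
      = ff p powr (2 * a - 2) * ((\<eta> (snd p))\<^sup>2 * ((ff p)\<^sup>2 * (z p * box z p) + (ff p)\<^sup>2 * (egrad z p \<bullet> mink (egrad z p))
        + a * ff p * (z p * (p \<bullet> egrad z p))) + 2 * \<eta> (snd p) * (ff p)\<^sup>2 * z p * (N (snd p) \<bullet> snd (egrad z p)))"
      unfolding shift mink snd_mink by (simp add: power2_eq_square algebra_simps)
    show "(\<eta> (snd p) * \<eta> (snd p) * (ff p powr (2 * a) * z p)) *\<^sub>R mink (egrad z p)
        = (\<eta> (snd p) * \<eta> (snd p) * (ff p powr (2 * a) * z p)) *\<^sub>R mink (closure_grad p)"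
      by (simp add: grad)
  qed
qed

lemma caccioppoli_field_decay:
  assumes \<eta>_range: "\<And>x. 0 \<le> \<eta> x \<and> \<eta> x \<le> 1" and a_ge_2: "a \<ge> 2"
  obtains C where
    "\<And>p. p \<in> slab \<Omega> \<Longrightarrow> norm (((\<eta> (snd p) * \<eta> (snd p)) * (ff p powr (2 * a) * z p)) *\<^sub>R mink (closure_grad p)) \<le> C * (ff p)\<^sup>2"
proof -
  obtain M where M: "M > 0" "\<And>p. p \<in> slab \<Omega> \<Longrightarrow> \<bar>z p\<bar> \<le> M" "\<And>p. p \<in> slab \<Omega> \<Longrightarrow> norm (egrad z p) \<le> M" by (rule bounded_z_egrad) blast
  have "norm (((\<eta> (snd p) * \<eta> (snd p)) * (ff p powr (2 * a) * z p)) *\<^sub>R mink (closure_grad p))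
      \<le> (R\<^sup>2) powr (2 * a - 2) * M * M * (ff p)\<^sup>2" if p: "p \<in> slab \<Omega>" for p
  proof -
    have shift: "ff p powr (2 * a) = (ff p)\<^sup>2 * ff p powr (2 * a - 2)"
      using powr_add_nat[OF slab_bounds(2)[OF p], of "2 * a - 2" 2] by simp
    have "norm (((\<eta> (snd p) * \<eta> (snd p)) * (ff p powr (2 * a) * z p)) *\<^sub>R mink (closure_grad p))
        = (\<eta> (snd p) * \<eta> (snd p)) * (ff p powr (2 * a) * \<bar>z p\<bar> * norm (egrad z p))"
      using \<eta>_range[of "snd p"] by (simp add: closure_grad_eq[OF p] abs_mult)
    also have "\<dots> \<le> 1 * ((ff p)\<^sup>2 * (R\<^sup>2) powr (2 * a - 2) * M * M)"
      unfolding shift using \<eta>_range[of "snd p"] M p slab_bounds[OF p] a_ge_2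
      by (intro mult_mono mult_le_one powr_mono2) auto
    finally show ?thesis by (simp add: mult_ac)
  qed
  then show ?thesis by (rule that)
qed

lemma caccioppoli:
  assumes \<eta>: "C1_deriv UNIV \<eta> (\<lambda>x v. N x \<bullet> v)" and N: "continuous_on UNIV N"
    and \<eta>_range: "\<And>x. 0 \<le> \<eta> x \<and> \<eta> x \<le> 1" and a_ge_2: "a \<ge> 2"
  shows "slab_integral \<Omega> (\<lambda>p. (\<eta> (snd p))\<^sup>2 * ff p powr (2 * a) * (snd (egrad z p) \<bullet> snd (egrad z p)) / 2)
    \<le> slab_integral \<Omega> (\<lambda>p. 2 * ((\<eta> (snd p))\<^sup>2 * ff p powr (2 * a) * (fst (egrad z p) \<bullet> fst (egrad z p)))
        + (\<eta> (snd p))\<^sup>2 * (ff p powr (2 * a + 1) * (box z p)\<^sup>2)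
        + (R\<^sup>2 + 4 * a\<^sup>2 * R\<^sup>2) * ((\<eta> (snd p))\<^sup>2 * ff p powr (2 * a - 2) * (z p)\<^sup>2)
        + 4 * ((N (snd p) \<bullet> N (snd p)) * ff p powr (2 * a) * (z p)\<^sup>2))"
    (is "slab_integral \<Omega> ?L \<le> slab_integral \<Omega> ?F")
proof -
  let ?P = "\<lambda>p. ff p powr (2 * a - 2)"
  define \<delta> where "\<delta> p = ?P p * ((\<eta> (snd p))\<^sup>2 * ((ff p)\<^sup>2 * (z p * box z p) + (ff p)\<^sup>2 * (egrad z p \<bullet> mink (egrad z p))
        + a * ff p * (z p * (p \<bullet> egrad z p))) + 2 * \<eta> (snd p) * (ff p)\<^sup>2 * z p * (N (snd p) \<bullet> snd (egrad z p)))" for p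
  have density_le: "?L p \<le> ?F p + \<delta> p" if p: "p \<in> slab \<Omega>" for p
  proof -
    have shift: "ff p powr (2 * a) = (ff p)\<^sup>2 * ?P p" "ff p powr (2 * a + 1) = ff p ^ 3 * ?P p"
      using powr_add_nat[OF slab_bounds(2)[OF p], of "2 * a - 2" 2] powr_add_nat[OF slab_bounds(2)[OF p], of "2 * a - 2" 3]
      by (simp_all add: add.commute)
    show ?thesis
      using mult_left_mono[OF caccioppoli_pointwise[OF slab_bounds(2,6,5)[OF p], of "\<eta> (snd p)" "egrad z p" "box z p" a "z p" "N (snd p)"],
          of "?P p"]
      unfolding shift \<delta>_def by (simp add: algebra_simps)
  qed
  obtain C where decay: "\<And>p. p \<in> slab \<Omega> \<Longrightarrow>
      norm (((\<eta> (snd p) * \<eta> (snd p)) * (ff p powr (2 * a) * z p)) *\<^sub>R mink (closure_grad p)) \<le> C * (ff p)\<^sup>2"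
    by (rule caccioppoli_field_decay[OF \<eta>_range a_ge_2]) (rule that)
  have "slab_integral \<Omega> ?L \<le> slab_integral \<Omega> (\<lambda>p. ?F p + \<delta> p)" by (rule slab_integral_mono[OF density_le])
  also have "\<dots> \<le> slab_integral \<Omega> ?F"
    unfolding slab_integral_def
  proof (rule divergence_inequality_slab[OF C1_div_caccioppoli_field[OF \<eta>, of a, folded \<delta>_def] _ decay])
    show "snd (((\<eta> (snd p) * \<eta> (snd p)) * (ff p powr (2 * a) * z p)) *\<^sub>R mink (closure_grad p)) \<bullet> grad \<phi> (snd p) \<le> 0"
      if "p \<in> frontier (UNIV \<times> \<Omega>)" "p \<in> DD" for p V \<phi>
      using zero_on_boundary[OF that] by simp
    show "continuous_on (closure (UNIV \<times> \<Omega>) \<inter> DD)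
        (\<lambda>p. ((\<eta> (snd p) * \<eta> (snd p)) * (ff p powr (2 * a) * z p)) *\<^sub>R mink (closure_grad p))"
      by (intro continuous_on_scaleR continuous_on_mult C1_deriv_continuous_on[OF C1_deriv_snd[OF \<eta>]] continuous_on_ff_powr
          continuous_on_subset[OF continuous_on_closure_z] bounded_linear.continuous_on[OF bounded_linear_mink]
          continuous_on_subset[OF continuous_on_closure_grad]) auto
    show "continuous_on (slab \<Omega>) ?F"
      by (intro continuous_on_add continuous_on_mult continuous_on_const continuous_on_power continuous_on_inner
          continuous_on_fst continuous_on_snd continuous_on_snd_compose[OF N] C1_deriv_continuous_on[OF C1_deriv_snd[OF \<eta>]]
          continuous_on_ff_powr slab_subset continuous_on_box continuous_on_egrad continuous_on_z)
    show "0 \<le> ?F p" for p by (auto intro!: add_nonneg_nonneg mult_nonneg_nonneg)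
    show "0 \<le> ?F p + \<delta> p" if "p \<in> slab \<Omega>" for p by (rule order_trans[OF _ density_le[OF that]]) simp
  qed
  finally show ?thesis .
qed

end

section \<open>The localized Carleman inequality\<close>

context dirichlet_function
begin

lemma slab_subset_exterior: "slab \<Omega> \<subseteq> (exterior e :: ((real^'m) \<times> (real^'n)) set)"
  and closure_subset_exterior: "closure (UNIV \<times> \<Omega>) \<inter> DD \<subseteq> (exterior e :: ((real^'m) \<times> (real^'n)) set)"
  if small: "e > 0" "e * R \<le> 1 / 4"
proof -
  have "\<Omega> \<subseteq> cball 0 R" using norm_less by force
  then have "closure \<Omega> \<subseteq> cball 0 R" by (rule closure_minimal) simp
  then have rr_le: "rr p \<le> R" if "p \<in> closure (UNIV \<times> \<Omega>)" for p :: "(real^'m) \<times> (real^'n)"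
    using that by (auto simp: closure_Times rr_def)
  have in_exterior: "p \<in> exterior e" if "p \<in> closure (UNIV \<times> \<Omega>) \<inter> DD" for p :: "(real^'m) \<times> (real^'n)"
    by (rule exterior_of_bounded(1)[OF IntD2[OF that] rr_le[OF IntD1[OF that]] small])
  then show "closure (UNIV \<times> \<Omega>) \<inter> DD \<subseteq> (exterior e :: ((real^'m) \<times> (real^'n)) set)" by (rule subsetI)
  have "p \<in> closure (UNIV \<times> \<Omega>) \<inter> DD" if "p \<in> slab \<Omega>" for p :: "(real^'m) \<times> (real^'n)"
    using that closure_subset[of "UNIV \<times> \<Omega>"] unfolding slab_def by blast
  then show "slab \<Omega> \<subseteq> (exterior e :: ((real^'m) \<times> (real^'n)) set)" by (intro subsetI in_exterior)
qed

lemma current_inward: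
  assumes e: "e > 0" "e * R \<le> 1 / 4" and p: "p \<in> frontier (UNIV \<times> \<Omega>)" "p \<in> DD" "snd p \<notin> Gamma_plus \<Omega>"
    and defining: "local_defining \<Omega> (snd p) V \<phi>"
  shows "snd (current a e d p (z p) (closure_grad p)) \<bullet> grad \<phi> (snd p) \<le> 0"
proof -
  have "snd p \<in> frontier \<Omega>" using p(1) by (simp add: frontier_cylinder mem_Times_iff)
  then have "snd p \<bullet> grad \<phi> (snd p) \<le> 0" using inward_radial_outside_Gamma_plus[OF defining _ open_\<Omega>] p(3) by blast
  moreover have "p \<in> exterior e" using closure_subset_exterior[OF e] p by (auto simp: frontier_def)
  moreover obtain l where "closure_grad p = (0, l *\<^sub>R grad \<phi> (snd p))" by (rule closure_grad_normal[OF p(1,2) defining])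
  ultimately show ?thesis using current_boundary_sign e(1) zero_on_boundary[OF p(1,2)] by simp
qed

lemma current_decay:
  assumes e: "e > 0" "e * R \<le> 1 / 4" and d_nonneg: "d \<ge> 0" and a_ge_2: "a \<ge> 2"
  obtains C where "\<And>p. p \<in> slab \<Omega> \<Longrightarrow> norm (current a e d p (z p) (egrad z p)) \<le> C * (ff p)\<^sup>2"
proof -
  have "a > 0" using a_ge_2 by simp
  then obtain K where K: "K > 0" "\<And>p s g. \<lbrakk>p \<in> (DD :: ((real^'m) \<times> (real^'n)) set); rr p \<le> R\<rbrakk> \<Longrightarrow>
     norm (current a e d p s g) \<le> K * weighted_energy a p s g"
    using norm_current_le[OF _ radius_pos e d_nonneg] by blast
  obtain M where M: "M > 0" "\<And>p. p \<in> slab \<Omega> \<Longrightarrow> \<bar>z p\<bar> \<le> M" "\<And>p. p \<in> slab \<Omega> \<Longrightarrow> norm (egrad z p) \<le> M" by (rule bounded_z_egrad) blast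
  let ?C = "((R\<^sup>2) powr (2 * a - 2) + (R\<^sup>2) powr (2 * a - 4)) * M\<^sup>2"
  have "norm (current a e d p (z p) (egrad z p)) \<le> K * ?C * (ff p)\<^sup>2" if p: "p \<in> slab \<Omega>" for p
  proof -
    have bounds: "p \<in> DD" "rr p \<le> R" using slab_bounds[OF p] by auto
    have "norm (current a e d p (z p) (egrad z p)) \<le> K * weighted_energy a p (z p) (egrad z p)" by (rule K(2)[OF bounds])
    also have "\<dots> \<le> K * (?C * (ff p)\<^sup>2)"
      using K(1) M(2,3)[OF p] by (intro mult_left_mono weighted_energy_le_ff_sq[OF bounds a_ge_2]) auto
    finally show ?thesis by (simp add: mult.assoc)
  qed
  then show ?thesis using that by blast
qed

lemma C1_div_current_slab:
  assumes e: "e > 0" "e * R \<le> 1 / 4"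
  shows "C1_div (slab \<Omega>) (\<lambda>p. current a e d p (z p) (egrad z p)) (\<lambda>p. current_div a e d p (z p) (egrad z p) (box z p))"
  using C1_div_current[OF open_slab[OF open_\<Omega>] slab_subset_exterior[OF e] C1_deriv_z C1_deriv_egrad, of a d]
  by (simp add: box_eq_trace)

definition source :: "real \<Rightarrow> real \<Rightarrow> (real^'m) \<times> (real^'n) \<Rightarrow> real" where
  "source a e p = ff p / (2 * a) * (weight a e p * box z p)\<^sup>2"

lemma continuous_on_source:
  assumes e: "e > 0" "e * R \<le> 1 / 4" shows "continuous_on (slab \<Omega>) (source a e)"
proof -
  have "source a e = (\<lambda>p. (1 / (2 * a)) * ff p * (weight a e p * box z p)\<^sup>2)" by (simp add: source_def fun_eq_iff)
  then show ?thesis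
    by (simp only:) (intro continuous_intros continuous_on_ff continuous_on_box
        continuous_on_subset[OF C1_deriv_continuous_on[OF C1_deriv_weight] slab_subset_exterior[OF e]])
qed

lemma carleman_localized:
  assumes a_ge_2: "a \<ge> 2" and e: "e > 0" "e * R \<le> 1 / 4" and d_nonneg: "d \<ge> 0"
    and \<theta>: "C1_deriv UNIV \<theta> (\<lambda>x v. N x \<bullet> v)" and N: "continuous_on UNIV N"
    and \<theta>_range: "\<And>x. 0 \<le> \<theta> x \<and> \<theta> x \<le> 1" and \<theta>_zero: "\<And>x. x \<in> Gamma_plus \<Omega> \<Longrightarrow> \<theta> x = 0"
  defines "J \<equiv> \<lambda>p. current a e d p (z p) (egrad z p)"
    and "\<delta> \<equiv> \<lambda>p. current_div a e d p (z p) (egrad z p) (box z p)"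
  assumes nonneg: "\<And>p. p \<in> slab \<Omega> \<Longrightarrow> 0 \<le> \<delta> p + source a e p"
  shows "slab_integral \<Omega> (\<lambda>p. \<theta> (snd p) * (\<delta> p + source a e p))
      \<le> slab_integral \<Omega> (\<lambda>p. \<theta> (snd p) * source a e p + \<bar>N (snd p) \<bullet> snd (J p)\<bar>)"
      (is "_ \<le> slab_integral \<Omega> ?F")
proof -
  let ?W = "\<lambda>p. \<theta> (snd p) *\<^sub>R current a e d p (z p) (closure_grad p)" and ?\<delta> = "\<lambda>p. \<theta> (snd p) * \<delta> p + N (snd p) \<bullet> snd (J p)"
  note C1_div_J = C1_div_current_slab[OF e, of a d, folded J_def \<delta>_def]
  have C1_div_W: "C1_div (slab \<Omega>) ?W ?\<delta>"
    by (rule C1_div_cong[OF C1_div_scaleR[OF C1_deriv_snd[OF \<theta>] C1_div_J] open_slab[OF open_\<Omega>]])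
      (simp add: J_def closure_grad_eq)
  note continuous_on_\<theta> = C1_deriv_continuous_on[OF C1_deriv_snd[OF \<theta>]]
  have localized_le: "\<theta> (snd p) * (\<delta> p + source a e p) \<le> ?F p + ?\<delta> p" for p by (simp add: distrib_left)
  obtain C where decay: "\<And>p. p \<in> slab \<Omega> \<Longrightarrow> norm (J p) \<le> C * (ff p)\<^sup>2"
    using current_decay[OF e d_nonneg a_ge_2] unfolding J_def by blast
  have "slab_integral \<Omega> (\<lambda>p. \<theta> (snd p) * (\<delta> p + source a e p)) \<le> slab_integral \<Omega> (\<lambda>p. ?F p + ?\<delta> p)"
    by (rule slab_integral_mono[OF localized_le])
  also have "\<dots> \<le> slab_integral \<Omega> ?F"
    unfolding slab_integral_def
  proof (rule divergence_inequality_slab[OF C1_div_W])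
    show "norm (?W p) \<le> C * (ff p)\<^sup>2" if p: "p \<in> slab \<Omega>" for p
    proof -
      have "norm (?W p) = \<theta> (snd p) * norm (J p)" using \<theta>_range[of "snd p"] by (simp add: J_def closure_grad_eq[OF p])
      also have "\<dots> \<le> 1 * (C * (ff p)\<^sup>2)" using \<theta>_range[of "snd p"] decay[OF p] by (intro mult_mono) auto
      finally show ?thesis by simp
    qed
    show "snd (?W p) \<bullet> grad \<phi> (snd p) \<le> 0"
      if p: "p \<in> frontier (UNIV \<times> \<Omega>)" "p \<in> DD" and defining: "local_defining \<Omega> (snd p) V \<phi>" for p V \<phi>
      using current_inward[OF e p _ defining, of a d] \<theta>_range[of "snd p"] \<theta>_zero[of "snd p"]
      by (cases "snd p \<in> Gamma_plus \<Omega>") (simp_all add: mult_nonneg_nonpos)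
    show "continuous_on (closure (UNIV \<times> \<Omega>) \<inter> DD) ?W"
      by (intro continuous_on_scaleR continuous_on_\<theta> continuous_on_current[OF closure_subset_exterior[OF e]]
          continuous_on_subset[OF continuous_on_closure_z] continuous_on_subset[OF continuous_on_closure_grad]) auto
    show "continuous_on (slab \<Omega>) ?F"
      by (intro continuous_intros continuous_on_\<theta> continuous_on_source e continuous_on_snd_compose[OF N]
          C1_div_continuous_on[OF C1_div_J])
    show "0 \<le> ?F p" if "p \<in> slab \<Omega>" for p
      unfolding source_def using \<theta>_range[of "snd p"] slab_bounds(2)[OF that] a_ge_2 by simp
    show "0 \<le> ?F p + ?\<delta> p" if "p \<in> slab \<Omega>" for p
      using nonneg[OF that] \<theta>_range[of "snd p"] by (intro order_trans[OF mult_nonneg_nonneg localized_le]) auto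
  qed
  finally show ?thesis .
qed

end

section \<open>The Carleman estimate\<close>

lemma slab_integral_le_lincomb:
  fixes h1 h2 :: "(real^'m) \<times> (real^'n) \<Rightarrow> real"
  assumes "open \<Omega>" and h1: "continuous_on (slab \<Omega>) h1" "\<And>p. p \<in> slab \<Omega> \<Longrightarrow> 0 \<le> h1 p"
    and h2: "continuous_on (slab \<Omega>) h2" "\<And>p. p \<in> slab \<Omega> \<Longrightarrow> 0 \<le> h2 p" and coeffs_nonneg: "c1 \<ge> 0" "c2 \<ge> 0"
    and g_le: "\<And>p. p \<in> slab \<Omega> \<Longrightarrow> g p \<le> c1 * h1 p + c2 * h2 p"
  shows "slab_integral \<Omega> g \<le> ennreal c1 * slab_integral \<Omega> h1 + ennreal c2 * slab_integral \<Omega> h2"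
proof -
  note [measurable] = borel_measurable_indicator_on_open[OF open_slab[OF \<open>open \<Omega>\<close>] h1(1)]
    borel_measurable_indicator_on_open[OF open_slab[OF \<open>open \<Omega>\<close>] h2(1)]
  have "ennreal (g p) \<le> ennreal c1 * ennreal (h1 p) + ennreal c2 * ennreal (h2 p)" if "p \<in> slab \<Omega>" for p
    using ennreal_leI[OF g_le[OF that]] h1(2)[OF that] h2(2)[OF that] coeffs_nonneg by (simp add: ennreal_mult)
  then have "slab_integral \<Omega> g
    \<le> (\<integral>\<^sup>+p. ennreal c1 * (ennreal (h1 p) * indicator (slab \<Omega>) p) + ennreal c2 * (ennreal (h2 p) * indicator (slab \<Omega>) p) \<partial>lborel)"
    unfolding slab_integral_def by (intro nn_integral_mono) (auto simp: indicator_def)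
  also have "\<dots> = ennreal c1 * slab_integral \<Omega> h1 + ennreal c2 * slab_integral \<Omega> h2"
    by (simp add: slab_integral_def nn_integral_add nn_integral_cmult)
  finally show ?thesis .
qed

definition box_term :: "real \<Rightarrow> ((real^'m) \<times> (real^'n) \<Rightarrow> real) \<Rightarrow> (real^'m) \<times> (real^'n) \<Rightarrow> real" where
  "box_term a z p = ff p powr (2 * a + 1) * (box z p)\<^sup>2"

definition time_term :: "real \<Rightarrow> ((real^'m) \<times> (real^'n) \<Rightarrow> real) \<Rightarrow> (real^'m) \<times> (real^'n) \<Rightarrow> real" where
  "time_term a z p = ff p powr (2 * a - 2) * gradt_sq z p"

definition value_term :: "real \<Rightarrow> ((real^'m) \<times> (real^'n) \<Rightarrow> real) \<Rightarrow> (real^'m) \<times> (real^'n) \<Rightarrow> real" where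
  "value_term a z p = ff p powr (2 * a - 3) * (z p)\<^sup>2"

definition observation :: "real \<Rightarrow> (real^'n) set \<Rightarrow> (real^'n) set \<Rightarrow> ((real^'m) \<times> (real^'n) \<Rightarrow> real) \<Rightarrow> ennreal" where
  "observation a \<Omega> \<omega> z = slab_integral \<Omega> (box_term a z) + slab_integral \<omega> (time_term a z) + slab_integral \<omega> (value_term a z)"

lemma terms_nonneg: "0 \<le> box_term a z p" "0 \<le> time_term a z p" "0 \<le> value_term a z p"
  by (simp_all add: box_term_def time_term_def value_term_def gradt_sq_def sum_nonneg)

definition carleman_density :: "real \<Rightarrow> ((real^'m) \<times> (real^'n) \<Rightarrow> real) \<Rightarrow> (real^'m) \<times> (real^'n) \<Rightarrow> real" where
  "carleman_density a z p = ff p powr (2 * a) * (1 / rr p * energy_density p (egrad z p) + 1 / sqrt (ff p) * (z p)\<^sup>2)"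

context dirichlet_function
begin

lemma continuous_on_box_term: "continuous_on (slab \<Omega>) (box_term a z)"
  unfolding box_term_def by (intro continuous_on_mult continuous_on_power continuous_on_ff_powr slab_subset continuous_on_box)

lemma gradt_sq_egrad: "p \<in> slab \<Omega> \<Longrightarrow> gradt_sq z p = fst (egrad z p) \<bullet> fst (egrad z p)"
  by (rule gradt_sq_eq[OF differentiable_z])

lemma continuous_on_time_term: "continuous_on (slab \<Omega>) (time_term a z)"
proof (rule continuous_on_eq)
  show "continuous_on (slab \<Omega>) (\<lambda>p. ff p powr (2 * a - 2) * (fst (egrad z p) \<bullet> fst (egrad z p)))"
    by (intro continuous_on_mult continuous_on_inner continuous_on_fst continuous_on_ff_powr slab_subset continuous_on_egrad)
qed (simp add: time_term_def gradt_sq_egrad)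

lemma continuous_on_value_term: "continuous_on (slab \<Omega>) (value_term a z)"
  unfolding value_term_def by (intro continuous_on_mult continuous_on_power continuous_on_ff_powr slab_subset continuous_on_z)

lemma slab_integral_le_observation:
  fixes g :: "(real^'m) \<times> (real^'n) \<Rightarrow> real"
  assumes \<omega>: "open \<omega>" "\<omega> \<subseteq> \<Omega>" and c_nonneg: "c \<ge> 0"
    and outside: "\<And>p. p \<in> slab \<Omega> \<Longrightarrow> snd p \<notin> \<omega> \<Longrightarrow> g p \<le> c * box_term a z p"
    and inside: "\<And>p. p \<in> slab \<Omega> \<Longrightarrow> snd p \<in> \<omega> \<Longrightarrow> g p \<le> c * (box_term a z p + time_term a z p + value_term a z p)"
  shows "slab_integral \<Omega> g \<le> ennreal c * observation a \<Omega> \<omega> z"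
proof -
  have slab_mono: "slab \<omega> \<subseteq> (slab \<Omega> :: ((real^'m) \<times> (real^'n)) set)" using \<omega>(2) by (auto simp: slab_def)
  note [measurable] = borel_measurable_indicator_on_open[OF open_slab[OF open_\<Omega>] continuous_on_box_term]
    borel_measurable_indicator_on_open[OF open_slab[OF \<omega>(1)] continuous_on_subset[OF continuous_on_time_term slab_mono]]
    borel_measurable_indicator_on_open[OF open_slab[OF \<omega>(1)] continuous_on_subset[OF continuous_on_value_term slab_mono]]
  let ?h = "\<lambda>p. ennreal (box_term a z p) * indicator (slab \<Omega>) p + ennreal (time_term a z p) * indicator (slab \<omega>) p
      + ennreal (value_term a z p) * indicator (slab \<omega>) p"
  have g_le: "ennreal (g p) * indicator (slab \<Omega>) p \<le> ennreal c * ?h p" for p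
  proof (cases "p \<in> slab \<Omega>")
    case p: True
    show ?thesis
    proof (cases "snd p \<in> \<omega>")
      case True
      then have "p \<in> slab \<omega>" using p by (cases p) (simp add: slab_def)
      then show ?thesis
        using ennreal_leI[OF inside[OF p True]] p c_nonneg terms_nonneg[of a z p] by (simp add: ennreal_mult)
    next
      case False
      then have "p \<notin> slab \<omega>" by (cases p) (simp add: slab_def)
      then show ?thesis
        using ennreal_leI[OF outside[OF p False]] p c_nonneg terms_nonneg[of a z p] by (simp add: ennreal_mult)
    qed
  qed simp
  have "slab_integral \<Omega> g \<le> (\<integral>\<^sup>+p. ennreal c * ?h p \<partial>lborel)"
    unfolding slab_integral_def by (rule nn_integral_mono[OF g_le])
  also have "\<dots> = ennreal c * observation a \<Omega> \<omega> z"
    by (simp add: observation_def slab_integral_def nn_integral_cmult nn_integral_add)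
  finally show ?thesis .
qed

lemma ff_powr_shift_le:
  assumes "p \<in> slab \<Omega>" shows "ff p powr (c + real n) \<le> R ^ (2 * n) * ff p powr c"
proof -
  have "ff p ^ n \<le> (R\<^sup>2) ^ n" using slab_bounds[OF assms] by (intro power_mono) auto
  then show ?thesis
    unfolding powr_add_nat[OF slab_bounds(2)[OF assms]] by (intro mult_right_mono) (auto simp: power_mult)
qed

lemma carleman_density_nonneg: "p \<in> slab \<Omega> \<Longrightarrow> 0 \<le> carleman_density a z p"
  using energy_density_bounds(1)[of p R "egrad z p"] slab_bounds[of p] by (simp add: carleman_density_def)

lemma carleman_density_le_weighted_energy:
  assumes p: "p \<in> slab \<Omega>" shows "carleman_density a z p \<le> (5 * R + R ^ 3) * weighted_energy a p (z p) (egrad z p)"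
proof -
  let ?E = "weighted_energy a p (z p) (egrad z p)"
  have f: "ff p > 0" "sqrt (ff p) \<le> R" using slab_bounds[OF p] radius_pos by (auto simp: real_le_lsqrt)
  have "(ff p)\<^sup>2 / sqrt (ff p) = ff p * (ff p / sqrt (ff p))" by (simp add: power2_eq_square)
  also have "\<dots> = ff p * sqrt (ff p)" using f by (simp add: real_div_sqrt)
  also have "\<dots> \<le> R\<^sup>2 * R" using f slab_bounds[OF p] radius_pos by (intro mult_mono) auto
  finally have quotient: "(ff p)\<^sup>2 / sqrt (ff p) \<le> R ^ 3" by (simp add: power2_eq_square power3_eq_cube)
  have "ff p powr (2 * a) * (1 / rr p * energy_density p (egrad z p))
    \<le> ff p powr (2 * a) * (5 * R * (egrad z p \<bullet> egrad z p))"
    using energy_density_bounds(2)[OF slab_bounds(1,3)[OF p]] by (intro mult_left_mono) auto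
  also have "\<dots> = 5 * R * (ff p powr (2 * a) * (egrad z p \<bullet> egrad z p))" by simp
  also have "\<dots> \<le> 5 * R * ?E" using ff_powr_gradient_le[OF slab_bounds(1)[OF p]] radius_pos by (intro mult_left_mono) auto
  finally have gradient_part: "ff p powr (2 * a) * (1 / rr p * energy_density p (egrad z p)) \<le> 5 * R * ?E" .
  have "ff p powr (2 * a) * (1 / sqrt (ff p) * (z p)\<^sup>2) = 1 / sqrt (ff p) * (ff p powr (2 * a) * (z p)\<^sup>2)" by simp
  also have "\<dots> \<le> 1 / sqrt (ff p) * ((ff p)\<^sup>2 * ?E)"
    using ff_powr_value_le[OF slab_bounds(1)[OF p]] f by (intro mult_left_mono) auto
  also have "\<dots> = (ff p)\<^sup>2 / sqrt (ff p) * ?E" by simp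
  also have "\<dots> \<le> R ^ 3 * ?E" by (rule mult_right_mono[OF quotient weighted_energy_nonneg])
  finally show ?thesis using gradient_part by (simp add: carleman_density_def distrib_left distrib_right)
qed

end

definition spatial_const :: "real \<Rightarrow> real \<Rightarrow> real \<Rightarrow> real" where
  "spatial_const a R B = 2 * R ^ 4 + 1 + (R\<^sup>2 + 4 * a\<^sup>2 * R\<^sup>2) * R\<^sup>2 + 4 * (B\<^sup>2 * R ^ 6)"

definition local_const :: "real \<Rightarrow> real \<Rightarrow> real \<Rightarrow> real" where
  "local_const a R B = 2 * spatial_const a R B + (R ^ 4 + R\<^sup>2)"

definition current_const :: "real \<Rightarrow> real \<Rightarrow> real \<Rightarrow> real \<Rightarrow> real" where
  "current_const a R K B = 2 powr (2 * a) + B * K * local_const a R B"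

lemma spatial_const_pos: "spatial_const a R B > 0"
  unfolding spatial_const_def by (intro add_pos_nonneg add_nonneg_pos mult_nonneg_nonneg add_nonneg_nonneg) auto

lemma local_const_pos: "local_const a R B > 0"
  using spatial_const_pos[of a R B] by (simp add: local_const_def add_pos_nonneg)

locale localized_carleman = dirichlet_function \<Omega> R z + localizing_cutoffs "Gamma_plus \<Omega>" \<sigma> \<theta> \<eta> grad_\<theta> grad_\<eta>
  for \<Omega> :: "(real^'n) set" and R :: real and z :: "(real^'m) \<times> (real^'n) \<Rightarrow> real"
    and \<sigma> :: real and \<theta> \<eta> :: "real^'n \<Rightarrow> real" and grad_\<theta> grad_\<eta> :: "real^'n \<Rightarrow> real^'n" +
  fixes a e d C K B :: real
  assumes a_ge_2: "a \<ge> 2" and e_pos: "e > 0" and e_small: "e * R \<le> 1 / 4" and d_nonneg: "d \<ge> 0"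
    and C_pos: "C > 0" and K_pos: "K > 0" and B_pos: "B > 0"
    and pointwise: "\<And>p s g b. p \<in> (slab \<Omega> :: ((real^'m) \<times> (real^'n)) set) \<Longrightarrow>
      (weight a e p)\<^sup>2 * (1 / rr p * energy_density p g + 1 / sqrt (ff p) * s\<^sup>2)
        \<le> C * (current_div a e d p s g b + ff p / (2 * a) * (weight a e p * b)\<^sup>2)"
    and current_le: "\<And>p s g. p \<in> (slab \<Omega> :: ((real^'m) \<times> (real^'n)) set) \<Longrightarrow> norm (current a e d p s g) \<le> K * weighted_energy a p s g"
    and grad_\<theta>_le: "x \<in> \<Omega> \<Longrightarrow> norm (grad_\<theta> x) \<le> B" and grad_\<eta>_le: "x \<in> \<Omega> \<Longrightarrow> norm (grad_\<eta> x) \<le> B"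
begin

abbreviation "\<omega> \<equiv> nbhd \<sigma> (Gamma_plus \<Omega>) \<inter> \<Omega>"

lemma open_\<omega>: "open \<omega>"
proof -
  have "nbhd \<sigma> (Gamma_plus \<Omega>) = (\<Union>x\<in>Gamma_plus \<Omega>. ball x \<sigma>)" by (auto simp: nbhd_def dist_commute)
  then show ?thesis using open_\<Omega> by auto
qed

lemma \<eta>_outside:
  assumes "p \<in> slab \<Omega>" "snd p \<notin> \<omega>" shows "\<eta> (snd p) = 0" "grad_\<eta> (snd p) = 0"
  using \<eta>_support[of "snd p"] assms by (auto simp: nbhd_def slab_def)

lemma damp_bounds: "p \<in> slab \<Omega> \<Longrightarrow> 3 / 4 \<le> damp e p" "p \<in> slab \<Omega> \<Longrightarrow> damp e p \<le> 1" for p :: "(real^'m) \<times> (real^'n)"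
  using exterior_of_bounded(2,3)[OF _ _ e_pos e_small, of p] slab_bounds[of p] by auto

definition local_energy :: "(real^'m) \<times> (real^'n) \<Rightarrow> real" where
  "local_energy p = (\<eta> (snd p))\<^sup>2 * weighted_energy a p (z p) (egrad z p)"

definition spatial_energy :: "(real^'m) \<times> (real^'n) \<Rightarrow> real" where
  "spatial_energy p = (\<eta> (snd p))\<^sup>2 * ff p powr (2 * a) * (snd (egrad z p) \<bullet> snd (egrad z p)) / 2"

definition remainder_energy :: "(real^'m) \<times> (real^'n) \<Rightarrow> real" where
  "remainder_energy p = (\<eta> (snd p))\<^sup>2 * ff p powr (2 * a) * (fst (egrad z p) \<bullet> fst (egrad z p))
     + (\<eta> (snd p))\<^sup>2 * ff p powr (2 * a - 2) * (z p)\<^sup>2"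

lemma local_energy_eq: "local_energy p = 2 * spatial_energy p + remainder_energy p"
  by (simp add: local_energy_def spatial_energy_def remainder_energy_def weighted_energy_def inner_prod_def algebra_simps)

lemma energies_nonneg: "0 \<le> local_energy p" "0 \<le> spatial_energy p" "0 \<le> remainder_energy p"
  by (simp_all add: local_energy_def spatial_energy_def remainder_energy_def weighted_energy_nonneg)

lemma continuous_on_energies:
  "continuous_on (slab \<Omega>) spatial_energy" "continuous_on (slab \<Omega>) remainder_energy" "continuous_on (slab \<Omega>) local_energy"
proof -
  note intros = continuous_on_add continuous_on_mult continuous_on_divide continuous_on_const continuous_on_power
    continuous_on_inner continuous_on_fst continuous_on_snd C1_deriv_continuous_on[OF C1_deriv_snd[OF C1_\<eta>]]
    continuous_on_ff_powr slab_subset continuous_on_egrad continuous_on_z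
  show spatial: "continuous_on (slab \<Omega>) spatial_energy"
    unfolding spatial_energy_def by (intro intros) auto
  show remainder: "continuous_on (slab \<Omega>) remainder_energy"
    unfolding remainder_energy_def by (intro intros)
  show "continuous_on (slab \<Omega>) local_energy"
    unfolding local_energy_eq[abs_def] by (intro intros spatial remainder)
qed

lemma
  assumes p: "p \<in> slab \<Omega>"
  shows time_energy_le: "(\<eta> (snd p))\<^sup>2 * ff p powr (2 * a) * (fst (egrad z p) \<bullet> fst (egrad z p)) \<le> R ^ 4 * time_term a z p"
    and value_energy_le: "(\<eta> (snd p))\<^sup>2 * ff p powr (2 * a - 2) * (z p)\<^sup>2 \<le> R\<^sup>2 * value_term a z p"
    and cutoff_energy_le: "(grad_\<eta> (snd p) \<bullet> grad_\<eta> (snd p)) * ff p powr (2 * a) * (z p)\<^sup>2 \<le> B\<^sup>2 * R ^ 6 * value_term a z p"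
proof -
  have shift: "ff p powr (2 * a) \<le> R ^ 4 * ff p powr (2 * a - 2)" "ff p powr (2 * a - 2) \<le> R\<^sup>2 * ff p powr (2 * a - 3)"
    "ff p powr (2 * a) \<le> R ^ 6 * ff p powr (2 * a - 3)"
    using ff_powr_shift_le[OF p, of "2 * a - 2" 2] ff_powr_shift_le[OF p, of "2 * a - 3" 1]
      ff_powr_shift_le[OF p, of "2 * a - 3" 3] by simp_all
  have \<eta>: "(\<eta> (snd p))\<^sup>2 \<le> 1" using \<eta>_range[of "snd p"] by (simp add: power_le_one)
  have "snd p \<in> \<Omega>" using p by (auto simp: slab_def)
  then have grad_\<eta>: "grad_\<eta> (snd p) \<bullet> grad_\<eta> (snd p) \<le> B\<^sup>2"
    using power_mono[OF grad_\<eta>_le norm_ge_zero, of "snd p" 2] by (simp add: power2_norm_eq_inner)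
  have "(\<eta> (snd p))\<^sup>2 * (ff p powr (2 * a) * gradt_sq z p) \<le> 1 * (R ^ 4 * ff p powr (2 * a - 2) * gradt_sq z p)"
    using \<eta> shift by (intro mult_mono) (auto simp: gradt_sq_def sum_nonneg)
  then show "(\<eta> (snd p))\<^sup>2 * ff p powr (2 * a) * (fst (egrad z p) \<bullet> fst (egrad z p)) \<le> R ^ 4 * time_term a z p"
    by (simp add: time_term_def gradt_sq_egrad[OF p] mult.assoc)
  have "(\<eta> (snd p))\<^sup>2 * (ff p powr (2 * a - 2) * (z p)\<^sup>2) \<le> 1 * (R\<^sup>2 * ff p powr (2 * a - 3) * (z p)\<^sup>2)"
    using \<eta> shift by (intro mult_mono) auto
  then show "(\<eta> (snd p))\<^sup>2 * ff p powr (2 * a - 2) * (z p)\<^sup>2 \<le> R\<^sup>2 * value_term a z p"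
    by (simp add: value_term_def mult.assoc)
  have "(grad_\<eta> (snd p) \<bullet> grad_\<eta> (snd p)) * (ff p powr (2 * a) * (z p)\<^sup>2) \<le> B\<^sup>2 * (R ^ 6 * ff p powr (2 * a - 3) * (z p)\<^sup>2)"
    using grad_\<eta> shift by (intro mult_mono) auto
  then show "(grad_\<eta> (snd p) \<bullet> grad_\<eta> (snd p)) * ff p powr (2 * a) * (z p)\<^sup>2 \<le> B\<^sup>2 * R ^ 6 * value_term a z p"
    by (simp add: value_term_def mult.assoc)
qed

lemma spatial_energy_le_observation: "slab_integral \<Omega> spatial_energy \<le> ennreal (spatial_const a R B) * observation a \<Omega> \<omega> z"
proof -
  let ?F = "\<lambda>p. 2 * ((\<eta> (snd p))\<^sup>2 * ff p powr (2 * a) * (fst (egrad z p) \<bullet> fst (egrad z p)))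
      + (\<eta> (snd p))\<^sup>2 * (ff p powr (2 * a + 1) * (box z p)\<^sup>2)
      + (R\<^sup>2 + 4 * a\<^sup>2 * R\<^sup>2) * ((\<eta> (snd p))\<^sup>2 * ff p powr (2 * a - 2) * (z p)\<^sup>2)
      + 4 * ((grad_\<eta> (snd p) \<bullet> grad_\<eta> (snd p)) * ff p powr (2 * a) * (z p)\<^sup>2)"
  have "slab_integral \<Omega> spatial_energy \<le> slab_integral \<Omega> ?F"
    unfolding spatial_energy_def by (rule caccioppoli[OF C1_\<eta> continuous_grad_\<eta> \<eta>_range a_ge_2])
  also have "\<dots> \<le> ennreal (spatial_const a R B) * observation a \<Omega> \<omega> z"
  proof (rule slab_integral_le_observation[OF open_\<omega>])
    show "spatial_const a R B \<ge> 0" using spatial_const_pos[of a R B] by simp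
    fix p :: "(real^'m) \<times> (real^'n)" assume p: "p \<in> slab \<Omega>"
    show "?F p \<le> spatial_const a R B * box_term a z p" if "snd p \<notin> \<omega>"
      using \<eta>_outside[OF p that] terms_nonneg(1)[of a z p] spatial_const_pos[of a R B] by simp
    have "(\<eta> (snd p))\<^sup>2 * (ff p powr (2 * a + 1) * (box z p)\<^sup>2) \<le> 1 * box_term a z p"
      using \<eta>_range[of "snd p"] by (intro mult_mono) (auto simp: box_term_def power_le_one)
    moreover have "(R\<^sup>2 + 4 * a\<^sup>2 * R\<^sup>2) * ((\<eta> (snd p))\<^sup>2 * ff p powr (2 * a - 2) * (z p)\<^sup>2) \<le> (R\<^sup>2 + 4 * a\<^sup>2 * R\<^sup>2) * (R\<^sup>2 * value_term a z p)"
      by (intro mult_left_mono value_energy_le[OF p]) auto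
    ultimately have "?F p \<le> (2 * R ^ 4) * time_term a z p + 1 * box_term a z p
        + ((R\<^sup>2 + 4 * a\<^sup>2 * R\<^sup>2) * R\<^sup>2 + 4 * (B\<^sup>2 * R ^ 6)) * value_term a z p"
      using time_energy_le[OF p] cutoff_energy_le[OF p] by (simp add: algebra_simps)
    also have "\<dots> \<le> spatial_const a R B * time_term a z p + spatial_const a R B * box_term a z p + spatial_const a R B * value_term a z p"
      by (intro add_mono mult_right_mono terms_nonneg) (auto simp: spatial_const_def)
    finally show "?F p \<le> spatial_const a R B * (box_term a z p + time_term a z p + value_term a z p)"
      by (simp add: algebra_simps)
  qed auto
  finally show ?thesis .
qed

lemma local_energy_le_observation: "slab_integral \<Omega> local_energy \<le> ennreal (local_const a R B) * observation a \<Omega> \<omega> z"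
proof -
  have "slab_integral \<Omega> remainder_energy \<le> ennreal (R ^ 4 + R\<^sup>2) * observation a \<Omega> \<omega> z"
  proof (rule slab_integral_le_observation[OF open_\<omega>])
    fix p :: "(real^'m) \<times> (real^'n)" assume p: "p \<in> slab \<Omega>"
    show "remainder_energy p \<le> (R ^ 4 + R\<^sup>2) * box_term a z p" if "snd p \<notin> \<omega>"
      using \<eta>_outside[OF p that] terms_nonneg(1)[of a z p] by (simp add: remainder_energy_def)
    have "remainder_energy p \<le> R ^ 4 * time_term a z p + R\<^sup>2 * value_term a z p"
      unfolding remainder_energy_def using time_energy_le[OF p] value_energy_le[OF p] by linarith
    also have "\<dots> \<le> (R ^ 4 + R\<^sup>2) * time_term a z p + (R ^ 4 + R\<^sup>2) * value_term a z p"
      by (intro add_mono mult_right_mono terms_nonneg) auto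
    also have "\<dots> \<le> (R ^ 4 + R\<^sup>2) * (box_term a z p + time_term a z p + value_term a z p)"
      using terms_nonneg(1)[of a z p] by (simp add: distrib_left)
    finally show "remainder_energy p \<le> (R ^ 4 + R\<^sup>2) * (box_term a z p + time_term a z p + value_term a z p)" .
  qed auto
  moreover have "slab_integral \<Omega> local_energy \<le> ennreal 2 * slab_integral \<Omega> spatial_energy + ennreal 1 * slab_integral \<Omega> remainder_energy"
    using open_\<Omega> continuous_on_energies energies_nonneg by (intro slab_integral_le_lincomb) (auto simp: local_energy_eq)
  ultimately have "slab_integral \<Omega> local_energy
      \<le> ennreal 2 * (ennreal (spatial_const a R B) * observation a \<Omega> \<omega> z) + ennreal (R ^ 4 + R\<^sup>2) * observation a \<Omega> \<omega> z"
    using spatial_energy_le_observation by (elim order_trans) (auto intro!: add_mono mult_left_mono)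
  also have "\<dots> = ennreal (local_const a R B) * observation a \<Omega> \<omega> z"
    using spatial_const_pos[of a R B] by (simp add: local_const_def ennreal_mult distrib_right mult.assoc)
  finally show ?thesis .
qed

lemma density_le:
  assumes p: "p \<in> slab \<Omega>"
  shows "carleman_density a z p \<le> C * (current_div a e d p (z p) (egrad z p) (box z p) + source a e p)"
proof -
  have "0 \<le> 1 / rr p * energy_density p (egrad z p) + 1 / sqrt (ff p) * (z p)\<^sup>2"
    using energy_density_bounds(1)[OF slab_bounds(1,3)[OF p], of "egrad z p"] slab_bounds[OF p] by simp
  then have "carleman_density a z p
      \<le> (weight a e p)\<^sup>2 * (1 / rr p * energy_density p (egrad z p) + 1 / sqrt (ff p) * (z p)\<^sup>2)"
    unfolding carleman_density_def using weight_sq_bounds(1)[OF slab_bounds(1)[OF p] damp_bounds[OF p]] a_ge_2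
    by (intro mult_right_mono) auto
  also have "\<dots> \<le> C * (current_div a e d p (z p) (egrad z p) (box z p) + source a e p)"
    unfolding source_def by (rule pointwise[OF p])
  finally show ?thesis .
qed

lemma source_le:
  assumes p: "p \<in> slab \<Omega>" shows "0 \<le> source a e p" "source a e p \<le> 2 powr (2 * a) * box_term a z p"
proof -
  have ff_pos: "ff p > 0" and a_pos: "a > 0" using slab_bounds[OF p] a_ge_2 by auto
  show "0 \<le> source a e p" unfolding source_def using ff_pos a_pos by simp
  have "ff p / (2 * a) \<le> ff p / 1" using ff_pos a_ge_2 by (intro divide_left_mono) auto
  then have "source a e p \<le> ff p * ((2 powr (2 * a) * ff p powr (2 * a)) * (box z p)\<^sup>2)"
    unfolding source_def power_mult_distrib
    using weight_sq_bounds(2)[OF slab_bounds(1)[OF p] damp_bounds[OF p] a_pos] ff_pos by (intro mult_mono) auto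
  also have "\<dots> = 2 powr (2 * a) * box_term a z p"
    using powr_add_nat[OF ff_pos, of "2 * a" 1] by (simp add: box_term_def)
  finally show "source a e p \<le> 2 powr (2 * a) * box_term a z p" .
qed

lemma commutator_le:
  assumes p: "p \<in> slab \<Omega>"
  shows "\<bar>grad_\<theta> (snd p) \<bullet> snd (current a e d p (z p) (egrad z p))\<bar> \<le> B * K * local_energy p"
proof (cases "grad_\<theta> (snd p) = 0")
  case True
  then show ?thesis using B_pos K_pos energies_nonneg(1)[of p] by simp
next
  case False
  then have local: "local_energy p = weighted_energy a p (z p) (egrad z p)" using \<eta>_one by (simp add: local_energy_def)
  have \<Omega>: "snd p \<in> \<Omega>" using p by (auto simp: slab_def)
  let ?J = "current a e d p (z p) (egrad z p)"
  have "\<bar>grad_\<theta> (snd p) \<bullet> snd ?J\<bar> \<le> norm (grad_\<theta> (snd p)) * norm (snd ?J)" by (rule Cauchy_Schwarz_ineq2)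
  also have "\<dots> \<le> B * norm ?J"
    using grad_\<theta>_le[OF \<Omega>] B_pos norm_snd_le[of "snd ?J" "fst ?J"] by (intro mult_mono) auto
  also have "\<dots> \<le> B * (K * local_energy p)"
    unfolding local using current_le[OF p] B_pos by (intro mult_left_mono) auto
  finally show ?thesis by simp
qed

lemma div_source_nonneg: "p \<in> slab \<Omega> \<Longrightarrow> 0 \<le> current_div a e d p (z p) (egrad z p) (box z p) + source a e p"
  using order_trans[OF carleman_density_nonneg density_le] C_pos by (simp add: zero_le_mult_iff)

lemma localized_div_le_observation:
  "slab_integral \<Omega> (\<lambda>p. \<theta> (snd p) * (current_div a e d p (z p) (egrad z p) (box z p) + source a e p))
    \<le> ennreal (current_const a R K B) * observation a \<Omega> \<omega> z"
proof -
  have "slab_integral \<Omega> (\<lambda>p. \<theta> (snd p) * (current_div a e d p (z p) (egrad z p) (box z p) + source a e p))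
    \<le> slab_integral \<Omega> (\<lambda>p. \<theta> (snd p) * source a e p + \<bar>grad_\<theta> (snd p) \<bullet> snd (current a e d p (z p) (egrad z p))\<bar>)"
    by (rule carleman_localized[OF a_ge_2 e_pos e_small d_nonneg C1_\<theta> continuous_grad_\<theta> \<theta>_range \<theta>_zero div_source_nonneg])
  also have "\<dots> \<le> ennreal (2 powr (2 * a)) * slab_integral \<Omega> (box_term a z) + ennreal (B * K) * slab_integral \<Omega> local_energy"
  proof (rule slab_integral_le_lincomb[OF open_\<Omega> continuous_on_box_term terms_nonneg(1) continuous_on_energies(3) energies_nonneg(1)])
    fix p :: "(real^'m) \<times> (real^'n)" assume p: "p \<in> slab \<Omega>"
    have "\<theta> (snd p) * source a e p \<le> 1 * (2 powr (2 * a) * box_term a z p)"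
      using \<theta>_range[of "snd p"] source_le[OF p] by (intro mult_mono) auto
    then show "\<theta> (snd p) * source a e p + \<bar>grad_\<theta> (snd p) \<bullet> snd (current a e d p (z p) (egrad z p))\<bar>
      \<le> 2 powr (2 * a) * box_term a z p + B * K * local_energy p"
      using commutator_le[OF p] by simp
  qed (use B_pos K_pos in auto)
  also have "\<dots> \<le> ennreal (2 powr (2 * a)) * observation a \<Omega> \<omega> z + ennreal (B * K) * (ennreal (local_const a R B) * observation a \<Omega> \<omega> z)"
    by (intro add_mono mult_left_mono local_energy_le_observation) (auto simp: observation_def add.assoc)
  also have "\<dots> = ennreal (current_const a R K B) * observation a \<Omega> \<omega> z"
    using B_pos K_pos local_const_pos[of a R B] by (simp add: current_const_def ennreal_mult distrib_right mult.assoc)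
  finally show ?thesis .
qed

lemma density_bound_le_observation:
  assumes \<kappa>_nonneg: "\<kappa> \<ge> 0" and g: "\<And>p. p \<in> slab \<Omega> \<Longrightarrow> g p \<le> \<kappa> * carleman_density a z p"
  shows "slab_integral \<Omega> g \<le> ennreal (\<kappa> * (C * current_const a R K B + (5 * R + R ^ 3) * local_const a R B)) * observation a \<Omega> \<omega> z"
proof -
  let ?w = "\<lambda>p. \<theta> (snd p) * (current_div a e d p (z p) (egrad z p) (box z p) + source a e p)" and ?K = "5 * R + R ^ 3"
  have w_nonneg: "0 \<le> ?w p" if "p \<in> slab \<Omega>" for p
    using div_source_nonneg[OF that] \<theta>_range[of "snd p"] by simp
  have continuous_on_w: "continuous_on (slab \<Omega>) ?w"
    by (intro continuous_on_mult continuous_on_add C1_deriv_continuous_on[OF C1_deriv_snd[OF C1_\<theta>]]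
        C1_div_continuous_div[OF C1_div_current_slab] continuous_on_source e_pos e_small)
  have "g p \<le> \<kappa> * C * ?w p + \<kappa> * ?K * local_energy p" if p: "p \<in> slab \<Omega>" for p
  proof -
    have density: "carleman_density a z p \<le> C * ?w p + ?K * local_energy p"
    proof (cases "\<theta> (snd p) = 1")
      case True
      then show ?thesis using density_le[OF p] energies_nonneg(1)[of p] radius_pos by (simp add: add_increasing2)
    next
      case False
      then have "local_energy p = weighted_energy a p (z p) (egrad z p)" using \<eta>_one by (simp add: local_energy_def)
      then show ?thesis using carleman_density_le_weighted_energy[OF p, of a] w_nonneg[OF p] C_pos by (simp add: add_increasing)
    qed
    have "g p \<le> \<kappa> * carleman_density a z p" by (rule g[OF p])
    also have "\<dots> \<le> \<kappa> * (C * ?w p + ?K * local_energy p)" by (rule mult_left_mono[OF density \<kappa>_nonneg])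
    also have "\<dots> = \<kappa> * C * ?w p + \<kappa> * ?K * local_energy p" by (simp only: distrib_left[of \<kappa> "C * ?w p"] mult.assoc)
    finally show ?thesis .
  qed
  then have "slab_integral \<Omega> g \<le> ennreal (\<kappa> * C) * slab_integral \<Omega> ?w + ennreal (\<kappa> * ?K) * slab_integral \<Omega> local_energy"
    using open_\<Omega> continuous_on_w w_nonneg continuous_on_energies(3) energies_nonneg(1) \<kappa>_nonneg C_pos radius_pos
    by (intro slab_integral_le_lincomb) auto
  also have "\<dots> \<le> ennreal (\<kappa> * C) * (ennreal (current_const a R K B) * observation a \<Omega> \<omega> z)
      + ennreal (\<kappa> * ?K) * (ennreal (local_const a R B) * observation a \<Omega> \<omega> z)"
    by (intro add_mono mult_left_mono localized_div_le_observation local_energy_le_observation) auto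
  also have "\<dots> = ennreal (\<kappa> * (C * current_const a R K B + ?K * local_const a R B)) * observation a \<Omega> \<omega> z"
  proof -
    have "current_const a R K B \<ge> 0" using B_pos K_pos local_const_pos[of a R B] by (simp add: current_const_def)
    then have "ennreal (\<kappa> * C * current_const a R K B + \<kappa> * ?K * local_const a R B)
      = ennreal (\<kappa> * C) * ennreal (current_const a R K B) + ennreal (\<kappa> * ?K) * ennreal (local_const a R B)"
      using \<kappa>_nonneg C_pos radius_pos local_const_pos[of a R B] by (simp add: ennreal_mult)
    then show ?thesis by (simp only: distrib_left[of \<kappa> "C * _"] distrib_right mult.assoc)
  qed
  finally show ?thesis .
qed

end

lemma bounded_on_bounded_set:
  fixes N :: "'a::euclidean_space \<Rightarrow> 'b::real_normed_vector"
  assumes "continuous_on UNIV N" "bounded \<Omega>"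
  obtains B where "B > 0" "\<And>x. x \<in> \<Omega> \<Longrightarrow> norm (N x) \<le> B"
proof -
  have "compact (closure \<Omega>)" using assms(2) by simp
  from compact_imp_bounded[OF compact_continuous_image[OF continuous_on_subset[OF assms(1)] this]]
  obtain M where M: "\<forall>x\<in>closure \<Omega>. norm (N x) \<le> M" by (auto simp: bounded_iff)
  then have "norm (N x) \<le> max M 1" if "x \<in> \<Omega>" for x using closure_subset[of \<Omega>] that by (auto simp: le_max_iff_disj)
  then show ?thesis using that[of "max M 1"] by simp
qed

lemma (in cylinder) localized_carleman_exist:
  assumes "bounded \<Omega>" and a_ge_2: "a \<ge> 2" and "\<sigma> > 0"
  obtains \<theta> \<eta> grad_\<theta> grad_\<eta> e d C K B where
    "\<And>z :: (real^'m) \<times> (real^'n) \<Rightarrow> real. dirichlet_function \<Omega> R z \<Longrightarrow>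
      localized_carleman \<Omega> R z \<sigma> \<theta> \<eta> grad_\<theta> grad_\<eta> a e d C K B"
proof -
  have "Gamma_plus \<Omega> \<subseteq> closure \<Omega>" by (auto simp: Gamma_plus_def frontier_def)
  then have "bounded (Gamma_plus \<Omega>)" using bounded_closure[OF \<open>bounded \<Omega>\<close>] bounded_subset by blast
  then obtain \<theta> \<eta> grad_\<theta> grad_\<eta> where cutoffs: "localizing_cutoffs (Gamma_plus \<Omega>) \<sigma> \<theta> \<eta> grad_\<theta> grad_\<eta>"
    using localizing_cutoffs_exist[OF _ \<open>\<sigma> > 0\<close>] by blast
  interpret localizing_cutoffs "Gamma_plus \<Omega>" \<sigma> \<theta> \<eta> grad_\<theta> grad_\<eta> by (rule cutoffs)
  have "continuous_on UNIV (\<lambda>x. (grad_\<theta> x, grad_\<eta> x))" by (intro continuous_intros continuous_grad_\<theta> continuous_grad_\<eta>)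
  then obtain B where B: "B > 0" "\<And>x. x \<in> \<Omega> \<Longrightarrow> norm (grad_\<theta> x, grad_\<eta> x) \<le> B"
    using bounded_on_bounded_set[OF _ \<open>bounded \<Omega>\<close>] by blast
  then have grads: "norm (grad_\<theta> x) \<le> B" "norm (grad_\<eta> x) \<le> B" if "x \<in> \<Omega>" for x
    using order_trans[OF norm_fst_le B(2)[OF that]] order_trans[OF norm_snd_le B(2)[OF that]] by auto
  have a_pos: "a > 0" using a_ge_2 by simp
  obtain e d C where e: "e > 0" "e * R \<le> 1 / 4" and d_nonneg: "d \<ge> 0" and C_pos: "C > 0"
    and pointwise: "\<And>p s g b. \<lbrakk>p \<in> (DD :: ((real^'m) \<times> (real^'n)) set); rr p < R\<rbrakk> \<Longrightarrow>
       (weight a e p)\<^sup>2 * (1 / rr p * energy_density p g + 1 / sqrt (ff p) * s\<^sup>2)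
        \<le> C * (current_div a e d p s g b + ff p / (2 * a) * (weight a e p * b)\<^sup>2)"
    using carleman_pointwise[OF a_pos radius_pos] by metis
  obtain K where K: "K > 0" "\<And>p s g. \<lbrakk>p \<in> (DD :: ((real^'m) \<times> (real^'n)) set); rr p \<le> R\<rbrakk> \<Longrightarrow>
      norm (current a e d p s g) \<le> K * weighted_energy a p s g"
    using norm_current_le[OF a_pos radius_pos e d_nonneg] by metis
  have "localized_carleman \<Omega> R z \<sigma> \<theta> \<eta> grad_\<theta> grad_\<eta> a e d C K B" if "dirichlet_function \<Omega> R z"
    for z :: "(real^'m) \<times> (real^'n) \<Rightarrow> real"
    by (intro localized_carleman.intro localized_carleman_axioms.intro that cutoffs a_ge_2 e d_nonneg C_pos B(1) grads pointwise K
        slab_bounds(1,3) less_imp_le[OF slab_bounds(3)])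
  then show ?thesis by (rule that)
qed

lemma (in cylinder) carleman_estimate:
  assumes "bounded \<Omega>" and "a \<ge> 2" and "\<sigma> > 0"
  obtains C where "C > 0" "\<And>(z :: (real^'m) \<times> (real^'n) \<Rightarrow> real) g \<kappa>. dirichlet_function \<Omega> R z \<Longrightarrow> \<kappa> \<ge> 0 \<Longrightarrow>
      (\<And>p. p \<in> slab \<Omega> \<Longrightarrow> g p \<le> \<kappa> * carleman_density a z p) \<Longrightarrow>
      slab_integral \<Omega> g \<le> ennreal (\<kappa> * C) * observation a \<Omega> (nbhd \<sigma> (Gamma_plus \<Omega>) \<inter> \<Omega>) z"
proof -
  obtain \<theta> \<eta> grad_\<theta> grad_\<eta> e d C K B where setting: "\<And>z :: (real^'m) \<times> (real^'n) \<Rightarrow> real. dirichlet_function \<Omega> R z \<Longrightarrow>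
      localized_carleman \<Omega> R z \<sigma> \<theta> \<eta> grad_\<theta> grad_\<eta> a e d C K B"
    by (rule localized_carleman_exist[OF assms]) blast
  define C' where "C' = C * current_const a R K B + (5 * R + R ^ 3) * local_const a R B"
  have "slab_integral \<Omega> g \<le> ennreal (\<kappa> * max 1 C') * observation a \<Omega> (nbhd \<sigma> (Gamma_plus \<Omega>) \<inter> \<Omega>) z"
    if "dirichlet_function \<Omega> R z" and \<kappa>_nonneg: "\<kappa> \<ge> 0" and g: "\<And>p. p \<in> slab \<Omega> \<Longrightarrow> g p \<le> \<kappa> * carleman_density a z p"
    for z g :: "(real^'m) \<times> (real^'n) \<Rightarrow> real" and \<kappa>
  proof -
    interpret localized_carleman \<Omega> R z \<sigma> \<theta> \<eta> grad_\<theta> grad_\<eta> a e d C K B by (rule setting) fact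
    have "slab_integral \<Omega> g \<le> ennreal (\<kappa> * C') * observation a \<Omega> \<omega> z"
      unfolding C'_def by (rule density_bound_le_observation[OF \<kappa>_nonneg g])
    also have "\<dots> \<le> ennreal (\<kappa> * max 1 C') * observation a \<Omega> \<omega> z"
      using \<kappa>_nonneg by (intro mult_right_mono ennreal_leI mult_left_mono) auto
    finally show ?thesis .
  qed
  then show ?thesis by (intro that[of "max 1 C'"]) auto
qed

lemma zeta_bounds:
  assumes p: "p \<in> DD" "rr p < R" and \<epsilon>: "\<epsilon> > 0" "\<epsilon> * R \<le> 1 / 2" and b_pos: "b > 0" and a_pos: "a > 0"
  shows "ff p powr (2 * a) \<le> zeta a b \<epsilon> p" "zeta a b \<epsilon> p \<le> (4 * exp (2 * b * R)) powr (2 * a) * ff p powr (2 * a)"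
proof -
  define f u v where "f = ff p" and "u = uu p" and "v = vv p"
  have f: "f > 0" "sqrt f \<le> R"
    using p ff_le_sq[of p R] rr_pos[OF p(1)] by (auto simp: f_def DD_def real_le_lsqrt)
  have "tau p < rr p" "0 \<le> tau p" using tau_less_rr[OF p(1)] by (auto simp: tau_def)
  then have u: "- R \<le> u" "u \<le> 0" and v: "0 \<le> v" "v \<le> R" using p(2) by (auto simp: u_def v_def uu_def vv_def)
  have "\<epsilon> * (- R) \<le> \<epsilon> * u" "\<epsilon> * u \<le> 0" "0 \<le> \<epsilon> * v" "\<epsilon> * v \<le> \<epsilon> * R"
    using mult_left_mono[OF u(1), of \<epsilon>] mult_left_mono[OF u(2), of \<epsilon>] mult_left_mono[OF v(1), of \<epsilon>]
      mult_left_mono[OF v(2), of \<epsilon>] \<epsilon>(1) by simp_all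
  then have factors: "1 / 2 \<le> 1 + \<epsilon> * u" "1 + \<epsilon> * u \<le> 1" "1 / 2 \<le> 1 - \<epsilon> * v" "1 - \<epsilon> * v \<le> 1"
    and roots: "1 \<le> sqrt (1 - \<epsilon> * u)" "1 \<le> sqrt (1 + \<epsilon> * v)"
    using \<epsilon>(2) by auto
  define q where "q = (1 + \<epsilon> * u) * (1 - \<epsilon> * v)"
  have q: "1 / 4 \<le> q" "q \<le> 1"
    using mult_mono[OF factors(1,3)] mult_le_one[of "1 + \<epsilon> * u" "1 - \<epsilon> * v"] factors by (auto simp: q_def)
  define g where "g = 2 * b * sqrt f / (sqrt (1 - \<epsilon> * u) * sqrt (1 + \<epsilon> * v))"
  have root: "1 \<le> sqrt (1 - \<epsilon> * u) * sqrt (1 + \<epsilon> * v)" using mult_mono[OF roots] factors by simp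
  then have "g \<le> 2 * b * sqrt f / 1" unfolding g_def using b_pos f by (intro divide_left_mono) auto
  also have "\<dots> \<le> 2 * b * R" using f b_pos by simp
  finally have g: "0 \<le> g" "g \<le> 2 * b * R" using b_pos f root by (simp_all add: g_def)
  have zeta_eq: "zeta a b \<epsilon> p = (f / q * exp g) powr (2 * a)" by (simp add: zeta_def f_def q_def g_def u_def v_def)
  have "f \<le> f / q" "f / q \<le> 4 * f" using f q by (simp_all add: le_divide_eq divide_le_eq mult_left_le)
  then have "f * 1 \<le> f / q * exp g" "f / q * exp g \<le> (4 * f) * exp (2 * b * R)"
    using f q g by (intro mult_mono; simp)+
  then have "f powr (2 * a) \<le> (f / q * exp g) powr (2 * a)"
    "(f / q * exp g) powr (2 * a) \<le> ((4 * exp (2 * b * R)) * f) powr (2 * a)"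
    using f q a_pos by (intro powr_mono2; simp add: mult_ac)+
  then show "ff p powr (2 * a) \<le> zeta a b \<epsilon> p" "zeta a b \<epsilon> p \<le> (4 * exp (2 * b * R)) powr (2 * a) * ff p powr (2 * a)"
    unfolding zeta_eq f_def[symmetric] using f by (simp_all add: powr_mult)
qed

context dirichlet_function
begin

context
  fixes a b \<epsilon> :: real
  assumes \<epsilon>: "\<epsilon> > 0" "\<epsilon> * R \<le> 1 / 2" and b_pos: "b > 0" and a_pos: "a > 0"
begin

lemma
  assumes p: "p \<in> slab \<Omega>"
  defines "\<kappa> \<equiv> (4 * exp (2 * b * R)) powr (2 * a)"
  shows zeta_energy_le: "zeta a b \<epsilon> p * (1 / rr p) * ((uu p * du z p)\<^sup>2 + (vv p * dv z p)\<^sup>2 + ff p * ang_x z p - ff p * ang_t z p)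
      \<le> \<kappa> * carleman_density a z p"
    and zeta_value_le: "zeta a b \<epsilon> p * ff p powr (-1/2) * (z p)\<^sup>2 \<le> \<kappa> * carleman_density a z p"
proof -
  have energy: "0 \<le> 1 / rr p * energy_density p (egrad z p)" and "value": "0 \<le> 1 / sqrt (ff p) * (z p)\<^sup>2"
    using energy_density_bounds(1)[OF slab_bounds(1,3)[OF p], of "egrad z p"] slab_bounds[OF p] by simp_all
  have zeta: "zeta a b \<epsilon> p \<le> \<kappa> * ff p powr (2 * a)"
    unfolding \<kappa>_def by (rule zeta_bounds(2)[OF slab_bounds(1,3)[OF p] \<epsilon> b_pos a_pos])
  have zeta_mult_le: "zeta a b \<epsilon> p * y \<le> \<kappa> * carleman_density a z p"
    if "0 \<le> y" "y \<le> 1 / rr p * energy_density p (egrad z p) + 1 / sqrt (ff p) * (z p)\<^sup>2" for y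
    using mult_mono[OF zeta that(2) _ that(1)] by (simp add: carleman_density_def \<kappa>_def mult.assoc)
  show "zeta a b \<epsilon> p * (1 / rr p) * ((uu p * du z p)\<^sup>2 + (vv p * dv z p)\<^sup>2 + ff p * ang_x z p - ff p * ang_t z p)
      \<le> \<kappa> * carleman_density a z p"
    using zeta_mult_le[of "1 / rr p * energy_density p (egrad z p)"] energy "value"
    by (simp add: energy_density_egrad[OF differentiable_z[OF p]] mult.assoc)
  have "ff p powr (-1/2) = 1 / sqrt (ff p)" using slab_bounds[OF p] by (simp add: powr_minus_divide powr_half_sqrt)
  then show "zeta a b \<epsilon> p * ff p powr (-1/2) * (z p)\<^sup>2 \<le> \<kappa> * carleman_density a z p"
    using zeta_mult_le[of "1 / sqrt (ff p) * (z p)\<^sup>2"] energy "value" by (simp add: mult.assoc)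
qed

lemma ff_powr_add_le:
  assumes "p \<in> slab \<Omega>" shows "ff p powr (2 * a + c) \<le> zeta a b \<epsilon> p * ff p powr c"
  unfolding powr_add using zeta_bounds(1)[OF slab_bounds(1,3)[OF assms] \<epsilon> b_pos a_pos] by (intro mult_right_mono) auto

lemma observation_le_zeta:
  assumes "\<omega> \<subseteq> \<Omega>" and m: "m \<le> A" "m \<le> B" "m \<le> C" "0 \<le> m"
  shows "ennreal m * observation a \<Omega> \<omega> z
    \<le> ennreal A * slab_integral \<Omega> (\<lambda>p. zeta a b \<epsilon> p * ff p * (box z p)\<^sup>2)
      + ennreal B * slab_integral \<omega> (\<lambda>p. zeta a b \<epsilon> p * ff p powr (-2) * gradt_sq z p)
      + ennreal C * slab_integral \<omega> (\<lambda>p. zeta a b \<epsilon> p * ff p powr (-3) * (z p)\<^sup>2)"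
proof -
  have slab_mono: "p \<in> slab \<omega> \<Longrightarrow> p \<in> slab \<Omega>" for p :: "(real^'m) \<times> (real^'n)" using \<open>\<omega> \<subseteq> \<Omega>\<close> by (auto simp: slab_def)
  have "ff p powr (2 * a + 1) \<le> zeta a b \<epsilon> p * ff p" if "p \<in> slab \<Omega>" for p :: "(real^'m) \<times> (real^'n)"
    using ff_powr_add_le[OF that, of 1] slab_bounds[OF that] by simp
  then have "slab_integral \<Omega> (box_term a z) \<le> slab_integral \<Omega> (\<lambda>p. zeta a b \<epsilon> p * ff p * (box z p)\<^sup>2)"
    by (intro slab_integral_mono) (simp add: box_term_def mult_right_mono)
  moreover have "slab_integral \<omega> (time_term a z) \<le> slab_integral \<omega> (\<lambda>p. zeta a b \<epsilon> p * ff p powr (-2) * gradt_sq z p)"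
    using ff_powr_add_le[OF slab_mono, of _ "-2"]
    by (intro slab_integral_mono) (simp add: time_term_def gradt_sq_def sum_nonneg mult_right_mono)
  moreover have "slab_integral \<omega> (value_term a z) \<le> slab_integral \<omega> (\<lambda>p. zeta a b \<epsilon> p * ff p powr (-3) * (z p)\<^sup>2)"
    using ff_powr_add_le[OF slab_mono, of _ "-3"]
    by (intro slab_integral_mono) (simp add: value_term_def mult_right_mono)
  ultimately show ?thesis
    unfolding observation_def distrib_left using m by (intro add_mono mult_mono ennreal_leI) auto
qed

end

end

lemma (in cylinder) carleman_estimate_zeta:
  assumes "bounded \<Omega>" and a_ge_2: "a \<ge> 2" and b_pos: "b > 0" and \<epsilon>: "\<epsilon> > 0" "\<epsilon> * R \<le> 1 / 2" and "\<sigma> > 0"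
  shows "\<exists>C>0. \<forall>z :: (real^'m) \<times> (real^'n) \<Rightarrow> real. dirichlet_function \<Omega> R z \<longrightarrow>
      ennreal (C * \<epsilon>) * slab_integral \<Omega> (\<lambda>p. zeta a b \<epsilon> p * (1 / rr p) *
          ((uu p * du z p)\<^sup>2 + (vv p * dv z p)\<^sup>2 + ff p * ang_x z p - ff p * ang_t z p))
        + ennreal (C * b * a\<^sup>2) * slab_integral \<Omega> (\<lambda>p. zeta a b \<epsilon> p * ff p powr (-1/2) * (z p)\<^sup>2)
      \<le> ennreal (1 / a) * slab_integral \<Omega> (\<lambda>p. zeta a b \<epsilon> p * ff p * (box z p)\<^sup>2)
        + ennreal (a\<^sup>2 * R ^ 3) * slab_integral (nbhd \<sigma> (Gamma_plus \<Omega>) \<inter> \<Omega>) (\<lambda>p. zeta a b \<epsilon> p * ff p powr (-2) * gradt_sq z p)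
        + ennreal (a ^ 4 * R ^ 4) * slab_integral (nbhd \<sigma> (Gamma_plus \<Omega>) \<inter> \<Omega>) (\<lambda>p. zeta a b \<epsilon> p * ff p powr (-3) * (z p)\<^sup>2)"
    (is "\<exists>C>0. \<forall>z. _ \<longrightarrow> ennreal (C * \<epsilon>) * ?energy z + ennreal (C * b * a\<^sup>2) * ?value z \<le> ?rhs z")
proof -
  let ?\<omega> = "nbhd \<sigma> (Gamma_plus \<Omega>) \<inter> \<Omega>"
  obtain K where K: "K > 0" "\<And>(z :: (real^'m) \<times> (real^'n) \<Rightarrow> real) g \<kappa>. dirichlet_function \<Omega> R z \<Longrightarrow> \<kappa> \<ge> 0 \<Longrightarrow>
      (\<And>p. p \<in> slab \<Omega> \<Longrightarrow> g p \<le> \<kappa> * carleman_density a z p) \<Longrightarrow>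
      slab_integral \<Omega> g \<le> ennreal (\<kappa> * K) * observation a \<Omega> ?\<omega> z"
    by (rule carleman_estimate[OF \<open>bounded \<Omega>\<close> a_ge_2 \<open>\<sigma> > 0\<close>]) blast
  define \<kappa> where "\<kappa> = (4 * exp (2 * b * R)) powr (2 * a)"
  define m where "m = min (1 / a) (min (a\<^sup>2 * R ^ 3) (a ^ 4 * R ^ 4))"
  define D where "D = (\<epsilon> + b * a\<^sup>2) * (\<kappa> * K)"
  define C where "C = m / D"
  have a_pos: "a > 0" using a_ge_2 by simp
  have m_pos: "m > 0" using a_pos radius_pos by (simp add: m_def)
  have \<kappa>_pos: "\<kappa> > 0" by (simp add: \<kappa>_def)
  have D_pos: "D > 0" unfolding D_def using \<epsilon> b_pos a_pos \<kappa>_pos K(1) by (intro mult_pos_pos add_pos_pos) auto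
  then have C_pos: "C > 0" unfolding C_def using m_pos by simp
  have "C * \<epsilon> * (\<kappa> * K) + C * b * a\<^sup>2 * (\<kappa> * K) = C * D" by (simp add: D_def algebra_simps)
  also have "\<dots> = m" using D_pos by (simp add: C_def)
  finally have C_eq: "C * \<epsilon> * (\<kappa> * K) + C * b * a\<^sup>2 * (\<kappa> * K) = m" .
  show ?thesis
  proof (intro exI[of _ C] conjI C_pos allI impI)
    fix z :: "(real^'m) \<times> (real^'n) \<Rightarrow> real" assume z: "dirichlet_function \<Omega> R z"
    interpret dirichlet_function \<Omega> R z by (rule z)
    note zeta_le = zeta_energy_le[OF \<epsilon> b_pos a_pos, folded \<kappa>_def] zeta_value_le[OF \<epsilon> b_pos a_pos, folded \<kappa>_def]
    have "ennreal (C * \<epsilon>) * ?energy z + ennreal (C * b * a\<^sup>2) * ?value z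
      \<le> ennreal (C * \<epsilon>) * (ennreal (\<kappa> * K) * observation a \<Omega> ?\<omega> z)
        + ennreal (C * b * a\<^sup>2) * (ennreal (\<kappa> * K) * observation a \<Omega> ?\<omega> z)"
      using \<kappa>_pos by (intro add_mono mult_left_mono K(2)[OF z] zeta_le) auto
    also have "\<dots> = ennreal m * observation a \<Omega> ?\<omega> z"
      unfolding C_eq[symmetric] using C_pos \<epsilon> b_pos \<kappa>_pos K(1) by (simp add: ennreal_mult distrib_right mult.assoc)
    also have "\<dots> \<le> ?rhs z"
      using m_pos by (intro observation_le_zeta[OF \<epsilon> b_pos a_pos]) (auto simp: m_def)
    finally show "ennreal (C * \<epsilon>) * ?energy z + ennreal (C * b * a\<^sup>2) * ?value z \<le> ?rhs z" .
  qed
qed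

theorem theorem3p13:
  shows "\<exists>K c1 c2. K > 0 \<and> c1 > 0 \<and> c2 > 0 \<and>
    (\<forall>(\<Omega>::(real^'n) set) R a b \<epsilon> \<sigma>.
       open \<Omega> \<and> bounded \<Omega> \<and> smooth_boundary \<Omega> \<and>
       R > 0 \<and> (\<forall>x\<in>\<Omega>. norm x < R) \<and>
       \<epsilon> > 0 \<and> a > 0 \<and> b > 0 \<and>
       a \<ge> (real (CARD('m) + CARD('n)))\<^sup>2 \<and> a \<ge> K * R \<and>
       \<epsilon> \<le> c1 * b \<and> b \<le> c2 / R \<and> \<sigma> > 0
     \<longrightarrow> (\<exists>C>0. \<forall>z :: (real^'m) \<times> (real^'n) \<Rightarrow> real.
          Ck 2 (UNIV \<times> \<Omega>) z \<and> C1_closure (UNIV \<times> \<Omega>) z \<and>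
          (\<forall>p \<in> frontier (UNIV \<times> \<Omega>) \<inter> DD. z p = 0)
          \<longrightarrow>
          ennreal (C * \<epsilon>) *
            set_nn_integral lborel ((UNIV \<times> \<Omega>) \<inter> DD)
              (\<lambda>p. ennreal (zeta a b \<epsilon> p * (1 / rr p) *
                 ((uu p * du z p)\<^sup>2 + (vv p * dv z p)\<^sup>2 + ff p * ang_x z p - ff p * ang_t z p)))
          + ennreal (C * b * a\<^sup>2) *
            set_nn_integral lborel ((UNIV \<times> \<Omega>) \<inter> DD)
              (\<lambda>p. ennreal (zeta a b \<epsilon> p * ff p powr (-1/2) * (z p)\<^sup>2))
          \<le> ennreal (1 / a) *
            set_nn_integral lborel ((UNIV \<times> \<Omega>) \<inter> DD)
              (\<lambda>p. ennreal (zeta a b \<epsilon> p * ff p * (box z p)\<^sup>2))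
          + ennreal (a\<^sup>2 * R ^ 3) *
            set_nn_integral lborel ((UNIV \<times> (nbhd \<sigma> (Gamma_plus \<Omega>) \<inter> \<Omega>)) \<inter> DD)
              (\<lambda>p. ennreal (zeta a b \<epsilon> p * ff p powr (-2) * gradt_sq z p))
          + ennreal (a ^ 4 * R ^ 4) *
            set_nn_integral lborel ((UNIV \<times> (nbhd \<sigma> (Gamma_plus \<Omega>) \<inter> \<Omega>)) \<inter> DD)
              (\<lambda>p. ennreal (zeta a b \<epsilon> p * ff p powr (-3) * (z p)\<^sup>2))))"
proof (rule exI[of _ "1::real"], rule exI[of _ "1::real"], rule exI[of _ "1 / 2 :: real"],
    intro conjI allI impI, goal_cases K_pos c1_pos c2_pos estimate)
  case (estimate \<Omega> R a b \<epsilon> \<sigma>)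
  then interpret cylinder \<Omega> R by unfold_locales auto
  have dirichlet: "dirichlet_function \<Omega> R z"
    if "Ck 2 (UNIV \<times> \<Omega>) z \<and> C1_closure (UNIV \<times> \<Omega>) z \<and> (\<forall>p\<in>frontier (UNIV \<times> \<Omega>) \<inter> DD. z p = 0)"
    for z :: "(real^'m) \<times> (real^'n) \<Rightarrow> real"
    using that by unfold_locales auto
  have "real (CARD('m) + CARD('n)) \<ge> 2"
    using zero_less_card_finite[where 'a='m] zero_less_card_finite[where 'a='n] by linarith
  then have "(real (CARD('m) + CARD('n)))\<^sup>2 \<ge> 2\<^sup>2" by (rule power_mono) simp
  then have a_ge_2: "a \<ge> 2" using estimate by simp
  have "\<epsilon> \<le> 1 / 2 / R" using estimate by linarith
  then have \<epsilon>R: "\<epsilon> * R \<le> 1 / 2" using radius_pos by (simp add: field_simps)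
  have "bounded \<Omega>" "b > 0" "\<epsilon> > 0" "\<sigma> > 0" using estimate by auto
  from carleman_estimate_zeta[OF this(1) a_ge_2 this(2,3) \<epsilon>R this(4), where 'm='m] show ?case
    unfolding slab_integral_def slab_def using dirichlet by blast
qed simp_all

end
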